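(* Let $\delta$ be an error parameter and $h$ the mesh size parameter. Then one can prepare an $$\left(O\!\left(\log^2\frac1h\right),\ O\!\left(\mathrm{poly}\!\left(\log\frac1h,\log\frac1\delta\right)\right),\ O\!\left(\delta^{1/4}\cdot\mathrm{poly}\!\left(\log\frac1\delta,\log\frac1h\right)\right)\right)\text{-block encoding}$$ of the Hamiltonian $H=C^{1/2}(L+A)^{-1}C^{1/2}$ using $O\!\left(z\cdot\mathrm{poly}\!\left(\log\frac1h,\log\frac1\delta\right)\right)$ one- and two-qubit gates and $\mathrm{poly}\!\left(\log\frac1h,\log\frac1\delta\right)$ ancillas, where $z$ is the number of material regions.
   Context: Let $\Omega=[0,1]^3$. $D,\Sigma_a:\Omega\to\mathbb{R}_{>0}$ and $\nu\Sigma_f:\Omega\to\mathbb{R}_{\ge0}$ are fixed (independent of $h$) piecewise-constant functions, constant on each of $z$ Lipschitz polyhedral material regions, provided as a list of region boundaries and the values in each region. Big-$O$ constants may depend on $D,\Sigma_a,\nu\Sigma_f$ (not on $h$, $\delta$). Let $h=2^{-\ell}$ for a positive integer $\ell$ and divide $\Omega$ into $(1/h)^3$ uniform cubes of side $h$; it is assumed that each cube lies in only one material region. For $i\in\{1,\dots,1/h-1\}$ let $\varphi_i:[0,1]\to[0,1]$ be the hat function, piecewise linear on $\{0,h,\dots,1\}$, with value $1$ at $ih$ and $0$ at the other grid points, and $\varphi_{ijk}(x,y,z)=\varphi_i(x)\varphi_j(y)\varphi_k(z)$. With $N=(1/h-1)^3$, the matrices $L,A,C\in\mathbb{R}^{N\times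 N}$ are $L_{ijk,i'j'k'}=\int_\Omega D\,\nabla\varphi_{ijk}\cdot\nabla\varphi_{i'j'k'}\,d\mathbf{x}$, $A_{ijk,i'j'k'}=\int_\Omega\Sigma_a\,\varphi_{ijk}\varphi_{i'j'k'}\,d\mathbf{x}$, $C_{ijk,i'j'k'}=\int_\Omega\nu\Sigma_f\,\varphi_{ijk}\varphi_{i'j'k'}\,d\mathbf{x}$. Block encoding: an $(s+q)$-qubit unitary $U$ is an $(\alpha,q,\epsilon)$-block encoding of an $s$-qubit operator $M$ if $\|M-\alpha(\langle0|^{\otimes q}\otimes I)U(|0\rangle^{\otimes q}\otimes I)\|\le\epsilon$; a matrix whose dimension is not a power of two is zero-padded. One- and two-qubit gates are assumed to be implemented perfectly. *)

theory Defs
  imports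
    "HOL-Analysis.Analysis"
    "Jordan_Normal_Form.Gauss_Jordan_Elimination"
    "Jordan_Normal_Form.Schur_Decomposition"
begin

section \<open>Geometry of the material regions\<close>

definition Omega :: "(real^3) set" where
  "Omega = {x. \<forall>m. 0 \<le> x $ m \<and> x $ m \<le> 1}"

text \<open>Near each boundary point the set is the strict epigraph, in some direction \<open>n\<close>, of a
  Lipschitz function on the hyperplane orthogonal to \<open>n\<close>.\<close>

definition lipschitz_domain :: "'a::euclidean_space set \<Rightarrow> bool" where
  "lipschitz_domain S \<longleftrightarrow> open S \<and> bounded S \<and> S \<noteq> {} \<and>
     (\<forall>x\<in>frontier S. \<exists>n r K g. norm n = 1 \<and> 0 < r \<and> K-lipschitz_on {y. inner y n = 0} g \<and>
        S \<inter> ball x r = {y \<in> ball x r. g (y - inner y n *\<^sub>R n) < inner y n})"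

definition polyhedral :: "'a::euclidean_space set \<Rightarrow> bool" where
  "polyhedral S \<longleftrightarrow> (\<exists>F. finite F \<and> (\<forall>P\<in>F. polytope P) \<and> closure S = \<Union>F)"

text \<open>Regions are open, so that interfaces, which are null sets, belong to no region. A region need
  be neither convex nor connected.\<close>

definition material_regions :: "(real^3) set list \<Rightarrow> bool" where
  "material_regions Rs \<longleftrightarrow>
     (\<forall>R\<in>set Rs. lipschitz_domain R \<and> polyhedral R) \<and>
     (\<forall>a<length Rs. \<forall>b<length Rs. a \<noteq> b \<longrightarrow> Rs ! a \<inter> Rs ! b = {}) \<and>
     (\<Union>R\<in>set Rs. closure R) = Omega"

abbreviation mesh :: "nat \<Rightarrow> real" where
  "mesh l \<equiv> 1 / 2 ^ l"

definition cell :: "nat \<Rightarrow> (3 \<Rightarrow> nat) \<Rightarrow> (real^3) set" where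
  "cell l a = {x. \<forall>m. real (a m) * mesh l < x $ m \<and> x $ m < (real (a m) + 1) * mesh l}"

definition grid_resolves :: "nat \<Rightarrow> (real^3) set list \<Rightarrow> bool" where
  "grid_resolves l Rs \<longleftrightarrow> (\<forall>a. (\<forall>m. a m < 2 ^ l) \<longrightarrow> (\<exists>R\<in>set Rs. cell l a \<subseteq> R))"


section \<open>Finite element matrices\<close>

definition hat :: "real \<Rightarrow> nat \<Rightarrow> real \<Rightarrow> real" where
  "hat h i t = max 0 (1 - \<bar>t / h - real i\<bar>)"

lemma hat_node: "h > 0 \<Longrightarrow> hat h i (real j * h) = (if j = i then 1 else 0)"
proof -
  assume "h > 0"
  moreover have "1 \<le> \<bar>real j - real i\<bar>" if "j \<noteq> i"
    using that by linarith
  ultimately show ?thesis by (auto simp: hat_def)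
qed

lemma hat_piecewise_linear:
  assumes "h > 0" "0 \<le> s" "s \<le> 1"
  shows "hat h i ((real j + s) * h) = (1 - s) * hat h i (real j * h) + s * hat h i (real (Suc j) * h)"
proof -
  consider "j = i" | "Suc j = i" | "j \<ge> Suc i" | "i \<ge> Suc (Suc j)" by linarith
  then show ?thesis
  proof cases
    case 3
    then have "1 \<le> \<bar>real j + s - real i\<bar>" using assms by linarith
    then have "hat h i ((real j + s) * h) = 0" using assms by (simp add: hat_def)
    then show ?thesis using assms 3 by (simp only: hat_node) simp
  next
    case 4
    then have "1 \<le> \<bar>real j + s - real i\<bar>" using assms by linarith
    then have "hat h i ((real j + s) * h) = 0" using assms by (simp add: hat_def)
    then show ?thesis using assms 4 by (simp only: hat_node) simp
  next
    case 1
    have "hat h i ((real j + s) * h) = 1 - s" using assms 1 by (simp add: hat_def)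
    then show ?thesis using assms 1 by (simp only: hat_node) simp
  next
    case 2
    have "hat h i ((real j + s) * h) = s" using assms 2[symmetric] by (simp add: hat_def)
    then show ?thesis using assms 2 by (simp only: hat_node) simp
  qed
qed

type_synonym node = "nat \<times> nat \<times> nat"

definition basis_fun :: "nat \<Rightarrow> node \<Rightarrow> real^3 \<Rightarrow> real" where
  "basis_fun l = (\<lambda>(i, j, k) x. hat (mesh l) i (x $ 1) * hat (mesh l) j (x $ 2) * hat (mesh l) k (x $ 3))"

text \<open>The gradient is unspecified where the function is not differentiable; for the basis functions
  this happens only on a null set, which the integrals below do not see.\<close>

definition gradient :: "('a::real_inner \<Rightarrow> real) \<Rightarrow> 'a \<Rightarrow> 'a" where
  "gradient f x = (THE g. GDERIV f x :> g)"

definition nodes :: "nat \<Rightarrow> node list" where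
  "nodes l = List.product [1..<2 ^ l] (List.product [1..<2 ^ l] [1..<2 ^ l])"

definition node_matrix :: "nat \<Rightarrow> (node \<Rightarrow> node \<Rightarrow> real) \<Rightarrow> real mat" where
  "node_matrix l a = mat (length (nodes l)) (length (nodes l)) (\<lambda>(p, q). a (nodes l ! p) (nodes l ! q))"

definition stiffness_matrix :: "nat \<Rightarrow> (real^3 \<Rightarrow> real) \<Rightarrow> real mat" where
  "stiffness_matrix l D = node_matrix l (\<lambda>u v.
     LINT x:Omega|lebesgue. D x * inner (gradient (basis_fun l u) x) (gradient (basis_fun l v) x))"

definition mass_matrix :: "nat \<Rightarrow> (real^3 \<Rightarrow> real) \<Rightarrow> real mat" where
  "mass_matrix l f = node_matrix l (\<lambda>u v.
     LINT x:Omega|lebesgue. f x * basis_fun l u x * basis_fun l v x)"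

definition psd :: "real mat \<Rightarrow> bool" where
  "psd S \<longleftrightarrow> S \<in> carrier_mat (dim_row S) (dim_row S) \<and> transpose_mat S = S \<and>
     (\<forall>v\<in>carrier_vec (dim_row S). 0 \<le> scalar_prod v (S *\<^sub>v v))"

definition psd_sqrt :: "real mat \<Rightarrow> real mat" where
  "psd_sqrt M = (THE S. psd S \<and> S * S = M)"

definition hamiltonian :: "nat \<Rightarrow> (real^3 \<Rightarrow> real) \<Rightarrow> (real^3 \<Rightarrow> real) \<Rightarrow> (real^3 \<Rightarrow> real) \<Rightarrow> real mat" where
  "hamiltonian l D Sa nSf =
     (let L = stiffness_matrix l D; A = mass_matrix l Sa; C = mass_matrix l nSf
      in psd_sqrt C * the (mat_inverse (L + A)) * psd_sqrt C)"

text \<open>Zero-padding to \<open>3 * l\<close> qubits, registerwise: the node \<open>(i, j, k)\<close> is the computational basis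
  state of three \<open>l\<close>-qubit registers holding \<open>i\<close>, \<open>j\<close> and \<open>k\<close>. The basis states with a register equal
  to zero correspond to no node; their rows and columns are zero.\<close>

definition node_embedding :: "nat \<Rightarrow> real mat" where
  "node_embedding l = mat (2 ^ (3 * l)) (length (nodes l)) (\<lambda>(P, p).
     case nodes l ! p of (i, j, k) \<Rightarrow> if P = i * 2 ^ (2 * l) + j * 2 ^ l + k then 1 else 0)"

definition zero_pad :: "nat \<Rightarrow> real mat \<Rightarrow> complex mat" where
  "zero_pad l M = map_mat complex_of_real (node_embedding l * M * transpose_mat (node_embedding l))"


section \<open>Circuits and block encodings\<close>

definition unitary :: "nat \<Rightarrow> complex mat \<Rightarrow> bool" where
  "unitary n U \<longleftrightarrow> U \<in> carrier_mat n n \<and> mat_adjoint U * U = 1\<^sub>m n \<and> U * mat_adjoint U = 1\<^sub>m n"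

definition vec_l2norm :: "complex vec \<Rightarrow> real" where
  "vec_l2norm v = sqrt (\<Sum>i<dim_vec v. (cmod (vec_index v i))\<^sup>2)"

definition spectral_norm :: "complex mat \<Rightarrow> real" where
  "spectral_norm M = (SUP v\<in>{v \<in> carrier_vec (dim_col M). vec_l2norm v = 1}. vec_l2norm (M *\<^sub>v v))"

definition kron :: "complex mat \<Rightarrow> complex mat \<Rightarrow> complex mat" where
  "kron A B = mat (dim_row A * dim_row B) (dim_col A * dim_col B)
     (\<lambda>(i, j). A $$ (i div dim_row B, j div dim_col B) * B $$ (i mod dim_row B, j mod dim_col B))"

definition ket0 :: "nat \<Rightarrow> complex mat" where
  "ket0 q = mat (2 ^ q) 1 (\<lambda>(i, j). if i = 0 then 1 else 0)"

definition block_encoding :: "nat \<Rightarrow> real \<Rightarrow> nat \<Rightarrow> real \<Rightarrow> complex mat \<Rightarrow> complex mat \<Rightarrow> bool" where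
  "block_encoding s \<alpha> q \<epsilon> U M \<longleftrightarrow>
     unitary (2 ^ (q + s)) U \<and> M \<in> carrier_mat (2 ^ s) (2 ^ s) \<and>
     spectral_norm (M - complex_of_real \<alpha> \<cdot>\<^sub>m
       (kron (mat_adjoint (ket0 q)) (1\<^sub>m (2 ^ s)) * U * kron (ket0 q) (1\<^sub>m (2 ^ s)))) \<le> \<epsilon>"

text \<open>Qubit \<open>t\<close> of a register is bit \<open>t\<close> of the basis index, so it has weight \<open>2 ^ t\<close>. In
  \<open>Gate2 t u G\<close> qubit \<open>t\<close> is the more significant one for the \<open>4 \<times> 4\<close> matrix \<open>G\<close>.\<close>

datatype gate = Gate1 nat "complex mat" | Gate2 nat nat "complex mat"

fun valid_gate :: "nat \<Rightarrow> gate \<Rightarrow> bool" where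
  "valid_gate n (Gate1 t G) \<longleftrightarrow> t < n \<and> unitary 2 G"
| "valid_gate n (Gate2 t u G) \<longleftrightarrow> t < n \<and> u < n \<and> t \<noteq> u \<and> unitary 4 G"

fun gate_mat :: "nat \<Rightarrow> gate \<Rightarrow> complex mat" where
  "gate_mat n (Gate1 t G) = mat (2 ^ n) (2 ^ n) (\<lambda>(i, j).
     if \<forall>b<n. b \<noteq> t \<longrightarrow> (bit i b \<longleftrightarrow> bit j b)
     then G $$ (of_bool (bit i t), of_bool (bit j t)) else 0)"
| "gate_mat n (Gate2 t u G) = mat (2 ^ n) (2 ^ n) (\<lambda>(i, j).
     if \<forall>b<n. b \<noteq> t \<and> b \<noteq> u \<longrightarrow> (bit i b \<longleftrightarrow> bit j b)
     then G $$ (2 * of_bool (bit i t) + of_bool (bit i u), 2 * of_bool (bit j t) + of_bool (bit j u))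
     else 0)"

text \<open>The head of the list is applied first.\<close>

fun circuit_mat :: "nat \<Rightarrow> gate list \<Rightarrow> complex mat" where
  "circuit_mat n [] = 1\<^sub>m (2 ^ n)"
| "circuit_mat n (g # gs) = circuit_mat n gs * gate_mat n g"

text \<open>The circuit realises \<open>U\<close> exactly on \<open>m\<close> qubits with the help of \<open>r\<close> work ancillas that start
  in, and are returned to, the zero state.\<close>

definition implements :: "gate list \<Rightarrow> nat \<Rightarrow> nat \<Rightarrow> complex mat \<Rightarrow> bool" where
  "implements gs r m U \<longleftrightarrow> (\<forall>g\<in>set gs. valid_gate (r + m) g) \<and>
     circuit_mat (r + m) gs * kron (ket0 r) (1\<^sub>m (2 ^ m)) = kron (ket0 r) U"

text \<open>A bivariate quantity is polynomially bounded in \<open>ln (1 / h)\<close> and \<open>ln (1 / \<delta>)\<close> iff it is at most a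
  constant times some power of the following base.\<close>

definition polylog_base :: "real \<Rightarrow> real \<Rightarrow> real" where
  "polylog_base h \<delta> = 1 + ln (1 / h) + ln (1 / \<delta>)"

end

theory Submission
 imports Defs
begin

text \<open>
 Both stiffness and mass matrix have the form \<open>G\<^sup>* \<Theta> G\<close>, where \<open>G\<close> collects, for each of the three
 directions, the average and the difference of neighbouring nodal values and \<open>\<Theta>\<close> is the diagonal matrix
 of the cellwise coefficients. After odd reflection across the faces, the cube becomes a discrete
 torus, averages and differences become polynomials in cyclic shifts, and these are cheap
 circuits. With a diagonal scaling \<open>e\<close> by \<open>1\<close> or \<open>h\<close>, solving \<open>(L + A) v = g\<close> becomes inverting the
 compression of a uniformly well-conditioned diagonal matrix to the range of \<open>e G\<close>. A damped
 Neumann series does this at a cost logarithmic in the accuracy, once the orthogonal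
 projection onto that range is available. The projection comes from a multilevel frame: the scaled box
 filters \<open>2\<^sup>m \<Prod>\<^sub>j\<^sub><\<^sub>m (1 + T\<^bsup>2^j\<^esup>) / 2\<close> followed by \<open>e G\<close> have norm \<open>O(1)\<close> on all \<open>l + 2\<close> levels \<open>m\<close>, and together they
 generate the range with a frame bound of order \<open>1 / l\<^sup>2\<close>. The square root of the mass matrix is applied through the
 binomial series, since the mass matrix has a spectral gap above its kernel.

 All circuits are controlled block encodings built from reversible increments, sign flips and a
 rotation for convex combinations. As the coefficients are constant on the cells of one fixed
 coarse level, the diagonal operators depend on boundedly many qubits.
\<close>

section \<open>Circuits as operators on amplitude functions\<close>

text \<open>The obstacle is the normalisation: it multiplies under composition, so only operators
  encoded with normalisation one can be iterated until the accuracy is reached. The iterations are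
  therefore built on the form \<open>1 - A' A / N\<^sup>2\<close>, which a conjugated reflection
  yields with normalisation one whatever the \<open>N\<close> of \<open>A\<close>; this covers the
  deflation, the approximate projection and the contraction in the square root. The factorisation of
  the matrices is exact. On an edge a hat function is a multiple of 1 plus a multiple of the linear
  function running from 1 to -1; these two are orthogonal, with mean squares 1 and 1/3. Each
  difference factor thus contributes 1/3 to the mass, and a derivative multiplies it by
  \<open>12 * 4 ^ l\<close>. The bounds obtained are stronger than the claim: the normalisation is
  bounded, the error is of order \<delta>, and the gate count does not involve the number of
  regions, because the coarse level on which the coefficients are constant depends on the
  coefficients alone and disappears in the constant.\<close>

type_synonym bits = "nat => bool"
text \<open>Bit strings carry no length: wires that are not touched are spectators, so that circuits
  on disjoint wires compose without tensor products or relabelling. A register size enters only with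
  \<open>slice\<close>.\<close>

type_synonym state = "bits => complex"
type_synonym linop = "state => state"

abbreviation cr :: "real => complex" where "cr \<equiv> complex_of_real"

fun gate_op :: "gate => linop" where
 "gate_op (Gate1 t G) \<psi> x =
   G $$ (of_bool (x t), 0) * \<psi> (x(t := False)) + G $$ (of_bool (x t), 1) * \<psi> (x(t := True))"
| "gate_op (Gate2 t u G) \<psi> x =
   G $$ (2 * of_bool (x t) + of_bool (x u), 0) * \<psi> (x(t := False, u := False)) +
   G $$ (2 * of_bool (x t) + of_bool (x u), 1) * \<psi> (x(t := False, u := True)) +
   G $$ (2 * of_bool (x t) + of_bool (x u), 2) * \<psi> (x(t := True, u := False)) +
   G $$ (2 * of_bool (x t) + of_bool (x u), 3) * \<psi> (x(t := True, u := True))"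

fun gate_wires :: "gate => nat set" where
 "gate_wires (Gate1 t G) = {t}"
| "gate_wires (Gate2 t u G) = {t, u}"

fun proper_gate :: "gate => bool" where
 "proper_gate (Gate1 t G) \<longleftrightarrow> unitary 2 G"
| "proper_gate (Gate2 t u G) \<longleftrightarrow> t \<noteq> u \<and> unitary 4 G"

lemma valid_gate_iff: "valid_gate n g \<longleftrightarrow> proper_gate g \<and> gate_wires g \<subseteq> {..<n}"
 by (cases g) auto

abbreviation run :: "gate list => linop" where
 "run \<equiv> fold gate_op"

lemma run_append: "run (gs @ hs) \<psi> = run hs (run gs \<psi>)"
 by simp

lemma gate_op_add: "gate_op g (\<lambda>x. \<psi> x + \<phi> x) = (\<lambda>x. gate_op g \<psi> x + gate_op g \<phi> x)"
 by (cases g) (auto simp: fun_eq_iff algebra_simps)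

lemma gate_op_scale: "gate_op g (\<lambda>x. c * \<psi> x) = (\<lambda>x. c * gate_op g \<psi> x)"
 by (cases g) (auto simp: fun_eq_iff algebra_simps)

lemma run_add: "run gs (\<lambda>x. \<psi> x + \<phi> x) = (\<lambda>x. run gs \<psi> x + run gs \<phi> x)"
 by (induction gs arbitrary: \<psi> \<phi>) (simp_all add: gate_op_add)

lemma run_scale: "run gs (\<lambda>x. c * \<psi> x) = (\<lambda>x. c * run gs \<psi> x)"
 by (induction gs arbitrary: \<psi>) (simp_all add: gate_op_scale)

text \<open>Wires that no gate touches are classical labels, so a projection that reads only them
  commutes with the circuit. This lets the ancillas of one block be projected while another block
  runs.\<close>

lemma run_mask:
 assumes "\<And>g y t b. g \<in> set gs ==> t \<in> gate_wires g ==> P (y(t := b)) = P y"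
 shows "run gs (\<lambda>x. if P x then \<psi> x else 0) = (\<lambda>x. if P x then run gs \<psi> x else 0)"
 using assms
proof (induction gs arbitrary: \<psi>)
 case (Cons g gs)
 have P: "P (y(t := b)) = P y" if "t \<in> gate_wires g" for y t b
  using Cons.prems(1) that by (metis list.set_intros(1))
 have "gate_op g (\<lambda>x. if P x then \<psi> x else 0) = (\<lambda>x. if P x then gate_op g \<psi> x else 0)"
  using P by (cases g) (simp_all add: fun_eq_iff)
 moreover have "run gs (\<lambda>x. if P x then gate_op g \<psi> x else 0) = (\<lambda>x. if P x then run gs (gate_op g \<psi>) x else 0)"
  by (rule Cons.IH) (meson Cons.prems list.set_intros(2))
 ultimately show ?case by (simp only: fold_simps)
qed (simp only: fold_simps)

section \<open>Elementary gates\<close>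

lemma mat_adjoint_mat:
 "mat_adjoint (mat n n f) = mat n n (\<lambda>(i, j). cnj (f (j, i)))"
 by (rule eq_matI) (auto simp: mat_adjoint_def mat_of_rows_index)

lemma unitary_matI:
 assumes "\<And>i j. i < n ==> j < n ==> (\<Sum>k<n. cnj (f (k, i)) * f (k, j)) = (if i = j then 1 else 0)"
 shows "unitary n (mat n n f)"
proof -
 let ?U = "mat n n f"
 have 1: "mat_adjoint ?U * ?U = 1\<^sub>m n"
  using assms by (intro eq_matI) (auto simp: mat_adjoint_mat scalar_prod_def lessThan_atLeast0)
 have "?U * mat_adjoint ?U = 1\<^sub>m n"
  by (rule mat_mult_left_right_inverse[OF _ _ 1]) (auto simp: mat_adjoint_mat)
 with 1 show ?thesis by (simp add: unitary_def)
qed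

definition ctrl_mat :: "complex mat => complex mat" where
 "ctrl_mat G = mat 4 4 (\<lambda>(i, j). if i < 2 \<or> j < 2 then of_bool (i = j) else G $$ (i - 2, j - 2))"

abbreviation "mat2 a b c d \<equiv> mat 2 2 (\<lambda>(i, j). if i = 0 then if j = 0 then a else b else if j = 0 then c else (d::complex))"

lemma less_4_cases: "i < (4::nat) ==> i = 0 \<or> i = 1 \<or> i = 2 \<or> i = 3"
 by auto

lemma unitary_ctrl_mat2:
 assumes "unitary 2 (mat2 a b c d)"
 shows "unitary 4 (ctrl_mat (mat2 a b c d))"
proof -
 have *: "mat_adjoint (mat2 a b c d) * mat2 a b c d = 1\<^sub>m 2"
  using assms by (simp add: unitary_def)
 have e: "cnj a * a + cnj c * c = 1" "cnj a * b + cnj c * d = 0" "cnj b * a + cnj d * c = 0"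
  "cnj b * b + cnj d * d = 1"
  using arg_cong[OF *, of "\<lambda>M. M $$ (0, 0)"] arg_cong[OF *, of "\<lambda>M. M $$ (0, 1)"]
   arg_cong[OF *, of "\<lambda>M. M $$ (1, 0)"] arg_cong[OF *, of "\<lambda>M. M $$ (1, 1)"]
  by (simp_all add: mat_adjoint_mat scalar_prod_def numeral_2_eq_2)
 show ?thesis
  unfolding ctrl_mat_def using e
  by (intro unitary_matI) (auto dest!: less_4_cases simp: eval_nat_numeral lessThan_Suc add_ac)
qed

definition X_mat :: "complex mat" where "X_mat = mat2 0 1 1 0"
definition Z_mat :: "complex mat" where "Z_mat = mat2 1 0 0 (- 1)"
definition V_mat :: "complex mat" where
 "V_mat = mat2 ((1 + \<i>) / 2) ((1 - \<i>) / 2) ((1 - \<i>) / 2) ((1 + \<i>) / 2)"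
definition V'_mat :: "complex mat" where
 "V'_mat = mat2 ((1 - \<i>) / 2) ((1 + \<i>) / 2) ((1 + \<i>) / 2) ((1 - \<i>) / 2)"

lemma less_2_cases': "i < (2::nat) ==> i = 0 \<or> i = 1"
 by auto

lemma unitary_basic: "unitary 2 X_mat" "unitary 2 Z_mat" "unitary 2 V_mat" "unitary 2 V'_mat"
 unfolding X_mat_def Z_mat_def V_mat_def V'_mat_def
 by (intro unitary_matI; auto dest!: less_2_cases' simp: eval_nat_numeral lessThan_Suc algebra_simps complex_eq_iff)+

lemma unitary_ctrl: "unitary 4 (ctrl_mat X_mat)" "unitary 4 (ctrl_mat V_mat)" "unitary 4 (ctrl_mat V'_mat)"
 using unitary_basic unfolding X_mat_def V_mat_def V'_mat_def by (auto intro: unitary_ctrl_mat2)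

definition not_gate :: "nat => gate" where "not_gate t = Gate1 t X_mat"
definition cnot_gate :: "nat => nat => gate" where "cnot_gate c t = Gate2 c t (ctrl_mat X_mat)"

text \<open>The standard decomposition of the Toffoli gate, with \<open>V_mat\<close> a square root of \<open>X_mat\<close>.\<close>

definition toffoli :: "nat => nat => nat => gate list" where
 "toffoli a b t = [Gate2 b t (ctrl_mat V_mat), cnot_gate a b, Gate2 b t (ctrl_mat V'_mat),
   cnot_gate a b, Gate2 a t (ctrl_mat V_mat)]"

lemma not_gate_op: "gate_op (not_gate t) \<psi> x = \<psi> (x(t := \<not> x t))"
 by (cases "x t") (auto simp: not_gate_def X_mat_def gate_op.simps)

lemma ctrl_gate_op:
 assumes "c \<noteq> t"
 shows "gate_op (Gate2 c t (ctrl_mat G)) \<psi> x =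
  (if x c then G $$ (of_bool (x t), 0) * \<psi> (x(t := False)) + G $$ (of_bool (x t), 1) * \<psi> (x(t := True)) else \<psi> x)"
proof -
 have "x(c := False, t := False) = x(t := False)" "x(c := False, t := True) = x(t := True)" if "\<not> x c"
  using that assms by (auto simp: fun_eq_iff)
 moreover have "x(c := True, t := False) = x(t := False)" "x(c := True, t := True) = x(t := True)" if "x c"
  using that assms by (auto simp: fun_eq_iff)
 moreover have "x(t := False) = x" if "\<not> x t" using that by (simp add: fun_upd_idem)
 moreover have "x(t := True) = x" if "x t" using that by (simp add: fun_upd_idem)
 ultimately show ?thesis
  by (cases "x c"; cases "x t") (auto simp: ctrl_mat_def gate_op.simps)
qed

declare gate_op.simps [simp del]

lemma cnot_gate_op: "c \<noteq> t ==> gate_op (cnot_gate c t) \<psi> x = \<psi> (x(t := (x t \<noteq> x c)))"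
 unfolding cnot_gate_def by (subst ctrl_gate_op) (auto simp: X_mat_def fun_upd_idem)

lemma run_toffoli:
 assumes "a \<noteq> b" "a \<noteq> t" "b \<noteq> t"
 shows "run (toffoli a b t) \<psi> x = \<psi> (x(t := (x t \<noteq> (x a \<and> x b))))"
proof -
 obtain p q where v: "V_mat $$ (0, 0) = p" "V_mat $$ (0, Suc 0) = q" "V_mat $$ (Suc 0, 0) = q"
   "V_mat $$ (Suc 0, Suc 0) = p" "V'_mat $$ (0, 0) = q" "V'_mat $$ (0, Suc 0) = p"
   "V'_mat $$ (Suc 0, 0) = p" "V'_mat $$ (Suc 0, Suc 0) = q" and def: "p = (1 + \<i>) / 2" "q = (1 - \<i>) / 2"
  by (rule that[of "(1 + \<i>) / 2" "(1 - \<i>) / 2"]) (simp_all add: V_mat_def V'_mat_def)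
 \<comment> \<open>For the symmetric matrix with entries \<open>p\<close> and \<open>q\<close> these
   equations say that its square is \<open>X_mat\<close>; exchanging \<open>p\<close> and
   \<open>q\<close> gives its inverse.\<close>
 have pq: "p * p + q * q = 0" "2 * (p * q) = 1"
  unfolding def by (simp_all add: complex_eq_iff)
 have r: "p * (p * A + q * B) + q * (q * A + p * B) = B" "p * (q * A + p * B) + q * (p * A + q * B) = A"
  "q * (p * A + q * B) + p * (q * A + p * B) = A" "q * (q * A + p * B) + p * (p * A + q * B) = B" for A B
 proof -
  have 1: "p * (p * A + q * B) + q * (q * A + p * B) = (p * p + q * q) * A + 2 * (p * q) * B" for A B
   by (simp add: algebra_simps)
  have 2: "p * (q * A + p * B) + q * (p * A + q * B) = 2 * (p * q) * A + (p * p + q * q) * B" for A B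
   by (simp add: algebra_simps)
  show "p * (p * A + q * B) + q * (q * A + p * B) = B" "p * (q * A + p * B) + q * (p * A + q * B) = A"
   "q * (p * A + q * B) + p * (q * A + p * B) = A" "q * (q * A + p * B) + p * (p * A + q * B) = B"
   using 1[of A B] 2[of A B] pq by (simp_all add: add.commute)
 qed
 define w where "w \<beta> c = x(b := \<beta>, t := c)" for \<beta> c
 have w: "w \<beta> c a = x a" "w \<beta> c b = \<beta>" "w \<beta> c t = c"
  "(w \<beta> c)(t := c') = w \<beta> c'" "(w \<beta> c)(b := \<beta>') = w \<beta>' c" for \<beta> c \<beta>' c'
  using assms by (simp_all add: w_def fun_upd_twist)
 have "run (toffoli a b t) \<psi> (w \<beta> c) = \<psi> (w \<beta> (c \<noteq> (x a \<and> \<beta>)))" for \<beta> c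
  using assms by (cases "x a"; cases \<beta>; cases c)
   (simp_all add: toffoli_def cnot_gate_op ctrl_gate_op v w r)
 from this[of "x b" "x t"] show ?thesis by (simp add: w_def)
qed

section \<open>Controlled block encodings\<close>

definition clean :: "nat set => state => bool" where
 "clean K \<psi> \<longleftrightarrow> (\<forall>x. (\<exists>w\<in>K. x w) \<longrightarrow> \<psi> x = 0)"

abbreviation zero_on :: "nat set => bits => bool" where
 "zero_on K x \<equiv> \<forall>w\<in>K. \<not> x w"

definition lin :: "linop => bool" where
 "lin A \<longleftrightarrow> (\<forall>\<psi> \<phi>. A (\<lambda>x. \<psi> x + \<phi> x) = (\<lambda>x. A \<psi> x + A \<phi> x)) \<and> (\<forall>c \<psi>. A (\<lambda>x. c * \<psi> x) = (\<lambda>x. c * A \<psi> x))"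

text \<open>\<open>local s A\<close>: the operator \<open>A\<close> acts on the wires below \<open>s\<close> only, with all other wires as
 spectators. \<open>paste s x u\<close> takes its first \<open>s\<close> bits from \<open>u\<close> and the others from \<open>x\<close>.\<close>

definition paste :: "nat => bits => bits => bits" where
 "paste s x u = (\<lambda>w. if w < s then u w else x w)"

definition local :: "nat => linop => bool" where
 "local s A \<longleftrightarrow> (\<forall>\<psi> \<phi> x y. (\<forall>w<s. x w = y w) \<longrightarrow> (\<forall>u. \<psi> (paste s x u) = \<phi> (paste s y u)) \<longrightarrow> A \<psi> x = A \<phi> y)"

text \<open>Encodings are controlled from the outset, because combining them consumes control: a
  convex combination hands the flag to one of two circuits.\<close>

definition flagged :: "nat => linop => linop" where
 "flagged f A \<psi> x = (if x f then A \<psi> x else \<psi> x)"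

definition circuit_on :: "nat set => gate list => bool" where
 "circuit_on W gs \<longleftrightarrow> (\<forall>g\<in>set gs. proper_gate g \<and> gate_wires g \<subseteq> W)"

definition inverses :: "gate list => gate list => bool" where
 "inverses gs hs \<longleftrightarrow> (\<forall>\<psi>. run hs (run gs \<psi>) = \<psi> \<and> run gs (run hs \<psi>) = \<psi>)"

text \<open>On states whose work wires \<open>K\<close> are zero, and after projecting these wires back to zero, the
 circuit acts as \<open>U\<close>.\<close>

definition blocks :: "gate list => nat set => linop => bool" where
 "blocks gs K U \<longleftrightarrow> (\<forall>\<psi> x. clean K \<psi> \<longrightarrow> zero_on K x \<longrightarrow> run gs \<psi> x = U \<psi> x)"

text \<open>The inverse circuit \<open>hs\<close> is carried along with its own block
  \<open>U'\<close>: a reflection needs the exact inverse of the whole circuit, about which the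
  block \<open>U\<close> alone says nothing.\<close>

definition realises where
 "realises W K \<kappa> gs hs U U' \<longleftrightarrow> length gs \<le> \<kappa> \<and> length hs \<le> \<kappa> \<and> circuit_on W gs \<and> circuit_on W hs \<and>
   inverses gs hs \<and> blocks gs K U \<and> blocks hs K U'"

abbreviation "controlled s f a \<kappa> \<equiv> realises ({..<s} \<union> {f} \<union> {a..<a+\<kappa>}) {a..<a+\<kappa>} \<kappa>"

text \<open>Quantifying over the places of the flag and of the work wires makes an encoding
  relocatable, which replaces tensor factors when encodings are combined.\<close>

definition encodes :: "nat => nat => linop => linop => bool" where
 "encodes s \<kappa> A A' \<longleftrightarrow> lin A \<and> lin A' \<and> local s A \<and> local s A' \<and>
   (\<forall>f a. s \<le> f \<longrightarrow> s \<le> a \<longrightarrow> f \<notin> {a..<a+\<kappa>} \<longrightarrow>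
    (\<exists>gs hs. controlled s f a \<kappa> gs hs (flagged f A) (flagged f A')))"

lemma lin_add: "lin A ==> A (\<lambda>x. \<psi> x + \<phi> x) = (\<lambda>x. A \<psi> x + A \<phi> x)"
 and lin_scale: "lin A ==> A (\<lambda>x. c * \<psi> x) = (\<lambda>x. c * A \<psi> x)"
 by (simp_all add: lin_def)

lemma paste_same [simp]: "paste s x x = x"
 by (simp add: paste_def)

lemma paste_ge [simp]: "s \<le> w ==> paste s x u w = x w"
 by (simp add: paste_def)

lemma localD: "local s A ==> (\<And>w. w < s ==> x w = y w) ==> (\<And>u. \<psi> (paste s x u) = \<phi> (paste s y u)) ==> A \<psi> x = A \<phi> y"
 unfolding local_def by blast

lemma local_cong: "local s A ==> (\<And>u. \<psi> (paste s x u) = \<phi> (paste s x u)) ==> A \<psi> x = A \<phi> x"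
 by (rule localD) auto

lemma circuit_on_append [simp]: "circuit_on W (gs @ hs) \<longleftrightarrow> circuit_on W gs \<and> circuit_on W hs"
 by (auto simp: circuit_on_def)

lemma circuit_on_mono: "circuit_on W gs ==> W \<subseteq> W' ==> circuit_on W' gs"
 by (auto simp: circuit_on_def)

lemma cleanI: "(\<And>x w. w \<in> K ==> x w ==> \<psi> x = 0) ==> clean K \<psi>"
 by (auto simp: clean_def)

lemma clean_mono: "clean K \<psi> ==> K' \<subseteq> K ==> clean K' \<psi>"
 by (auto simp: clean_def)

lemma zero_on_mask:
 assumes "circuit_on W gs" "W \<inter> K = {}"
 shows "run gs (\<lambda>x. if zero_on K x then \<psi> x else 0) = (\<lambda>x. if zero_on K x then run gs \<psi> x else 0)"
proof (rule run_mask)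
 fix g t and y :: bits and b
 assume "g \<in> set gs" "t \<in> gate_wires g"
 then have "t \<notin> K" using assms by (auto simp: circuit_on_def)
 then show "zero_on K (y(t := b)) = zero_on K y" by (metis fun_upd_other)
qed

lemma clean_run:
 assumes "circuit_on W gs" "W \<inter> K = {}" "clean K \<psi>"
 shows "clean K (run gs \<psi>)"
proof -
 have "\<psi> = (\<lambda>x. if zero_on K x then \<psi> x else 0)"
  using assms(3) by (auto simp: clean_def fun_eq_iff)
 from arg_cong[OF this, of "run gs"] have "run gs \<psi> = (\<lambda>x. if zero_on K x then run gs \<psi> x else 0)"
  unfolding zero_on_mask[OF assms(1,2)] .
 then have "run gs \<psi> x = (if zero_on K x then run gs \<psi> x else 0)" for x
  by (rule fun_cong)
 then show ?thesis unfolding clean_def by presburger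
qed

lemma flagged_local: "local s A ==> s \<le> f ==> (\<And>u. \<psi> (paste s x u) = \<phi> (paste s x u)) ==> flagged f A \<psi> x = flagged f A \<phi> x"
 unfolding flagged_def using local_cong[of s A \<psi> x \<phi>] by (metis paste_same)

text \<open>Ancillas are projected only at the end, but the second circuit does not touch
  \<open>K1\<close>, so the projection of \<open>K1\<close> may be moved in front of it. Only then
  does the second circuit meet the block of the first.\<close>

lemma blocks_seq:
 assumes "circuit_on W1 gs" "circuit_on W2 hs" "W1 \<inter> K2 = {}" "W2 \<inter> K1 = {}"
  and 1: "blocks gs K1 U1" and 2: "blocks hs K2 (flagged f B)" and B: "local s B" "s \<le> f" "\<And>w. w \<in> K1 \<union> K2 ==> s \<le> w"
 shows "blocks (gs @ hs) (K1 \<union> K2) (\<lambda>\<psi>. flagged f B (U1 \<psi>))"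
 unfolding blocks_def
proof (intro allI impI)
 fix \<psi> and x :: bits
 assume c: "clean (K1 \<union> K2) \<psi>" and x: "zero_on (K1 \<union> K2) x"
 define \<phi> where "\<phi> = run gs \<psi>"
 have c2: "clean K2 \<phi>"
  unfolding \<phi>_def by (rule clean_run[OF assms(1,3)]) (rule clean_mono[OF c], simp)
 define \<phi>1 where "\<phi>1 = (\<lambda>x. if zero_on K1 x then \<phi> x else 0)"
 have "run (gs @ hs) \<psi> x = run hs \<phi> x" by (simp add: \<phi>_def)
 also have "\<dots> = run hs \<phi>1 x"
  unfolding \<phi>1_def using x by (simp add: zero_on_mask[OF assms(2,4)])
 also have "\<dots> = flagged f B \<phi>1 x"
  using 2 c2 x unfolding blocks_def by (auto simp: clean_def \<phi>1_def)
 also have "\<dots> = flagged f B (U1 \<psi>) x"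
 proof (rule flagged_local[OF B(1,2)])
  fix u
  have z: "zero_on K1 (paste s x u)" using x B(3) by auto
  then show "\<phi>1 (paste s x u) = U1 \<psi> (paste s x u)"
   using 1 clean_mono[OF c, of K1] by (auto simp: \<phi>1_def \<phi>_def blocks_def)
 qed
 finally show "run (gs @ hs) \<psi> x = flagged f B (U1 \<psi>) x" .
qed

lemma blocks_mono: "blocks gs K U ==> K \<subseteq> K' ==> blocks gs K' U"
 unfolding blocks_def by (meson clean_mono subsetD)

lemma blocks_cong: "blocks gs K U ==> (\<And>\<psi> x. zero_on K x ==> U \<psi> x = U' \<psi> x) ==> blocks gs K U'"
 unfolding blocks_def by auto

lemma encodesD:
 assumes "encodes s \<kappa> A A'" "s \<le> f" "s \<le> a" "f \<notin> {a..<a+\<kappa>}"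
 obtains gs hs where
  "controlled s f a \<kappa> gs hs (flagged f A) (flagged f A')"
 using assms unfolding encodes_def by blast

lemma realises_mono:
 "realises W K \<kappa> gs hs U U' ==> W \<subseteq> W' ==> K \<subseteq> K' ==> \<kappa> \<le> \<kappa>' ==> realises W' K' \<kappa>' gs hs U U'"
 unfolding realises_def by (meson blocks_mono circuit_on_mono le_trans)

lemma encodes_mono:
 assumes "encodes s \<kappa> A A'" "\<kappa> \<le> \<kappa>'"
 shows "encodes s \<kappa>' A A'"
 unfolding encodes_def
proof (intro conjI allI impI)
 fix f a assume fa: "s \<le> f" "s \<le> a" "f \<notin> {a..<a+\<kappa>'}"
 then have "f \<notin> {a..<a+\<kappa>}" using assms(2) by auto
 from encodesD[OF assms(1) fa(1,2) this] obtain gs hs where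
  "controlled s f a \<kappa> gs hs (flagged f A) (flagged f A')" .
 then have "controlled s f a \<kappa>' gs hs (flagged f A) (flagged f A')"
  by (rule realises_mono) (use assms(2) in auto)
 then show "\<exists>gs hs. controlled s f a \<kappa>' gs hs (flagged f A) (flagged f A')"
  by blast
qed (use assms in \<open>auto simp: encodes_def\<close>)

lemma encodesI:
 assumes "lin A" "lin A'" "local s A" "local s A'"
  and "\<And>f a. s \<le> f ==> s \<le> a ==> f \<notin> {a..<a+\<kappa>} ==>
   \<exists>gs hs. controlled s f a \<kappa> gs hs (flagged f A) (flagged f A')"
 shows "encodes s \<kappa> A A'"
 using assms unfolding encodes_def by blast

lemma realises_sym: "realises W K \<kappa> gs hs U U' ==> realises W K \<kappa> hs gs U' U"
 by (auto simp: realises_def inverses_def)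

lemma encodes_props: "encodes s \<kappa> A A' ==> lin A" "encodes s \<kappa> A A' ==> lin A'"
 "encodes s \<kappa> A A' ==> local s A" "encodes s \<kappa> A A' ==> local s A'"
 unfolding encodes_def by blast+

lemma encodes_adj:
 assumes "encodes s \<kappa> A A'" shows "encodes s \<kappa> A' A"
 by (intro encodesI encodes_props[OF assms]) (blast elim: encodesD[OF assms] intro: realises_sym)

lemma local_id: "local s (\<lambda>\<psi>. \<psi>)"
 unfolding local_def
proof (intro allI impI)
 fix \<psi> \<phi> :: state and x y :: bits
 assume "\<forall>w<s. x w = y w" and "\<forall>u. \<psi> (paste s x u) = \<phi> (paste s y u)"
 moreover from this(1) have "paste s y x = y" by (auto simp: paste_def)
 ultimately show "\<psi> x = \<phi> y" by (metis paste_same)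
qed

lemma encodes_id: "encodes s 0 (\<lambda>\<psi>. \<psi>) (\<lambda>\<psi>. \<psi>)"
proof (rule encodesI)
 fix f a
 have "controlled s f a 0 [] [] (flagged f (\<lambda>\<psi>. \<psi>)) (flagged f (\<lambda>\<psi>. \<psi>))"
  by (simp add: realises_def circuit_on_def inverses_def blocks_def flagged_def)
 then show "\<exists>gs hs. controlled s f a 0 gs hs (flagged f (\<lambda>\<psi>. \<psi>)) (flagged f (\<lambda>\<psi>. \<psi>))"
  by blast
qed (auto simp: lin_def local_id)

lemma lin_comp: "lin A ==> lin B ==> lin (\<lambda>\<psi>. A (B \<psi>))"
 by (simp add: lin_def)

lemma local_comp:
 assumes "local s A" "local s B" shows "local s (\<lambda>\<psi>. A (B \<psi>))"
 unfolding local_def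
proof (intro allI impI)
 fix \<psi> \<phi> :: state and x y :: bits
 assume xy: "\<forall>w<s. x w = y w" and e: "\<forall>u. \<psi> (paste s x u) = \<phi> (paste s y u)"
 show "A (B \<psi>) x = A (B \<phi>) y"
 proof (rule localD[OF assms(1)])
  fix u
  have "paste s (paste s x u) v = paste s x v" "paste s (paste s y u) v = paste s y v" for v
   by (auto simp: paste_def)
  then show "B \<psi> (paste s x u) = B \<phi> (paste s y u)"
   by (intro localD[OF assms(2)]) (use e in \<open>auto simp: paste_def\<close>)
 qed (use xy in auto)
qed

text \<open>The ancillas of the factor applied first must stay untouched until the final projection;
  hence the disjoint ranges of work wires and the sum of the costs.\<close>

lemma encodes_comp:
 assumes "encodes s \<kappa> A A'" "encodes s \<mu> B B'"
 shows "encodes s (\<kappa> + \<mu>) (\<lambda>\<psi>. A (B \<psi>)) (\<lambda>\<psi>. B' (A' \<psi>))"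
proof (rule encodesI)
 note pA = encodes_props[OF assms(1)] and pB = encodes_props[OF assms(2)]
 fix f a assume fa: "s \<le> f" "s \<le> a" "f \<notin> {a..<a+(\<kappa>+\<mu>)}"
 let ?K1 = "{a..<a+\<kappa>}" and ?K2 = "{a+\<kappa>..<a+\<kappa>+\<mu>}"
 have K: "{a..<a+(\<kappa>+\<mu>)} = ?K2 \<union> ?K1" by auto
 have f: "f \<notin> ?K1" "f \<notin> ?K2" using fa by auto
 from encodesD[OF assms(1) fa(1,2) f(1)] obtain gs hs where
  "realises ({..<s} \<union> {f} \<union> ?K1) ?K1 \<kappa> gs hs (flagged f A) (flagged f A')" .
 note A = this[unfolded realises_def, THEN conjunct1] this[unfolded realises_def, THEN conjunct2]
 from encodesD[OF assms(2) fa(1) _ f(2)] fa obtain gs' hs' where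
  "realises ({..<s} \<union> {f} \<union> ?K2) ?K2 \<mu> gs' hs' (flagged f B) (flagged f B')" by auto
 note B = this[unfolded realises_def, THEN conjunct1] this[unfolded realises_def, THEN conjunct2]
 have d: "({..<s} \<union> {f} \<union> ?K1) \<inter> ?K2 = {}" "({..<s} \<union> {f} \<union> ?K2) \<inter> ?K1 = {}" using fa f by auto
 have 1: "blocks (gs' @ gs) (?K2 \<union> ?K1) (\<lambda>\<psi>. flagged f A (flagged f B \<psi>))"
  by (rule blocks_seq[of "{..<s} \<union> {f} \<union> ?K2" _ "{..<s} \<union> {f} \<union> ?K1", OF _ _ d(2,1) _ _ pA(3) fa(1)])
   (use A B fa in auto)
 have 2: "blocks (hs @ hs') (?K1 \<union> ?K2) (\<lambda>\<psi>. flagged f B' (flagged f A' \<psi>))"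
  by (rule blocks_seq[of "{..<s} \<union> {f} \<union> ?K1" _ "{..<s} \<union> {f} \<union> ?K2", OF _ _ d(1,2) _ _ pB(4) fa(1)])
   (use A B fa in auto)
 have ff: "flagged f C (flagged f C' \<psi>) x = flagged f (\<lambda>\<psi>. C (C' \<psi>)) \<psi> x" if "local s C" for C C' \<psi> x
 proof (cases "x f")
  case True
  then have "C (flagged f C' \<psi>) x = C (C' \<psi>) x"
   by (intro local_cong[OF that]) (simp add: flagged_def fa(1))
  then show ?thesis using True by (simp add: flagged_def)
 qed (simp add: flagged_def)
 have "controlled s f a (\<kappa>+\<mu>) (gs' @ gs) (hs @ hs')
   (flagged f (\<lambda>\<psi>. A (B \<psi>))) (flagged f (\<lambda>\<psi>. B' (A' \<psi>)))"
  unfolding realises_def circuit_on_append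
 proof (intro conjI)
  show "blocks (gs' @ gs) {a..<a+(\<kappa>+\<mu>)} (flagged f (\<lambda>\<psi>. A (B \<psi>)))"
   unfolding K by (rule blocks_cong[OF 1]) (simp add: ff pA)
  show "blocks (hs @ hs') {a..<a+(\<kappa>+\<mu>)} (flagged f (\<lambda>\<psi>. B' (A' \<psi>)))"
   unfolding K Un_commute[of ?K2] by (rule blocks_cong[OF 2]) (simp add: ff pB)
  show "inverses (gs' @ gs) (hs @ hs')"
   using A B by (simp add: inverses_def)
 qed (use A B in \<open>auto intro: circuit_on_mono\<close>)
 then show "\<exists>gs hs. controlled s f a (\<kappa>+\<mu>) gs hs
   (flagged f (\<lambda>\<psi>. A (B \<psi>))) (flagged f (\<lambda>\<psi>. B' (A' \<psi>)))"
  by blast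
qed (use encodes_props[OF assms(1)] encodes_props[OF assms(2)] in \<open>simp_all add: lin_comp local_comp\<close>)

subsection \<open>Convex combinations\<close>

text \<open>A rotation in the span of the two basis states with exactly one wire set: it shares a
  raised flag between two wires and leaves a lowered flag alone.\<close>

definition givens_mat :: "real => real => complex mat" where
 "givens_mat c s = mat 4 4 (\<lambda>(i, j). cr
   (if i = j then if i = 0 \<or> i = 3 then 1 else c else if (i, j) = (1, 2) then s else if (i, j) = (2, 1) then - s else 0))"

lemma unitary_givens:
 assumes "c\<^sup>2 + s\<^sup>2 = 1" shows "unitary 4 (givens_mat c s)"
proof -
 have "cr c * cr c + cr s * cr s = 1"
  using assms by (metis of_real_1 of_real_add of_real_mult power2_eq_square)
 then show ?thesis unfolding givens_mat_def
  by (intro unitary_matI) (auto dest!: less_4_cases simp: eval_nat_numeral lessThan_Suc add_ac)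
qed

lemma givens_op:
 assumes "f \<noteq> g"
 shows "gate_op (Gate2 f g (givens_mat c s)) \<psi> x =
  (if x f = x g then \<psi> x
   else if x f then c * \<psi> x - s * \<psi> (x(f := False, g := True))
   else c * \<psi> x + s * \<psi> (x(f := True, g := False)))"
proof -
 have "x(f := x f, g := x g) = x" by auto
 then show ?thesis
  using assms by (cases "x f"; cases "x g") (simp_all add: gate_op.simps givens_mat_def)
qed

lemma givens_inverse:
 assumes "f \<noteq> g" "c\<^sup>2 + s\<^sup>2 = 1"
 shows "gate_op (Gate2 f g (givens_mat c (- s))) (gate_op (Gate2 f g (givens_mat c s)) \<psi>) = \<psi>"
proof
 fix x :: bits
 define w where "w a b = x(f := a, g := b)" for a b
 have w: "w a b f = a" "w a b g = b" "(w a b)(f := a', g := b') = w a' b'" for a b a' b'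
  using assms by (auto simp: w_def)
 have cs: "cr c * (cr c * z) + cr s * (cr s * z) = z" for z
 proof -
  have "cr (c\<^sup>2 + s\<^sup>2) * z = z" using assms by simp
  then show ?thesis by (simp add: power2_eq_square algebra_simps)
 qed
 have "gate_op (Gate2 f g (givens_mat c (- s))) (gate_op (Gate2 f g (givens_mat c s)) \<psi>) (w a b) = \<psi> (w a b)" for a b
  using cs[of "\<psi> (w True False)"] cs[of "\<psi> (w False True)"]
  by (cases a; cases b) (simp_all add: givens_op[OF assms(1)] w algebra_simps)
 moreover have "w (x f) (x g) = x" by (auto simp: w_def)
 ultimately show "gate_op (Gate2 f g (givens_mat c (- s))) (gate_op (Gate2 f g (givens_mat c s)) \<psi>) x = \<psi> x"
  by metis
qed

text \<open>After the first rotation the raised flag sits on \<open>f\<close> with amplitude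
  \<open>sqrt (1 - p)\<close> and on \<open>g\<close> with amplitude \<open>sqrt p\<close>; these
  branches meet \<open>B\<close> and \<open>A\<close>. Rotating back and projecting \<open>g\<close>
  to zero squares both amplitudes. \<open>U\<close> is pinned down only at the three flag positions
  that occur, so that either order of the two circuits fits.\<close>

lemma givens_wrap:
 fixes p :: real and A B :: linop
 assumes ms: "blocks ms (K - {g}) U" and "f \<noteq> g" "f \<notin> K" "g \<in> K" "s \<le> f" "\<And>w. w \<in> K ==> s \<le> w"
  and A: "lin A" "local s A" and B: "lin B" "local s B" and p: "0 \<le> p" "p \<le> 1"
  and U: "\<And>\<psi> y. zero_on (K - {g}) y ==> y f ==> \<not> y g ==> U \<psi> y = B \<psi> y"
   "\<And>\<psi> y. zero_on (K - {g}) y ==> \<not> y f ==> y g ==> U \<psi> y = A \<psi> y"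
   "\<And>\<psi> y. zero_on (K - {g}) y ==> \<not> y f ==> \<not> y g ==> U \<psi> y = \<psi> y"
 shows "blocks ([Gate2 f g (givens_mat (sqrt (1 - p)) (sqrt p))] @ ms @ [Gate2 f g (givens_mat (sqrt (1 - p)) (- sqrt p))]) K
  (flagged f (\<lambda>\<psi> x. p * A \<psi> x + (1 - p) * B \<psi> x))"
 unfolding blocks_def
proof (intro allI impI)
 fix \<psi> and x :: bits
 assume c: "clean K \<psi>" and x: "zero_on K x"
 let ?c = "sqrt (1 - p)" and ?s = "sqrt p"
 define \<psi>1 where "\<psi>1 = gate_op (Gate2 f g (givens_mat ?c ?s)) \<psi>"
 have u: "unitary 4 (givens_mat ?c ?s)" using p by (intro unitary_givens) simp
 have "clean (K - {g}) (run [Gate2 f g (givens_mat ?c ?s)] \<psi>)"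
  by (rule clean_run[of "{f, g}"]) (use assms u in \<open>auto simp: circuit_on_def intro: clean_mono[OF c]\<close>)
 then have c1: "clean (K - {g}) \<psi>1" by (simp add: \<psi>1_def)
 have sg: "s \<le> g" using assms by blast
 define x' where "x' = x(f := False, g := True)"
 have x': "\<not> x' f" "x' g" "\<And>w. w \<noteq> f ==> w \<noteq> g ==> x' w = x w"
  using \<open>f \<noteq> g\<close> by (simp_all add: x'_def)
 have g: "\<not> x g" using x assms by auto
 have run: "run ([Gate2 f g (givens_mat ?c ?s)] @ ms @ [Gate2 f g (givens_mat ?c (- ?s))]) \<psi> x =
   gate_op (Gate2 f g (givens_mat ?c (- ?s))) (run ms \<psi>1) x" by (simp add: \<psi>1_def)
 have zx: "zero_on (K - {g}) x" "zero_on (K - {g}) x'"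
  using x x'(3) \<open>f \<notin> K\<close> by (blast, metis DiffE singletonI)
 have ms': "run ms \<psi>1 y = U \<psi>1 y" if "zero_on (K - {g}) y" for y
  using ms c1 that by (auto simp: blocks_def)
 have \<psi>0: "\<psi> y = 0" if "y g" for y using c that assms by (auto simp: clean_def)
 show "run ([Gate2 f g (givens_mat ?c ?s)] @ ms @ [Gate2 f g (givens_mat ?c (- ?s))]) \<psi> x =
   flagged f (\<lambda>\<psi> x. p * A \<psi> x + (1 - p) * B \<psi> x) \<psi> x"
 proof (cases "x f")
  case False
  have "run ms \<psi>1 x = \<psi>1 x" using ms'[OF zx(1)] U(3)[OF zx(1) False g] by simp
  also have "\<psi>1 x = \<psi> x" using False g by (simp add: \<psi>1_def givens_op \<open>f \<noteq> g\<close>)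
  finally show ?thesis using False g by (simp only: run) (simp add: givens_op \<open>f \<noteq> g\<close> flagged_def)
 next
  case True
  have "B \<psi>1 x = B (\<lambda>y. ?c * \<psi> y) x"
  proof (rule local_cong[OF B(2)])
   fix u
   have "\<not> paste s x u g" "paste s x u f" using g True sg assms(5) by auto
   then show "\<psi>1 (paste s x u) = ?c * \<psi> (paste s x u)"
    using \<psi>0 by (simp add: \<psi>1_def givens_op \<open>f \<noteq> g\<close>)
  qed
  then have 1: "run ms \<psi>1 x = ?c * B \<psi> x"
   using U(1)[OF zx(1) True g] ms'[OF zx(1)] by (simp add: lin_scale[OF B(1)])
  have "A \<psi>1 x' = A (\<lambda>y. ?s * \<psi> y) x"
  proof (rule localD[OF A(2)])
   fix w assume "w < s"
   then show "x' w = x w" using assms(5) sg by (intro x'(3)) auto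
  next
   fix u
   have "(paste s x' u)(f := True, g := False) = paste s x u"
    using g True assms(5) sg x' by (auto simp: paste_def fun_eq_iff)
   moreover have "paste s x' u g" "\<not> paste s x' u f" using assms(5) sg x' by auto
   ultimately show "\<psi>1 (paste s x' u) = ?s * \<psi> (paste s x u)"
    using \<psi>0[of "paste s x' u"] by (simp add: \<psi>1_def givens_op \<open>f \<noteq> g\<close>)
  qed
  then have 2: "run ms \<psi>1 x' = ?s * A \<psi> x"
   using U(2)[OF zx(2) x'(1,2)] ms'[OF zx(2)] by (simp add: lin_scale[OF A(1)])
  have sq: "cr ?s * cr ?s = p" "cr ?c * cr ?c = 1 - p"
   using p by (simp_all flip: of_real_mult)
  have "gate_op (Gate2 f g (givens_mat ?c (- ?s))) (run ms \<psi>1) x = ?c * run ms \<psi>1 x + ?s * run ms \<psi>1 x'"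
   using True g by (simp add: givens_op \<open>f \<noteq> g\<close> x'_def)
  also have "\<dots> = (cr ?c * cr ?c) * B \<psi> x + (cr ?s * cr ?s) * A \<psi> x"
   by (simp only: 1 2 mult.assoc)
  finally show ?thesis using True by (simp only: run sq) (simp add: flagged_def)
 qed
qed

lemma lin_combine:
 assumes "lin A" "lin B" shows "lin (\<lambda>\<psi> x. a * A \<psi> x + b * B \<psi> x)"
 by (simp add: lin_def lin_add[OF assms(1)] lin_add[OF assms(2)] lin_scale[OF assms(1)] lin_scale[OF assms(2)] algebra_simps)

lemma local_combine:
 assumes "local s A" "local s B" shows "local s (\<lambda>\<psi> x. a * A \<psi> x + b * B \<psi> x)"
 using assms unfolding local_def by metis

lemma encodes_convex:
 fixes p :: real and A A' B B' :: linop
 assumes "encodes s \<kappa> A A'" "encodes s \<mu> B B'" and p: "0 \<le> p" "p \<le> 1"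
 shows "encodes s (\<kappa> + \<mu> + 2) (\<lambda>\<psi> x. p * A \<psi> x + (1 - p) * B \<psi> x) (\<lambda>\<psi> x. p * A' \<psi> x + (1 - p) * B' \<psi> x)"
proof (rule encodesI)
 note pA = encodes_props[OF assms(1)] and pB = encodes_props[OF assms(2)]
 fix f g assume fa: "s \<le> f" "s \<le> g" "f \<notin> {g..<g+(\<kappa>+\<mu>+2)}"
 let ?K1 = "{Suc g..<Suc g+\<kappa>}" and ?K2 = "{Suc g+\<kappa>..<Suc g+\<kappa>+\<mu>}"
 \<comment> \<open>One extra wire \<open>g\<close> holds the second flag; the summand 2 in the cost
   is due to the two rotations.\<close>
 let ?K = "{g..<g+(\<kappa>+\<mu>+1)}"
 have K: "?K - {g} = ?K1 \<union> ?K2" by auto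
 have f: "f \<notin> ?K1" "f \<notin> ?K2" "f \<noteq> g" using fa by auto
 from encodesD[OF assms(1), of g "Suc g"] fa obtain gs hs where
  "realises ({..<s} \<union> {g} \<union> ?K1) ?K1 \<kappa> gs hs (flagged g A) (flagged g A')" by auto
 note A = this[unfolded realises_def, THEN conjunct1] this[unfolded realises_def, THEN conjunct2]
 from encodesD[OF assms(2) fa(1) _ f(2)] fa obtain gs' hs' where
  "realises ({..<s} \<union> {f} \<union> ?K2) ?K2 \<mu> gs' hs' (flagged f B) (flagged f B')" by auto
 note B = this[unfolded realises_def, THEN conjunct1] this[unfolded realises_def, THEN conjunct2]
 have d: "({..<s} \<union> {g} \<union> ?K1) \<inter> ?K2 = {}" "({..<s} \<union> {f} \<union> ?K2) \<inter> ?K1 = {}" using fa f by auto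
 have 1: "blocks (gs @ gs') (?K1 \<union> ?K2) (\<lambda>\<psi>. flagged f B (flagged g A \<psi>))"
  by (rule blocks_seq[of "{..<s} \<union> {g} \<union> ?K1" _ "{..<s} \<union> {f} \<union> ?K2", OF _ _ d(1,2) _ _ pB(3) fa(1)])
   (use A B fa in auto)
 have 2: "blocks (hs' @ hs) (?K2 \<union> ?K1) (\<lambda>\<psi>. flagged g A' (flagged f B' \<psi>))"
  by (rule blocks_seq[of "{..<s} \<union> {f} \<union> ?K2" _ "{..<s} \<union> {g} \<union> ?K1", OF _ _ d(2,1) _ _ pA(4) fa(2)])
   (use A B fa in auto)
 let ?G = "Gate2 f g (givens_mat (sqrt (1 - p)) (sqrt p))" and ?H = "Gate2 f g (givens_mat (sqrt (1 - p)) (- sqrt p))"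
 have I: "f \<noteq> g" "f \<notin> ?K" "g \<in> ?K" "s \<le> f" "\<And>w. w \<in> ?K ==> s \<le> w" using fa by auto
 have fl: "C (flagged i D \<psi>) y = C \<psi> y" if "local s C" "s \<le> i" "\<not> y i" for C i D \<psi> y
  using that by (intro local_cong[of s C]) (auto simp: flagged_def)
 have b1: "blocks ([?G] @ (gs @ gs') @ [?H]) ?K (flagged f (\<lambda>\<psi> x. p * A \<psi> x + (1 - p) * B \<psi> x))"
  by (rule givens_wrap[OF 1[folded K] I pA(1,3) pB(1,3) p]) (use fl[OF pB(3) fa(2)] in \<open>auto simp: flagged_def[of f] flagged_def[of g A]\<close>)
 have b2: "blocks ([?G] @ (hs' @ hs) @ [?H]) ?K (flagged f (\<lambda>\<psi> x. p * A' \<psi> x + (1 - p) * B' \<psi> x))"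
  by (rule givens_wrap[OF 2[unfolded Un_commute[of ?K2], folded K] I pA(2,4) pB(2,4) p])
   (use fl[OF pA(4) fa(1)] in \<open>auto simp: flagged_def[of g] flagged_def[of f B']\<close>)
 have cs: "(sqrt (1 - p))\<^sup>2 + (sqrt p)\<^sup>2 = 1" "(sqrt (1 - p))\<^sup>2 + (- sqrt p)\<^sup>2 = 1" using p by auto
 have u: "unitary 4 (givens_mat (sqrt (1 - p)) (sqrt p))" "unitary 4 (givens_mat (sqrt (1 - p)) (- sqrt p))"
  using cs by (auto intro: unitary_givens)
 have "controlled s f g (\<kappa>+\<mu>+2)
   ([?G] @ (gs @ gs') @ [?H]) ([?G] @ (hs' @ hs) @ [?H])
   (flagged f (\<lambda>\<psi> x. p * A \<psi> x + (1 - p) * B \<psi> x)) (flagged f (\<lambda>\<psi> x. p * A' \<psi> x + (1 - p) * B' \<psi> x))"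
  unfolding realises_def circuit_on_append
 proof (intro conjI)
  show "blocks ([?G] @ (gs @ gs') @ [?H]) {g..<g+(\<kappa>+\<mu>+2)} (flagged f (\<lambda>\<psi> x. p * A \<psi> x + (1 - p) * B \<psi> x))"
   by (rule blocks_mono[OF b1]) auto
  show "blocks ([?G] @ (hs' @ hs) @ [?H]) {g..<g+(\<kappa>+\<mu>+2)} (flagged f (\<lambda>\<psi> x. p * A' \<psi> x + (1 - p) * B' \<psi> x))"
   by (rule blocks_mono[OF b2]) auto
  show "inverses ([?G] @ (gs @ gs') @ [?H]) ([?G] @ (hs' @ hs) @ [?H])"
   using A B givens_inverse[OF f(3) cs(1)] givens_inverse[OF f(3) cs(2)] by (simp add: inverses_def)
  show "circuit_on ({..<s} \<union> {f} \<union> {g..<g + (\<kappa> + \<mu> + 2)}) [?G]" "circuit_on ({..<s} \<union> {f} \<union> {g..<g + (\<kappa> + \<mu> + 2)}) [?H]"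
   "circuit_on ({..<s} \<union> {f} \<union> {g..<g + (\<kappa> + \<mu> + 2)}) [?G]" "circuit_on ({..<s} \<union> {f} \<union> {g..<g + (\<kappa> + \<mu> + 2)}) [?H]"
   using u f by (auto simp: circuit_on_def)
 qed (use A B in \<open>auto intro: circuit_on_mono\<close>)
 then show "\<exists>gs hs. controlled s f g (\<kappa>+\<mu>+2) gs hs
   (flagged f (\<lambda>\<psi> x. p * A \<psi> x + (1 - p) * B \<psi> x)) (flagged f (\<lambda>\<psi> x. p * A' \<psi> x + (1 - p) * B' \<psi> x))"
  by blast
qed (intro lin_combine local_combine encodes_props[OF assms(1)] encodes_props[OF assms(2)])+

subsection \<open>Reflections\<close>

definition toffoli0 :: "nat => nat => nat => gate list" where
 "toffoli0 a b t = not_gate b # toffoli a b t @ [not_gate b]"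

lemma run_toffoli0:
 assumes "a \<noteq> b" "a \<noteq> t" "b \<noteq> t"
 shows "run (toffoli0 a b t) \<psi> x = \<psi> (x(t := (x t \<noteq> (x a \<and> \<not> x b))))"
proof -
 have "x(b := \<not> x b, t := y, b := x b) = x(t := y)" for y
  using assms by (auto simp: fun_eq_iff)
 then show ?thesis
  using assms by (simp add: toffoli0_def not_gate_op run_toffoli)
qed

lemma length_toffoli: "length (toffoli a b t) = 5" "length (toffoli0 a b t) = 7"
 by (simp_all add: toffoli_def toffoli0_def)

lemma circuit_on_toffoli:
 "a \<noteq> b ==> a \<noteq> t ==> b \<noteq> t ==> {a, b, t} \<subseteq> W ==> circuit_on W (toffoli a b t)"
 "a \<noteq> b ==> a \<noteq> t ==> b \<noteq> t ==> {a, b, t} \<subseteq> W ==> circuit_on W (toffoli0 a b t)"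
 using unitary_basic unitary_ctrl
 by (auto simp: circuit_on_def toffoli_def toffoli0_def cnot_gate_def not_gate_def)

lemma xor_cancel: "((p = q) = q) = p"
 by auto

lemma toffoli_involution:
 assumes "a \<noteq> b" "a \<noteq> t" "b \<noteq> t"
 shows "run (toffoli a b t) (run (toffoli a b t) \<psi>) = \<psi>" "run (toffoli0 a b t) (run (toffoli0 a b t) \<psi>) = \<psi>"
 using assms by (simp_all add: run_toffoli run_toffoli0 fun_eq_iff xor_cancel)

text \<open>The work wires \<open>b, b + 1, \<dots>\<close> hold the partial conjunctions.\<close>

fun sign_flip :: "nat => nat => nat list => gate list" where
 "sign_flip f b [] = [Gate1 f Z_mat]"
| "sign_flip f b (w # ws) = toffoli0 f w b @ sign_flip b (Suc b) ws @ toffoli0 f w b"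

lemma length_sign_flip: "length (sign_flip f b ws) = 14 * length ws + 1"
 by (induction f b ws rule: sign_flip.induct) (simp_all add: length_toffoli)

lemma Z_gate_op: "gate_op (Gate1 f Z_mat) \<psi> x = (if x f then - \<psi> x else \<psi> x)"
 by (simp add: gate_op.simps Z_mat_def fun_upd_idem)

lemma circuit_on_sign_flip:
 assumes "distinct (f # ws)" "(set (f # ws)) \<inter> {b..<b + length ws} = {}" "set (f # ws) \<union> {b..<b + length ws} \<subseteq> W"
 shows "circuit_on W (sign_flip f b ws)"
 using assms
proof (induction f b ws rule: sign_flip.induct)
 case (1 f b)
 then show ?case using unitary_basic by (simp add: circuit_on_def)
next
 case (2 f b w ws)
 have "circuit_on W (toffoli0 f w b)" using 2(2-) by (intro circuit_on_toffoli) auto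
 moreover have "circuit_on W (sign_flip b (Suc b) ws)" using 2(2-) by (intro 2(1)) auto
 ultimately show ?case by simp
qed

lemma sign_flip_involution:
 assumes "distinct (f # ws)" "(set (f # ws)) \<inter> {b..<b + length ws} = {}"
 shows "run (sign_flip f b ws) (run (sign_flip f b ws) \<psi>) = \<psi>"
 using assms
proof (induction f b ws arbitrary: \<psi> rule: sign_flip.induct)
 case (1 f b)
 then show ?case by (auto simp: fun_eq_iff Z_gate_op)
next
 case (2 f b w ws)
 have "run (toffoli0 f w b) (run (toffoli0 f w b) \<phi>) = \<phi>" for \<phi> using 2(2-) by (intro toffoli_involution) auto
 moreover have "run (sign_flip b (Suc b) ws) (run (sign_flip b (Suc b) ws) \<phi>) = \<phi>" for \<phi> using 2(2-) by (intro 2(1)) auto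
 ultimately show ?case by simp
qed

lemma run_sign_flip:
 assumes "distinct (f # ws)" "(set (f # ws)) \<inter> {b..<b + length ws} = {}" "clean {b..<b + length ws} \<psi>"
 shows "run (sign_flip f b ws) \<psi> x = (if x f \<and> zero_on (set ws) x then - \<psi> x else \<psi> x)"
 using assms
proof (induction f b ws arbitrary: \<psi> x rule: sign_flip.induct)
 case (1 f b)
 then show ?case by (simp add: Z_gate_op)
next
 case (2 f b w ws)
 have d: "f \<noteq> w" "f \<noteq> b" "w \<noteq> b" using 2(2,3) by auto
 define \<phi> where "\<phi> = run (toffoli0 f w b) \<psi>"
 have \<phi>: "\<phi> y = \<psi> (y(b := (y b \<noteq> (y f \<and> \<not> y w))))" for y
  by (simp add: \<phi>_def run_toffoli0 d)
 have z: "\<psi> y = 0" if "v \<in> {b..<b + length (w # ws)}" "y v" for y v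
  using that 2(4) unfolding clean_def by blast
 have "clean {Suc b..<Suc b + length ws} \<phi>"
 proof (rule cleanI)
  fix y v assume "v \<in> {Suc b..<Suc b + length ws}" "y v"
  then show "\<phi> y = 0" unfolding \<phi> by (intro z[of v]) auto
 qed
 then have IH: "run (sign_flip b (Suc b) ws) \<phi> y = (if y b \<and> zero_on (set ws) y then - \<phi> y else \<phi> y)" for y
  using 2(2,3) by (intro 2(1)) auto
 define y where "y = x(b := (x b \<noteq> (x f \<and> \<not> x w)))"
 have b: "b \<notin> set ws" using 2(3) by auto
 have y: "y b = (x b \<noteq> (x f \<and> \<not> x w))" "zero_on (set ws) y = zero_on (set ws) x"
  unfolding y_def by (simp, metis b fun_upd_other)
 have "\<phi> y = \<psi> x"
 proof -
  have "y f = x f" "y w = x w" using d by (simp_all add: y_def)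
  then have "(y b \<noteq> (y f \<and> \<not> y w)) = x b" using y(1) by blast
  then have "y(b := (y b \<noteq> (y f \<and> \<not> y w))) = x" by (simp only: y_def fun_upd_upd fun_upd_triv)
  then show ?thesis by (simp only: \<phi>)
 qed
 moreover have "run (sign_flip f b (w # ws)) \<psi> x = run (sign_flip b (Suc b) ws) \<phi> y"
  by (simp only: sign_flip.simps fold_append o_apply run_toffoli0[OF d(1,2,3)] \<phi>_def y_def)
 ultimately have "run (sign_flip f b (w # ws)) \<psi> x = (if y b \<and> zero_on (set ws) x then - \<psi> x else \<psi> x)"
  unfolding IH y(2) by simp
 moreover have "\<psi> x = 0" if "x b" using z[of b x] that by simp
 ultimately show ?case unfolding y(1) by (cases "x b") simp_all
qed

abbreviation zero_flip :: "nat list => linop" where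
 "zero_flip ws \<psi> x \<equiv> if zero_on (set ws) x then - \<psi> x else \<psi> x"

lemma encodes_sign_flip:
 assumes "distinct ws" "set ws \<subseteq> {..<s}"
 shows "encodes s (14 * length ws + 1) (zero_flip ws)
  (zero_flip ws)"
proof (rule encodesI)
 have "local s (zero_flip ws)"
  unfolding local_def
 proof (intro allI impI)
  fix \<psi> \<phi> :: state and x y :: bits
  assume e: "\<forall>w<s. x w = y w" "\<forall>u. \<psi> (paste s x u) = \<phi> (paste s y u)"
  have "\<psi> x = \<phi> y" 
   by (rule localD[OF local_id, where s = s and x = x and y = y and \<psi> = \<psi> and \<phi> = \<phi>]) (use e in auto)
  moreover have "zero_on (set ws) x = zero_on (set ws) y"
   by (metis assms(2) e(1) lessThan_iff subsetD)
  ultimately show "(if zero_on (set ws) x then - \<psi> x else \<psi> x) = (if zero_on (set ws) y then - \<phi> y else \<phi> y)"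
   by simp
 qed
 note loc = this
 show "local s (zero_flip ws)" by (rule loc)
 show "local s (zero_flip ws)" by (rule loc)
 fix f a assume fa: "s \<le> f" "s \<le> a" "f \<notin> {a..<a+(14 * length ws + 1)}"
 let ?K = "{a..<a+(14 * length ws + 1)}" and ?gs = "sign_flip f a ws"
 have d: "distinct (f # ws)" "set (f # ws) \<inter> {a..<a + length ws} = {}" using assms fa by auto
 have "blocks ?gs ?K (flagged f (zero_flip ws))"
  unfolding blocks_def
 proof (intro allI impI)
  fix \<psi> x assume "clean ?K \<psi>"
  then have "clean {a..<a+length ws} \<psi>" by (rule clean_mono) auto
  from run_sign_flip[OF d this] show "run ?gs \<psi> x = flagged f (zero_flip ws) \<psi> x"
   by (simp add: flagged_def)
 qed
 moreover have "circuit_on ({..<s} \<union> {f} \<union> ?K) ?gs"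
  by (rule circuit_on_sign_flip[OF d]) (use assms in auto)
 moreover have "inverses ?gs ?gs"
  using sign_flip_involution[OF d] by (simp add: inverses_def)
 ultimately have "realises ({..<s} \<union> {f} \<union> ?K) ?K (14 * length ws + 1) ?gs ?gs
   (flagged f (zero_flip ws)) (flagged f (zero_flip ws))"
  by (simp add: realises_def length_sign_flip)
 then show "\<exists>gs hs. realises ({..<s} \<union> {f} \<union> ?K) ?K (14 * length ws + 1) gs hs
   (flagged f (zero_flip ws)) (flagged f (zero_flip ws))"
  by blast
qed (auto simp: lin_def)

text \<open>The reflection about the zero state of the ancillas, conjugated by the circuit for \<open>A\<close>,
 encodes \<open>1 - 2 A' A\<close> without any loss in normalisation.\<close>

lemma encodes_reflect:
 fixes A A' :: linop
 assumes "encodes s \<kappa> A A'"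
 shows "encodes s (16 * \<kappa> + 1) (\<lambda>\<psi> x. \<psi> x - 2 * A' (A \<psi>) x) (\<lambda>\<psi> x. \<psi> x - 2 * A' (A \<psi>) x)"
proof (rule encodesI)
 note pA = encodes_props[OF assms]
 have "lin (\<lambda>\<psi> x. 1 * \<psi> x + (- 2) * A' (A \<psi>) x)"
  by (rule lin_combine[OF _ lin_comp[OF pA(2,1)]]) (simp add: lin_def)
 then show "lin (\<lambda>\<psi> x. \<psi> x - 2 * A' (A \<psi>) x)" "lin (\<lambda>\<psi> x. \<psi> x - 2 * A' (A \<psi>) x)" by simp_all
 have "local s (\<lambda>\<psi> x. 1 * \<psi> x + (- 2) * A' (A \<psi>) x)"
  by (rule local_combine[OF local_id local_comp[OF pA(4,3)]])
 then show "local s (\<lambda>\<psi> x. \<psi> x - 2 * A' (A \<psi>) x)" "local s (\<lambda>\<psi> x. \<psi> x - 2 * A' (A \<psi>) x)" by simp_all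
 fix f a assume fa: "s \<le> f" "s \<le> a" "f \<notin> {a..<a+(16 * \<kappa> + 1)}"
 let ?K = "{a..<a+(16 * \<kappa> + 1)}" and ?K1 = "{a..<a+\<kappa>}" and ?K2 = "{a+\<kappa>..<a+\<kappa>+\<kappa>}"
 have f: "f \<notin> ?K1" using fa by auto
 from encodesD[OF assms fa(1,2) f] obtain gs hs where
  "realises ({..<s} \<union> {f} \<union> ?K1) ?K1 \<kappa> gs hs (flagged f A) (flagged f A')" .
 note A = this[unfolded realises_def, THEN conjunct1] this[unfolded realises_def, THEN conjunct2]
 \<comment> \<open>The reflection puts its work wires behind those of \<open>A\<close>. It takes
   \<open>14 * \<kappa> + 1\<close> gates; the circuit and its inverse add twice \<kappa>.\<close>
 let ?R = "sign_flip f (a + \<kappa>) [a..<a+\<kappa>]"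
 have d: "distinct (f # [a..<a+\<kappa>])" "set (f # [a..<a+\<kappa>]) \<inter> {a+\<kappa>..<a+\<kappa> + length [a..<a+\<kappa>]} = {}" using fa by auto
 let ?cs = "gs @ ?R @ hs"
 have "blocks ?cs ?K (flagged f (\<lambda>\<psi> x. \<psi> x - 2 * A' (A \<psi>) x))"
  unfolding blocks_def
 proof (intro allI impI)
  fix \<psi> and x :: bits
  assume c: "clean ?K \<psi>" and x: "zero_on ?K x"
  have c1: "clean ?K1 \<psi>" by (rule clean_mono[OF c]) auto
  define \<phi> where "\<phi> = run gs \<psi>"
  have "clean ?K2 \<phi>" unfolding \<phi>_def
   by (rule clean_run[of "{..<s} \<union> {f} \<union> ?K1"]) (use A fa in \<open>auto intro: clean_mono[OF c]\<close>)
  then have R: "run ?R \<phi> y = (if y f \<and> zero_on ?K1 y then - \<phi> y else \<phi> y)" for y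
   using run_sign_flip[OF d, of \<phi>] by simp
  \<comment> \<open>The part of the state with raised flag whose work wires came back to zero.
    Flipping its sign subtracts it twice, and \<open>hs\<close> undoes everything else
    exactly.\<close>
  define \<zeta> where "\<zeta> y = (if y f \<and> zero_on ?K1 y then \<phi> y else 0)" for y
  have "run ?R \<phi> = (\<lambda>y. \<phi> y + (- 2) * \<zeta> y)"
   by (rule ext) (simp only: R \<zeta>_def, simp)
  then have "run ?cs \<psi> x = run hs \<phi> x + (- 2) * run hs \<zeta> x"
   by (simp only: fold_append o_apply run_add run_scale flip: \<phi>_def)
  also have "run hs \<phi> = \<psi>" using A by (simp add: inverses_def \<phi>_def)
  also have "run hs \<zeta> x = flagged f A' \<zeta> x"
  proof -
   have "clean ?K1 \<zeta>" by (rule cleanI) (metis \<zeta>_def)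
   moreover have "zero_on ?K1 x" using x by auto
   ultimately show ?thesis using A unfolding blocks_def by blast
  qed
  also have "\<dots> = (if x f then A' (A \<psi>) x else 0)"
  proof (cases "x f")
   case True
   have "A' \<zeta> x = A' (A \<psi>) x"
   proof (rule local_cong[OF pA(4)])
    fix u
    have z: "zero_on ?K1 (paste s x u)" using x fa by auto
    have "paste s x u f" using True fa by simp
    then have "\<zeta> (paste s x u) = \<phi> (paste s x u)" using z by (metis \<zeta>_def)
    also have "\<dots> = flagged f A \<psi> (paste s x u)" using A c1 z unfolding blocks_def \<phi>_def by blast
    finally show "\<zeta> (paste s x u) = A \<psi> (paste s x u)"
     using \<open>paste s x u f\<close> by (simp add: flagged_def)
   qed
   then show ?thesis using True by (simp add: flagged_def)
  qed (simp add: flagged_def \<zeta>_def)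
  finally show "run ?cs \<psi> x = flagged f (\<lambda>\<psi> x. \<psi> x - 2 * A' (A \<psi>) x) \<psi> x"
   by (simp add: flagged_def)
 qed
 moreover have "circuit_on ({..<s} \<union> {f} \<union> ?K) ?R"
  by (rule circuit_on_sign_flip[OF d]) auto
 moreover have "circuit_on ({..<s} \<union> {f} \<union> ?K) gs" "circuit_on ({..<s} \<union> {f} \<union> ?K) hs"
  using A by (auto intro: circuit_on_mono)
 moreover have "inverses ?cs ?cs"
  using A sign_flip_involution[OF d] unfolding inverses_def by (simp only: fold_append o_apply simp_thms)
 moreover have "length ?cs \<le> 16 * \<kappa> + 1"
  using A by (simp add: length_sign_flip)
 ultimately have "realises ({..<s} \<union> {f} \<union> ?K) ?K (16 * \<kappa> + 1) ?cs ?cs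
   (flagged f (\<lambda>\<psi> x. \<psi> x - 2 * A' (A \<psi>) x)) (flagged f (\<lambda>\<psi> x. \<psi> x - 2 * A' (A \<psi>) x))"
  unfolding realises_def circuit_on_append by blast
 then show "\<exists>gs hs. realises ({..<s} \<union> {f} \<union> ?K) ?K (16 * \<kappa> + 1) gs hs
   (flagged f (\<lambda>\<psi> x. \<psi> x - 2 * A' (A \<psi>) x)) (flagged f (\<lambda>\<psi> x. \<psi> x - 2 * A' (A \<psi>) x))"
  by blast
qed

subsection \<open>Bit flips and register increments\<close>

lemma local_perm:
 assumes "\<And>x y w. (\<forall>v<s. x v = y v) ==> w < s ==> \<pi> x w = \<pi> y w" "\<And>x w. s \<le> w ==> \<pi> x w = x w"
 shows "local s (\<lambda>\<psi> x. \<psi> (\<pi> x))"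
 unfolding local_def
proof (intro allI impI)
 fix \<psi> \<phi> :: state and x y :: bits
 assume e: "\<forall>w<s. x w = y w" "\<forall>u. \<psi> (paste s x u) = \<phi> (paste s y u)"
 have "paste s x (\<pi> x) = \<pi> x" "paste s y (\<pi> x) = \<pi> y"
  using assms(1)[OF e(1)] assms(2) by (auto simp: paste_def fun_eq_iff)
 with e(2) show "\<psi> (\<pi> x) = \<phi> (\<pi> y)" by metis
qed

lemma encodes_not:
 assumes "w < s" shows "encodes s 1 (\<lambda>\<psi> x. \<psi> (x(w := \<not> x w))) (\<lambda>\<psi> x. \<psi> (x(w := \<not> x w)))"
proof (rule encodesI)
 show loc: "local s (\<lambda>\<psi> x. \<psi> (x(w := \<not> x w)))"
  by (rule local_perm) (use assms in auto)
 show "local s (\<lambda>\<psi> x. \<psi> (x(w := \<not> x w)))" by (rule loc)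
 fix f a assume fa: "s \<le> f" "s \<le> a" "f \<notin> {a..<a+1}"
 then have "f \<noteq> w" using assms by auto
 have "cnot_gate f w = Gate2 f w (ctrl_mat X_mat)" by (simp add: cnot_gate_def)
 then have c: "circuit_on ({..<s} \<union> {f} \<union> {a..<a+1}) [cnot_gate f w]"
  using unitary_ctrl(1) assms \<open>f \<noteq> w\<close> by (simp add: circuit_on_def)
 have op: "run [cnot_gate f w] \<psi> x = \<psi> (x(w := (x w \<noteq> x f)))" for \<psi> x
  by (simp add: cnot_gate_op \<open>f \<noteq> w\<close>)
 have "inverses [cnot_gate f w] [cnot_gate f w]"
  using \<open>f \<noteq> w\<close> unfolding inverses_def fun_eq_iff op by (simp add: xor_cancel)
 moreover have "blocks [cnot_gate f w] {a..<a+1} (flagged f (\<lambda>\<psi> x. \<psi> (x(w := \<not> x w))))"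
  unfolding blocks_def op flagged_def by (auto simp: fun_upd_idem)
 ultimately have "controlled s f a 1 [cnot_gate f w] [cnot_gate f w]
   (flagged f (\<lambda>\<psi> x. \<psi> (x(w := \<not> x w)))) (flagged f (\<lambda>\<psi> x. \<psi> (x(w := \<not> x w))))"
  unfolding realises_def using c by simp
 then show "\<exists>gs hs. controlled s f a 1 gs hs
   (flagged f (\<lambda>\<psi> x. \<psi> (x(w := \<not> x w)))) (flagged f (\<lambda>\<psi> x. \<psi> (x(w := \<not> x w))))"
  by blast
qed (simp_all add: lin_def)

text \<open>Addition of one modulo a power of two, least significant wire first.\<close>

fun incr :: "nat list => bits => bits" where
 "incr [] x = x"
| "incr (w # ws) x = (if x w then incr ws (x(w := False)) else x(w := True))"

fun decr :: "nat list => bits => bits" where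
 "decr [] x = x"
| "decr (w # ws) x = (if x w then x(w := False) else decr ws (x(w := True)))"

lemma incr_upd: "v \<notin> set ws ==> incr ws (x(v := b)) = (incr ws x)(v := b)"
 by (induction ws arbitrary: x) (auto simp: fun_upd_twist)

lemma decr_upd: "v \<notin> set ws ==> decr ws (x(v := b)) = (decr ws x)(v := b)"
 by (induction ws arbitrary: x) (auto simp: fun_upd_twist)

lemma incr_other [simp]: "v \<notin> set ws ==> incr ws x v = x v"
 by (induction ws arbitrary: x) auto

lemma decr_other [simp]: "v \<notin> set ws ==> decr ws x v = x v"
 by (induction ws arbitrary: x) auto

lemma decr_incr: "distinct ws ==> decr ws (incr ws x) = x"
 by (induction ws arbitrary: x) (auto simp: incr_upd decr_upd fun_upd_idem)

lemma incr_decr: "distinct ws ==> incr ws (decr ws x) = x"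
 by (induction ws arbitrary: x) (auto simp: incr_upd decr_upd fun_upd_idem)

lemma incr_agree: "(\<forall>v\<in>W. x v = y v) ==> set ws \<subseteq> W ==> w \<in> W ==> incr ws x w = incr ws y w"
 by (induction ws arbitrary: x y) auto

lemma decr_agree: "(\<forall>v\<in>W. x v = y v) ==> set ws \<subseteq> W ==> w \<in> W ==> decr ws x w = decr ws y w"
 by (induction ws arbitrary: x y) auto

text \<open>Ripple-carry increment controlled by \<open>f\<close>; the carries are kept in the work wires
 \<open>a, a + 1, \<dots>\<close> and erased on the way back.\<close>

fun incr_circuit :: "nat => nat => nat list => gate list" where
 "incr_circuit f a [] = []"
| "incr_circuit f a (w # ws) =
   toffoli0 f w a @ incr_circuit a (Suc a) ws @ cnot_gate f w # toffoli f w a"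

fun decr_circuit :: "nat => nat => nat list => gate list" where
 "decr_circuit f a [] = []"
| "decr_circuit f a (w # ws) =
   toffoli f w a @ cnot_gate f w # decr_circuit a (Suc a) ws @ toffoli0 f w a"

lemma length_incr_circuit: "length (incr_circuit f a ws) = 13 * length ws"
 "length (decr_circuit f a ws) = 13 * length ws"
 by (induction ws arbitrary: f a) (simp_all add: length_toffoli)

lemma circuit_on_incr:
 assumes "distinct (f # ws)" "(set (f # ws)) \<inter> {a..<a + length ws} = {}" "set (f # ws) \<union> {a..<a + length ws} \<subseteq> W"
 shows "circuit_on W (incr_circuit f a ws) \<and> circuit_on W (decr_circuit f a ws)"
 using assms
proof (induction f a ws rule: incr_circuit.induct)
 case (1 f a)
 then show ?case by (simp add: circuit_on_def)
next
 case (2 f a w ws)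
 have "circuit_on W (toffoli0 f w a)" "circuit_on W (toffoli f w a)" using 2(2-) by (intro circuit_on_toffoli; auto)+
 moreover have "circuit_on W [cnot_gate f w]" using 2(2-) unitary_ctrl(1) by (simp add: circuit_on_def cnot_gate_def)
 moreover have "circuit_on W (incr_circuit a (Suc a) ws) \<and> circuit_on W (decr_circuit a (Suc a) ws)"
  using 2(2-) by (intro 2(1)) auto
 ultimately show ?case
  by (metis append_Cons append_Nil circuit_on_append decr_circuit.simps(2) incr_circuit.simps(2))
qed

lemma inverses_incr:
 assumes "distinct (f # ws)" "(set (f # ws)) \<inter> {a..<a + length ws} = {}"
 shows "inverses (incr_circuit f a ws) (decr_circuit f a ws)"
 using assms
proof (induction f a ws rule: incr_circuit.induct)
 case (1 f a)
 then show ?case by (simp add: inverses_def)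
next
 case (2 f a w ws)
 have d: "f \<noteq> w" "f \<noteq> a" "w \<noteq> a" using 2(2,3) by auto
 have "gate_op (cnot_gate f w) (gate_op (cnot_gate f w) \<psi>) = \<psi>" for \<psi>
  using d by (simp add: fun_eq_iff cnot_gate_op xor_cancel)
 moreover have "inverses (incr_circuit a (Suc a) ws) (decr_circuit a (Suc a) ws)"
  using 2(2-) by (intro 2(1)) auto
 ultimately show ?case
  by (simp add: inverses_def toffoli_involution[OF d])
qed

lemma run_incr:
 assumes "distinct (f # ws)" "(set (f # ws)) \<inter> {a..<a + length ws} = {}" "zero_on {a..<a + length ws} x"
 shows "run (incr_circuit f a ws) \<psi> x = \<psi> (if x f then incr ws x else x)"
 using assms
proof (induction f a ws arbitrary: \<psi> x rule: incr_circuit.induct)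
 case (2 f a w ws)
 have d: "f \<noteq> w" "f \<noteq> a" "w \<noteq> a" using 2(2,3) by auto
 have na: "a \<notin> set ws" "w \<notin> set ws" "f \<notin> set ws" using 2(2,3) by auto
 have xa: "\<not> x a" using 2(4) by auto
 \<comment> \<open>Gates pull amplitudes back, so the end of the list acts on the argument first:
   the carry into \<open>a\<close>, then the sum bit in \<open>w\<close>. The gate at the head of
   the list erases the carry, which equals the flag together with the negated new bit.\<close>
 define y where "y = x(a := (x f \<and> x w), w := (x w \<noteq> x f))"
 have y: "y a = (x f \<and> x w)" "y w = (x w \<noteq> x f)" "y f = x f" using d by (auto simp: y_def)
 have zy: "zero_on {Suc a..<Suc a + length ws} y"
 proof
  fix v assume v: "v \<in> {Suc a..<Suc a + length ws}"
  then have "v \<noteq> a" "v \<noteq> w" "v \<in> {a..<a + length (w # ws)}" using 2(3) by auto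
  then show "\<not> y v" using 2(4) by (metis fun_upd_other y_def)
 qed
 have "run (incr_circuit f a (w # ws)) \<psi> x = run (incr_circuit a (Suc a) ws) (run (toffoli0 f w a) \<psi>) y"
  using xa by (simp add: run_toffoli[OF d] cnot_gate_op d(1)) (simp add: y_def d d[symmetric])
 also have "\<dots> = run (toffoli0 f w a) \<psi> (if y a then incr ws y else y)"
  by (rule 2(1)) (use 2(2,3) zy in auto)
 also have "\<dots> = \<psi> (if x f then incr (w # ws) x else x)"
 proof (cases "x f \<and> x w")
  case True
  then have "incr ws y a" "incr ws y f" "\<not> incr ws y w" using y na by auto
  then have "run (toffoli0 f w a) \<psi> (incr ws y) = \<psi> ((incr ws y)(a := False))"
   by (simp add: run_toffoli0[OF d])
  also have "(incr ws y)(a := False) = incr ws (y(a := False))" by (simp add: incr_upd na)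
  also have "y(a := False) = x(w := False)" using xa True d by (auto simp: y_def fun_eq_iff)
  finally have "run (toffoli0 f w a) \<psi> (incr ws y) = \<psi> (incr ws (x(w := False)))" .
  moreover have "incr (w # ws) x = incr ws (x(w := False))" "y a" using True y(1) by simp_all
  ultimately show ?thesis using True by (simp only: if_True simp_thms)
 next
  case False
  then have "run (toffoli0 f w a) \<psi> y = \<psi> y" using y by (auto simp: run_toffoli0[OF d] fun_upd_idem)
  moreover have "y = (if x f then incr (w # ws) x else x)"
   using xa False d by (auto simp: y_def fun_eq_iff)
  moreover have "\<not> y a" using False y(1) by simp
  ultimately show ?thesis by (simp only: if_False simp_thms)
 qed
 finally show ?case .
qed simp

text \<open>Obtained from the increment through the inverse circuits, with no second
  induction.\<close>

lemma run_decr: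
 assumes "distinct (f # ws)" "(set (f # ws)) \<inter> {a..<a + length ws} = {}" "zero_on {a..<a + length ws} x"
 shows "run (decr_circuit f a ws) \<psi> x = \<psi> (if x f then decr ws x else x)"
proof -
 let ?y = "if x f then decr ws x else x"
 have f: "f \<notin> set ws" "distinct ws" using assms by auto
 have "zero_on {a..<a + length ws} ?y"
 proof
  fix v assume v: "v \<in> {a..<a + length ws}"
  then have "v \<notin> set ws" using assms(2) by auto
  then show "\<not> ?y v" using v assms(3) by simp
 qed
 from run_incr[OF assms(1,2) this, of "run (decr_circuit f a ws) \<psi>"]
 have "\<psi> ?y = run (decr_circuit f a ws) \<psi> (if ?y f then incr ws ?y else ?y)"
  using inverses_incr[OF assms(1,2)] unfolding inverses_def by metis
 also have "(if ?y f then incr ws ?y else ?y) = x" using f by (simp add: incr_decr)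
 finally show ?thesis by simp
qed

lemma local_incr:
 assumes "set ws \<subseteq> {..<s}"
 shows "local s (\<lambda>\<psi> x. \<psi> (incr ws x))" "local s (\<lambda>\<psi> x. \<psi> (decr ws x))"
proof -
 have o: "w \<notin> set ws" if "s \<le> w" for w using that assms by auto
 show "local s (\<lambda>\<psi> x. \<psi> (incr ws x))"
 proof (rule local_perm[of s "incr ws"])
  show "incr ws x w = incr ws y w" if "\<forall>v<s. x v = y v" "w < s" for x y w
   by (rule incr_agree[of "{..<s}"]) (use that assms in auto)
 qed (use o in simp)
 show "local s (\<lambda>\<psi> x. \<psi> (decr ws x))"
 proof (rule local_perm[of s "decr ws"])
  show "decr ws x w = decr ws y w" if "\<forall>v<s. x v = y v" "w < s" for x y w
   by (rule decr_agree[of "{..<s}"]) (use that assms in auto)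
 qed (use o in simp)
qed

lemma encodes_incr:
 assumes "distinct ws" "set ws \<subseteq> {..<s}"
 shows "encodes s (13 * length ws) (\<lambda>\<psi> x. \<psi> (incr ws x)) (\<lambda>\<psi> x. \<psi> (decr ws x))"
proof (rule encodesI)
 show "local s (\<lambda>\<psi> x. \<psi> (incr ws x))" by (rule local_incr(1)[OF assms(2)])
 show "local s (\<lambda>\<psi> x. \<psi> (decr ws x))" by (rule local_incr(2)[OF assms(2)])
 fix f a assume fa: "s \<le> f" "s \<le> a" "f \<notin> {a..<a+13 * length ws}"
 let ?K = "{a..<a+13 * length ws}"
 have d: "distinct (f # ws)" "set (f # ws) \<inter> {a..<a + length ws} = {}" using assms fa by auto
 have sub: "{a..<a + length ws} \<subseteq> ?K" by auto
 have "blocks (incr_circuit f a ws) ?K (flagged f (\<lambda>\<psi> x. \<psi> (incr ws x)))"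
  unfolding blocks_def flagged_def
 proof (intro allI impI)
  fix \<psi> :: state and x :: bits assume "zero_on ?K x"
  then have "zero_on {a..<a + length ws} x" using sub by blast
  from run_incr[OF d this] show "run (incr_circuit f a ws) \<psi> x = (if x f then \<psi> (incr ws x) else \<psi> x)" by simp
 qed
 moreover have "blocks (decr_circuit f a ws) ?K (flagged f (\<lambda>\<psi> x. \<psi> (decr ws x)))"
  unfolding blocks_def flagged_def
 proof (intro allI impI)
  fix \<psi> :: state and x :: bits assume "zero_on ?K x"
  then have "zero_on {a..<a + length ws} x" using sub by blast
  from run_decr[OF d this] show "run (decr_circuit f a ws) \<psi> x = (if x f then \<psi> (decr ws x) else \<psi> x)" by simp
 qed
 moreover have "circuit_on ({..<s} \<union> {f} \<union> ?K) (incr_circuit f a ws) \<and> circuit_on ({..<s} \<union> {f} \<union> ?K) (decr_circuit f a ws)"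
  by (rule circuit_on_incr[OF d]) (use assms sub in auto)
 ultimately have "realises ({..<s} \<union> {f} \<union> ?K) ?K (13 * length ws) (incr_circuit f a ws) (decr_circuit f a ws)
   (flagged f (\<lambda>\<psi> x. \<psi> (incr ws x))) (flagged f (\<lambda>\<psi> x. \<psi> (decr ws x)))"
  using inverses_incr[OF d] by (simp add: realises_def length_incr_circuit)
 then show "\<exists>gs hs. realises ({..<s} \<union> {f} \<union> ?K) ?K (13 * length ws) gs hs
   (flagged f (\<lambda>\<psi> x. \<psi> (incr ws x))) (flagged f (\<lambda>\<psi> x. \<psi> (decr ws x)))"
  by blast
qed (simp_all add: lin_def)

section \<open>Operators with norm bounds\<close>

text \<open>The finite set over which norms are taken. Operators still act on all states, so that
  many identities below are available only up to norm zero.\<close>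

definition slice :: "nat => bits set" where
 "slice s = {x. \<forall>w\<ge>s. \<not> x w}"

definition ip :: "nat => state => state => complex" where
 "ip s f g = (\<Sum>x\<in>slice s. cnj (f x) * g x)"

definition nrm :: "nat => state => real" where
 "nrm s f = L2_set (\<lambda>x. cmod (f x)) (slice s)"

lemma finite_slice [simp]: "finite (slice s)"
proof -
 have "slice s \<subseteq> (\<lambda>A w. w \<in> A) ` Pow {..<s}"
 proof
  fix x assume "x \<in> slice s"
  then have "{w. x w} \<in> Pow {..<s}" by (auto simp: slice_def) (meson not_le)
  moreover have "x = (\<lambda>w. w \<in> {w. x w})" by simp
  ultimately show "x \<in> (\<lambda>A w. w \<in> A) ` Pow {..<s}" by blast
 qed
 then show ?thesis using finite_surj[of "Pow {..<s}"] by auto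
qed

lemma nrm_nonneg [simp]: "0 \<le> nrm s f"
 by (simp add: nrm_def L2_set_nonneg)

lemma nrm_sq: "(nrm s f)\<^sup>2 = (\<Sum>x\<in>slice s. (cmod (f x))\<^sup>2)"
 by (simp add: nrm_def L2_set_def sum_nonneg)

lemma nrm_cong: "(\<And>x. x \<in> slice s ==> f x = g x) ==> nrm s f = nrm s g"
 unfolding nrm_def by (intro L2_set_cong) auto

lemma nrm_mono: "(\<And>x. x \<in> slice s ==> cmod (f x) \<le> cmod (g x)) ==> nrm s f \<le> nrm s g"
 unfolding nrm_def by (intro L2_set_mono) auto

lemma nrm_add: "nrm s (\<lambda>x. f x + g x) \<le> nrm s f + nrm s g"
proof -
 have "nrm s (\<lambda>x. f x + g x) \<le> L2_set (\<lambda>x. cmod (f x) + cmod (g x)) (slice s)"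
  unfolding nrm_def by (intro L2_set_mono) (auto simp: norm_triangle_ineq)
 also have "\<dots> \<le> nrm s f + nrm s g" unfolding nrm_def by (rule L2_set_triangle_ineq)
 finally show ?thesis .
qed

lemma nrm_scale: "nrm s (\<lambda>x. c * f x) = cmod c * nrm s f"
 unfolding nrm_def by (simp add: norm_mult L2_set_right_distrib)

lemma nrm_zero [simp]: "nrm s (\<lambda>x. 0) = 0"
 by (simp add: nrm_def L2_set_def)

lemma nrm_minus: "nrm s (\<lambda>x. - f x) = nrm s f"
 by (simp add: nrm_def)

lemma nrm_diff: "nrm s (\<lambda>x. f x - g x) \<le> nrm s f + nrm s g"
 using nrm_add[of s f "\<lambda>x. - g x"] by (simp add: nrm_minus)

lemma nrm_eq_0: "nrm s f = 0 ==> x \<in> slice s ==> f x = 0"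
 unfolding nrm_def by (simp add: L2_set_eq_0_iff)

lemma nrm_sum: "finite I ==> nrm s (\<lambda>x. \<Sum>i\<in>I. f i x) \<le> (\<Sum>i\<in>I. nrm s (f i))"
proof (induction I rule: finite_induct)
 case (insert i I)
 have "nrm s (\<lambda>x. \<Sum>i\<in>insert i I. f i x) = nrm s (\<lambda>x. f i x + (\<Sum>i\<in>I. f i x))"
  using insert by simp
 also have "\<dots> \<le> nrm s (f i) + nrm s (\<lambda>x. \<Sum>i\<in>I. f i x)" by (rule nrm_add)
 finally show ?case using insert by simp
qed simp

lemma cmod_ip: "cmod (ip s f g) \<le> nrm s f * nrm s g"
proof -
 have "cmod (ip s f g) \<le> (\<Sum>x\<in>slice s. \<bar>cmod (f x)\<bar> * \<bar>cmod (g x)\<bar>)"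
  unfolding ip_def by (rule order_trans[OF norm_sum]) (simp add: norm_mult)
 also have "\<dots> \<le> nrm s f * nrm s g" unfolding nrm_def by (rule L2_set_mult_ineq)
 finally show ?thesis .
qed

lemma ip_self: "ip s f f = of_real ((nrm s f)\<^sup>2)"
proof -
 have "cnj z * z = of_real ((cmod z)\<^sup>2)" for z
  using complex_norm_square[of z] by (simp add: mult.commute)
 then show ?thesis unfolding ip_def nrm_sq of_real_sum by simp
qed

lemma ip_add_left: "ip s (\<lambda>x. f x + g x) h = ip s f h + ip s g h"
 and ip_add_right: "ip s f (\<lambda>x. g x + h x) = ip s f g + ip s f h"
 and ip_diff_left: "ip s (\<lambda>x. f x - g x) h = ip s f h - ip s g h"
 and ip_diff_right: "ip s f (\<lambda>x. g x - h x) = ip s f g - ip s f h"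
 and ip_scale_left: "ip s (\<lambda>x. c * f x) h = cnj c * ip s f h"
 and ip_scale_right: "ip s f (\<lambda>x. c * h x) = c * ip s f h"
 unfolding ip_def by (simp_all add: algebra_simps sum.distrib sum_subtractf sum_distrib_left)

lemma ip_cnj: "cnj (ip s f g) = ip s g f"
 unfolding ip_def by (simp add: mult.commute)

lemma ip_sum_right: "ip s f (\<lambda>x. \<Sum>i\<in>I. g i x) = (\<Sum>i\<in>I. ip s f (g i))"
 unfolding ip_def by (simp add: sum_distrib_left) (rule sum.swap)

lemma nrm_diff_sq: "(nrm s (\<lambda>x. f x - g x))\<^sup>2 = (nrm s f)\<^sup>2 - 2 * Re (ip s f g) + (nrm s g)\<^sup>2"
proof -
 have "cr ((nrm s (\<lambda>x. f x - g x))\<^sup>2) = ip s f f - (ip s f g + cnj (ip s f g)) + ip s g g"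
  unfolding ip_self[symmetric] ip_diff_left ip_diff_right ip_cnj by simp
 from arg_cong[OF this, of Re] show ?thesis by (simp add: ip_self)
qed

definition oper :: "nat => real => linop => linop => bool" where
 "oper s N A A' \<longleftrightarrow> lin A \<and> lin A' \<and> (\<forall>f. nrm s (A f) \<le> N * nrm s f) \<and> (\<forall>f g. ip s (A f) g = ip s f (A' g))"

lemma operD:
 assumes "oper s N A A'"
 shows "lin A" "lin A'" "nrm s (A f) \<le> N * nrm s f" "ip s (A f) g = ip s f (A' g)"
 using assms by (auto simp: oper_def)

lemma oper_ip': "oper s N A A' ==> ip s (A' f) g = ip s f (A g)"
 by (metis ip_cnj operD(4))

lemma oper_bound':
 assumes "oper s N A A'" shows "nrm s (A' f) \<le> N * nrm s f"
proof (cases "nrm s (A' f) = 0")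
 case True
 have "0 \<le> N * nrm s f" by (rule order_trans[OF nrm_nonneg operD(3)[OF assms]])
 with True show ?thesis by simp
next
 case False
 have "(nrm s (A' f))\<^sup>2 = cmod (ip s (A' f) (A' f))"
  unfolding ip_self norm_of_real by simp
 also have "\<dots> = cmod (ip s f (A (A' f)))" by (simp add: oper_ip'[OF assms])
 also have "\<dots> \<le> nrm s f * nrm s (A (A' f))" by (rule cmod_ip)
 also have "\<dots> \<le> nrm s f * (N * nrm s (A' f))" by (rule mult_left_mono[OF operD(3)[OF assms] nrm_nonneg])
 finally have "nrm s (A' f) * nrm s (A' f) \<le> (N * nrm s f) * nrm s (A' f)" by (simp add: power2_eq_square mult_ac)
 then show ?thesis using False nrm_nonneg[of s "A' f"] by (simp add: mult_le_cancel_right)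
qed

lemma oper_adj: "oper s N A A' ==> oper s N A' A"
 unfolding oper_def using oper_bound'[of s N A A'] oper_ip'[of s N A A'] by (auto simp: oper_def)

lemma oper_comp:
 assumes "oper s N A A'" "oper s M B B'" "0 \<le> N"
 shows "oper s (N * M) (\<lambda>f. A (B f)) (\<lambda>f. B' (A' f))"
 unfolding oper_def
proof (intro conjI allI)
 fix f
 have "nrm s (A (B f)) \<le> N * nrm s (B f)" by (rule operD(3)[OF assms(1)])
 also have "\<dots> \<le> N * (M * nrm s f)" using operD(3)[OF assms(2)] assms(3) by (rule mult_left_mono)
 finally show "nrm s (A (B f)) \<le> N * M * nrm s f" by (simp add: mult.assoc)
qed (use assms operD in \<open>auto intro: lin_comp\<close>)

lemma oper_add:
 assumes "oper s N A A'" "oper s M B B'"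
 shows "oper s (N + M) (\<lambda>f x. A f x + B f x) (\<lambda>f x. A' f x + B' f x)"
 unfolding oper_def
proof (intro conjI allI)
 show "lin (\<lambda>f x. A f x + B f x)" "lin (\<lambda>f x. A' f x + B' f x)"
  using lin_combine[of A B 1 1] lin_combine[of A' B' 1 1] operD[OF assms(1)] operD[OF assms(2)] by simp_all
 fix f
 have "nrm s (\<lambda>x. A f x + B f x) \<le> nrm s (A f) + nrm s (B f)" by (rule nrm_add)
 also have "\<dots> \<le> N * nrm s f + M * nrm s f" by (intro add_mono operD(3)[OF assms(1)] operD(3)[OF assms(2)])
 finally show "nrm s (\<lambda>x. A f x + B f x) \<le> (N + M) * nrm s f" by (simp add: algebra_simps)
 show "ip s (\<lambda>x. A f x + B f x) g = ip s f (\<lambda>x. A' g x + B' g x)" for g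
  by (simp add: ip_add_left ip_add_right operD(4)[OF assms(1)] operD(4)[OF assms(2)])
qed

lemma oper_scale:
 fixes c :: real and A A' :: linop
 assumes "oper s N A A'"
 shows "oper s (\<bar>c\<bar> * N) (\<lambda>f x. c * A f x) (\<lambda>f x. c * A' f x)"
 unfolding oper_def
proof (intro conjI allI)
 show "lin (\<lambda>f x. c * A f x)" "lin (\<lambda>f x. c * A' f x)"
  using lin_combine[of A A "of_real c" 0] lin_combine[of A' A' "of_real c" 0] operD[OF assms(1)] by simp_all
 fix f
 show "nrm s (\<lambda>x. c * A f x) \<le> \<bar>c\<bar> * N * nrm s f"
  using operD(3)[OF assms, of f] mult_left_mono[of _ _ "\<bar>c\<bar>"] by (simp add: nrm_scale mult.assoc)
 show "ip s (\<lambda>x. c * A f x) g = ip s f (\<lambda>x. c * A' g x)" for g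
  by (simp add: ip_scale_left ip_scale_right operD(4)[OF assms(1)])
qed

lemma oper_id: "oper s 1 (\<lambda>f. f) (\<lambda>f. f)"
 by (simp add: oper_def lin_def)

text \<open>Expanding the square, the image has squared norm
  \<open>|f|^2 - 4 |A f|^2 + 4 |A' (A f)|^2\<close>, and \<open>A'\<close> is a contraction.\<close>

lemma oper_reflect:
 assumes "oper s 1 A A'"
 shows "oper s 1 (\<lambda>f x. f x - 2 * A' (A f) x) (\<lambda>f x. f x - 2 * A' (A f) x)"
proof -
 have 1: "oper s (1 * 1) (\<lambda>f. A' (A f)) (\<lambda>f. A' (A f))"
  by (rule oper_comp[OF oper_adj[OF assms] assms]) simp
 have 2: "oper s (1 + \<bar>-2\<bar> * (1 * 1)) (\<lambda>f x. f x + cr (-2) * A' (A f) x) (\<lambda>f x. f x + cr (-2) * A' (A f) x)"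
  by (rule oper_add[OF oper_id oper_scale[OF 1]])
 have eq: "(\<lambda>f x. f x + cr (-2) * A' (A f) x) = (\<lambda>f x. f x - 2 * A' (A f) x)" by simp
 have "nrm s (\<lambda>x. f x - 2 * A' (A f) x) \<le> 1 * nrm s f" for f
 proof -
  have "(nrm s (\<lambda>x. f x - 2 * A' (A f) x))\<^sup>2 = (nrm s f)\<^sup>2 - 4 * (nrm s (A f))\<^sup>2 + 4 * (nrm s (A' (A f)))\<^sup>2"
   unfolding nrm_diff_sq by (simp add: nrm_scale ip_scale_right power_mult_distrib ip_self flip: operD(4)[OF assms])
  also have "\<dots> \<le> (nrm s f)\<^sup>2"
   using power_mono[OF oper_bound'[OF assms, of "A f"] nrm_nonneg, of 2] by simp
  finally have "nrm s (\<lambda>x. f x - 2 * A' (A f) x) \<le> nrm s f" by (rule power2_le_imp_le) simp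
  then show ?thesis by simp
 qed
 then show ?thesis using 2 unfolding eq oper_def by auto
qed

lemma ip_perm:
 assumes "\<And>x. x \<in> slice s ==> \<pi> x \<in> slice s" "\<And>x. x \<in> slice s ==> \<pi>' x \<in> slice s"
  and "\<And>x. \<pi> (\<pi>' x) = x" "\<And>x. \<pi>' (\<pi> x) = x"
 shows "ip s (\<lambda>x. f (\<pi> x)) g = ip s f (\<lambda>x. g (\<pi>' x))"
 unfolding ip_def
 by (rule sum.reindex_bij_witness[of _ \<pi>' \<pi>]) (use assms in auto)

lemma oper_perm:
 assumes "\<And>x. x \<in> slice s ==> \<pi> x \<in> slice s" "\<And>x. x \<in> slice s ==> \<pi>' x \<in> slice s"
  and "\<And>x. \<pi> (\<pi>' x) = x" "\<And>x. \<pi>' (\<pi> x) = x"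
 shows "oper s 1 (\<lambda>f x. f (\<pi> x)) (\<lambda>f x. f (\<pi>' x))" "nrm s (\<lambda>x. f (\<pi> x)) = nrm s f"
proof -
 have n: "nrm s (\<lambda>x. f (\<pi> x)) = nrm s f" for f
 proof -
  have "(nrm s (\<lambda>x. f (\<pi> x)))\<^sup>2 = (nrm s f)\<^sup>2"
   unfolding nrm_sq by (rule sum.reindex_bij_witness[of _ \<pi>' \<pi>]) (use assms in auto)
  then show ?thesis by simp
 qed
 then show "nrm s (\<lambda>x. f (\<pi> x)) = nrm s f" .
 show "oper s 1 (\<lambda>f x. f (\<pi> x)) (\<lambda>f x. f (\<pi>' x))"
  unfolding oper_def using n ip_perm[OF assms] by (simp add: lin_def)
qed

lemma slice_upd: "x \<in> slice s ==> w < s ==> x(w := b) \<in> slice s"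
 by (auto simp: slice_def)

lemma slice_incr: "x \<in> slice s ==> set ws \<subseteq> {..<s} ==> incr ws x \<in> slice s"
 "x \<in> slice s ==> set ws \<subseteq> {..<s} ==> decr ws x \<in> slice s"
 by (induction ws arbitrary: x) (auto simp: slice_upd)

lemma oper_not: "w < s ==> oper s 1 (\<lambda>f x. f (x(w := \<not> x w))) (\<lambda>f x. f (x(w := \<not> x w)))"
 by (rule oper_perm) (auto simp: slice_upd)

lemma oper_incr:
 assumes "distinct ws" "set ws \<subseteq> {..<s}"
 shows "oper s 1 (\<lambda>f x. f (incr ws x)) (\<lambda>f x. f (decr ws x))" "nrm s (\<lambda>x. f (incr ws x)) = nrm s f"
 using assms by (intro oper_perm[of s "incr ws" "decr ws"]; auto simp: slice_incr incr_decr decr_incr)+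

lemma lin_diag: "lin (\<lambda>f x. d x * f x)"
 by (simp add: lin_def algebra_simps)

lemma oper_diag:
 assumes "\<And>x. \<bar>d x\<bar> \<le> N"
 shows "oper s N (\<lambda>f x. cr (d x) * f x) (\<lambda>f x. cr (d x) * f x)"
 unfolding oper_def
proof (intro conjI allI lin_diag)
 fix f
 have "nrm s (\<lambda>x. cr (d x) * f x) \<le> nrm s (\<lambda>x. cr N * f x)"
  using assms by (intro nrm_mono) (auto simp: norm_mult intro!: mult_right_mono order_trans[OF assms abs_ge_self])
 also have "\<dots> = N * nrm s f" using assms[of undefined] by (simp add: nrm_scale)
 finally show "nrm s (\<lambda>x. cr (d x) * f x) \<le> N * nrm s f" .
 show "ip s (\<lambda>x. cr (d x) * f x) g = ip s f (\<lambda>x. cr (d x) * g x)" for g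
  by (simp add: ip_def mult_ac)
qed

subsection \<open>Calculus of block encodings\<close>

text \<open>\<open>N\<close> is the normalisation and \<open>\<kappa>\<close> bounds both the number of gates and the number of
 ancillas.\<close>

definition encodable :: "nat => nat => real => linop => linop => bool" where
 "encodable s \<kappa> N A A' \<longleftrightarrow> 0 < N \<and> oper s N A A' \<and>
   encodes s \<kappa> (\<lambda>f x. A f x / cr N) (\<lambda>f x. A' f x / cr N)"

lemma encodable_eqI:
 "encodable s \<kappa> N A A' ==> \<kappa> \<le> \<kappa>' ==> N = N' ==> (\<And>f x. A f x = B f x) ==> (\<And>f x. A' f x = B' f x) ==>
  encodable s \<kappa>' N' B B'"
proof -
 assume a: "encodable s \<kappa> N A A'" "\<kappa> \<le> \<kappa>'" "N = N'" and eq: "\<And>f x. A f x = B f x" "\<And>f x. A' f x = B' f x"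
 have "A = B" "A' = B'" using eq by (auto simp: fun_eq_iff)
 with a show ?thesis unfolding encodable_def using encodes_mono by blast
qed

lemma encodable_oper: "encodable s \<kappa> N A A' ==> oper s N A A'"
 by (simp add: encodable_def)

lemma encodable_lin: "encodable s \<kappa> N A A' ==> lin A"
 by (simp add: encodable_def oper_def)

lemma encodable_mono: "encodable s \<kappa> N A A' ==> \<kappa> \<le> \<mu> ==> encodable s \<mu> N A A'"
 unfolding encodable_def using encodes_mono by blast

lemma encodable_adj: "encodable s \<kappa> N A A' ==> encodable s \<kappa> N A' A"
 unfolding encodable_def by (auto intro: encodes_adj oper_adj)

lemma encodableI1: "oper s 1 A A' ==> encodes s \<kappa> A A' ==> encodable s \<kappa> 1 A A'"
 by (simp add: encodable_def)

lemma encodable_id: "encodable s 0 1 (\<lambda>f. f) (\<lambda>f. f)"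
 by (intro encodableI1 oper_id encodes_id)

lemma encodable_not: "w < s ==> encodable s 1 1 (\<lambda>f x. f (x(w := \<not> x w))) (\<lambda>f x. f (x(w := \<not> x w)))"
 by (intro encodableI1 oper_not encodes_not)

lemma encodable_incr: "distinct ws ==> set ws \<subseteq> {..<s} ==>
  encodable s (13 * length ws) 1 (\<lambda>f x. f (incr ws x)) (\<lambda>f x. f (decr ws x))"
 by (intro encodableI1 oper_incr encodes_incr)

lemma encodable_comp:
 fixes A A' B B' :: linop
 assumes "encodable s \<kappa> N A A'" "encodable s \<mu> M B B'"
 shows "encodable s (\<kappa> + \<mu>) (N * M) (\<lambda>f. A (B f)) (\<lambda>f. B' (A' f))"
proof -
 have o: "oper s N A A'" "oper s M B B'" "0 < N" "0 < M" using assms by (auto simp: encodable_def)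
 have l: "A (\<lambda>x. f x / cr M) = (\<lambda>x. A f x / cr M)"
  "B' (\<lambda>x. f x / cr N) = (\<lambda>x. B' f x / cr N)" for f
  using lin_scale[OF operD(1)[OF o(1)], of "inverse (cr M)" f]
   lin_scale[OF operD(2)[OF o(2)], of "inverse (cr N)" f]
  by (simp_all add: field_simps)
 have "encodes s (\<kappa> + \<mu>) (\<lambda>f x. A (\<lambda>x. B f x / cr M) x / cr N)
   (\<lambda>f x. B' (\<lambda>x. A' f x / cr N) x / cr M)"
  using encodes_comp[of s \<kappa> "\<lambda>f x. A f x / cr N" "\<lambda>f x. A' f x / cr N" \<mu>
   "\<lambda>f x. B f x / cr M" "\<lambda>f x. B' f x / cr M"] assms
  unfolding encodable_def by blast
 then have "encodes s (\<kappa> + \<mu>) (\<lambda>f x. A (B f) x / cr (N * M)) (\<lambda>f x. B' (A' f) x / cr (N * M))"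
  unfolding l by (simp add: mult.commute)
 then show ?thesis unfolding encodable_def using oper_comp[OF o(1,2)] o(3,4) by simp
qed

lemma encodable_add:
 fixes A A' B B' :: linop
 assumes "encodable s \<kappa> N A A'" "encodable s \<mu> M B B'"
 shows "encodable s (\<kappa> + \<mu> + 2) (N + M) (\<lambda>f x. A f x + B f x) (\<lambda>f x. A' f x + B' f x)"
proof -
 have o: "oper s N A A'" "oper s M B B'" "0 < N" "0 < M" using assms by (auto simp: encodable_def)
 \<comment> \<open>The weight for which both summands end up divided by
   \<open>N + M\<close>.\<close>
 let ?p = "N / (N + M)"
 have p: "0 \<le> ?p" "?p \<le> 1" using o by simp_all
 have NM: "N + M \<noteq> 0" "N \<noteq> 0" "M \<noteq> 0" using o by linarith+
 have NM': "cr N + cr M \<noteq> 0" using NM(1) by (metis of_real_add of_real_eq_0_iff)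
 have 2: "cr ?p * (a / cr N) = a / cr (N + M)"
  "cr (1 - ?p) * (b / cr M) = b / cr (N + M)" for a b
  using NM NM' by (simp_all add: field_simps)
 have e: "encodes s \<kappa> (\<lambda>f x. A f x / cr N) (\<lambda>f x. A' f x / cr N)"
  "encodes s \<mu> (\<lambda>f x. B f x / cr M) (\<lambda>f x. B' f x / cr M)"
  using assms by (simp_all add: encodable_def)
 have "encodes s (\<kappa> + \<mu> + 2) (\<lambda>f x. A f x / cr (N + M) + B f x / cr (N + M))
   (\<lambda>f x. A' f x / cr (N + M) + B' f x / cr (N + M))"
  using encodes_convex[OF e p] by (simp only: 2)
 then show ?thesis
  unfolding encodable_def using oper_add[OF o(1,2)] o(3,4) by (simp add: add_divide_distrib)
qed

text \<open>Free of charge: the circuit stays the same and only the normalisation is read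
  differently.\<close>

lemma encodable_scale:
 fixes A A' :: linop and c :: real
 assumes "encodable s \<kappa> N A A'" "0 < c"
 shows "encodable s \<kappa> (c * N) (\<lambda>f x. c * A f x) (\<lambda>f x. c * A' f x)"
 using assms oper_scale[of s N A A' c] unfolding encodable_def by simp

lemma encodable_uminus:
 fixes A A' :: linop
 assumes "encodable s \<kappa> N A A'"
 shows "encodable s (\<kappa> + 1) N (\<lambda>f x. - A f x) (\<lambda>f x. - A' f x)"
proof -
 have 1: "oper s 1 (\<lambda>f x. - f x) (\<lambda>f x. - f x)"
  using oper_scale[OF oper_id, of s "-1"] by simp
 have 2: "encodes s 1 (\<lambda>f x. - f x) (\<lambda>f x. - f x)"
  using encodes_sign_flip[of "[]" s] by simp
 have "A' (\<lambda>x. - f x) = (\<lambda>x. - A' f x)" for f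
  using lin_scale[of A' "-1" f] assms by (simp add: encodable_def oper_def)
 then show ?thesis
  using encodable_comp[OF encodableI1[OF 1 2] assms] by (simp add: add.commute)
qed

text \<open>A larger normalisation is reached by adding zero, encoded as \<open>f - f\<close> with
  normalisation two.\<close>

lemma encodable_weaken:
 fixes A A' :: linop
 assumes "encodable s \<kappa> N A A'" "N \<le> M"
 shows "encodable s (\<kappa> + 5) M A A'"
proof (cases "N = M")
 case True
 then show ?thesis using assms encodable_mono by (metis le_add1)
next
 case False
 have z: "encodable s (0 + (0 + 1) + 2) (1 + 1) (\<lambda>f x. f x + - f x) (\<lambda>f x. f x + - f x)"
  by (rule encodable_add[OF encodable_id encodable_uminus[OF encodable_id]])
 let ?c = "(M - N) / 2"
 have "0 < ?c" using assms False by simp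
 from encodable_add[OF assms(1) encodable_scale[OF z this]] show ?thesis
  by (rule encodable_eqI) (simp_all add: field_simps)
qed

lemma encodable_sum:
 fixes A A' :: "'i => linop"
 assumes "finite I" "I \<noteq> {}" "\<And>i. i \<in> I ==> encodable s \<kappa> (N i) (A i) (A' i)"
 shows "encodable s (card I * (\<kappa> + 2)) (\<Sum>i\<in>I. N i) (\<lambda>f x. \<Sum>i\<in>I. A i f x) (\<lambda>f x. \<Sum>i\<in>I. A' i f x)"
 using assms
proof (induction I rule: finite_ne_induct)
 case (singleton i)
 then show ?case using encodable_mono[of s \<kappa> "N i" "A i" "A' i"] by simp
next
 case (insert i I)
 have "encodable s (\<kappa> + card I * (\<kappa> + 2) + 2) (N i + (\<Sum>i\<in>I. N i)) (\<lambda>f x. A i f x + (\<Sum>i\<in>I. A i f x)) (\<lambda>f x. A' i f x + (\<Sum>i\<in>I. A' i f x))"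
  using insert by (intro encodable_add) auto
 then show ?case using insert by (simp add: algebra_simps)
qed

lemma encodable_reflect:
 fixes A A' :: linop
 assumes "encodable s \<kappa> N A A'"
 shows "encodable s (16 * \<kappa> + 1) 1 (\<lambda>f x. f x - 2 * A' (A f) x / cr (N\<^sup>2)) (\<lambda>f x. f x - 2 * A' (A f) x / cr (N\<^sup>2))"
proof -
 have o: "oper s N A A'" "0 < N" using assms by (auto simp: encodable_def)
 have l: "A' (\<lambda>x. f x / cr N) = (\<lambda>x. A' f x / cr N)" for f
  using lin_scale[OF operD(2)[OF o(1)], of "inverse (cr N)" f] by (simp add: field_simps)
 have 1: "oper s 1 (\<lambda>f x. A f x / cr N) (\<lambda>f x. A' f x / cr N)"
  using oper_scale[OF o(1), of "inverse N"] o(2) by (simp add: field_simps)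
 have 2: "encodes s \<kappa> (\<lambda>f x. A f x / cr N) (\<lambda>f x. A' f x / cr N)"
  using assms by (simp add: encodable_def)
 have eq: "(\<lambda>f x. f x - 2 * (A' (\<lambda>x. A f x / cr N) x / cr N)) =
   (\<lambda>f x. f x - 2 * A' (A f) x / cr (N\<^sup>2))"
  unfolding l by (simp add: power2_eq_square)
 show ?thesis
  using encodableI1[OF oper_reflect[OF 1] encodes_reflect[OF 2]] unfolding eq by simp
qed

text \<open>The mean of the identity and the reflection; the normalisation stays one however large
  \<open>N\<close> is.\<close>

lemma encodable_complement:
 fixes A A' :: linop
 assumes "encodable s \<kappa> N A A'"
 shows "encodable s (16 * \<kappa> + 3) 1 (\<lambda>f x. f x - A' (A f) x / cr (N\<^sup>2)) (\<lambda>f x. f x - A' (A f) x / cr (N\<^sup>2))"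
proof -
 have "encodable s (0 + (16 * \<kappa> + 1) + 2) (1/2 * (1 + 1))
   (\<lambda>f x. cr (1/2) * (f x + (f x - 2 * A' (A f) x / cr (N\<^sup>2))))
   (\<lambda>f x. cr (1/2) * (f x + (f x - 2 * A' (A f) x / cr (N\<^sup>2))))"
  by (rule encodable_scale[OF encodable_add[OF encodable_id encodable_reflect[OF assms]]]) simp
 then show ?thesis by (rule encodable_eqI) (simp_all add: algebra_simps)
qed

text \<open>Horner's scheme: one use of \<open>A\<close> per degree, and a normalisation equal to
  the value of the polynomial at one.\<close>

lemma encodable_poly:
 fixes A A' :: linop and a :: "nat => real"
 assumes "encodable s \<kappa> 1 A A'" "\<And>k. k \<le> d ==> 0 < a k"
 shows "encodable s (d * (\<kappa> + 2)) (\<Sum>k\<le>d. a k) (\<lambda>f x. \<Sum>k\<le>d. a k * (A ^^ k) f x) (\<lambda>f x. \<Sum>k\<le>d. a k * (A' ^^ k) f x)"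
 using assms(2)
proof (induction d arbitrary: a)
 case 0
 then show ?case using encodable_scale[OF encodable_id, of "a 0" s] by simp
next
 case (Suc d)
 have lA: "lin A" "lin A'" using assms(1) by (auto simp: encodable_def oper_def)
 have lsum: "B (\<lambda>x. \<Sum>k\<le>d. c k * g k x) = (\<lambda>x. \<Sum>k\<le>d. c k * B (g k) x)" if "lin B" for B :: linop and c g and d :: nat
  by (induction d) (simp_all add: lin_add[OF that] lin_scale[OF that])
 have comm: "(A' ^^ k) (A' f) = A' ((A' ^^ k) f)" for k f
  by (metis comp_apply funpow_Suc_right funpow.simps(2))
 have "encodable s (d * (\<kappa> + 2)) (\<Sum>k\<le>d. a (Suc k)) (\<lambda>f x. \<Sum>k\<le>d. a (Suc k) * (A ^^ k) f x) (\<lambda>f x. \<Sum>k\<le>d. a (Suc k) * (A' ^^ k) f x)"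
  by (rule Suc.IH) (use Suc.prems in auto)
 from encodable_comp[OF assms(1) this]
 have "encodable s (\<kappa> + d * (\<kappa> + 2)) (\<Sum>k\<le>d. a (Suc k)) (\<lambda>f x. \<Sum>k\<le>d. a (Suc k) * (A ^^ Suc k) f x) (\<lambda>f x. \<Sum>k\<le>d. a (Suc k) * (A' ^^ Suc k) f x)"
  by (simp add: lsum[OF lA(1)] comm)
 from encodable_add[OF encodable_scale[OF encodable_id, of "a 0"] this] Suc.prems[of 0]
 have *: "encodable s (0 + (\<kappa> + d * (\<kappa> + 2)) + 2) (a 0 * 1 + (\<Sum>k\<le>d. a (Suc k)))
  (\<lambda>f x. a 0 * f x + (\<Sum>k\<le>d. a (Suc k) * (A ^^ Suc k) f x)) (\<lambda>f x. a 0 * f x + (\<Sum>k\<le>d. a (Suc k) * (A' ^^ Suc k) f x))"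
  by simp
 show ?case unfolding sum.atMost_Suc_shift using * by (simp add: algebra_simps)
qed

text \<open>Splitting on a wire \<open>v\<close> writes the operator as a product of two, each equal
  to one where the other acts, the second conjugated by a negation of \<open>v\<close>. At a leaf it
  has a single value \<open>e\<close> on one pattern of the wires \<open>cs\<close>, which makes it
  a convex combination of the identity and a sign flip. The \<open>- 2\<close> in the cost makes
  room for the two negations.\<close>

lemma encodable_diag_aux:
 fixes d :: "bits => real"
 assumes "\<And>x. \<bar>d x\<bar> \<le> 1" "\<And>x y. (\<forall>w\<in>set vs. x w = y w) ==> d x = d y"
  and "distinct (cs @ vs)" "set (cs @ vs) \<subseteq> {..<s}" "length (cs @ vs) \<le> T"
 shows "encodable s (2 ^ length vs * (14 * T + 5) - 2) 1
  (\<lambda>f x. cr (if zero_on (set cs) x then d x else 1) * f x)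
  (\<lambda>f x. cr (if zero_on (set cs) x then d x else 1) * f x)"
 using assms
proof (induction vs arbitrary: cs d)
 case Nil
 define e where "e = d (\<lambda>_. False)"
 have d: "d x = e" for x using Nil(2) unfolding e_def by simp
 have e: "\<bar>e\<bar> \<le> 1" using Nil(1) d by metis
 let ?p = "(1 + e) / 2"
 have p: "0 \<le> ?p" "?p \<le> 1" using e by auto
 have "oper s 1 (\<lambda>f x. cr (if zero_on (set cs) x then d x else 1) * f x) (\<lambda>f x. cr (if zero_on (set cs) x then d x else 1) * f x)"
  by (rule oper_diag) (use e in \<open>simp add: d\<close>)
 moreover have "encodes s (0 + (14 * length cs + 1) + 2) (\<lambda>f x. ?p * f x + (1 - ?p) * (if zero_on (set cs) x then - f x else f x))
    (\<lambda>f x. ?p * f x + (1 - ?p) * (if zero_on (set cs) x then - f x else f x))"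
  using encodes_convex[OF encodes_id encodes_sign_flip p, of cs s] Nil(3,4) by simp
 moreover have "?p * f x + (1 - ?p) * (if zero_on (set cs) x then - f x else f x) =
   cr (if zero_on (set cs) x then d x else 1) * f x" for f :: state and x
  by (simp add: d field_simps)
 ultimately have "encodable s (0 + (14 * length cs + 1) + 2) 1 (\<lambda>f x. cr (if zero_on (set cs) x then d x else 1) * f x)
   (\<lambda>f x. cr (if zero_on (set cs) x then d x else 1) * f x)"
  unfolding encodable_def by simp
 then show ?case by (rule encodable_mono) (use Nil(5) in simp)
next
 case (Cons v vs)
 let ?K = "2 ^ length vs * (14 * T + 5) - 2"
 define D where "D b x = cr (if zero_on (set (v # cs)) x then d (x(v := b)) else 1)" for b x
 have IH: "encodable s ?K 1 (\<lambda>f x. D b x * f x) (\<lambda>f x. D b x * f x)" for b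
  unfolding D_def
 proof (rule Cons.IH)
  show "\<bar>d (x(v := b))\<bar> \<le> 1" for x by (rule Cons.prems(1))
  show "d (x(v := b)) = d (y(v := b))" if "\<forall>w\<in>set vs. x w = y w" for x y
   by (rule Cons.prems(2)) (use that in auto)
 qed (use Cons.prems(3-5) in auto)
 have v: "v < s" "v \<notin> set cs" using Cons.prems(3,4) by auto
 have c: "encodable s (?K + (1 + (?K + 1))) (1 * (1 * (1 * 1)))
   (\<lambda>f x. D False x * (D True (x(v := \<not> x v)) * f (x(v := \<not> x v, v := \<not> (x(v := \<not> x v)) v))))
   (\<lambda>f x. D True (x(v := \<not> x v)) * (D False (x(v := \<not> x v, v := \<not> (x(v := \<not> x v)) v)) * f (x(v := \<not> x v, v := \<not> (x(v := \<not> x v)) v))))"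
  by (rule encodable_comp[OF IH encodable_comp[OF encodable_not[OF v(1)] encodable_comp[OF IH encodable_not[OF v(1)]]]])
 have eq: "D False x * D True (x(v := \<not> x v)) = cr (if zero_on (set cs) x then d x else 1)" for x
 proof -
  have "zero_on (set cs) (x(v := b)) = zero_on (set cs) x" for b using v by (metis fun_upd_other)
  then show ?thesis by (cases "x v") (simp_all add: D_def fun_upd_idem)
 qed
 have "2 \<le> 2 ^ length vs * (14 * T + 5)" using mult_le_mono[of 1 "2 ^ length vs" 2 "14 * T + 5"] by simp
 then have K: "?K + (1 + (?K + 1)) = 2 ^ length (v # vs) * (14 * T + 5) - 2" by simp
 have eq': "D True (x(v := \<not> x v)) * D False x = cr (if zero_on (set cs) x then d x else 1)" for x
  using eq[of x] by (simp add: mult.commute)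
 show ?case using c unfolding K
  by (rule encodable_eqI) (simp_all only: mult.assoc[symmetric] eq eq' mult_1 fun_upd_upd fun_upd_same not_not fun_upd_triv order_refl)
qed

lemma encodable_diag:
 fixes d :: "bits => real"
 assumes "\<And>x. \<bar>d x\<bar> \<le> N" "\<And>x y. (\<forall>w\<in>set vs. x w = y w) ==> d x = d y" "0 < N"
  and "distinct vs" "set vs \<subseteq> {..<s}"
 shows "encodable s (2 ^ length vs * (14 * length vs + 5)) N (\<lambda>f x. cr (d x) * f x) (\<lambda>f x. cr (d x) * f x)"
proof -
 have "encodable s (2 ^ length vs * (14 * length vs + 5) - 2) 1
  (\<lambda>f x. cr (if zero_on (set []) x then d x / N else 1) * f x)
  (\<lambda>f x. cr (if zero_on (set []) x then d x / N else 1) * f x)"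
 proof (rule encodable_diag_aux)
  show "d x / N = d y / N" if "\<forall>w\<in>set vs. x w = y w" for x y
   using assms(2)[OF that] by simp
 qed (use assms in \<open>simp_all add: abs_divide\<close>)
 from encodable_scale[OF this assms(3)]
 have "encodable s (2 ^ length vs * (14 * length vs + 5) - 2) N (\<lambda>f x. cr (d x) * f x) (\<lambda>f x. cr (d x) * f x)"
  using assms(3) by simp
 then show ?thesis by (rule encodable_mono) simp
qed

section \<open>Approximate projections and Neumann series\<close>

lemma lin_diff: "lin A ==> A (\<lambda>x. f x - g x) = (\<lambda>x. A f x - A g x)"
 using lin_add[of A f "\<lambda>x. -1 * g x"] lin_scale[of A "-1" g] by simp

lemma lin_zero: "lin A ==> A (\<lambda>x. 0) = (\<lambda>x. 0)"
 using lin_scale[of A 0 "\<lambda>x. 0"] by simp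

lemma lin_sum:
 assumes "lin A" "finite I" shows "A (\<lambda>x. \<Sum>i\<in>I. g i x) = (\<lambda>x. \<Sum>i\<in>I. A (g i) x)"
 using assms(2) by (induction I rule: finite_induct) (simp_all add: lin_zero[OF assms(1)] lin_add[OF assms(1)])

lemma lin_funpow: "lin A ==> lin (A ^^ k)"
 by (induction k) (auto simp: lin_def)

lemma encodable_funpow:
 fixes A A' :: linop
 assumes "encodable s \<kappa> 1 A A'" shows "encodable s (k * \<kappa>) 1 (A ^^ k) (A' ^^ k)"
proof (induction k)
 case 0
 then show ?case using encodable_id by (simp add: id_def)
next
 case (Suc k)
 have "(\<lambda>f. (A' ^^ k) (A' f)) = A' ^^ Suc k" by (simp add: funpow_Suc_right comp_def del: funpow.simps)
 then show ?case using encodable_comp[OF assms Suc] by (simp add: comp_def)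
qed

text \<open>One Richardson step for the frame operator, with the step length at which it is the mean
  of the contractions \<open>1 - F m F' m / b\<^sup>2\<close>.\<close>

definition deflate :: "nat set => (nat => state => state) => (nat => state => state) => real => linop" where
 "deflate I F F' b f x = f x - (\<Sum>m\<in>I. F m (F' m f) x) / cr (b\<^sup>2 * card I)"

text \<open>Divided by \<open>q\<close> the frame operator lies between zero and one: by
  Cauchy-Schwarz over \<open>I\<close> the squared norm of its image is at most its quadratic form
  \<open>t\<close>. The cross term \<open>- 2 t\<close> therefore leaves a decrease of
  \<open>t\<close>.\<close>

lemma deflate_contracts:
 assumes I: "finite I" "I \<noteq> {}" and F: "\<And>m. m \<in> I ==> oper s b (F m) (F' m)" and b: "0 < b"
  and c: "c * (nrm s y)\<^sup>2 \<le> (\<Sum>m\<in>I. (nrm s (F' m y))\<^sup>2) / (b\<^sup>2 * card I)"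
 shows "(nrm s (deflate I F F' b y))\<^sup>2 \<le> (1 - c) * (nrm s y)\<^sup>2"
proof -
 define q where "q = b\<^sup>2 * card I"
 have card: "0 < card I" using I by (simp add: card_gt_0_iff)
 have q: "0 < q" using b card by (simp add: q_def)
 define t where "t = (\<Sum>m\<in>I. (nrm s (F' m y))\<^sup>2) / q"
 define X where "X x = (\<Sum>m\<in>I. F m (F' m y) x)" for x
 have X: "nrm s X \<le> b * (\<Sum>m\<in>I. nrm s (F' m y))"
 proof -
  have "nrm s X \<le> (\<Sum>m\<in>I. nrm s (F m (F' m y)))"
   unfolding X_def by (rule nrm_sum[OF I(1)])
  also have "\<dots> \<le> (\<Sum>m\<in>I. b * nrm s (F' m y))"
   by (intro sum_mono operD(3)[OF F])
  finally show ?thesis by (simp add: sum_distrib_left)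
 qed
 have "(nrm s X)\<^sup>2 \<le> (b * (\<Sum>m\<in>I. nrm s (F' m y)))\<^sup>2"
  using X by (rule power_mono) simp
 also have "\<dots> \<le> b\<^sup>2 * ((\<Sum>m\<in>I. (nrm s (F' m y))\<^sup>2) * card I)"
  unfolding power_mult_distrib using sum_squared_le_sum_of_squares by (intro mult_left_mono) auto
 also have "\<dots> = t * q * q" using card b by (simp add: t_def q_def field_simps)
 finally have X2: "(nrm s X)\<^sup>2 / (q * q) \<le> t"
  using q by (simp add: field_simps)
 have "ip s y X = (\<Sum>m\<in>I. of_real ((nrm s (F' m y))\<^sup>2))"
  unfolding X_def ip_sum_right
 proof (rule sum.cong[OF refl])
  fix m assume m: "m \<in> I"
  show "ip s y (F m (F' m y)) = of_real ((nrm s (F' m y))\<^sup>2)"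
   unfolding oper_ip'[OF F[OF m], symmetric] by (rule ip_self)
 qed
 then have ipX: "Re (ip s y X) = t * q" using q by (simp add: t_def)
 define r where "r = inverse q"
 have "deflate I F F' b y = (\<lambda>x. y x - cr r * X x)"
  by (rule ext) (simp only: deflate_def X_def r_def q_def of_real_inverse divide_inverse mult.commute)
 then have "(nrm s (deflate I F F' b y))\<^sup>2 = (nrm s y)\<^sup>2 - 2 * (r * Re (ip s y X)) + (\<bar>r\<bar> * nrm s X)\<^sup>2"
  by (simp only: nrm_diff_sq ip_scale_right nrm_scale norm_of_real) simp
 also have "\<dots> = (nrm s y)\<^sup>2 - 2 * (Re (ip s y X) / q) + (nrm s X)\<^sup>2 / (q * q)"
  by (simp only: r_def power_mult_distrib power2_abs divide_inverse power2_eq_square inverse_mult_distrib mult_ac)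
 also have "\<dots> \<le> (nrm s y)\<^sup>2 - t" using X2 ipX q by simp
 also have "\<dots> \<le> (1 - c) * (nrm s y)\<^sup>2" using c by (simp add: t_def q_def algebra_simps)
 finally show ?thesis .
qed

lemma deflate_power_contracts:
 assumes "finite I" "I \<noteq> {}" "\<And>m. m \<in> I ==> oper s b (F m) (F' m)" "0 < b" "c \<le> 1"
  and R: "\<And>y. y \<in> R ==> deflate I F F' b y \<in> R"
   "\<And>y. y \<in> R ==> c * (nrm s y)\<^sup>2 \<le> (\<Sum>m\<in>I. (nrm s (F' m y))\<^sup>2) / (b\<^sup>2 * card I)"
  and "y \<in> R"
 shows "(deflate I F F' b ^^ k) y \<in> R \<and> (nrm s ((deflate I F F' b ^^ k) y))\<^sup>2 \<le> (1 - c) ^ k * (nrm s y)\<^sup>2"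
proof (induction k)
 case 0
 then show ?case using assms by simp
next
 case (Suc k)
 let ?y = "(deflate I F F' b ^^ k) y"
 have "(nrm s (deflate I F F' b ?y))\<^sup>2 \<le> (1 - c) * (nrm s ?y)\<^sup>2"
  using Suc by (intro deflate_contracts assms) auto
 also have "\<dots> \<le> (1 - c) * ((1 - c) ^ k * (nrm s y)\<^sup>2)" using Suc assms(5) by (intro mult_left_mono) auto
 finally show ?case using Suc R(1) by (simp add: mult.assoc)
qed

text \<open>As a mean of complements of normalisation one, the step does not pay for the number of
  levels in its normalisation.\<close>

lemma encodable_deflate:
 fixes F F' :: "nat => linop"
 assumes I: "finite I" "I \<noteq> {}" and F: "\<And>m. m \<in> I ==> encodable s \<kappa> b (F m) (F' m)"
 shows "encodable s (card I * (16 * \<kappa> + 5)) 1 (deflate I F F' b) (deflate I F F' b)"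
proof -
 have card: "0 < card I" using I by (simp add: card_gt_0_iff)
 have 1: "encodable s (16 * \<kappa> + 3) (1 / card I * 1)
   (\<lambda>f x. cr (1 / card I) * (f x - F m (F' m f) x / cr (b\<^sup>2)))
   (\<lambda>f x. cr (1 / card I) * (f x - F m (F' m f) x / cr (b\<^sup>2)))" if "m \<in> I" for m
  by (rule encodable_scale[OF encodable_complement[OF encodable_adj[OF F[OF that]]]]) (use card in simp)
 have eq: "(\<Sum>m\<in>I. cr (1 / card I) * (f x - F m (F' m f) x / cr (b\<^sup>2))) = deflate I F F' b f x" for f x
 proof -
  have "(\<Sum>m\<in>I. cr (1 / card I) * (f x - F m (F' m f) x / cr (b\<^sup>2))) =
    cr (1 / card I) * (of_nat (card I) * f x - (\<Sum>m\<in>I. F m (F' m f) x) / cr (b\<^sup>2))"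
   by (simp only: sum_distrib_left[symmetric] sum_subtractf sum_constant sum_divide_distrib[symmetric])
  also have "\<dots> = deflate I F F' b f x"
   using card by (simp add: deflate_def right_diff_distrib)
  finally show ?thesis .
 qed
 have 2: "encodable s (card I * (16 * \<kappa> + 3 + 2)) (\<Sum>m\<in>I. 1 / real (card I) * 1)
   (\<lambda>f x. \<Sum>m\<in>I. cr (1 / card I) * (f x - F m (F' m f) x / cr (b\<^sup>2)))
   (\<lambda>f x. \<Sum>m\<in>I. cr (1 / card I) * (f x - F m (F' m f) x / cr (b\<^sup>2)))"
  by (rule encodable_sum[OF I 1])
 show ?thesis
 proof (rule encodable_eqI[OF 2])
  show "(\<Sum>i\<in>I. 1 / real (card I) * 1) = 1" using card by simp
 qed (simp, (rule eq)+)
qed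

lemma neumann_identity:
 assumes "lin Y" and e: "\<And>x. e x = z x - Y z x - g x"
 shows "z x = (\<Sum>k\<le>K. (Y ^^ k) g x) + (Y ^^ Suc K) z x + (\<Sum>k\<le>K. (Y ^^ k) e x)"
proof -
 have e': "e = (\<lambda>x. (z x - Y z x) - g x)" using e by auto
 have "(Y ^^ k) e = (\<lambda>x. ((Y ^^ k) z x - (Y ^^ k) (Y z) x) - (Y ^^ k) g x)" for k
  unfolding e' lin_diff[OF lin_funpow[OF assms(1)]] ..
 moreover have "(Y ^^ k) (Y z) = (Y ^^ Suc k) z" for k
  by (simp add: funpow_Suc_right del: funpow.simps)
 ultimately have *: "(Y ^^ k) e x = (Y ^^ k) z x - (Y ^^ Suc k) z x - (Y ^^ k) g x" for k by simp
 have "(\<Sum>k\<le>K. (Y ^^ k) z x - (Y ^^ Suc k) z x) = (Y ^^ 0) z x - (Y ^^ Suc K) z x"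
  by (rule sum_telescope)
 then show ?thesis by (simp only: * sum_subtractf) simp
qed

lemma oper_funpow_bound:
 assumes "\<And>f. nrm s (Y f) \<le> \<rho> * nrm s f" "0 \<le> \<rho>"
 shows "nrm s ((Y ^^ k) f) \<le> \<rho> ^ k * nrm s f"
proof (induction k)
 case (Suc k)
 have "nrm s (Y ((Y ^^ k) f)) \<le> \<rho> * nrm s ((Y ^^ k) f)" by (rule assms(1))
 also have "\<dots> \<le> \<rho> * (\<rho> ^ k * nrm s f)" using Suc assms(2) by (rule mult_left_mono)
 finally show ?case by (simp add: mult.assoc)
qed simp

text \<open>The fixed point equation is allowed a residual \<eta>, because the projection in the
  solver is only approximate; the geometric series amplifies it by at most
  \<open>1 / (1 - \<rho>)\<close>.\<close>

lemma neumann_bound: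
 assumes "lin Y" and Y: "\<And>f. nrm s (Y f) \<le> \<rho> * nrm s f" "0 \<le> \<rho>" "\<rho> < 1"
  and e: "nrm s (\<lambda>x. z x - Y z x - g x) \<le> \<eta>"
 shows "nrm s (\<lambda>x. z x - (\<Sum>k\<le>K. (Y ^^ k) g x)) \<le> \<rho> ^ Suc K * nrm s z + \<eta> / (1 - \<rho>)"
proof -
 define d where "d x = z x - Y z x - g x" for x
 have \<eta>: "0 \<le> \<eta>" "nrm s d \<le> \<eta>" using order_trans[OF nrm_nonneg e] e by (auto simp: d_def[abs_def])
 have "(\<lambda>x. z x - (\<Sum>k\<le>K. (Y ^^ k) g x)) = (\<lambda>x. (Y ^^ Suc K) z x + (\<Sum>k\<le>K. (Y ^^ k) d x))"
  by (rule ext, unfold diff_eq_eq, rule trans[OF neumann_identity[OF assms(1) d_def, where K = K]]) (simp only: add_ac)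
 then have "nrm s (\<lambda>x. z x - (\<Sum>k\<le>K. (Y ^^ k) g x)) \<le> nrm s ((Y ^^ Suc K) z) + nrm s (\<lambda>x. \<Sum>k\<le>K. (Y ^^ k) d x)"
  by (simp only: nrm_add)
 also have "nrm s (\<lambda>x. \<Sum>k\<le>K. (Y ^^ k) d x) \<le> (\<Sum>k\<le>K. \<rho> ^ k * \<eta>)"
 proof (rule order_trans[OF nrm_sum sum_mono])
  show "nrm s ((Y ^^ k) d) \<le> \<rho> ^ k * \<eta>" for k
   using oper_funpow_bound[OF Y(1,2), of k d] mult_left_mono[OF \<eta>(2), of "\<rho> ^ k"] Y(2) by simp
 qed simp
 also have "(\<Sum>k\<le>K. \<rho> ^ k * \<eta>) = \<eta> * (\<Sum>k\<le>K. \<rho> ^ k)" by (simp add: sum_distrib_left mult.commute)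
 also have "\<dots> \<le> \<eta> * (1 / (1 - \<rho>))"
 proof (rule mult_left_mono[OF _ \<eta>(1)])
  have "(\<Sum>k\<le>K. \<rho> ^ k) = (1 - \<rho> ^ Suc K) / (1 - \<rho>)"
   using Y(3) by (subst sum_gp0) auto
  also have "\<dots> \<le> 1 / (1 - \<rho>)" using Y by (intro divide_right_mono) auto
  finally show "(\<Sum>k\<le>K. \<rho> ^ k) \<le> 1 / (1 - \<rho>)" .
 qed
 also have "nrm s ((Y ^^ Suc K) z) \<le> \<rho> ^ Suc K * nrm s z" by (rule oper_funpow_bound[OF Y(1,2)])
 finally show ?thesis by simp
qed

section \<open>Shift operators on the discrete torus\<close>

text \<open>Adding two leaves the lowest bit alone. A shift by \<open>2 ^ m\<close> is therefore an
  increment of the register without its \<open>m\<close> lowest wires, and large shifts cost no more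
  than small ones.\<close>

lemma incr_twice: "distinct (w # ws) ==> incr (w # ws) (incr (w # ws) x) = incr ws x"
 by (cases "x w") (auto simp: incr_upd fun_upd_idem simp flip: incr_upd)

lemma incr_drop_pow: "distinct ws ==> j \<le> length ws ==> incr (drop j ws) = (incr ws ^^ (2 ^ j))"
proof (induction j)
 case (Suc j)
 then obtain w vs where d: "drop j ws = w # vs" by (metis Cons_nth_drop_Suc Suc_le_lessD)
 then have "drop (Suc j) ws = vs" by (metis drop_Suc list.sel(3) tl_drop)
 moreover have "distinct (w # vs)" using Suc.prems(1) d by (metis distinct_drop)
 then have "incr (drop j ws) \<circ> incr (drop j ws) = incr vs" 
  unfolding d comp_def by (intro ext fun_cong[OF incr_twice])
 ultimately show ?case using Suc by (simp flip: funpow_add mult_2)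
qed (simp add: fun_eq_iff)

lemma incr_commute_disjoint: "set ws \<inter> set vs = {} ==> incr ws (incr vs x) = incr vs (incr ws x)"
proof (induction vs arbitrary: x)
 case (Cons v vs)
 then have "v \<notin> set ws" by auto
 with Cons.prems have "incr ws (incr vs y) = incr vs (incr ws y)" "incr ws (x(v := b)) = (incr ws x)(v := b)" "incr ws x v = x v" for y b
  by (auto intro!: Cons.IH incr_upd)
 then show ?case by (cases "x v") (simp_all only: incr.simps if_True if_False)
qed simp

lemma funpow_commute: "(f ^^ i) ((f ^^ j) x) = (f ^^ j) ((f ^^ i) x)"
 by (metis add.commute comp_apply funpow_add)

locale grid = fixes l :: nat
begin

text \<open>Three registers of \<open>l\<close> wires, three further wires \<open>3 * l + a\<close>
  that double each register to a circle of \<open>2 ^ (l + 1)\<close> points, and three selectors.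
  The registers come first, so that the padded Hamiltonian lives on an initial segment of the wires
  and the others are ancillas.\<close>

definition sz :: nat where "sz = 3 * l + 6"
definition reg :: "nat => nat list" where "reg a = [a * l..<a * l + l] @ [3 * l + a]"
definition al :: "nat => nat" where "al a = 3 * l + 3 + a"
text \<open>Translation by \<open>2 ^ m\<close>; for \<open>m = Suc l\<close> the list of wires is
  empty, in accordance with a full turn.\<close>

definition shift :: "nat => nat => linop" where "shift a m f = (\<lambda>x. f (incr (drop m (reg a)) x))"

lemma reg_bound: "a < 3 ==> v \<in> set (reg a) ==> v < 3 * l + 3"
 by (auto simp: reg_def) (use mult_le_mono1[of a 2 l] in linarith)

lemma distinct_reg: "a < 3 ==> distinct (reg a)"
 by (auto simp: reg_def) (use mult_le_mono1[of a 2 l] in linarith)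

lemma length_reg [simp]: "length (reg a) = Suc l"
 by (simp add: reg_def)

lemma reg_sub: "a < 3 ==> set (drop m (reg a)) \<subseteq> {..<sz}"
 using reg_bound set_drop_subset[of m "reg a"] by (fastforce simp: sz_def)

lemma reg_disjoint:
 assumes "a < 3" "b < 3" "a \<noteq> b" shows "set (reg a) \<inter> set (reg b) = {}"
proof -
 have el: "a * l \<le> v \<and> v < Suc a * l \<and> Suc a * l \<le> 3 * l \<or> v = 3 * l + a" if "v \<in> set (reg a)" "a < 3" for v a
  using that mult_le_mono1[of "Suc a" 3 l] by (auto simp: reg_def)
 have *: "set (reg a) \<inter> set (reg b) = {}" if "a < b" "b < 3" for a b
 proof -
  have "Suc a * l \<le> b * l" using that by (intro mult_le_mono1) simp
  then have False if "v \<in> set (reg a)" "v \<in> set (reg b)" for v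
   using el[OF that(1)] el[OF that(2)] \<open>a < b\<close> \<open>b < 3\<close> by linarith
  then show ?thesis by blast
 qed
 show ?thesis using *[of a b] *[of b a] assms by (cases "a < b") auto
qed

lemma al_notin_reg: "b < 3 ==> al a \<notin> set (reg b)"
 using reg_bound[of b "al a"] by (auto simp: al_def)

lemma al_lt: "a < 3 ==> al a < sz"
 by (simp add: al_def sz_def)

lemma al_inj [simp]: "al a = al b \<longleftrightarrow> a = b"
 by (simp add: al_def)

lemma incr_drop_commute:
 assumes "a < 3" "b < 3"
 shows "incr (drop m (reg a)) (incr (drop k (reg b)) x) = incr (drop k (reg b)) (incr (drop m (reg a)) x)"
proof (cases "a = b")
 case False
 have "set (drop m (reg a)) \<inter> set (drop k (reg b)) = {}"
  using reg_disjoint[OF assms False] set_drop_subset[of m "reg a"] set_drop_subset[of k "reg b"] by blast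
 then show ?thesis by (rule incr_commute_disjoint)
next
 case True
 consider "m \<le> Suc l" "k \<le> Suc l" | "Suc l < m" | "Suc l < k" by linarith
 then show ?thesis
 proof cases
  case 1
  then have "incr (drop m (reg a)) = incr (reg a) ^^ (2 ^ m)" "incr (drop k (reg b)) = incr (reg a) ^^ (2 ^ k)"
   using distinct_reg[OF assms(1)] True by (simp_all add: incr_drop_pow)
  then show ?thesis by (simp only: funpow_commute)
 qed simp_all
qed

lemma lin_shift: "lin (shift a m)"
 by (simp add: lin_def shift_def)

lemma shift_commute: "a < 3 ==> b < 3 ==> shift a m (shift b k f) = shift b k (shift a m f)"
 by (simp add: shift_def incr_drop_commute)

lemma nrm_shift: "a < 3 ==> nrm sz (shift a m f) = nrm sz f"
 unfolding shift_def by (rule oper_incr(2)) (auto simp: distinct_reg reg_sub)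

lemma encodable_shift:
 assumes "a < 3" shows "\<exists>A'. encodable sz (13 * Suc l) 1 (shift a m) A'"
proof -
 have "encodable sz (13 * length (drop m (reg a))) 1 (shift a m) (\<lambda>f x. f (decr (drop m (reg a)) x))"
  unfolding shift_def[abs_def] by (rule encodable_incr) (simp_all add: distinct_reg assms reg_sub)
 then show ?thesis using encodable_mono by (metis diff_le_self length_drop length_reg mult_le_mono2)
qed

lemma shift_twice:
 assumes "a < 3" "m \<le> l" shows "shift a m (shift a m f) = shift a (Suc m) f"
proof -
 obtain w vs where d: "drop m (reg a) = w # vs" using assms(2) length_reg[of a] by (metis Cons_nth_drop_Suc le_imp_less_Suc)
 then have "drop (Suc m) (reg a) = vs" by (metis drop_Suc list.sel(3) tl_drop)
 moreover have "distinct (w # vs)" using distinct_reg[OF assms(1)] d by (metis distinct_drop)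
 ultimately show ?thesis by (simp only: shift_def d incr_twice)
qed

text \<open>The commutative algebra generated by the shifts; membership is all it takes to
  interchange averages, differences and filters.\<close>

inductive shiftop :: "linop => bool" where
 shiftop_id: "shiftop (\<lambda>f. f)"
| shiftop_shift: "a < 3 ==> shiftop (shift a m)"
| shiftop_comp: "shiftop A ==> shiftop B ==> shiftop (\<lambda>f. A (B f))"
| shiftop_comb: "shiftop A ==> shiftop B ==> shiftop (\<lambda>f x. c * A f x + d * B f x)"

lemma lin_shiftop: "shiftop A ==> lin A"
proof (induction rule: shiftop.induct)
 case shiftop_id then show ?case by (simp add: lin_def)
next
 case (shiftop_shift a m) show ?case by (rule lin_shift)
next
 case (shiftop_comp A B) show ?case by (rule lin_comp[OF shiftop_comp.IH])
next
 case (shiftop_comb A B c d) show ?case by (rule lin_combine[OF shiftop_comb.IH])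
qed

lemma lin_combine_apply: "lin A ==> A (\<lambda>x. c * f x + d * g x) = (\<lambda>x. c * A f x + d * A g x)"
 using lin_add[of A "\<lambda>x. c * f x" "\<lambda>x. d * g x"] lin_scale[of A c f] lin_scale[of A d g] by simp

lemma shiftop_commute_shift:
 assumes "shiftop A" "a < 3" shows "A (shift a m f) = shift a m (A f)"
 using assms
proof (induction arbitrary: f rule: shiftop.induct)
 case (shiftop_shift b k) then show ?case by (simp add: shift_commute)
next
 case (shiftop_comb A B c d) then show ?case by (simp add: lin_combine_apply[OF lin_shift])
qed simp_all

lemma shiftop_commute:
 assumes "shiftop A" "shiftop B" shows "A (B f) = B (A f)"
 using assms(2)
proof (induction arbitrary: f rule: shiftop.induct)
 case (shiftop_shift a m) then show ?case by (simp add: shiftop_commute_shift[OF assms(1)])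
next
 case (shiftop_comb B C c d) then show ?case by (simp add: lin_combine_apply[OF lin_shiftop[OF assms(1)]])
qed simp_all

lemma shiftop_mask:
 assumes "shiftop A" "\<And>a m x. a < 3 ==> Q (incr (drop m (reg a)) x) = Q x"
 shows "A (\<lambda>x. if Q x then f x else 0) = (\<lambda>x. if Q x then A f x else 0)"
 using assms(1)
proof (induction arbitrary: f rule: shiftop.induct)
 case (shiftop_shift a m) then show ?case by (intro ext) (simp add: shift_def assms(2))
next
 case (shiftop_comb A B c d) show ?case unfolding shiftop_comb.IH by (intro ext) simp
qed simp_all

definition avg :: "nat => nat => linop" where "avg a m f = (\<lambda>x. (f x + shift a m f x) / 2)"
definition dif :: "nat => nat => linop" where "dif a m f = (\<lambda>x. (f x - shift a m f x) / 2)"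

lemma shiftop_avg: "a < 3 ==> shiftop (avg a m)"
 using shiftop_comb[OF shiftop_id shiftop_shift[of a m], of "1/2" "1/2"] by (simp add: avg_def[abs_def] add_divide_distrib)

lemma shiftop_dif: "a < 3 ==> shiftop (dif a m)"
 using shiftop_comb[OF shiftop_id shiftop_shift[of a m], of "1/2" "-1/2"] by (simp add: dif_def[abs_def] diff_divide_distrib)

lemma avg_plus_dif: "avg a m f x + dif a m f x = f x"
 by (simp add: avg_def dif_def field_simps)

text \<open>The parallelogram law at each point, summed up with the help of the isometry of the
  shift.\<close>

lemma nrm_avg_dif:
 assumes "a < 3" shows "(nrm sz (avg a m f))\<^sup>2 + (nrm sz (dif a m f))\<^sup>2 = (nrm sz f)\<^sup>2"
proof -
 have p: "(cmod ((z + w) / 2))\<^sup>2 + (cmod ((z - w) / 2))\<^sup>2 = ((cmod z)\<^sup>2 + (cmod w)\<^sup>2) / 2" for z w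
  unfolding cmod_power2 by (simp add: power2_eq_square field_simps)
 have "(nrm sz (avg a m f))\<^sup>2 + (nrm sz (dif a m f))\<^sup>2 = (\<Sum>x\<in>slice sz. ((cmod (f x))\<^sup>2 + (cmod (shift a m f x))\<^sup>2) / 2)"
  unfolding nrm_sq avg_def dif_def sum.distrib[symmetric] p ..
 also have "\<dots> = ((nrm sz f)\<^sup>2 + (nrm sz (shift a m f))\<^sup>2) / 2"
  unfolding nrm_sq by (simp add: sum.distrib sum_divide_distrib[symmetric])
 finally show ?thesis using nrm_shift[OF assms] by simp
qed

lemma nrm_avg_le:
 assumes "a < 3" shows "nrm sz (avg a m f) \<le> nrm sz f" "nrm sz (dif a m f) \<le> nrm sz f"
proof -
 have "(nrm sz (avg a m f))\<^sup>2 \<le> (nrm sz f)\<^sup>2" "(nrm sz (dif a m f))\<^sup>2 \<le> (nrm sz f)\<^sup>2"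
  unfolding nrm_avg_dif[OF assms, of m f, symmetric] by simp_all
 then show "nrm sz (avg a m f) \<le> nrm sz f" "nrm sz (dif a m f) \<le> nrm sz f"
  by (auto intro: power2_le_imp_le)
qed

text \<open>\<open>(1 - T) (1 + T) = 1 - T\<^sup>2\<close>.\<close>

lemma dif_avg_double:
 assumes "a < 3" "m \<le> l" shows "2 * dif a m (avg a m f) x = dif a (Suc m) f x"
proof -
 have "shift a m (\<lambda>x. 1/2 * f x + 1/2 * shift a m f x) = (\<lambda>x. 1/2 * shift a m f x + 1/2 * shift a (Suc m) f x)"
  unfolding lin_combine_apply[OF lin_shift] shift_twice[OF assms] ..
 moreover have "avg a m f = (\<lambda>x. 1/2 * f x + 1/2 * shift a m f x)" by (simp add: avg_def add_divide_distrib)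
 ultimately show ?thesis by (simp add: dif_def field_simps)
qed

lemma nrm_dif_double:
 assumes "a < 3" "m \<le> Suc l" shows "nrm sz (dif a m f) \<le> 2 ^ m * nrm sz (dif a 0 f)"
 using assms(2)
proof (induction m)
 case (Suc m)
 have "dif a (Suc m) f = (\<lambda>x. 2 * avg a m (dif a m f) x)"
  using Suc.prems dif_avg_double[OF assms(1), of m f] shiftop_commute[OF shiftop_dif shiftop_avg, OF assms(1,1)] by (simp add: fun_eq_iff)
 then have "nrm sz (dif a (Suc m) f) = 2 * nrm sz (avg a m (dif a m f))" by (simp add: nrm_scale)
 also have "\<dots> \<le> 2 * nrm sz (dif a m f)" using nrm_avg_le(1)[OF assms(1)] by simp
 finally show ?case using Suc by simp
qed simp

lemma encodable_avg:
 assumes "a < 3" shows "\<exists>A'. encodable sz (13 * l + 16) 1 (avg a m) A'"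
proof -
 obtain S' where S: "encodable sz (13 * Suc l) 1 (shift a m) S'" using encodable_shift[OF assms] by blast
 have "encodable sz (0 + 13 * Suc l + 2) (1/2 * (1 + 1)) (\<lambda>f x. cr (1/2) * (f x + shift a m f x)) (\<lambda>f x. cr (1/2) * (f x + S' f x))"
  by (rule encodable_scale[OF encodable_add[OF encodable_id S]]) simp
 then have "encodable sz (13 * l + 16) 1 (avg a m) (\<lambda>f x. cr (1/2) * (f x + S' f x))"
  by (rule encodable_eqI) (simp_all add: avg_def)
 then show ?thesis by blast
qed

lemma encodable_dif:
 assumes "a < 3" shows "\<exists>A'. encodable sz (13 * l + 16) 1 (dif a m) A'"
proof -
 obtain S' where S: "encodable sz (13 * Suc l) 1 (shift a m) S'" using encodable_shift[OF assms] by blast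
 have "encodable sz (0 + (13 * Suc l + 1) + 2) (1/2 * (1 + 1)) (\<lambda>f x. cr (1/2) * (f x + - shift a m f x)) (\<lambda>f x. cr (1/2) * (f x + - S' f x))"
  by (rule encodable_scale[OF encodable_add[OF encodable_id encodable_uminus[OF S]]]) simp
 then have "encodable sz (13 * l + 16) 1 (dif a m) (\<lambda>f x. cr (1/2) * (f x + - S' f x))"
  by (rule encodable_eqI) (simp_all add: dif_def)
 then show ?thesis by blast
qed

end

subsection \<open>Gradients and multilevel frames\<close>

context grid
begin

text \<open>The three wires \<open>al a\<close> select, for each direction, between the average (\<open>False\<close>) and the
 difference (\<open>True\<close>) of the two values at the ends of an edge.\<close>

definition bsel :: "bool \<times> bool \<times> bool => nat => bool" where
 "bsel \<beta> a = (case \<beta> of (p, q, r) => if a = 0 then p else if a = 1 then q else r)"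

definition alpha :: "bits => bool \<times> bool \<times> bool" where "alpha x = (x (al 0), x (al 1), x (al 2))"

definition put :: "bool \<times> bool \<times> bool => bits => bits" where
 "put \<beta> x = x(al 0 := bsel \<beta> 0, al 1 := bsel \<beta> 1, al 2 := bsel \<beta> 2)"

abbreviation "z3 \<equiv> (False, False, False)"

definition proj :: linop where "proj f x = (if alpha x = z3 then f x else 0)"

text \<open>The column of the eight operators \<open>J \<beta>\<close>, stacked along the selector
  wires.\<close>

definition comb :: "(bool \<times> bool \<times> bool => state => state) => linop" where
 "comb J f x = J (alpha x) f (put z3 x)"

lemma alpha_put [simp]: "alpha (put \<beta> x) = \<beta>"
 by (cases \<beta>) (simp add: alpha_def put_def bsel_def)

lemma put_put [simp]: "put \<beta> (put \<gamma> x) = put \<beta> x"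
 by (simp add: put_def fun_upd_twist)

lemma put_alpha [simp]: "put (alpha x) x = x"
 by (simp add: alpha_def put_def bsel_def)

lemma put_z3: "alpha x = z3 ==> put z3 x = x"
 using put_alpha[of x] by simp

lemma slice_put: "x \<in> slice sz ==> put \<beta> x \<in> slice sz"
 by (simp add: put_def slice_upd al_lt)

lemma sum_slice_put: "(\<Sum>x\<in>slice sz. F x) = (\<Sum>\<beta>\<in>UNIV. \<Sum>x\<in>{x \<in> slice sz. alpha x = z3}. F (put \<beta> x))"
proof -
 have "(\<Sum>\<beta>\<in>UNIV. \<Sum>x\<in>{x \<in> slice sz. alpha x = z3}. F (put \<beta> x)) =
   (\<Sum>(\<beta>, x)\<in>UNIV \<times> {x \<in> slice sz. alpha x = z3}. F (put \<beta> x))"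
  by (rule sum.cartesian_product)
 also have "\<dots> = (\<Sum>x\<in>slice sz. F x)"
  by (rule sum.reindex_bij_witness[of _ "\<lambda>x. (alpha x, put z3 x)" "\<lambda>(\<beta>, x). put \<beta> x"])
   (auto simp: slice_put put_z3)
 finally show ?thesis ..
qed

lemma nrm_comb: "(nrm sz (comb J f))\<^sup>2 = (\<Sum>\<beta>\<in>UNIV. (nrm sz (proj (J \<beta> f)))\<^sup>2)"
proof -
 have "(nrm sz (proj g))\<^sup>2 = (\<Sum>x\<in>{x \<in> slice sz. alpha x = z3}. (cmod (g x))\<^sup>2)" for g
  unfolding nrm_sq proj_def by (subst sum.inter_filter) (auto intro!: sum.cong)
 moreover have "(nrm sz (comb J f))\<^sup>2 = (\<Sum>\<beta>\<in>UNIV. \<Sum>x\<in>{x \<in> slice sz. alpha x = z3}. (cmod (J \<beta> f x))\<^sup>2)"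
  unfolding nrm_sq sum_slice_put by (intro sum.cong refl) (simp add: comb_def put_z3)
 ultimately show ?thesis by simp
qed

lemma shiftop_proj: "shiftop A ==> A (proj f) = proj (A f)"
proof -
 assume A: "shiftop A"
 have "alpha (incr (drop m (reg a)) x) = alpha x" if "a < 3" for a m x
 proof -
  have "al b \<notin> set (drop m (reg a))" for b using al_notin_reg[OF that] by (meson in_set_dropD)
  then show ?thesis by (simp add: alpha_def)
 qed
 from shiftop_mask[OF A, of "\<lambda>x. alpha x = z3" f] this show ?thesis
  by (simp add: proj_def[abs_def])
qed

lemma encodable_flip:
 assumes "a < 3" shows "encodable sz 1 1 (\<lambda>f x. f (x(al a := (x (al a) \<noteq> b)))) (\<lambda>f x. f (x(al a := (x (al a) \<noteq> b))))"
proof (cases b)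
 case True
 then show ?thesis using encodable_not[OF al_lt[OF assms]] by simp
next
 case False
 then show ?thesis using encodable_mono[OF encodable_id, of 1 sz] by simp
qed

lemma encodable_proj: "encodable sz 376 1 proj proj"
proof -
 have "encodable sz (2 ^ length [al 0, al 1, al 2] * (14 * length [al 0, al 1, al 2] + 5)) 1
   (\<lambda>f x. cr (if alpha x = z3 then 1 else 0) * f x) (\<lambda>f x. cr (if alpha x = z3 then 1 else 0) * f x)"
  by (rule encodable_diag) (auto simp: alpha_def al_lt)
 then show ?thesis by (rule encodable_eqI) (simp_all add: proj_def)
qed

text \<open>One entry of the column \<open>comb\<close>: bit flips move the selector pattern \<beta>
  to zero, where \<open>proj\<close> tests it.\<close>

lemma encodable_prep: "\<exists>A'. encodable sz 380 1 (\<lambda>f x. if alpha x = \<beta> then f (put z3 x) else 0) A'"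
proof -
 define fl where "fl a x = x(al a := (x (al a) \<noteq> bsel \<beta> a))" for a x
 have e: "encodable sz 1 1 (\<lambda>f x. f (fl a x)) (\<lambda>f x. f (fl a x))" if "a < 3" for a
  unfolding fl_def by (rule encodable_flip[OF that])
 have c: "encodable sz (1 + (1 + (1 + 376))) (1 * (1 * (1 * 1))) (\<lambda>f x. proj f (fl 2 (fl 1 (fl 0 x)))) (\<lambda>f. proj (\<lambda>x. f (fl 0 (fl 1 (fl 2 x)))))"
  by (rule encodable_comp[OF e[of 0] encodable_comp[OF e[of 1] encodable_comp[OF e[of 2] encodable_proj]]]) simp_all
 have "proj f (fl 2 (fl 1 (fl 0 x))) = (if alpha x = \<beta> then f (put z3 x) else 0)" for f x
 proof -
  have a: "alpha (fl 2 (fl 1 (fl 0 x))) = z3 \<longleftrightarrow> alpha x = \<beta>"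
   by (cases \<beta>) (auto simp: alpha_def fl_def bsel_def)
  have "fl 2 (fl 1 (fl 0 x)) = put z3 x" if "alpha x = \<beta>"
   using that by (cases \<beta>) (auto simp: alpha_def fl_def bsel_def put_def fun_eq_iff)
  with a show ?thesis by (simp add: proj_def)
 qed
 then have "encodable sz 380 1 (\<lambda>f x. if alpha x = \<beta> then f (put z3 x) else 0) (\<lambda>f. proj (\<lambda>x. f (fl 0 (fl 1 (fl 2 x)))))"
  by (intro encodable_eqI[OF c]) simp_all
 then show ?thesis by blast
qed

lemma encodable_comb:
 assumes "\<And>\<beta>. \<exists>A'. encodable sz \<kappa> (N \<beta>) (J \<beta>) A'"
 shows "\<exists>A'. encodable sz (8 * (\<kappa> + 400)) (\<Sum>\<beta>\<in>UNIV. N \<beta>) (comb J) A'"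
proof -
 have "\<exists>J'. \<forall>\<beta>. encodable sz \<kappa> (N \<beta>) (J \<beta>) (J' \<beta>)"
  by (rule choice) (use assms in blast)
 then obtain J' where J: "\<And>\<beta>. encodable sz \<kappa> (N \<beta>) (J \<beta>) (J' \<beta>)" by blast
 have "\<exists>Q. \<forall>\<beta>. encodable sz 380 1 (\<lambda>f x. if alpha x = \<beta> then f (put z3 x) else 0) (Q \<beta>)"
  by (rule choice) (use encodable_prep in blast)
 then obtain Q where Q: "\<And>\<beta>. encodable sz 380 1 (\<lambda>f x. if alpha x = \<beta> then f (put z3 x) else 0) (Q \<beta>)" by blast
 have 1: "encodable sz (380 + \<kappa>) (1 * N \<beta>) (\<lambda>f x. if alpha x = \<beta> then J \<beta> f (put z3 x) else 0) (\<lambda>f. J' \<beta> (Q \<beta> f))" for \<beta>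
  by (rule encodable_comp[OF Q J])
 have 2: "encodable sz (card (UNIV :: (bool \<times> bool \<times> bool) set) * (380 + \<kappa> + 2)) (\<Sum>\<beta>\<in>UNIV. 1 * N \<beta>)
   (\<lambda>f x. \<Sum>\<beta>\<in>UNIV. if alpha x = \<beta> then J \<beta> f (put z3 x) else 0) (\<lambda>f x. \<Sum>\<beta>\<in>UNIV. J' \<beta> (Q \<beta> f) x)"
  by (rule encodable_sum[OF _ _ 1]) auto
 have "encodable sz (8 * (\<kappa> + 400)) (\<Sum>\<beta>\<in>UNIV. N \<beta>) (comb J) (\<lambda>f x. \<Sum>\<beta>\<in>UNIV. J' \<beta> (Q \<beta> f) x)"
  by (rule encodable_eqI[OF 2]) (simp_all add: comb_def sum.delta' card_prod)
 then show ?thesis by blast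
qed

section \<open>Averages, differences and box filters\<close>

definition fac :: "nat => bool => linop" where "fac a b = (if b then dif a 0 else avg a 0)"
definition facs :: "nat list => (nat => bool) => linop" where "facs S b = foldr (\<lambda>a. fac a (b a)) S"
definition avgs :: "nat list => nat => linop" where "avgs S m = foldr (\<lambda>a. avg a m) S"

abbreviation "facs3 \<beta> \<equiv> facs [0, 1, 2] (bsel \<beta>)"

text \<open>The mean over a box of side \<open>2 ^ m\<close>: by binary expansion
  \<open>1 + T + \<dots> + T^(2^m - 1)\<close> factors into the \<open>1 + T^(2^j)\<close> with
  \<open>j < m\<close>.\<close>

primrec box :: "nat list => nat => linop" where
 "box S 0 f = f"
| "box S (Suc m) f = box S m (avgs S m f)"

lemma shiftop_fac: "a < 3 ==> shiftop (fac a b)"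
 by (simp add: fac_def shiftop_avg shiftop_dif)

lemma shiftop_foldr: "(\<And>a. a \<in> set S ==> shiftop (h a)) ==> shiftop (foldr h S)"
 by (induction S) (auto simp: id_def comp_def intro: shiftop_id shiftop_comp)

lemma shiftop_facs: "set S \<subseteq> {..<3} ==> shiftop (facs S b)"
 unfolding facs_def by (rule shiftop_foldr) (auto intro: shiftop_fac)

lemma shiftop_avgs: "set S \<subseteq> {..<3} ==> shiftop (avgs S m)"
 unfolding avgs_def by (rule shiftop_foldr) (auto intro: shiftop_avg)

lemma shiftop_box: "set S \<subseteq> {..<3} ==> shiftop (box S m)"
proof (induction m)
 case 0
 have "box S 0 = (\<lambda>f. f)" by auto
 then show ?case by (simp add: shiftop_id)
next
 case (Suc m)
 have "box S (Suc m) = (\<lambda>f. box S m (avgs S m f))" by auto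
 then show ?case using Suc shiftop_comp[OF _ shiftop_avgs] by simp
qed

lemma encodable_foldr:
 assumes "\<And>a. a \<in> set S ==> \<exists>A'. encodable sz \<kappa> 1 (h a) A'"
 shows "\<exists>A'. encodable sz (length S * \<kappa>) 1 (foldr h S) A'"
 using assms
proof (induction S)
 case Nil
 then show ?case using encodable_id by (auto simp: id_def)
next
 case (Cons a S)
 obtain A' B' where "encodable sz \<kappa> 1 (h a) A'" "encodable sz (length S * \<kappa>) 1 (foldr h S) B'"
  using Cons by (metis list.set_intros)
 from encodable_comp[OF this] show ?case by (auto simp: comp_def)
qed

lemma encodable_fac: "a < 3 ==> \<exists>A'. encodable sz (13 * l + 16) 1 (fac a b) A'"
 by (simp add: fac_def encodable_avg encodable_dif)

lemma encodable_facs: "set S \<subseteq> {..<3} ==> \<exists>A'. encodable sz (length S * (13 * l + 16)) 1 (facs S b) A'"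
 unfolding facs_def by (rule encodable_foldr) (auto intro: encodable_fac)

lemma encodable_box:
 assumes "set S \<subseteq> {..<3}" shows "\<exists>A'. encodable sz (m * (length S * (13 * l + 16))) 1 (box S m) A'"
proof (induction m)
 case 0
 have "box S 0 = (\<lambda>f. f)" by auto
 then show ?case using encodable_id by auto
next
 case (Suc m)
 have "\<exists>A'. encodable sz (length S * (13 * l + 16)) 1 (avgs S m) A'"
  unfolding avgs_def by (rule encodable_foldr) (use assms encodable_avg in auto)
 then obtain A' B' where "encodable sz (m * (length S * (13 * l + 16))) 1 (box S m) A'"
  "encodable sz (length S * (13 * l + 16)) 1 (avgs S m) B'" using Suc by blast
 from encodable_comp[OF this] have "encodable sz (Suc m * (length S * (13 * l + 16))) 1 (box S (Suc m)) (\<lambda>f. B' (A' f))"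
  by (rule encodable_eqI) simp_all
 then show ?case by blast
qed

lemma sum_bool3: "(\<Sum>\<beta>\<in>UNIV. g \<beta>) = (\<Sum>p\<in>UNIV. \<Sum>q\<in>UNIV. \<Sum>r\<in>UNIV. g (p :: bool, q :: bool, r :: bool))"
 by (simp add: sum.cartesian_product flip: UNIV_Times_UNIV)

lemma nrm_fac: "a < 3 ==> (nrm sz (fac a True f))\<^sup>2 + (nrm sz (fac a False f))\<^sup>2 = (nrm sz f)\<^sup>2"
 using nrm_avg_dif[of a 0 f] by (simp add: fac_def)

lemma facs_3: "facs3 (p, q, r) f = fac 0 p (fac 1 q (fac 2 r f))"
 by (simp add: facs_def bsel_def)

lemma fac_commute: "a < 3 ==> b < 3 ==> fac a p (fac b q f) = fac b q (fac a p f)"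
 by (intro shiftop_commute shiftop_fac)

lemma sum_nrm_fac2:
 "a < 3 ==> b < 3 ==> (\<Sum>p\<in>UNIV. \<Sum>q\<in>UNIV. (nrm sz (fac a p (fac b q f)))\<^sup>2) = (nrm sz f)\<^sup>2"
 using nrm_fac[of a "fac b True f"] nrm_fac[of a "fac b False f"] nrm_fac[of b f] by (simp add: UNIV_bool)

text \<open>Once direction \<open>a\<close> is differenced, the other two directions split
  isometrically.\<close>

lemma sum_nrm_facs_sel:
 assumes "a < 3"
 shows "(\<Sum>\<beta>\<in>UNIV. if bsel \<beta> a then (nrm sz (facs3 \<beta> f))\<^sup>2 else 0) = (nrm sz (dif a 0 f))\<^sup>2"
proof -
 have t: "fac a True f = dif a 0 f" by (simp add: fac_def)
 consider "a = 0" | "a = 1" | "a = 2" using assms by linarith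
 then show ?thesis
 proof cases
  case 1
  have "fac 0 True (fac 1 q (fac 2 r f)) = fac 1 q (fac 2 r (fac 0 True f))" for q r
   using fac_commute[of 0 1 True q "fac 2 r f"] fac_commute[of 0 2 True r f] by simp
  then show ?thesis
   using sum_nrm_fac2[of 1 2 "fac 0 True f"] t 1 by (simp add: sum_bool3 facs_3[unfolded One_nat_def] bsel_def UNIV_bool)
 next
  case 2
  have "fac 1 True (fac 2 r f) = fac 2 r (fac 1 True f)" for r by (rule fac_commute) simp_all
  then show ?thesis
   using sum_nrm_fac2[of 0 2 "fac 1 True f"] t 2 by (simp add: sum_bool3 facs_3[unfolded One_nat_def] bsel_def UNIV_bool)
 next
  case 3
  then show ?thesis
   using sum_nrm_fac2[of 0 1 "fac 2 True f"] t by (simp add: sum_bool3 facs_3[unfolded One_nat_def] bsel_def UNIV_bool)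
 qed
qed

text \<open>The parallelogram law in each direction: the eight components together form an
  isometry.\<close>

lemma sum_nrm_facs: "(\<Sum>\<beta>\<in>UNIV. (nrm sz (facs3 \<beta> f))\<^sup>2) = (nrm sz f)\<^sup>2"
 using sum_nrm_fac2[of 0 1 "fac 2 True f"] sum_nrm_fac2[of 0 1 "fac 2 False f"] nrm_fac[of 2 f]
 by (simp add: sum_bool3 facs_3[unfolded One_nat_def] UNIV_bool)

definition grad :: "(bool \<times> bool \<times> bool => real) => linop" where
 "grad c = comb (\<lambda>\<beta> f x. cr (c \<beta>) * facs3 \<beta> f x)"

lemma lin_grad: "lin (grad c)"
proof -
 have "lin (facs3 \<beta>)" for \<beta> by (intro lin_shiftop shiftop_facs) auto
 from lin_add[OF this] lin_scale[OF this] show ?thesis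
  by (simp add: lin_def grad_def comb_def fun_eq_iff algebra_simps)
qed

lemma nrm_grad:
 assumes "proj f = f"
 shows "(nrm sz (grad c f))\<^sup>2 = (\<Sum>\<beta>\<in>UNIV. (c \<beta>)\<^sup>2 * (nrm sz (facs3 \<beta> f))\<^sup>2)"
proof -
 have "proj (\<lambda>x. cr (c \<beta>) * facs3 \<beta> f x) = (\<lambda>x. cr (c \<beta>) * facs3 \<beta> f x)" for \<beta>
 proof -
  have "facs3 \<beta> f = proj (facs3 \<beta> f)"
   using shiftop_proj[OF shiftop_facs, of "[0, 1, 2]" "bsel \<beta>" f] assms by simp
  then have "alpha x \<noteq> z3 ==> facs3 \<beta> f x = 0" for x by (metis proj_def)
  then show ?thesis by (auto simp: proj_def)
 qed
 then show ?thesis unfolding grad_def nrm_comb by (simp add: nrm_scale power_mult_distrib)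
qed

text \<open>The square root of the later weight \<open>om\<close>, up to the factor
  \<open>2 ^ l\<close>: differences count fully, the pure average only with the mesh size.\<close>

definition e1 :: "bool \<times> bool \<times> bool => real" where "e1 \<beta> = (if \<beta> = z3 then 1 / 2 ^ l else 1)"

lemma e1_bounds: "0 < e1 \<beta>" "e1 \<beta> \<le> 1" "1 / 2 ^ l \<le> e1 \<beta>"
 by (simp_all add: e1_def)

lemma nrm_dif_grad:
 assumes "proj f = f" "a < 3" shows "nrm sz (dif a 0 f) \<le> nrm sz (grad e1 f)"
proof (rule power2_le_imp_le)
 have "(nrm sz (dif a 0 f))\<^sup>2 \<le> (\<Sum>\<beta>\<in>UNIV. (e1 \<beta>)\<^sup>2 * (nrm sz (facs3 \<beta> f))\<^sup>2)"
  unfolding sum_nrm_facs_sel[OF assms(2), symmetric]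
 proof (rule sum_mono)
  fix \<beta>
  have "e1 \<beta> = 1" if "bsel \<beta> a"
  proof -
   have "\<not> bsel z3 a" by (simp add: bsel_def)
   with that have "\<beta> \<noteq> z3" by metis
   then show ?thesis by (simp add: e1_def)
  qed
  then show "(if bsel \<beta> a then (nrm sz (facs3 \<beta> f))\<^sup>2 else 0) \<le> (e1 \<beta>)\<^sup>2 * (nrm sz (facs3 \<beta> f))\<^sup>2"
   by (cases "bsel \<beta> a") (simp_all only: if_True if_False power_one mult_1 order_refl zero_le_power2 mult_nonneg_nonneg)
 qed
 then show "(nrm sz (dif a 0 f))\<^sup>2 \<le> (nrm sz (grad e1 f))\<^sup>2" by (simp only: nrm_grad[OF assms(1)])
qed (rule nrm_nonneg)

text \<open>Crude, since the pure average carries only the mesh size as its weight; the loss of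
  \<open>2 ^ l\<close> is compensated by the factor \<open>1 / 2 ^ Suc l\<close> of the coarsest
  level in \<open>frame_decomposition\<close>.\<close>

lemma nrm_grad_ge:
 assumes "proj f = f" shows "nrm sz f \<le> 2 ^ l * nrm sz (grad e1 f)"
proof (rule power2_le_imp_le)
 have "(nrm sz f)\<^sup>2 \<le> (\<Sum>\<beta>\<in>UNIV. (2 ^ l)\<^sup>2 * ((e1 \<beta>)\<^sup>2 * (nrm sz (facs3 \<beta> f))\<^sup>2))"
  unfolding sum_nrm_facs[of f, symmetric]
 proof (rule sum_mono)
  fix \<beta>
  have "1 \<le> 2 ^ l * e1 \<beta>" using mult_left_mono[OF e1_bounds(3)[of \<beta>], of "2 ^ l"] by simp
  then have "1 \<le> (2 ^ l * e1 \<beta>)\<^sup>2" by (rule one_le_power)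
  from mult_right_mono[OF this zero_le_power2, of "nrm sz (facs3 \<beta> f)"]
  show "(nrm sz (facs3 \<beta> f))\<^sup>2 \<le> (2 ^ l)\<^sup>2 * ((e1 \<beta>)\<^sup>2 * (nrm sz (facs3 \<beta> f))\<^sup>2)"
   by (simp only: power_mult_distrib mult.assoc mult_1)
 qed
 then show "(nrm sz f)\<^sup>2 \<le> (2 ^ l * nrm sz (grad e1 f))\<^sup>2"
  by (simp only: nrm_grad[OF assms] power_mult_distrib sum_distrib_left)
qed (simp del: power_mult_distrib)

end

section \<open>Stable multilevel splitting\<close>

context grid
begin

lemma avgs_Cons: "avgs (a # S) m f = avg a m (avgs S m f)"
 by (simp add: avgs_def)

lemma nrm_avgs_le: "set S \<subseteq> {..<3} ==> nrm sz (avgs S m f) \<le> nrm sz f"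
proof (induction S)
 case (Cons a S)
 then have "a < 3" "nrm sz (avgs S m f) \<le> nrm sz f" by auto
 then show ?case unfolding avgs_Cons using nrm_avg_le(1)[of a m "avgs S m f"] by linarith
qed (simp add: avgs_def)

text \<open>As \<open>1 - avg\<close> is \<open>dif\<close>, one minus the product of averages
  telescopes into one difference per direction, followed by averages, which are
  contractions.\<close>

lemma nrm_minus_avgs: "set S \<subseteq> {..<3} ==> nrm sz (\<lambda>x. f x - avgs S m f x) \<le> (\<Sum>a\<leftarrow>S. nrm sz (dif a m f))"
proof (induction S)
 case (Cons a S)
 then have a: "a < 3" and S: "set S \<subseteq> {..<3}" by auto
 have comm: "dif a m (avgs S m f) = avgs S m (dif a m f)"
  by (rule shiftop_commute[OF shiftop_dif[OF a] shiftop_avgs[OF S]])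
 have "f x - avgs (a # S) m f x = (f x - avgs S m f x) + dif a m (avgs S m f) x" for x
  unfolding avgs_Cons using avg_plus_dif[of a m "avgs S m f" x] by (simp add: algebra_simps)
 then have "nrm sz (\<lambda>x. f x - avgs (a # S) m f x) \<le> nrm sz (\<lambda>x. f x - avgs S m f x) + nrm sz (dif a m (avgs S m f))"
  by (simp only: nrm_add)
 also have "\<dots> \<le> (\<Sum>a\<leftarrow>S. nrm sz (dif a m f)) + nrm sz (dif a m f)"
  unfolding comm by (intro add_mono Cons.IH[OF S] nrm_avgs_le[OF S])
 finally show ?case by simp
qed (simp add: avgs_def)

lemma set_remove1_lt: "set (remove1 a [0, 1, 2 :: nat]) \<subseteq> {..<3}"
 using set_remove1_subset[of a "[0, 1, 2 :: nat]"] by auto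

lemma avgs_split:
 assumes "a < 3" shows "avgs [0, 1, 2] m f = avgs (remove1 a [0, 1, 2]) m (avg a m f)"
proof -
 have c: "avg i m (avg j m g) = avg j m (avg i m g)" if "i < 3" "j < 3" for i j g
  using that by (intro shiftop_commute shiftop_avg)
 consider "a = 0" | "a = 1" | "a = 2" using assms by linarith
 then show ?thesis
  by cases (use c[of 0 1] c[of 0 2] c[of 1 2] in \<open>simp_all add: avgs_def\<close>)
qed

lemma facs_split:
 assumes "a < 3" "b a" shows "facs [0, 1, 2] b f = facs (remove1 a [0, 1, 2]) b (dif a 0 f)"
proof -
 have c: "fac i p (fac j q g) = fac j q (fac i p g)" if "i < 3" "j < 3" for i j p q g
  using that by (rule fac_commute)
 have d: "dif a 0 f = fac a (b a) f" using assms by (simp add: fac_def)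
 consider "a = 0" | "a = 1" | "a = 2" using assms by linarith
 then show ?thesis unfolding d
  by cases (use c[of 0 1] c[of 0 2] c[of 1 2] in \<open>simp_all add: facs_def\<close>)
qed

text \<open>This is where the box filters pay off: \<open>(1 - T) (1 + T) (1 + T\<^sup>2) \<cdots> = 1 - T\<^bsup>2^m\<^esup>\<close>, so the
 factor \<open>2 ^ m\<close> costs nothing in the normalisation.\<close>

lemma amplify_dif:
 assumes "a < 3" "m \<le> Suc l"
 shows "2 ^ m * dif a 0 (box [0, 1, 2] m f) x = dif a m (box (remove1 a [0, 1, 2]) m f) x"
 using assms(2)
proof (induction m arbitrary: f x)
 case (Suc m)
 let ?r = "remove1 a [0, 1, 2]"
 have r: "set ?r \<subseteq> {..<3}" by (rule set_remove1_lt)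
 have "2 ^ Suc m * dif a 0 (box [0, 1, 2] (Suc m) f) x = 2 * (2 ^ m * dif a 0 (box [0, 1, 2] m (avgs [0, 1, 2] m f)) x)"
  by simp
 also have "\<dots> = 2 * dif a m (box ?r m (avgs [0, 1, 2] m f)) x" using Suc by simp
 also have "avgs [0, 1, 2] m f = avgs ?r m (avg a m f)" by (rule avgs_split[OF assms(1)])
 also have "box ?r m (avgs ?r m (avg a m f)) = avg a m (box ?r (Suc m) f)"
  using shiftop_commute[OF shiftop_box[OF r, of "Suc m"] shiftop_avg[OF assms(1), of m]] by simp
 also have "2 * dif a m (avg a m (box ?r (Suc m) f)) x = dif a (Suc m) (box ?r (Suc m) f) x"
  using Suc.prems by (intro dif_avg_double assms) simp
 finally show ?case .
qed simp

definition frame :: "nat => linop" where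
 "frame m f = (\<lambda>x. 2 ^ m * grad e1 (box [0, 1, 2] m f) x)"

lemma length_remove1_3: "a < 3 ==> length (remove1 a [0, 1, 2 :: nat]) = 2"
 by (auto simp: length_remove1 numeral_3_eq_3 less_Suc_eq)

definition frame_cost :: nat where "frame_cost = 8 * (3 * (l + 2) * (13 * l + 16) + 5 + 400)"

text \<open>The 9 is \<open>7 + 2\<close>: in seven components the factor \<open>2 ^ m\<close> is
  absorbed by a difference, which leaves norm one; in the pure average it meets the weight
  \<open>1 / 2 ^ l\<close> and leaves at most two.\<close>

lemma encodable_frame:
 assumes m: "m \<le> Suc l" shows "\<exists>A'. encodable sz frame_cost 9 (frame m) A'"
proof -
 let ?c = "13 * l + 16"
 define J where "J \<beta> f x = cr (2 ^ m * e1 \<beta>) * facs3 \<beta> (box [0, 1, 2] m f) x" for \<beta> f x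
 have cost: "k * ?c + m * (k * ?c) \<le> k * (l + 2) * ?c" for k
  using mult_right_mono[of "1 + m" "l + 2" "k * ?c"] m by (simp add: algebra_simps)
 have 1: "\<exists>A'. encodable sz (3 * (l + 2) * ?c + 5) (if \<beta> = z3 then 2 else 1) (J \<beta>) A'" for \<beta>
 proof (cases "\<beta> = z3")
  case True
  obtain A' where A: "encodable sz (3 * ?c) 1 (facs3 \<beta>) A'"
   using encodable_facs[of "[0, 1, 2]"] by auto
  obtain B' where B: "encodable sz (m * (3 * ?c)) 1 (box [0, 1, 2] m) B'"
   using encodable_box[of "[0, 1, 2]" m] by auto
  have p: "0 < 2 ^ m * e1 \<beta>" using e1_bounds(1)[of \<beta>] by simp
  have le: "2 ^ m * e1 \<beta> * (1 * 1) \<le> 2"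
  proof -
   have "(2 :: real) ^ m \<le> 2 ^ Suc l" using m by (intro power_increasing) auto
   then show ?thesis using True by (simp add: e1_def field_simps)
  qed
  have "encodable sz (3 * (l + 2) * ?c + 5) 2 (J \<beta>) (\<lambda>f x. cr (2 ^ m * e1 \<beta>) * B' (A' f) x)"
   by (rule encodable_eqI[OF encodable_weaken[OF encodable_scale[OF encodable_comp[OF A B] p] le]])
    (use cost[of 3] in \<open>linarith | simp only: J_def\<close>)+
  then show ?thesis using True by auto
 next
  case False
  then obtain a where a: "a < 3" "bsel \<beta> a"
   by (cases \<beta>) (auto simp: bsel_def split: if_splits intro: that[of 0] that[of 1] that[of 2])
  let ?r = "remove1 a [0, 1, 2]"
  have r: "set ?r \<subseteq> {..<3}" "length ?r = 2" using a by (simp_all add: set_remove1_lt length_remove1_3)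
  obtain A' where A: "encodable sz (2 * ?c) 1 (facs ?r (bsel \<beta>)) A'"
   using encodable_facs[OF r(1), of "bsel \<beta>"] unfolding r(2) by blast
  obtain D' where D: "encodable sz ?c 1 (dif a m) D'" using encodable_dif[OF a(1)] by blast
  obtain B' where B: "encodable sz (m * (2 * ?c)) 1 (box ?r m) B'"
   using encodable_box[OF r(1), of m] unfolding r(2) by blast
  have eq: "facs ?r (bsel \<beta>) (dif a m (box ?r m f)) x = J \<beta> f x" for f x
  proof -
   have "J \<beta> f x = 2 ^ m * facs3 \<beta> (box [0, 1, 2] m f) x"
    using False by (simp add: J_def e1_def)
   also have "\<dots> = 2 ^ m * facs ?r (bsel \<beta>) (dif a 0 (box [0, 1, 2] m f)) x"
    by (simp only: facs_split[where b = "bsel \<beta>", OF a])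
   also have "\<dots> = facs ?r (bsel \<beta>) (\<lambda>x. 2 ^ m * dif a 0 (box [0, 1, 2] m f) x) x"
    by (simp only: lin_scale[OF lin_shiftop[OF shiftop_facs[OF r(1)]]])
   finally show ?thesis by (simp only: amplify_dif[OF a(1) m])
  qed
  have "encodable sz (3 * (l + 2) * ?c + 5) 1 (J \<beta>) (\<lambda>f. B' (D' (A' f)))"
  proof (rule encodable_eqI[OF encodable_comp[OF A encodable_comp[OF D B]]])
   show "2 * ?c + (?c + m * (2 * ?c)) \<le> 3 * (l + 2) * ?c + 5"
    using cost[of 2] by (simp add: algebra_simps)
  qed (simp, rule eq, simp)
  then show ?thesis using False by auto
 qed
 have N: "(\<Sum>\<beta>\<in>UNIV. if \<beta> = z3 then 2 else (1 :: real)) = 9"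
  by (simp add: sum_bool3 UNIV_bool)
 have "comb J f x = frame m f x" for f x
  by (simp add: comb_def J_def frame_def grad_def)
 then have "comb J = frame m" by (simp add: fun_eq_iff)
 moreover have "\<exists>A'. encodable sz frame_cost (\<Sum>\<beta>\<in>UNIV. if \<beta> = z3 then 2 else 1) (comb J) A'"
  unfolding frame_cost_def by (rule encodable_comb[OF 1])
 ultimately show ?thesis unfolding N by simp
qed

lemma nrm_pow2: "nrm s (\<lambda>x. (1 / 2 ^ m) * f x) = nrm s f / 2 ^ m"
 unfolding nrm_scale by (simp add: norm_divide norm_power)

lemma lin_box3: "lin (box [0, 1, 2] m)"
 by (intro lin_shiftop shiftop_box) auto

lemma frame_pow2: "frame m (\<lambda>x. (1 / 2 ^ m) * g x) = grad e1 (box [0, 1, 2] m g)"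
 unfolding frame_def lin_scale[OF lin_box3] lin_scale[OF lin_grad] by simp

text \<open>Successive box means telescope, and \<open>w m\<close> is the scaled increment at level
  \<open>m\<close>. By \<open>nrm_minus_avgs\<close> it costs one difference at distance
  \<open>2 ^ m\<close> per direction, each at most \<open>2 ^ m\<close> times the finest one; the 3
  counts the directions. The coarsest term is controlled by \<open>nrm_grad_ge\<close>.\<close>

lemma frame_decomposition:
 assumes f: "proj f = f"
 obtains w where "\<And>m. m \<le> Suc l ==> nrm sz (w m) \<le> 3 * nrm sz (grad e1 f)"
  "grad e1 f = (\<lambda>x. \<Sum>m\<le>Suc l. frame m (w m) x)"
proof -
 let ?D = "[0, 1, 2]"
 define w where "w m = (if m \<le> l then (\<lambda>x. (1 / 2 ^ m) * (f x - avgs ?D m f x)) else (\<lambda>x. (1 / 2 ^ m) * f x))" for m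
 have "nrm sz (w m) \<le> 3 * nrm sz (grad e1 f)" if "m \<le> Suc l" for m
 proof (cases "m \<le> l")
  case True
  have "nrm sz (\<lambda>x. f x - avgs ?D m f x) \<le> (\<Sum>a\<leftarrow>?D. nrm sz (dif a m f))"
   by (rule nrm_minus_avgs) auto
  also have "\<dots> \<le> 2 ^ m * (3 * nrm sz (grad e1 f))"
  proof -
   have "nrm sz (dif a m f) \<le> 2 ^ m * nrm sz (grad e1 f)" if a: "a < 3" for a
    using nrm_dif_double[OF a \<open>m \<le> Suc l\<close>] nrm_dif_grad[OF f a] mult_left_mono[of "nrm sz (dif a 0 f)" _ "2 ^ m"]
    by (meson order_trans zero_le_numeral zero_le_power)
   from this[of 0] this[of 1] this[of 2] show ?thesis by simp
  qed
  finally have "nrm sz (\<lambda>x. f x - avgs ?D m f x) \<le> 2 ^ m * (3 * nrm sz (grad e1 f))" .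
  then have "nrm sz (\<lambda>x. f x - avgs ?D m f x) / 2 ^ m \<le> 3 * nrm sz (grad e1 f)"
   by (simp only: pos_divide_le_eq zero_less_power zero_less_numeral mult.commute)
  moreover have "nrm sz (w m) = nrm sz (\<lambda>x. f x - avgs ?D m f x) / 2 ^ m"
   using True by (simp only: w_def if_True nrm_pow2)
  ultimately show ?thesis by simp
 next
  case False
  then have m: "m = Suc l" using that by simp
  have "nrm sz f / 2 ^ Suc l \<le> 2 ^ l * nrm sz (grad e1 f) / 2 ^ Suc l"
   using nrm_grad_ge[OF f] by (rule divide_right_mono) simp
  also have "\<dots> \<le> 3 * nrm sz (grad e1 f)" by (simp add: field_simps)
  finally show ?thesis using False m by (simp only: w_def if_False nrm_pow2)
 qed
 moreover have "grad e1 f = (\<lambda>x. \<Sum>m\<le>Suc l. frame m (w m) x)"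
 proof
  fix x
  define L where "L m = grad e1 (box ?D m f) x" for m
  have top: "frame (Suc l) (w (Suc l)) x = L (Suc l)"
  proof -
   have "w (Suc l) = (\<lambda>x. (1 / 2 ^ Suc l) * f x)" by (simp add: w_def)
   then show ?thesis unfolding L_def by (simp only: frame_pow2)
  qed
  have low: "frame m (w m) x = L m - L (Suc m)" if m: "m \<le> l" for m
  proof -
   have "w m = (\<lambda>x. (1 / 2 ^ m) * (f x - avgs ?D m f x))" using m by (simp only: w_def if_True)
   then show ?thesis unfolding L_def box.simps
    by (simp only: frame_pow2 lin_diff[OF lin_box3] lin_diff[OF lin_grad])
  qed
  have "(\<Sum>m\<le>Suc l. frame m (w m) x) = (\<Sum>m\<le>l. L m - L (Suc m)) + L (Suc l)"
   unfolding sum.atMost_Suc top by (simp add: low)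
  also have "\<dots> = L 0" by (simp add: sum_telescope)
  finally show "grad e1 f x = (\<Sum>m\<le>Suc l. frame m (w m) x)" by (simp add: L_def)
 qed
 ultimately show ?thesis using that by blast
qed

end

subsection \<open>The preconditioned solver\<close>

text \<open>Polarisation; replacing \<open>g\<close> by \<open>\<i> * g\<close> yields the imaginary
  part.\<close>

lemma ip_eq_of_nrm_eq:
 assumes "lin A" "lin P" and n: "\<And>f. nrm s (A f) = nrm s (P f)"
 shows "ip s (A f) (A g) = ip s (P f) (P g)"
proof -
 have re: "Re (ip s (A f) (A g)) = Re (ip s (P f) (P g))" for f g
  using nrm_diff_sq[of s "A f" "A g"] nrm_diff_sq[of s "P f" "P g"] n
  by (simp flip: lin_diff[OF assms(1)] lin_diff[OF assms(2)])
 have "Re (\<i> * ip s (A f) (A g)) = Re (\<i> * ip s (P f) (P g))"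
  using re[of f "\<lambda>x. \<i> * g x"] by (simp only: lin_scale[OF assms(1)] lin_scale[OF assms(2)] ip_scale_right)
 with re[of f g] show ?thesis by (simp add: complex_eq_iff)
qed

context grid
begin

text \<open>Chosen, since the encoding lemmas assert only that some adjoint exists.\<close>

definition frame' :: "nat => linop" where
 "frame' m = (SOME A'. encodable sz frame_cost 9 (frame m) A')"

lemma encodable_frame': "m \<le> Suc l ==> encodable sz frame_cost 9 (frame m) (frame' m)"
 unfolding frame'_def using someI_ex[OF encodable_frame] by blast

definition defl :: linop where "defl = deflate {..Suc l} frame frame' 9"

text \<open>The form \<open>1 - A' A\<close> with the self-adjoint \<open>A = defl ^^ d\<close>,
  hence of normalisation one. The powers of \<open>defl\<close> nearly annihilate the range of
  \<open>grad e1\<close> and fix its orthogonal complement.\<close>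

definition range_proj :: "nat => linop" where
 "range_proj d f = (\<lambda>x. f x - (defl ^^ d) ((defl ^^ d) f) x)"

text \<open>\<open>729 = 3\<^sup>2 * 9\<^sup>2\<close>, from the constant of the splitting and the
  normalisation of the frame. One factor \<open>l + 2\<close> comes from Cauchy-Schwarz over the
  levels, the other from averaging over them.\<close>

definition gap :: real where "gap = 1 / (729 * (real l + 2)\<^sup>2)"

lemma gap_bounds: "0 < gap" "gap \<le> 1"
proof -
 have "1 \<le> (real l + 2)\<^sup>2" by (intro one_le_power) simp
 then have "1 \<le> 729 * (real l + 2)\<^sup>2" by linarith
 then show "0 < gap" "gap \<le> 1" unfolding gap_def by simp_all
qed

lemma oper_frame: "m \<in> {..Suc l} ==> oper sz 9 (frame m) (frame' m)"
 using encodable_oper[OF encodable_frame'] by simp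

lemma encodable_defl: "encodable sz ((l + 2) * (16 * frame_cost + 5)) 1 defl defl"
 using encodable_deflate[of "{..Suc l}" sz frame_cost 9 frame frame'] encodable_frame' unfolding defl_def by simp

lemma encodable_range_proj:
 "encodable sz (16 * (d * ((l + 2) * (16 * frame_cost + 5))) + 3) 1 (range_proj d) (range_proj d)"
 using encodable_complement[OF encodable_funpow[OF encodable_defl, of d]] by (simp add: range_proj_def[abs_def])

lemma lin_comb_grad: "grad c (\<lambda>x. f x - a * g x) = (\<lambda>x. grad c f x - a * grad c g x)"
 by (simp only: lin_diff[OF lin_grad] lin_scale[OF lin_grad])

lemma grad_proj: "grad c (proj f) = grad c f"
proof -
 have "facs3 \<beta> (proj f) = proj (facs3 \<beta> f)" for \<beta>
  by (rule shiftop_proj[OF shiftop_facs]) auto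
 then show ?thesis by (simp add: grad_def comb_def fun_eq_iff proj_def)
qed

lemma proj_proj: "proj (proj f) = proj f"
 by (simp add: proj_def fun_eq_iff)

text \<open>Duality: pairing \<open>y\<close> with its own stable splitting bounds
  \<open>nrm sz y\<close> by three times the sum of the \<open>nrm sz (frame' m y)\<close>.\<close>

lemma frame_bound:
 assumes "y \<in> range (grad e1)"
 shows "gap * (nrm sz y)\<^sup>2 \<le> (\<Sum>m\<in>{..Suc l}. (nrm sz (frame' m y))\<^sup>2) / (9\<^sup>2 * real (card {..Suc l}))"
proof -
 obtain f where y: "y = grad e1 (proj f)" using assms by (auto simp: grad_proj)
 obtain w where w: "\<And>m. m \<le> Suc l ==> nrm sz (w m) \<le> 3 * nrm sz y" and eq: "y = (\<lambda>x. \<Sum>m\<le>Suc l. frame m (w m) x)"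
  using frame_decomposition[OF proj_proj, of f] unfolding y by metis
 define t where "t = (\<Sum>m\<le>Suc l. nrm sz (frame' m y))"
 have "cr ((nrm sz y)\<^sup>2) = ip sz y y" by (rule ip_self[symmetric])
 also have "\<dots> = (\<Sum>m\<le>Suc l. ip sz y (frame m (w m)))"
  using ip_sum_right[of sz y "\<lambda>m. frame m (w m)" "{..Suc l}"] unfolding eq[symmetric] .
 also have "\<dots> = (\<Sum>m\<le>Suc l. ip sz (frame' m y) (w m))"
  by (intro sum.cong refl oper_ip'[OF oper_frame, symmetric])
 finally have "(nrm sz y)\<^sup>2 = cmod (\<Sum>m\<le>Suc l. ip sz (frame' m y) (w m))"
  by (metis abs_of_nonneg norm_of_real zero_le_power2)
 also have "\<dots> \<le> (\<Sum>m\<le>Suc l. nrm sz (frame' m y) * (3 * nrm sz y))"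
  by (intro order_trans[OF norm_sum] sum_mono order_trans[OF cmod_ip] mult_left_mono w) auto
 also have "\<dots> = t * (3 * nrm sz y)" by (simp only: t_def sum_distrib_right)
 finally have "nrm sz y * nrm sz y \<le> (3 * t) * nrm sz y" by (simp add: power2_eq_square mult_ac)
 moreover have "0 \<le> t" unfolding t_def by (intro sum_nonneg) simp
 ultimately have "nrm sz y \<le> 3 * t" using nrm_nonneg[of sz y] by (cases "nrm sz y = 0") (auto simp: mult_le_cancel_right)
 then have "(nrm sz y)\<^sup>2 \<le> (3 * t)\<^sup>2" by (rule power_mono) simp
 also have "\<dots> \<le> 9 * ((\<Sum>m\<le>Suc l. (nrm sz (frame' m y))\<^sup>2) * (real l + 2))"
  using sum_squared_le_sum_of_squares[of "\<lambda>m. nrm sz (frame' m y)" "{..Suc l}"] unfolding t_def power_mult_distrib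
  by (simp add: add.commute)
 finally have *: "(nrm sz y)\<^sup>2 \<le> 9 * ((\<Sum>m\<le>Suc l. (nrm sz (frame' m y))\<^sup>2) * (real l + 2))" .
 have arith: "1 / (729 * k\<^sup>2) * n \<le> u / (9\<^sup>2 * k)" if "n \<le> 9 * (u * k)" "0 < k" for n u k :: real
  using that by (simp add: divide_simps power2_eq_square)
 show ?thesis using arith[OF *] unfolding gap_def card_atMost by (simp add: add.commute del: sum.atMost_Suc)
qed

lemma defl_range: "y \<in> range (grad e1) ==> defl y \<in> range (grad e1)"
proof -
 assume "y \<in> range (grad e1)"
 then obtain f where y: "y = grad e1 f" by blast
 define g where "g = (\<lambda>x. \<Sum>m\<in>{..Suc l}. 2 ^ m * box [0, 1, 2] m (frame' m y) x)"
 have "grad e1 g = (\<lambda>x. \<Sum>m\<in>{..Suc l}. frame m (frame' m y) x)"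
  unfolding g_def frame_def lin_sum[OF lin_grad finite_atMost] lin_scale[OF lin_grad] ..
 then have "defl y = grad e1 (\<lambda>x. f x - inverse (cr (9\<^sup>2 * real (card {..Suc l}))) * g x)"
  unfolding lin_comb_grad by (simp only: defl_def deflate_def[abs_def] y divide_inverse mult.commute)
 then show ?thesis by blast
qed

text \<open>The defect is the \<open>2 * d\<close>-fold deflation, and each step shrinks the norm at
  least by \<open>sqrt (1 - gap)\<close>.\<close>

lemma range_proj_range:
 assumes "y \<in> range (grad e1)" shows "nrm sz (\<lambda>x. y x - range_proj d y x) \<le> (1 - gap) ^ d * nrm sz y"
proof -
 have "(nrm sz ((defl ^^ (2 * d)) y))\<^sup>2 \<le> (1 - gap) ^ (2 * d) * (nrm sz y)\<^sup>2"
  unfolding defl_def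
  by (rule conjunct2[OF deflate_power_contracts[OF finite_atMost _ oper_frame _ gap_bounds(2) defl_range[unfolded defl_def] frame_bound assms]])
   auto
 also have "\<dots> = ((1 - gap) ^ d * nrm sz y)\<^sup>2" by (simp only: power_mult_distrib power_even_eq)
 finally have "nrm sz ((defl ^^ (2 * d)) y) \<le> (1 - gap) ^ d * nrm sz y"
  by (rule power2_le_imp_le) (use gap_bounds in simp)
 moreover have "(\<lambda>x. y x - range_proj d y x) = (defl ^^ (2 * d)) y"
  by (simp add: range_proj_def mult_2 funpow_add)
 ultimately show ?thesis by simp
qed

lemma oper_defl: "oper sz 1 defl defl"
 by (rule encodable_oper[OF encodable_defl])

text \<open>Orthogonality makes every \<open>frame' m q\<close> vanish, so deflation fixes
  \<open>q\<close> and the complement of its power kills it. All this holds in norm only, since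
  nothing is known off \<open>slice sz\<close>.\<close>

lemma range_proj_orthogonal:
 assumes "\<And>f. ip sz (grad e1 f) q = 0" shows "nrm sz (range_proj d q) = 0"
proof -
 have fr: "nrm sz (frame' m q) = 0" if "m \<in> {..Suc l}" for m
 proof -
  have "ip sz (frame' m q) (frame' m q) = ip sz (frame m (frame' m q)) q"
   by (rule operD(4)[OF oper_frame[OF that], symmetric])
  also have "\<dots> = 0" unfolding frame_def ip_scale_left assms by simp
  finally show ?thesis unfolding ip_self by simp
 qed
 have d0: "nrm sz (\<lambda>x. defl q x - q x) = 0"
 proof -
  have "nrm sz (\<lambda>x. \<Sum>m\<in>{..Suc l}. frame m (frame' m q) x) \<le> (\<Sum>m\<in>{..Suc l}. nrm sz (frame m (frame' m q)))"
   by (rule nrm_sum) simp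
  also have "\<dots> \<le> (\<Sum>m\<in>{..Suc l}. 0)"
  proof (rule sum_mono)
   fix m assume m: "m \<in> {..Suc l}"
   show "nrm sz (frame m (frame' m q)) \<le> 0" using operD(3)[OF oper_frame[OF m], of "frame' m q"] fr[OF m] by simp
  qed
  finally have z: "nrm sz (\<lambda>x. \<Sum>m\<in>{..Suc l}. frame m (frame' m q) x) = 0" using nrm_nonneg by (simp add: order_antisym)
  have "(\<lambda>x. defl q x - q x) = (\<lambda>x. (- inverse (cr (9\<^sup>2 * real (card {..Suc l})))) * (\<Sum>m\<in>{..Suc l}. frame m (frame' m q) x))"
   by (simp add: defl_def deflate_def divide_inverse mult.commute del: sum.atMost_Suc)
  then show ?thesis by (simp only: nrm_scale z mult_zero_right)
 qed
 have "nrm sz (\<lambda>x. (defl ^^ k) q x - q x) = 0" for k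
 proof (induction k)
  case (Suc k)
  have "(\<lambda>x. (defl ^^ Suc k) q x - q x) = (\<lambda>x. defl (\<lambda>x. (defl ^^ k) q x - q x) x + (defl q x - q x))"
   by (simp add: lin_diff[OF operD(1)[OF oper_defl]])
  then have "nrm sz (\<lambda>x. (defl ^^ Suc k) q x - q x) \<le> nrm sz (defl (\<lambda>x. (defl ^^ k) q x - q x)) + nrm sz (\<lambda>x. defl q x - q x)"
   by (simp only: nrm_add)
  also have "\<dots> \<le> 1 * nrm sz (\<lambda>x. (defl ^^ k) q x - q x) + 0" by (intro add_mono operD(3)[OF oper_defl]) (simp add: d0)
  finally show ?case using Suc nrm_nonneg[of sz "\<lambda>x. (defl ^^ Suc k) q x - q x"] by (metis add_0_right mult_1 order_antisym)
 qed simp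
 from this[of "2 * d"] have "nrm sz (\<lambda>x. - ((defl ^^ (2 * d)) q x - q x)) = 0" by (simp only: nrm_minus)
 then show ?thesis by (simp add: range_proj_def mult_2 funpow_add)
qed

end

lemma nrm_triangle0: "nrm s g = 0 ==> nrm s (\<lambda>x. f x + g x) \<le> nrm s f"
 using nrm_add[of s f g] by simp

context grid
begin

abbreviation "igrad \<equiv> grad (\<lambda>_. 1)"

definition igrad_cost :: nat where "igrad_cost = 8 * (3 * (13 * l + 16) + 400)"

lemma encodable_igrad: "\<exists>A'. encodable sz igrad_cost 8 igrad A'"
proof -
 have "\<exists>A'. encodable sz (3 * (13 * l + 16)) 1 (\<lambda>f x. cr 1 * facs3 \<beta> f x) A'" for \<beta>
  using encodable_facs[of "[0, 1, 2]" "bsel \<beta>"] by (simp add: lessThan_def)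
 from encodable_comb[OF this] show ?thesis by (simp add: igrad_cost_def grad_def card_UNIV_bool)
qed

lemma grad_igrad: "grad c f = (\<lambda>x. cr (c (alpha x)) * igrad f x)"
 by (simp add: grad_def comb_def fun_eq_iff)

lemma nrm_igrad: "nrm sz (igrad f) = nrm sz (proj f)"
 using nrm_grad[OF proj_proj, of "\<lambda>_. 1" f] sum_nrm_facs[of "proj f"]
 by (simp add: grad_proj)

lemma lin_proj: "lin proj"
 by (simp add: lin_def proj_def fun_eq_iff)

lemma ip_igrad: "ip sz (igrad f) (igrad g) = ip sz (proj f) (proj g)"
 by (rule ip_eq_of_nrm_eq[OF lin_grad lin_proj nrm_igrad])

lemma ip_proj: "ip sz (proj f) g = ip sz f (proj g)"
 unfolding ip_def proj_def by (intro sum.cong) auto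

text \<open>The inverse square of the mesh size where a derivative acts. Once it is split off, the
  remaining coefficient is bounded from both sides independently of \<open>l\<close>.\<close>

definition om :: "bool \<times> bool \<times> bool => real" where "om \<beta> = (if \<beta> = z3 then 1 else 4 ^ l)"
text \<open>The mesh size divided by \<open>e1\<close>; it undoes that scaling of the range.\<close>

definition e0 :: "bool \<times> bool \<times> bool => real" where "e0 \<beta> = (if \<beta> = z3 then 1 else 1 / 2 ^ l)"

lemma four_pow: "(4::real) ^ l = 2 ^ l * 2 ^ l"
 by (simp flip: power_mult_distrib)

lemma weights: "e0 \<beta> * e1 \<beta> = 1 / 2 ^ l" "2 ^ l * e1 \<beta> * e1 \<beta> = om \<beta> / 2 ^ l" "\<bar>e0 \<beta>\<bar> \<le> 1"
 by (auto simp: e0_def e1_def om_def four_pow)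

lemma encodable_e0: "encodable sz 376 1 (\<lambda>f x. cr (e0 (alpha x)) * f x) (\<lambda>f x. cr (e0 (alpha x)) * f x)"
 using encodable_diag[of "\<lambda>x. e0 (alpha x)" 1 "[al 0, al 1, al 2]" sz] weights(3) al_lt by (simp add: alpha_def)

definition solver_cost :: "nat => nat => nat => nat" where
 "solver_cost d K n = (let S = 16 * (d * ((l + 2) * (16 * frame_cost + 5))) + 3
   in 2 * igrad_cost + 757 + K * (S + 2 ^ n * (14 * n + 5) + 2) + S)"

text \<open>Write \<open>G\<close> for \<open>igrad\<close>, an isometry at selector zero, and put
  \<open>z = 2 ^ l * e1 G v\<close> and \<open>r = e0 G g\<close>. The equation says that
  \<open>W z - r\<close> is orthogonal to the range of \<open>e1 G\<close>. Projecting by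
  \<open>S\<close> gives the fixed point equation
  \<open>z = S (1 - W / wmax) z + S r / wmax\<close>, whose contraction factor
  \<open>1 - wmin / wmax\<close> does not involve the mesh. Then \<open>e0 z = G v\<close>, and the
  adjoint of \<open>G\<close> returns \<open>v\<close>.\<close>

theorem solver:
 fixes W :: "bits => real"
 assumes W: "\<And>x. wmin \<le> W x" "\<And>x. W x \<le> wmax" "0 < wmin" "wmin < wmax"
  and dep: "\<And>x y. (\<forall>w\<in>set vs. x w = y w) ==> W x = W y" "distinct vs" "set vs \<subseteq> {..<sz}"
 shows "\<exists>B B'. encodable sz (solver_cost d K (length vs)) (64 / wmin) B B' \<and>
  (\<forall>v g. proj v = v \<longrightarrow> proj g = g \<longrightarrow>
   (\<forall>f. ip sz (igrad f) (\<lambda>x. cr (W x * om (alpha x)) * igrad v x) = ip sz f g) \<longrightarrow>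
   nrm sz (\<lambda>x. v x - B g x) \<le> 8 * ((1 - wmin / wmax) ^ Suc K + (1 - gap) ^ d * wmax / wmin) * nrm sz g / wmin)"
proof -
 obtain G' where G: "encodable sz igrad_cost 8 igrad G'" using encodable_igrad by blast
 note oG = encodable_oper[OF G]
 define S :: linop where "S = range_proj d"
 define sS where "sS = 16 * (d * ((l + 2) * (16 * frame_cost + 5))) + 3"
 have S: "encodable sz sS 1 S S"
  unfolding S_def sS_def by (rule encodable_range_proj)
 note oS = encodable_oper[OF S]
 define \<rho> where "\<rho> = 1 - wmin / wmax"
 have \<rho>: "0 < \<rho>" "\<rho> < 1" "1 - \<rho> = wmin / wmax" using W(3,4) by (auto simp: \<rho>_def field_simps)
 have wmax: "0 < wmax" using W(3,4) by simp
 define D where "D = (\<lambda>(f::state) x. cr (1 - W x / wmax) * f x)"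
 have Dn: "\<bar>1 - W x / wmax\<bar> \<le> \<rho>" for x
  using W(1,2)[of x] W(3) wmax by (simp add: \<rho>_def abs_le_iff field_simps)
 have D: "encodable sz (2 ^ length vs * (14 * length vs + 5)) \<rho> D D"
  unfolding D_def
 proof (rule encodable_diag[OF Dn _ \<rho>(1) dep(2,3)])
  fix x y :: bits assume "\<forall>w\<in>set vs. x w = y w"
  from dep(1)[OF this] show "1 - W x / wmax = 1 - W y / wmax" by simp
 qed
 define Y :: linop where "Y = (\<lambda>f. S (D f))"
 define E where "E = (\<lambda>(f::state) x. cr (e0 (alpha x)) * f x)"
 have E: "encodable sz 376 1 E E" unfolding E_def by (rule encodable_e0)
 note oE = encodable_oper[OF E]
 have Y: "encodable sz (sS + 2 ^ length vs * (14 * length vs + 5)) \<rho> Y (\<lambda>f. D (S f))"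
  unfolding Y_def using encodable_comp[OF S D] by simp
 note oY = encodable_oper[OF Y]
 define c where "c = sS + 2 ^ length vs * (14 * length vs + 5)"
 define Q :: linop where "Q = (\<lambda>f x. \<Sum>k\<le>K. (Y ^^ k) f x)"
 have "\<exists>Q'. encodable sz (K * (c + 2) + 5) (wmax / wmin) Q Q'"
 proof -
  \<comment> \<open>Scaled to norm one, \<open>Y\<close> can enter \<open>encodable_poly\<close>;
    the powers of \<rho> move into the coefficients, whose sum is the normalisation.\<close>
  define Z :: linop where "Z = (\<lambda>f x. cr (1 / \<rho>) * Y f x)"
  have Z: "\<exists>Z'. encodable sz c 1 Z Z'"
   using encodable_scale[OF Y, of "1 / \<rho>"] \<rho> unfolding Z_def c_def by auto
  then obtain Z' where Z: "encodable sz c 1 Z Z'" by blast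
  have "Z ^^ k = (\<lambda>f x. cr ((1 / \<rho>) ^ k) * (Y ^^ k) f x)" for k
  proof (induction k)
   case (Suc k)
   have "(Z ^^ Suc k) f = Z (\<lambda>x. cr ((1 / \<rho>) ^ k) * (Y ^^ k) f x)" for f using Suc by simp
   also have "\<dots> f = (\<lambda>x. cr ((1 / \<rho>) ^ Suc k) * (Y ^^ Suc k) f x)" for f
    unfolding Z_def lin_scale[OF encodable_lin[OF Y]] by (simp add: mult_ac)
   finally show ?case by (rule ext)
  qed simp
  then have "(\<Sum>k\<le>K. cr (\<rho> ^ k) * (Z ^^ k) f x) = Q f x" for f x
   unfolding Q_def using \<rho> by (intro sum.cong) (simp_all add: power_one_over)
  then have "encodable sz (K * (c + 2)) (\<Sum>k\<le>K. \<rho> ^ k) Q (\<lambda>f x. \<Sum>k\<le>K. cr (\<rho> ^ k) * (Z' ^^ k) f x)"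
   using encodable_poly[OF Z, of K "\<lambda>k. \<rho> ^ k"] \<rho> by simp
  moreover have "(\<Sum>k\<le>K. \<rho> ^ k) \<le> wmax / wmin"
  proof -
   have "(\<Sum>k\<le>K. \<rho> ^ k) = (1 - \<rho> ^ Suc K) / (1 - \<rho>)" using sum_gp0[of \<rho> K] \<rho> by simp
   also have "\<dots> \<le> 1 / (1 - \<rho>)" using \<rho> by (intro divide_right_mono) auto
   finally show ?thesis using \<rho>(3) by simp
  qed
  ultimately show ?thesis by (blast intro: encodable_weaken)
 qed
 then obtain Q' where Q: "encodable sz (K * (c + 2) + 5) (wmax / wmin) Q Q'" by blast
 define T :: linop where "T = (\<lambda>f x. cr (1 / wmax) * S f x)"
 have T: "encodable sz sS (1 / wmax * 1) T T"
  unfolding T_def by (rule encodable_scale[OF S]) (use wmax in simp)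
 define B :: linop where "B = (\<lambda>f. G' (E (Q (T (E (igrad f))))))"
 \<comment> \<open>64 collects the two factors 8 of \<open>igrad\<close>; \<open>wmax\<close>
   cancels between the series \<open>Q\<close> and \<open>T\<close>.\<close>
 have "\<exists>B'. encodable sz (2 * igrad_cost + 757 + K * (c + 2) + sS) (64 / wmin) B B'"
  unfolding B_def
  by (rule exI, rule encodable_eqI[OF encodable_comp[OF encodable_adj[OF G] encodable_comp[OF E
   encodable_comp[OF Q encodable_comp[OF T encodable_comp[OF E G]]]]] _ _ refl refl])
   (use wmax in simp_all)
 then have "\<exists>B'. encodable sz (solver_cost d K (length vs)) (64 / wmin) B B'"
  by (simp only: solver_cost_def sS_def c_def Let_def add.assoc)
 moreover have "nrm sz (\<lambda>x. v x - B g x) \<le> 8 * ((1 - wmin / wmax) ^ Suc K + (1 - gap) ^ d * wmax / wmin) * nrm sz g / wmin"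
  if v: "proj v = v" and g: "proj g = g"
   and weak: "\<And>f. ip sz (igrad f) (\<lambda>x. cr (W x * om (alpha x)) * igrad v x) = ip sz f g" for v g
 proof -
  define z where "z = (\<lambda>x. cr (2 ^ l * e1 (alpha x)) * igrad v x)"
  define r where "r = E (igrad g)"
  define Wz where "Wz = (\<lambda>x. cr (W x) * z x)"
  have zr: "z \<in> range (grad e1)"
  proof
   show "z = grad e1 (\<lambda>x. 2 ^ l * v x)"
    unfolding lin_scale[OF lin_grad] grad_igrad[of e1] z_def by (simp add: mult_ac)
  qed simp
  have w: "ip sz (grad e1 f) Wz = ip sz f g / 2 ^ l" for f
  proof -
   have "ip sz (grad e1 f) Wz = ip sz (igrad f) (\<lambda>x. (1 / 2 ^ l) * (cr (W x * om (alpha x)) * igrad v x))"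
    unfolding grad_igrad[of e1] ip_def
   proof (intro sum.cong refl)
    fix x
    have "cnj (cr (e1 (alpha x)) * igrad f x) * Wz x
     = cr (W x * (2 ^ l * e1 (alpha x) * e1 (alpha x))) * (cnj (igrad f x) * igrad v x)"
     by (simp add: Wz_def z_def)
    then show "cnj (cr (e1 (alpha x)) * igrad f x) * Wz x
     = cnj (igrad f x) * (1 / 2 ^ l * (cr (W x * om (alpha x)) * igrad v x))"
     unfolding weights(2) by simp
   qed
   then show ?thesis unfolding ip_scale_right weak by simp
  qed
  have r: "ip sz (grad e1 f) r = ip sz f g / 2 ^ l" for f
  proof -
   have "ip sz (grad e1 f) r = ip sz (igrad f) (\<lambda>x. (1 / 2 ^ l) * igrad g x)"
    unfolding grad_igrad[of e1] ip_def
   proof (intro sum.cong refl)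
    fix x
    have "cnj (cr (e1 (alpha x)) * igrad f x) * r x
     = cr (e0 (alpha x) * e1 (alpha x)) * (cnj (igrad f x) * igrad g x)"
     by (simp add: r_def E_def)
    then show "cnj (cr (e1 (alpha x)) * igrad f x) * r x
     = cnj (igrad f x) * (1 / 2 ^ l * igrad g x)"
     unfolding weights(1) by simp
   qed
   then show ?thesis unfolding ip_scale_right ip_igrad ip_proj g by (simp add: g)
  qed
  define q where "q = (\<lambda>x. Wz x - r x)"
  have q: "ip sz (grad e1 f) q = 0" for f unfolding q_def ip_diff_right w r by simp
  have Sq: "nrm sz (S q) = 0" unfolding S_def by (rule range_proj_orthogonal[OF q])
  have rg: "nrm sz r \<le> nrm sz g"
   using operD(3)[OF oE, of "igrad g"] unfolding r_def nrm_igrad g by simp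
  \<comment> \<open>Coercivity: \<open>z\<close> lies in the range, so \<open>W z\<close> may be
    replaced by \<open>r\<close> when tested against \<open>z\<close>.\<close>
  have zn: "nrm sz z \<le> nrm sz g / wmin"
  proof -
   have "wmin * (nrm sz z)\<^sup>2 \<le> Re (ip sz z Wz)"
    unfolding nrm_sq ip_def Re_sum sum_distrib_left
   proof (rule sum_mono)
    fix x
    have "Re (cnj (z x) * Wz x) = W x * (cmod (z x))\<^sup>2"
     by (simp add: Wz_def cmod_def power2_eq_square algebra_simps)
    then show "wmin * (cmod (z x))\<^sup>2 \<le> Re (cnj (z x) * Wz x)" using W(1)[of x] by (simp add: mult_right_mono)
   qed
   also have "ip sz z Wz = ip sz z r"
   proof -
    obtain f where "z = grad e1 f" using zr by blast
    then show ?thesis using w[of f] r[of f] by simp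
   qed
   also have "Re (ip sz z r) \<le> nrm sz z * nrm sz r" by (rule order_trans[OF complex_Re_le_cmod cmod_ip])
   also have "\<dots> \<le> nrm sz z * nrm sz g" using rg by (rule mult_left_mono) simp
   finally have "nrm sz z * (wmin * nrm sz z) \<le> nrm sz z * nrm sz g" by (simp add: power2_eq_square mult_ac)
   then have "wmin * nrm sz z \<le> nrm sz g \<or> nrm sz z = 0" by (metis mult_le_cancel_left_pos nrm_nonneg order_le_less)
   then show ?thesis using W(3) nrm_nonneg[of sz g] by (auto simp: field_simps)
  qed
  \<comment> \<open>As \<open>S q\<close> vanishes, the residual is just the defect of
    \<open>S\<close> on the range vector \<open>z\<close>.\<close>
  have res: "nrm sz (\<lambda>x. z x - Y z x - T r x) \<le> (1 - gap) ^ d * nrm sz z"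
  proof -
   have "D z = (\<lambda>x. z x - cr (1 / wmax) * Wz x)"
    by (simp add: D_def Wz_def algebra_simps)
   then have "Y z = (\<lambda>x. S z x - cr (1 / wmax) * S Wz x)"
    unfolding Y_def by (simp only: lin_diff[OF operD(1)[OF oS]] lin_scale[OF operD(1)[OF oS]])
   then have "(\<lambda>x. z x - Y z x - T r x) = (\<lambda>x. (z x - S z x) + cr (1 / wmax) * S q x)"
    unfolding q_def T_def by (simp add: lin_diff[OF operD(1)[OF oS]] algebra_simps)
   moreover have "nrm sz (\<lambda>x. cr (1 / wmax) * S q x) = 0" unfolding nrm_scale Sq by simp
   ultimately have "nrm sz (\<lambda>x. z x - Y z x - T r x) \<le> nrm sz (\<lambda>x. z x - S z x)" by (simp only: nrm_triangle0)
   also have "\<dots> \<le> (1 - gap) ^ d * nrm sz z" unfolding S_def by (rule range_proj_range[OF zr])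
   finally show ?thesis .
  qed
  have zQ: "nrm sz (\<lambda>x. z x - Q (T r) x) \<le> (\<rho> ^ Suc K + (1 - gap) ^ d * wmax / wmin) * nrm sz z"
   using neumann_bound[OF operD(1)[OF oY] operD(3)[OF oY] _ \<rho>(2) res, of K] \<rho>
   unfolding Q_def by (simp add: algebra_simps)
  have Ez: "E z = igrad v"
  proof
   fix x
   have "E z x = cr (2 ^ l * (e0 (alpha x) * e1 (alpha x))) * igrad v x" by (simp add: E_def z_def)
   then show "E z x = igrad v x" unfolding weights(1) by simp
  qed
  \<comment> \<open>By isometry the adjoint of \<open>igrad\<close> is a left inverse at selector
    zero.\<close>
  have Gv: "nrm sz (\<lambda>x. v x - G' (igrad v) x) = 0"
  proof -
   have i: "ip sz f (\<lambda>x. v x - G' (igrad v) x) = 0" for f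
    unfolding ip_diff_right operD(4)[OF oG, symmetric] ip_igrad ip_proj by (simp add: v)
   show ?thesis using i[of "\<lambda>x. v x - G' (igrad v) x"] unfolding ip_self by simp
  qed
  have "(\<lambda>x. v x - B g x) = (\<lambda>x. G' (E (\<lambda>y. z y - Q (T r) y)) x + (v x - G' (igrad v) x))"
   unfolding B_def lin_diff[OF operD(1)[OF oE]] lin_diff[OF operD(2)[OF oG]] Ez by (simp add: r_def)
  then have "nrm sz (\<lambda>x. v x - B g x) \<le> nrm sz (G' (E (\<lambda>y. z y - Q (T r) y)))"
   by (simp only: nrm_triangle0[OF Gv])
  also have "\<dots> \<le> 8 * nrm sz (E (\<lambda>y. z y - Q (T r) y))" by (rule oper_bound'[OF oG])
  also have "\<dots> \<le> 8 * nrm sz (\<lambda>y. z y - Q (T r) y)" using operD(3)[OF oE] by simp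
  also have "\<dots> \<le> 8 * ((\<rho> ^ Suc K + (1 - gap) ^ d * wmax / wmin) * nrm sz z)" using zQ by simp
  also have "\<dots> \<le> 8 * ((\<rho> ^ Suc K + (1 - gap) ^ d * wmax / wmin) * (nrm sz g / wmin))"
   using zn \<rho> gap_bounds wmax W(3) by (intro mult_left_mono) auto
  finally show ?thesis unfolding \<rho>_def by (simp only: times_divide_eq_right mult.assoc)
 qed
 ultimately show ?thesis by blast
qed

end

section \<open>Square roots of contractions\<close>

text \<open>The coefficients of \<open>(1 - x) ^ (- 1/2)\<close>. The root of
  \<open>M = 1 - Y\<close> is taken as \<open>M\<close> times this series in \<open>Y\<close>: every
  term then lies in the range of \<open>M\<close>, where \<open>Y\<close> contracts, and a kernel of
  \<open>M\<close> does no harm.\<close>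

definition sqc :: "nat => real" where "sqc j = (- 1) ^ j * (- 1 / 2 gchoose j)"

lemma sqc_0 [simp]: "sqc 0 = 1"
 by (simp add: sqc_def)

lemma sqc_Suc: "sqc (Suc j) = sqc j * ((2 * real j + 1) / (2 * real j + 2))"
proof -
 have "(real j + 1) * ((- 1 / 2 :: real) gchoose Suc j) = (- 1 / 2 - real j) * (- 1 / 2 gchoose j)"
  using gbinomial_absorb_comp[of "- 1 / 2 :: real" j] gbinomial_absorption[of j "- 1 / 2 :: real"] by (simp add: add.commute)
 moreover have "real j + 1 \<noteq> 0" by linarith
 ultimately have "((- 1 / 2 :: real) gchoose Suc j) = (- 1 / 2 - real j) / (real j + 1) * (- 1 / 2 gchoose j)"
  by (simp add: nonzero_eq_divide_eq mult.commute)
 also have "(- 1 / 2 - real j) / (real j + 1) = - ((2 * real j + 1) / (2 * real j + 2))"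
  by (simp add: divide_simps)
 finally show ?thesis unfolding sqc_def by simp
qed

lemma sqc_pos: "0 < sqc j"
 by (induction j) (simp_all add: sqc_Suc)

lemma sqc_less: "sqc (Suc j) < sqc j"
proof -
 have "(2 * real j + 1) / (2 * real j + 2) < 1" by simp
 then show ?thesis unfolding sqc_Suc using sqc_pos[of j] by (metis mult.right_neutral mult_less_cancel_left_pos)
qed

lemma sqc_le_1: "sqc j \<le> 1"
proof (induction j)
 case (Suc j)
 then show ?case using sqc_less[of j] by linarith
qed simp

text \<open>The square of the series is \<open>1 / (1 - x)\<close>; the coefficients follow from the
  Vandermonde convolution.\<close>

lemma sqc_convolution: "(\<Sum>i\<le>k. sqc i * sqc (k - i)) = 1"
proof -
 have "(\<Sum>i\<le>k. sqc i * sqc (k - i)) = (- 1) ^ k * (\<Sum>i\<le>k. (- 1 / 2 gchoose i) * (- 1 / 2 gchoose (k - i)))"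
  unfolding sum_distrib_left
 proof (rule sum.cong[OF refl])
  fix i assume "i \<in> {..k}"
  then have "(- 1 :: real) ^ k = (- 1) ^ i * (- 1) ^ (k - i)" by (simp flip: power_add)
  then show "sqc i * sqc (k - i) = (- 1) ^ k * ((- 1 / 2 gchoose i) * (- 1 / 2 gchoose (k - i)))"
   by (simp add: sqc_def)
 qed
 also have "\<dots> = (- 1) ^ k * (- 1 gchoose k)"
  using gbinomial_Vandermonde[of "- 1 / 2 :: real" "- 1 / 2" k] by (simp add: atMost_atLeast0)
 also have "\<dots> = (- 1) ^ k * (- 1) ^ k * (real k gchoose k)" using gbinomial_minus[of "1 :: real" k] by simp
 also have "\<dots> = 1" unfolding binomial_gbinomial[symmetric] by (simp flip: power_mult_distrib)
 finally show ?thesis .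
qed

definition sqrt_poly :: "nat => linop => linop" where
 "sqrt_poly d Y f x = (\<Sum>j\<le>d. cr (sqc j) * ((Y ^^ j) f x - (Y ^^ Suc j) f x))"

text \<open>Summation by parts gives \<open>1 - Y (a 0 + a 1 Y + \<dots>)\<close>, with coefficients
  that are positive because \<open>sqc\<close> decreases and that add up to one. The normalisation
  is thus two at every degree.\<close>

lemma encodable_sqrt_poly:
 fixes Y Y' :: linop
 assumes "encodable s \<kappa> 1 Y Y'"
 shows "\<exists>B'. encodable s (\<kappa> + d * (\<kappa> + 2) + 3) 2 (sqrt_poly d Y) B'"
proof -
 define a where "a k = (if k = d then sqc k else sqc k - sqc (Suc k))" for k
 have pos: "0 < a k" for k using sqc_less[of k] sqc_pos[of k] by (auto simp: a_def)
 have tele: "(\<Sum>k\<le>d. a k) = 1"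
 proof -
  have "(\<Sum>k\<le>d. a k) = (\<Sum>k<d. sqc k - sqc (Suc k)) + sqc d"
   by (simp only: lessThan_Suc_atMost[symmetric] sum.lessThan_Suc) (simp add: a_def)
  then show ?thesis unfolding sum_lessThan_telescope' by simp
 qed
 have eq: "f x - (\<Sum>k\<le>d. cr (a k) * (Y ^^ Suc k) f x) = sqrt_poly d Y f x" for f x
 proof -
  define u where "u k = (Y ^^ k) f x" for k
  have "(\<Sum>j\<le>n. cr (sqc j) * (u j - u (Suc j))) = u 0 - (\<Sum>k<n. cr (sqc k - sqc (Suc k)) * u (Suc k)) - cr (sqc n) * u (Suc n)" for n
   by (induction n) (simp_all add: algebra_simps)
  moreover have "(\<Sum>k\<le>d. cr (a k) * u (Suc k)) = (\<Sum>k<d. cr (sqc k - sqc (Suc k)) * u (Suc k)) + cr (sqc d) * u (Suc d)"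
   by (simp only: lessThan_Suc_atMost[symmetric] sum.lessThan_Suc) (simp add: a_def)
  ultimately show ?thesis unfolding sqrt_poly_def u_def[symmetric] by (simp add: u_def[of 0])
 qed
 have "encodable s (\<kappa> + d * (\<kappa> + 2)) 1 (\<lambda>f. (\<lambda>f x. \<Sum>k\<le>d. cr (a k) * (Y ^^ k) f x) (Y f)) (\<lambda>f. Y' ((\<lambda>f x. \<Sum>k\<le>d. cr (a k) * (Y' ^^ k) f x) f))"
  using encodable_comp[OF encodable_poly[where a = a and d = d, OF assms pos] assms] tele by (simp add: add.commute)
 from encodable_add[OF encodable_id encodable_uminus[OF this]]
 show ?thesis by (intro exI, rule encodable_eqI[OF _ _ _ _ refl]) (auto simp: eq[symmetric] funpow_swap1)
qed

text \<open>Self-adjoint, between zero and one, and with a gap demanded only on the range: the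
  intended mass matrix may be singular, since the fission coefficient may vanish.\<close>

locale sqrt_op =
 fixes s :: nat and M :: linop and \<rho> :: real
 assumes lin_M: "lin M" and sym_M: "\<And>f g. ip s (M f) g = ip s f (M g)"
  and contr: "\<And>f. (nrm s (M f))\<^sup>2 \<le> Re (ip s f (M f))"
  and gap_M: "\<And>f. nrm s (\<lambda>x. M f x - M (M f) x) \<le> \<rho> * nrm s (M f)"
  and \<rho>: "0 \<le> \<rho>" "\<rho> < 1"
begin

definition Y :: linop where "Y f = (\<lambda>x. f x - M f x)"

definition R :: "nat => linop" where
 "R d f x = (\<Sum>j<d. cr (sqc j) * (Y ^^ j) (M f) x)"

definition root :: linop where
 "root f x = (\<Sum>j. cr (sqc j) * (Y ^^ j) (M f) x)"

lemma lin_Y: "lin Y"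
 using lin_combine[OF local.lin_M lin_M] unfolding Y_def lin_def
 by (simp add: lin_add[OF lin_M] lin_scale[OF lin_M] algebra_simps)

lemma Y_M: "Y (M f) = M (Y f)"
 unfolding Y_def by (simp add: lin_diff[OF lin_M])

lemma Y_pow_M: "(Y ^^ j) (M f) = M ((Y ^^ j) f)"
 by (induction j) (simp_all add: Y_M)

lemma nrm_M: "nrm s (M f) \<le> nrm s f"
proof -
 have "nrm s (M f) * nrm s (M f) \<le> nrm s f * nrm s (M f)"
  using order_trans[OF contr order_trans[OF complex_Re_le_cmod cmod_ip], of f] by (simp add: power2_eq_square)
 then show ?thesis by (cases "nrm s (M f) = 0") (auto simp: mult_le_cancel_right order_less_le)
qed

lemma nrm_Y_pow: "nrm s ((Y ^^ j) (M f)) \<le> \<rho> ^ j * nrm s (M f)"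
proof (induction j)
 case (Suc j)
 have "nrm s ((Y ^^ Suc j) (M f)) = nrm s (Y (M ((Y ^^ j) f)))" by (simp add: Y_pow_M)
 also have "\<dots> \<le> \<rho> * nrm s ((Y ^^ j) (M f))" unfolding Y_def[of "M _"] Y_pow_M by (rule gap_M)
 also have "\<dots> \<le> \<rho> * (\<rho> ^ j * nrm s (M f))" by (rule mult_left_mono[OF Suc \<rho>(1)])
 finally show ?case by simp
qed simp

lemma sym_Y_pow: "ip s ((Y ^^ j) f) g = ip s f ((Y ^^ j) g)"
proof (induction j arbitrary: g)
 case (Suc j)
 have Y: "ip s (Y f) g = ip s f (Y g)" for f g unfolding Y_def ip_diff_left ip_diff_right sym_M ..
 show ?case by (simp only: funpow.simps(2) comp_apply Y Suc funpow_swap1[of Y j g])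
qed simp

lemma cmod_le_nrm: "x \<in> slice s ==> cmod (f x) \<le> nrm s f"
 unfolding nrm_def by (rule member_le_L2_set) auto

lemma summable_root: "x \<in> slice s ==> summable (\<lambda>j. cr (sqc j) * (Y ^^ j) (M f) x)"
proof (rule summable_comparison_test'[where N = 0 and g = "\<lambda>j. \<rho> ^ j * nrm s (M f)"])
 show "summable (\<lambda>j. \<rho> ^ j * nrm s (M f))" using \<rho> by (intro summable_mult2 summable_geometric) simp
 fix j assume x: "x \<in> slice s"
 have "sqc j * cmod ((Y ^^ j) (M f) x) \<le> 1 * (\<rho> ^ j * nrm s (M f))"
  by (rule mult_mono[OF sqc_le_1 order_trans[OF cmod_le_nrm[OF x] nrm_Y_pow]]) auto
 then show "norm (cr (sqc j) * (Y ^^ j) (M f) x) \<le> \<rho> ^ j * nrm s (M f)"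
  using sqc_pos[of j] by (simp add: norm_mult)
qed

lemma R_tendsto: "x \<in> slice s ==> (\<lambda>d. R d f x) \<longlonglongrightarrow> root f x"
 unfolding R_def root_def by (rule summable_LIMSEQ[OF summable_root])

lemma nrm_tendsto:
 assumes "\<And>x. x \<in> slice s ==> (\<lambda>d. F d x) \<longlonglongrightarrow> f x" shows "(\<lambda>d. nrm s (F d)) \<longlonglongrightarrow> nrm s f"
 unfolding nrm_def L2_set_def by (intro tendsto_intros assms)

lemma ip_tendsto:
 assumes "\<And>x. x \<in> slice s ==> (\<lambda>d. F d x) \<longlonglongrightarrow> f x" shows "(\<lambda>d. ip s g (F d)) \<longlonglongrightarrow> ip s g f"
 unfolding ip_def by (intro tendsto_intros assms)

lemma nrm_R_diff: "nrm s (\<lambda>x. R (d + e) f x - R d f x) \<le> \<rho> ^ d / (1 - \<rho>) * nrm s (M f)"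
proof -
 have "(\<lambda>x. R (d + e) f x - R d f x) = (\<lambda>x. \<Sum>j\<in>{d..<d+e}. cr (sqc j) * (Y ^^ j) (M f) x)"
  unfolding R_def by (simp add: sum_diff_nat_ivl[symmetric, of 0 d "d + e"] atLeast0LessThan fun_eq_iff)
 then have "nrm s (\<lambda>x. R (d + e) f x - R d f x) \<le> (\<Sum>j\<in>{d..<d+e}. nrm s (\<lambda>x. cr (sqc j) * (Y ^^ j) (M f) x))"
  by (simp add: nrm_sum)
 also have "\<dots> \<le> (\<Sum>j\<in>{d..<d+e}. \<rho> ^ j * nrm s (M f))"
 proof (rule sum_mono)
  fix j
  have "sqc j * nrm s ((Y ^^ j) (M f)) \<le> 1 * (\<rho> ^ j * nrm s (M f))"
   by (rule mult_mono[OF sqc_le_1 nrm_Y_pow]) auto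
  then show "nrm s (\<lambda>x. cr (sqc j) * (Y ^^ j) (M f) x) \<le> \<rho> ^ j * nrm s (M f)"
   using sqc_pos[of j] by (simp add: nrm_scale)
 qed
 also have "\<dots> = (\<Sum>j<e. \<rho> ^ (j + d) * nrm s (M f))"
  using sum.shift_bounds_nat_ivl[of "\<lambda>j. \<rho> ^ j * nrm s (M f)" 0 d e] by (simp only: add_0 add.commute[of d e] atLeast0LessThan)
 also have "\<dots> = \<rho> ^ d * (\<Sum>j<e. \<rho> ^ j) * nrm s (M f)"
  unfolding sum_distrib_left sum_distrib_right by (simp only: power_add mult_ac)
 also have "\<dots> \<le> \<rho> ^ d * (1 / (1 - \<rho>)) * nrm s (M f)"
 proof -
  have "(\<Sum>j<e. \<rho> ^ j) = (1 - \<rho> ^ e) / (1 - \<rho>)" using sum_gp_strict[of \<rho> e] \<rho> by simp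
  also have "\<dots> \<le> 1 / (1 - \<rho>)" using \<rho> by (intro divide_right_mono) auto
  finally show ?thesis using \<rho> by (intro mult_right_mono mult_left_mono) auto
 qed
 finally show ?thesis by simp
qed

lemma nrm_root_R: "nrm s (\<lambda>x. root f x - R d f x) \<le> \<rho> ^ d / (1 - \<rho>) * nrm s (M f)"
proof (rule LIMSEQ_le_const2)
 show "(\<lambda>e. nrm s (\<lambda>x. R (d + e) f x - R d f x)) \<longlonglongrightarrow> nrm s (\<lambda>x. root f x - R d f x)"
 proof (intro nrm_tendsto tendsto_intros)
  fix x assume "x \<in> slice s"
  from LIMSEQ_ignore_initial_segment[OF R_tendsto[OF this], where k = d]
  show "(\<lambda>e. R (d + e) f x) \<longlonglongrightarrow> root f x" by (simp only: add.commute)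
 qed
qed (intro exI allI impI nrm_R_diff)

lemma lin_R: "lin (R d)"
 unfolding lin_def R_def
 by (auto simp: fun_eq_iff lin_add[OF lin_M] lin_scale[OF lin_M] lin_add[OF lin_funpow[OF lin_Y]] lin_scale[OF lin_funpow[OF lin_Y]]
   algebra_simps sum.distrib sum_distrib_left)

lemma sym_R: "ip s (R d f) g = ip s f (R d g)"
proof -
 have "ip s (R d f) g = cnj (ip s g (R d f))" by (simp add: ip_cnj)
 also have "\<dots> = (\<Sum>j<d. cr (sqc j) * cnj (ip s g ((Y ^^ j) (M f))))"
  unfolding R_def[abs_def] ip_sum_right ip_scale_right by simp
 also have "\<dots> = (\<Sum>j<d. cr (sqc j) * ip s f ((Y ^^ j) (M g)))"
  unfolding ip_cnj sym_Y_pow sym_M Y_pow_M ..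
 also have "\<dots> = ip s f (R d g)" unfolding R_def[abs_def] ip_sum_right ip_scale_right ..
 finally show ?thesis .
qed

text \<open>By parity of \<open>j\<close>: with \<open>g\<close> the half power applied to
  \<open>f\<close>, the term is \<open><g, M g>\<close> or \<open><g, M g> - |M g|^2\<close>, and
  the latter is nonnegative by \<open>contr\<close>.\<close>

lemma nonneg_R: "0 \<le> Re (ip s f (R d f))"
proof -
 have p: "0 \<le> Re (ip s g (M g))" for g by (rule order_trans[OF zero_le_power2 contr])
 have "0 \<le> Re (ip s f ((Y ^^ j) (M f)))" for j
 proof -
  define i where "i = j div 2"
  define g where "g = (Y ^^ i) f"
  have g: "(Y ^^ i) (M f) = M g" unfolding g_def by (rule Y_pow_M)
  have "j = i + i \<or> j = i + Suc i" unfolding i_def by presburger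
  then show ?thesis
  proof
   assume "j = i + i"
   then have "(Y ^^ j) (M f) = (Y ^^ i) (M g)" by (simp only: funpow_add comp_apply g)
   then show ?thesis using p[of g] by (simp only: sym_Y_pow[symmetric] g_def)
  next
   assume "j = i + Suc i"
   then have "(Y ^^ j) (M f) = (Y ^^ i) (Y (M g))" by (simp only: funpow_add comp_apply funpow.simps(2) g)
   then have "ip s f ((Y ^^ j) (M f)) = ip s g (Y (M g))" by (simp only: sym_Y_pow[symmetric] g_def)
   also have "\<dots> = ip s g (M g) - ip s (M g) (M g)" unfolding Y_def ip_diff_right sym_M ..
   finally show ?thesis using contr[of g] by (simp add: ip_self)
  qed
 qed
 then show ?thesis unfolding R_def[abs_def] ip_sum_right ip_scale_right Re_sum
  by (intro sum_nonneg) (simp add: less_imp_le[OF sqc_pos])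
qed

lemma nonneg_root: "0 \<le> Re (ip s f (root f))"
 by (rule LIMSEQ_le_const[OF tendsto_Re[OF ip_tendsto[OF R_tendsto]]]) (auto simp: nonneg_R)

lemma sym_root: "ip s (root f) g = ip s f (root g)"
proof (rule LIMSEQ_unique)
 show "(\<lambda>d. cnj (ip s g (R d f))) \<longlonglongrightarrow> ip s (root f) g"
  unfolding ip_cnj[of s g "root f", symmetric] by (rule tendsto_cnj[OF ip_tendsto[OF R_tendsto]])
 show "(\<lambda>d. cnj (ip s g (R d f))) \<longlonglongrightarrow> ip s f (root g)"
  unfolding ip_cnj sym_R by (rule ip_tendsto[OF R_tendsto])
qed

lemma nrm_R_bound: "nrm s (R d f) \<le> 1 / (1 - \<rho>) * nrm s f"
proof -
 have "nrm s (R d f) \<le> 1 / (1 - \<rho>) * nrm s (M f)" using nrm_R_diff[of 0 d f] by (simp add: R_def[of 0])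
 also have "\<dots> \<le> 1 / (1 - \<rho>) * nrm s f" using \<rho> by (intro mult_left_mono nrm_M) auto
 finally show ?thesis .
qed

text \<open>Pairs of indices with sum below \<open>d\<close> combine, by the convolution, into
  \<open>1 + Y + \<dots>\<close> applied to \<open>M (M f)\<close>, which telescopes to
  \<open>M f\<close> up to a term with \<open>Y ^^ d\<close>. The remaining pairs, at most
  \<open>d\<^sup>2\<close> of them, carry at least \<open>d\<close> factors
  \<open>Y\<close>.\<close>

lemma R_R: "nrm s (\<lambda>x. R d (R d f) x - M f x) \<le> (1 + (real d)\<^sup>2) * \<rho> ^ d * nrm s f"
proof -
 define V where "V k = (Y ^^ k) (M (M f))" for k
 have Vn: "nrm s (V k) \<le> \<rho> ^ k * nrm s f" for k
  unfolding V_def using order_trans[OF nrm_M nrm_M] \<rho>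
  by (intro order_trans[OF nrm_Y_pow] mult_left_mono) auto
 let ?I = "{..<d} \<times> {..<d}" let ?T = "{(i, j). i + j < d}"
 have fin: "finite ?T" by (rule finite_subset[of _ ?I]) auto
 have RR: "R d (R d f) x = (\<Sum>(i, j)\<in>?I. cr (sqc i * sqc j) * V (i + j) x)" for x
 proof -
  have "M (R d f) = (\<lambda>x. \<Sum>j<d. cr (sqc j) * (Y ^^ j) (M (M f)) x)"
   unfolding R_def[abs_def] lin_sum[OF lin_M finite_lessThan] lin_scale[OF lin_M] Y_pow_M ..
  then have "(Y ^^ i) (M (R d f)) = (\<lambda>x. \<Sum>j<d. cr (sqc j) * V (i + j) x)" for i
   by (simp only: lin_sum[OF lin_funpow[OF lin_Y] finite_lessThan] lin_scale[OF lin_funpow[OF lin_Y]] V_def funpow_add comp_apply)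
  then show ?thesis unfolding R_def[of d "R d f"] by (simp add: sum.cartesian_product[symmetric] sum_distrib_left mult.assoc)
 qed
 have "(\<Sum>(i, j)\<in>?T. cr (sqc i * sqc j) * V (i + j) x) = (\<Sum>k<d. V k x)" for x
 proof -
  have "(\<Sum>(i, j)\<in>?T. cr (sqc i * sqc j) * V (i + j) x) = (\<Sum>k<d. \<Sum>i\<le>k. cr (sqc i * sqc (k - i)) * V k x)"
   unfolding sum.triangle_reindex by (intro sum.cong refl) simp
  also have "\<dots> = (\<Sum>k<d. cr (\<Sum>i\<le>k. sqc i * sqc (k - i)) * V k x)" by (simp add: sum_distrib_right)
  finally show ?thesis by (simp add: sqc_convolution)
 qed
 moreover have "(\<Sum>k<d. V k x) = M f x - (Y ^^ d) (M f) x" for x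
 proof (induction d)
  case (Suc d)
  have "V d x = (Y ^^ d) (M f) x - (Y ^^ Suc d) (M f) x"
   unfolding V_def Y_pow_M by (simp add: Y_def Y_pow_M lin_diff[OF lin_M])
  then show ?case using Suc by simp
 qed simp
 ultimately have T: "(\<Sum>(i, j)\<in>?T. cr (sqc i * sqc j) * V (i + j) x) = M f x - (Y ^^ d) (M f) x" for x by simp
 have sub: "?T \<subseteq> ?I" by auto
 have "R d (R d f) x - M f x = (\<Sum>p\<in>?I - ?T. cr (sqc (fst p) * sqc (snd p)) * V (fst p + snd p) x) + (- (Y ^^ d) (M f) x)" for x
  using T[of x] unfolding RR by (simp add: sum.subset_diff[OF sub] case_prod_unfold)
 then have "nrm s (\<lambda>x. R d (R d f) x - M f x) \<le> nrm s (\<lambda>x. \<Sum>p\<in>?I - ?T. cr (sqc (fst p) * sqc (snd p)) * V (fst p + snd p) x) + nrm s (\<lambda>x. - (Y ^^ d) (M f) x)"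
  by (simp only: nrm_add)
 also have "nrm s (\<lambda>x. \<Sum>p\<in>?I - ?T. cr (sqc (fst p) * sqc (snd p)) * V (fst p + snd p) x)
  \<le> (\<Sum>p\<in>?I - ?T. nrm s (\<lambda>x. cr (sqc (fst p) * sqc (snd p)) * V (fst p + snd p) x))"
  by (rule nrm_sum) simp
 also have "\<dots> \<le> (\<Sum>p\<in>?I - ?T. \<rho> ^ d * nrm s f)"
 proof (rule sum_mono)
  fix p assume p: "p \<in> ?I - ?T"
  have "sqc (fst p) * sqc (snd p) \<le> 1 * 1" by (rule mult_mono) (auto simp: sqc_le_1 less_imp_le[OF sqc_pos])
  then have "(sqc (fst p) * sqc (snd p)) * nrm s (V (fst p + snd p)) \<le> 1 * (\<rho> ^ (fst p + snd p) * nrm s f)"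
   by (intro mult_mono Vn) auto
  also have "\<dots> \<le> \<rho> ^ d * nrm s f" using p \<rho> by (auto intro!: mult_right_mono power_decreasing)
  finally show "nrm s (\<lambda>x. cr (sqc (fst p) * sqc (snd p)) * V (fst p + snd p) x) \<le> \<rho> ^ d * nrm s f"
   using sqc_pos[of "fst p"] sqc_pos[of "snd p"] by (simp add: nrm_scale norm_mult)
 qed
 also have "\<dots> \<le> (real d)\<^sup>2 * (\<rho> ^ d * nrm s f)"
 proof -
  have "card (?I - ?T) \<le> card ?I" by (rule card_mono) auto
  then have "real (card (?I - ?T)) \<le> (real d)\<^sup>2" by (simp add: power2_eq_square flip: of_nat_mult)
  then show ?thesis using \<rho> by (simp add: mult_right_mono)
 qed
 also have "nrm s (\<lambda>x. - (Y ^^ d) (M f) x) \<le> \<rho> ^ d * nrm s f"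
  unfolding nrm_minus using \<rho> by (intro order_trans[OF nrm_Y_pow] mult_left_mono nrm_M) auto
 finally show ?thesis by (simp add: algebra_simps)
qed

lemma root_root: "nrm s (\<lambda>x. root (root f) x - M f x) = 0"
proof -
 define e where "e d = \<rho> ^ d / (1 - \<rho>) * nrm s (root f) + 1 / (1 - \<rho>) * (\<rho> ^ d / (1 - \<rho>) * nrm s f) + (1 + (real d)\<^sup>2) * \<rho> ^ d * nrm s f" for d
 have "nrm s (\<lambda>x. root (root f) x - M f x) \<le> e d" for d
 proof -
  have "(\<lambda>x. root (root f) x - M f x) = (\<lambda>x. (root (root f) x - R d (root f) x) + R d (\<lambda>x. root f x - R d f x) x + (R d (R d f) x - M f x))"
   by (simp add: lin_diff[OF lin_R])
  then have "nrm s (\<lambda>x. root (root f) x - M f x) \<le> nrm s (\<lambda>x. root (root f) x - R d (root f) x) + nrm s (R d (\<lambda>x. root f x - R d f x)) + nrm s (\<lambda>x. R d (R d f) x - M f x)"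
   by (simp add: order_trans[OF nrm_add add_right_mono[OF nrm_add]])
  also have "\<dots> \<le> e d" unfolding e_def
  proof (intro add_mono R_R)
   show "nrm s (\<lambda>x. root (root f) x - R d (root f) x) \<le> \<rho> ^ d / (1 - \<rho>) * nrm s (root f)"
    using \<rho> by (intro order_trans[OF nrm_root_R] mult_left_mono nrm_M) auto
   show "nrm s (R d (\<lambda>x. root f x - R d f x)) \<le> 1 / (1 - \<rho>) * (\<rho> ^ d / (1 - \<rho>) * nrm s f)"
    using \<rho> by (intro order_trans[OF nrm_R_bound] mult_left_mono order_trans[OF nrm_root_R] nrm_M) auto
  qed
  finally show ?thesis .
 qed
 moreover have "e \<longlonglongrightarrow> 0"
 proof -
  \<comment> \<open>\<open>d\<^sup>2 * \<rho> ^ d\<close> is the square of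
    \<open>d * sqrt \<rho> ^ d\<close>, so the limit with the first power of \<open>d\<close>
    suffices.\<close>
  have "(\<lambda>d. real d * sqrt \<rho> ^ d) \<longlonglongrightarrow> 0" using \<rho> by (intro powser_times_n_limit_0) (simp add: real_sqrt_lt_1_iff)
  moreover have "(sqrt \<rho> ^ d)\<^sup>2 = \<rho> ^ d" for d
   using \<rho>(1) by (metis power_mult mult.commute real_sqrt_pow2)
  ultimately have "(\<lambda>d. (real d)\<^sup>2 * \<rho> ^ d) \<longlonglongrightarrow> 0"
   using tendsto_power[of "\<lambda>d. real d * sqrt \<rho> ^ d" 0 sequentially 2] by (simp add: power_mult_distrib)
  moreover have "(\<lambda>d. \<rho> ^ d) \<longlonglongrightarrow> 0" using \<rho> by (simp add: LIMSEQ_power_zero)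
  moreover have "(\<lambda>d. u d / (1 - \<rho>) * A + 1 / (1 - \<rho>) * (u d / (1 - \<rho>) * B) + (u d + w d) * C) \<longlonglongrightarrow> 0"
   if "u \<longlonglongrightarrow> 0" "w \<longlonglongrightarrow> 0" for u w :: "nat => real" and A B C
   by (rule tendsto_eq_rhs, (rule tendsto_intros that | use \<rho> in simp)+)
  moreover have "e = (\<lambda>d. \<rho> ^ d / (1 - \<rho>) * nrm s (root f) + 1 / (1 - \<rho>) * (\<rho> ^ d / (1 - \<rho>) * nrm s f) + (\<rho> ^ d + (real d)\<^sup>2 * \<rho> ^ d) * nrm s f)"
   by (rule ext) (simp add: e_def distrib_right)
  ultimately show ?thesis by blast
 qed
 ultimately have "nrm s (\<lambda>x. root (root f) x - M f x) \<le> 0" by (intro LIMSEQ_le_const) auto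
 then show ?thesis by (simp add: order_antisym)
qed

end

section \<open>Uniqueness of matrix square roots\<close>

text \<open>At \<open>v + t S v\<close> the form is \<open>2 t a + t\<^sup>2 b\<close> with
  \<open>a = |S v|^2\<close>; a small negative \<open>t\<close> would make it negative unless
  \<open>a = 0\<close>.\<close>

lemma psd_null:
 fixes S :: "real mat"
 assumes "psd S" "S \<in> carrier_mat n n" "v \<in> carrier_vec n" and 0: "scalar_prod v (S *\<^sub>v v) = 0"
 shows "S *\<^sub>v v = 0\<^sub>v n"
proof -
 define w where "w = S *\<^sub>v v"
 have w: "w \<in> carrier_vec n" and Sw: "S *\<^sub>v w \<in> carrier_vec n" using assms(2,3) by (auto simp: w_def)
 have tr: "transpose_mat S = S" and p: "\<And>u. u \<in> carrier_vec n ==> 0 \<le> scalar_prod u (S *\<^sub>v u)"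
  using assms(1,2) by (auto simp: psd_def)
 define a where "a = scalar_prod w w"
 define b where "b = scalar_prod w (S *\<^sub>v w)"
 have vSw: "scalar_prod v (S *\<^sub>v w) = a"
  using transpose_vec_mult_scalar[OF assms(2,3) w] assms(2,3) w by (simp add: tr a_def w_def comm_scalar_prod[of _ n])
 have "0 \<le> 2 * t * a + t\<^sup>2 * b" for t
 proof -
  have "S *\<^sub>v (v + t \<cdot>\<^sub>v w) = w + t \<cdot>\<^sub>v (S *\<^sub>v w)"
   using assms(2,3) w by (simp add: mult_add_distrib_mat_vec[of S n n] mult_mat_vec[of S n n] w_def)
  then have "scalar_prod (v + t \<cdot>\<^sub>v w) (S *\<^sub>v (v + t \<cdot>\<^sub>v w))
   = scalar_prod v w + t * scalar_prod v (S *\<^sub>v w) + (t * scalar_prod w w + t * (t * scalar_prod w (S *\<^sub>v w)))"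
   using assms(3) w Sw by (simp add: add_scalar_prod_distrib[of _ n] scalar_prod_add_distrib[of _ n] distrib_left)
  also have "\<dots> = 2 * t * a + t\<^sup>2 * b"
   unfolding vSw a_def[symmetric] b_def[symmetric] using 0 by (simp add: w_def[symmetric] power2_eq_square)
  finally show ?thesis using p[of "v + t \<cdot>\<^sub>v w"] assms(3) w by simp
 qed
 \<comment> \<open>The \<open>+ 1\<close> keeps the quotient meaningful when
   \<open>b = 0\<close>.\<close>
 from this[of "- (a / (b + 1))"] have "2 * a * (a / (b + 1)) \<le> (a / (b + 1))\<^sup>2 * b" by (simp add: algebra_simps)
 moreover have b: "0 \<le> b" using p[OF w] by (simp add: b_def)
 moreover have a: "0 \<le> a" unfolding a_def scalar_prod_def by (intro sum_nonneg) simp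
 moreover have "a = 0" if "2 * a * (a / (b + 1)) \<le> (a / (b + 1))\<^sup>2 * b"
 proof (rule ccontr)
  assume "a \<noteq> 0"
  then have "0 < a / (b + 1)" using a b by simp
  moreover have "(a / (b + 1)) * (2 * a) \<le> (a / (b + 1)) * ((a / (b + 1)) * b)"
   using that by (simp only: power2_eq_square mult_ac)
  ultimately have "2 * a \<le> (a / (b + 1)) * b" by (simp only: mult_le_cancel_left_pos)
  also have "\<dots> \<le> a" using a b by (simp add: field_simps)
  finally show False using a \<open>a \<noteq> 0\<close> by simp
 qed
 ultimately have "(\<Sum>i\<in>{0..<n}. vec_index w i * vec_index w i) = 0" using w by (simp add: a_def scalar_prod_def)
 then have "\<forall>i<n. vec_index w i = 0" by (subst (asm) sum_nonneg_eq_0_iff) auto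
 then show ?thesis unfolding w_def[symmetric] using w by (intro eq_vecI) auto
qed

text \<open>Uniqueness without a spectral theorem. A second root \<open>T\<close> commutes with
  \<open>C = T * T\<close>, hence with \<open>S\<close>, so \<open>(S - T) (S + T) = 0\<close>. For
  \<open>w = (S - T) v\<close> the forms of \<open>S\<close> and \<open>T\<close> at
  \<open>w\<close> then vanish, \<open>psd_null\<close> gives \<open>(S - T) w = 0\<close>, and
  \<open>w\<close> is orthogonal to itself.\<close>

lemma psd_sqrt_eq:
 fixes C S :: "real mat"
 assumes S: "psd S" "S \<in> carrier_mat n n" "S * S = C"
  and comm: "\<And>T. T \<in> carrier_mat n n ==> T * C = C * T ==> T * S = S * T"
 shows "psd_sqrt C = S"
 unfolding psd_sqrt_def
proof (rule the_equality)
 fix T assume T: "psd T \<and> T * T = C"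
 then have Td: "T \<in> carrier_mat n n" using S(2,3) unfolding psd_def by (metis carrier_matD(1) carrier_mat_triv index_mult_mat(2))
 have "T * C = C * T" using T Td by (metis assoc_mult_mat)
 from comm[OF Td this] have TS: "T * S = S * T" .
 define D where "D = S - T"
 have D: "D \<in> carrier_mat n n" unfolding D_def by (rule minus_carrier_mat[OF Td])
 have Dt: "transpose_mat D = D" using S(1) T S(2) Td unfolding psd_def D_def by (auto simp: transpose_minus)
 have ST: "S + T \<in> carrier_mat n n" using Td by simp
 have D0: "D * (S + T) = 0\<^sub>m n n"
  unfolding D_def minus_mult_distrib_mat[OF S(2) Td ST] mult_add_distrib_mat[OF S(2) S(2) Td] mult_add_distrib_mat[OF Td S(2) Td] TS
  using S T Td by (intro eq_matI) auto
 have "D *\<^sub>v v = 0\<^sub>v n" if v: "v \<in> carrier_vec n" for v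
 proof -
  define w where "w = D *\<^sub>v v"
  have w: "w \<in> carrier_vec n" using D v by (simp add: w_def)
  have "scalar_prod w (S *\<^sub>v w) + scalar_prod w (T *\<^sub>v w) = scalar_prod w ((S + T) *\<^sub>v w)"
   using S(2) Td w by (simp add: add_mult_distrib_mat_vec[of S n n] scalar_prod_add_distrib[of _ n])
  also have "\<dots> = scalar_prod (D *\<^sub>v ((S + T) *\<^sub>v w)) v"
  proof -
   have u: "(S + T) *\<^sub>v w \<in> carrier_vec n" using ST w by simp
   show ?thesis using transpose_vec_mult_scalar[OF D v u] unfolding Dt w_def[symmetric] comm_scalar_prod[OF w u] by simp
  qed
  also have "D *\<^sub>v ((S + T) *\<^sub>v w) = 0\<^sub>v n"
  proof -
   have "0\<^sub>m n n *\<^sub>v w = 0\<^sub>v n" using w by (intro eq_vecI) auto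
   then show ?thesis using assoc_mult_mat_vec[OF D ST w] unfolding D0 by simp
  qed
  finally have "scalar_prod w (S *\<^sub>v w) + scalar_prod w (T *\<^sub>v w) = 0" using v by simp
  moreover have "0 \<le> scalar_prod w (S *\<^sub>v w)" "0 \<le> scalar_prod w (T *\<^sub>v w)"
   using S(1,2) T Td w by (auto simp: psd_def)
  ultimately have "scalar_prod w (S *\<^sub>v w) = 0" "scalar_prod w (T *\<^sub>v w) = 0" by auto
  then have "S *\<^sub>v w = 0\<^sub>v n" "T *\<^sub>v w = 0\<^sub>v n"
  using psd_null[OF S(1,2) w] psd_null[OF conjunct1[OF T] Td w] by simp_all
  then have "D *\<^sub>v w = 0\<^sub>v n" using S(2) Td w by (simp add: D_def minus_mult_distrib_mat_vec[of _ n n])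
  then have "scalar_prod w w = 0"
   using transpose_vec_mult_scalar[OF D v w] v w by (simp add: Dt w_def)
  then have "(\<Sum>i\<in>{0..<n}. vec_index w i * vec_index w i) = 0" using w by (simp add: scalar_prod_def)
  then have "\<forall>i<n. vec_index w i = 0" by (subst (asm) sum_nonneg_eq_0_iff) auto
  then show ?thesis unfolding w_def[symmetric] using w by (intro eq_vecI) auto
 qed
 note D_null = this
 have "D $$ (i, j) = 0" if ij: "i < n" "j < n" for i j
 proof -
  have "D $$ (i, j) = vec_index (D *\<^sub>v unit_vec n j) i"
   using D ij by simp
  then show ?thesis using D_null[of "unit_vec n j"] ij by simp
 qed
 then show "T = S" unfolding D_def using S(2) Td by (intro eq_matI) auto
qed (use S in auto)

lemma mat_inverse_of_posdef:
 fixes M :: "real mat"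
 assumes M: "M \<in> carrier_mat n n" and pos: "\<And>v. v \<in> carrier_vec n ==> v \<noteq> 0\<^sub>v n ==> 0 < scalar_prod v (M *\<^sub>v v)"
 shows "M * the (mat_inverse M) = 1\<^sub>m n" "the (mat_inverse M) \<in> carrier_mat n n"
proof -
 have "det M \<noteq> 0"
 proof
  assume "det M = 0"
  then obtain v where v: "v \<in> carrier_vec n" "v \<noteq> 0\<^sub>v n" "M *\<^sub>v v = 0\<^sub>v n"
   using det_0_iff_vec_prod_zero[OF M] by blast
  then show False using pos[OF v(1,2)] by simp
 qed
 then have "M \<in> Units (ring_mat TYPE(real) n ())" by (rule det_non_zero_imp_unit[OF M])
 then obtain B where "mat_inverse M = Some B" using mat_inverse(1)[OF M, where b = "()"] by (cases "mat_inverse M") auto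
 then show "M * the (mat_inverse M) = 1\<^sub>m n" "the (mat_inverse M) \<in> carrier_mat n n"
  using mat_inverse(2)[OF M] by auto
qed

section \<open>Real matrices as operators\<close>

lemma smult_smult_mat: "a \<cdot>\<^sub>m (b \<cdot>\<^sub>m M) = (a * b :: real) \<cdot>\<^sub>m M"
 by (rule eq_matI) auto

lemma one_smult_mat: "(1 :: real) \<cdot>\<^sub>m M = M"
 by (rule eq_matI) auto

text \<open>The nodes as basis states of a larger register: matrices indexed by node numbers become
  operators whose images vanish off these points.\<close>

locale node_points =
 fixes s n :: nat and pt :: "nat => bits"
 assumes inj_pt: "inj_on pt {..<n}" and pt_slice: "p < n ==> pt p \<in> slice s"
begin

definition delta :: "nat => state" where "delta p x = (if x = pt p then 1 else 0)"

definition act :: "real mat => linop" where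
 "act A f x = (\<Sum>p<n. (\<Sum>q<n. cr (A $$ (p, q)) * f (pt q)) * delta p x)"

definition mask :: linop where "mask f x = (\<Sum>p<n. f (pt p) * delta p x)"

lemma delta_pt: "p < n ==> q < n ==> delta p (pt q) = (if p = q then 1 else 0)"
 using inj_pt by (auto simp: delta_def inj_on_def)

lemma sum_delta: "q < n ==> (\<Sum>p<n. g p * delta p (pt q)) = g q"
 by (simp add: delta_pt if_distrib[of "\<lambda>c. _ * c"] cong: if_cong)

lemma act_pt: "p < n ==> act A f (pt p) = (\<Sum>q<n. cr (A $$ (p, q)) * f (pt q))"
 by (simp add: act_def sum_delta)

lemma mask_pt: "p < n ==> mask f (pt p) = f (pt p)"
 by (simp add: mask_def sum_delta)

lemma act_cong: "(\<And>q. q < n ==> f (pt q) = g (pt q)) ==> act A f = act A g"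
 by (simp add: act_def fun_eq_iff)

lemma mask_cong: "(\<And>q. q < n ==> f (pt q) = g (pt q)) ==> mask f = mask g"
 by (simp add: mask_def fun_eq_iff)

lemma mask_act [simp]: "mask (act A f) = act A f"
 by (simp add: mask_def act_pt fun_eq_iff) (simp add: act_def)

lemma act_mask [simp]: "act A (mask f) = act A f"
 by (rule act_cong) (rule mask_pt)

lemma mask_mask [simp]: "mask (mask f) = mask f"
 by (rule mask_cong) (rule mask_pt)

lemma lin_act: "lin (act A)"
 by (simp add: lin_def act_def fun_eq_iff algebra_simps sum.distrib sum_distrib_left)

lemma lin_mask: "lin mask"
 by (simp add: lin_def mask_def fun_eq_iff algebra_simps sum.distrib sum_distrib_left)

lemma act_mult:
 assumes "A \<in> carrier_mat n n" "B \<in> carrier_mat n n" shows "act (A * B) f = act A (act B f)"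
proof -
 have "(\<Sum>q<n. cr ((A * B) $$ (p, q)) * f (pt q)) = (\<Sum>k<n. cr (A $$ (p, k)) * act B f (pt k))" if "p < n" for p
 proof -
  have "(\<Sum>q<n. cr ((A * B) $$ (p, q)) * f (pt q)) = (\<Sum>q<n. \<Sum>k<n. cr (A $$ (p, k)) * (cr (B $$ (k, q)) * f (pt q)))"
   using assms that by (intro sum.cong refl) (simp add: scalar_prod_def sum_distrib_right mult.assoc lessThan_atLeast0)
  also have "\<dots> = (\<Sum>k<n. \<Sum>q<n. cr (A $$ (p, k)) * (cr (B $$ (k, q)) * f (pt q)))"
   by (rule sum.swap)
  finally show ?thesis by (simp add: act_pt sum_distrib_left)
 qed
 then show ?thesis by (simp add: act_def[of "A * B"] act_def[of A] fun_eq_iff)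
qed

lemma act_smult: "A \<in> carrier_mat n n ==> act (c \<cdot>\<^sub>m A) f = (\<lambda>x. cr c * act A f x)"
 by (simp add: act_def fun_eq_iff sum_distrib_left sum_distrib_right mult_ac)

lemma act_one: "act (1\<^sub>m n) f = mask f"
 by (simp add: act_def mask_def fun_eq_iff if_distrib[of cr] if_distrib[of "\<lambda>c. c * _"] cong: if_cong)

lemma act_delta: "p < n ==> q < n ==> act A (delta q) (pt p) = cr (A $$ (p, q))"
 by (simp add: act_pt delta_pt if_distrib[of "\<lambda>c. _ * c"] cong: if_cong)

lemma ip_delta: "p < n ==> ip s (delta p) f = f (pt p)"
 using pt_slice[of p] by (simp add: ip_def delta_def if_distrib[of cnj] if_distrib[of "\<lambda>c. c * _"] cong: if_cong)

lemma ip_mask: "ip s (mask f) g = (\<Sum>p<n. cnj (f (pt p)) * g (pt p))"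
proof -
 have "cnj (ip s g (mask f)) = (\<Sum>p<n. cnj (f (pt p)) * cnj (ip s g (delta p)))"
  unfolding mask_def[abs_def] ip_sum_right ip_scale_right by simp
 then show ?thesis unfolding ip_cnj by (simp add: ip_delta)
qed

lemma ip_mask_swap: "ip s (mask f) g = ip s f (mask g)"
proof -
 have "ip s f (mask g) = cnj (ip s (mask g) f)" by (simp add: ip_cnj)
 also have "\<dots> = (\<Sum>p<n. cnj (f (pt p)) * g (pt p))" by (simp add: ip_mask mult.commute)
 finally show ?thesis by (simp add: ip_mask)
qed

lemma nrm_mask: "nrm s (mask f) \<le> nrm s f"
proof -
 have "(nrm s (mask f))\<^sup>2 = cmod (ip s f (mask f))"
  using ip_mask_swap[of f "mask f"] ip_self[of s "mask f"] by (metis abs_of_nonneg mask_mask norm_of_real zero_le_power2)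
 also have "\<dots> \<le> nrm s f * nrm s (mask f)" by (rule cmod_ip)
 finally have "nrm s (mask f) * nrm s (mask f) \<le> nrm s f * nrm s (mask f)" by (simp add: power2_eq_square)
 then show ?thesis by (cases "nrm s (mask f) = 0") (auto simp: mult_le_cancel_right order_less_le)
qed

definition vec_state :: "real Matrix.vec => state" where
 "vec_state v = mask (\<lambda>x. cr (vec_index v (inv_into {..<n} pt x)))"

lemma vec_state_pt: "p < n ==> vec_state v (pt p) = cr (vec_index v p)"
 unfolding vec_state_def using inj_pt by (simp add: mask_pt inv_into_f_f)

lemma mask_vec_state [simp]: "mask (vec_state v) = vec_state v"
 by (simp add: vec_state_def)

lemma scalar_prod_act:
 assumes A: "A \<in> carrier_mat n n" and v: "v \<in> carrier_vec n"
 shows "cr (scalar_prod v (A *\<^sub>v v)) = ip s (vec_state v) (act A (vec_state v))"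
proof -
 have "vec_index (A *\<^sub>v v) p = (\<Sum>q<n. A $$ (p, q) * vec_index v q)" if "p < n" for p
  using that v A by (simp add: scalar_prod_def lessThan_atLeast0)
 then have "scalar_prod v (A *\<^sub>v v) = (\<Sum>p<n. vec_index v p * (\<Sum>q<n. A $$ (p, q) * vec_index v q))"
  using A by (simp add: scalar_prod_def lessThan_atLeast0)
 then have "cr (scalar_prod v (A *\<^sub>v v)) = (\<Sum>p<n. cnj (vec_state v (pt p)) * act A (vec_state v) (pt p))"
  by (simp add: act_pt vec_state_pt)
 then show ?thesis using ip_mask[of "vec_state v" "act A (vec_state v)"] by simp
qed

lemma mat_eqI:
 assumes "A \<in> carrier_mat n n" "B \<in> carrier_mat n n" "\<And>q p. q < n ==> p < n ==> act A (delta q) (pt p) = act B (delta q) (pt p)"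
 shows "A = B"
 using assms by (intro eq_matI) (auto simp: act_delta)

end

locale node_sqrt = node_points s n pt + sqrt_op s "node_points.act n pt C" \<rho> for s n pt C \<rho> +
 assumes C: "C \<in> carrier_mat n n"
begin

lemma Y_pow_act: "(Y ^^ j) (act C f) = mask ((Y ^^ j) (act C f))"
 by (simp add: Y_pow_M)

lemma R_mask: "mask (R d f) = R d f"
proof
 fix x
 have "R d f x = (\<Sum>j<d. cr (sqc j) * mask ((Y ^^ j) (act C f)) x)"
  unfolding R_def by (subst Y_pow_act) simp
 also have "\<dots> = mask (R d f) x"
  unfolding mask_def R_def by (simp add: sum_distrib_left sum_distrib_right sum.swap[of _ _ "{..<d}"] mult_ac)
 finally show "mask (R d f) x = R d f x" ..
qed

lemma root_cong: "(\<And>q. q < n ==> f (pt q) = g (pt q)) ==> root f = root g"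
 unfolding root_def[abs_def] by (simp only: act_cong[of f g])

definition sqrt_mat :: "real mat" where
 "sqrt_mat = mat n n (\<lambda>(p, q). Re (root (delta q) (pt p)))"

lemma sqrt_mat_carrier: "sqrt_mat \<in> carrier_mat n n"
 by (simp add: sqrt_mat_def)

text \<open>Hence the real part taken in \<open>sqrt_mat\<close> discards nothing.\<close>

lemma R_real: assumes "q < n" "p < n" shows "Im (R d (delta q) (pt p)) = 0"
proof -
 have 1: "(\<forall>x. Im (f x) = 0) ==> (\<forall>x. Im (act C f x) = 0)" for f
  by (simp add: act_def delta_def Im_sum)
 have "\<forall>x. Im ((Y ^^ j) (act C (delta q)) x) = 0" for j
 proof (induction j)
  case 0
  have "Im (delta q x) = 0" for x by (simp add: delta_def)
  then show ?case using 1[of "delta q"] by simp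
 next
  case (Suc j)
  then show ?case using 1[of "(Y ^^ j) (act C (delta q))"] by (simp add: Y_def[of "(Y ^^ j) _"])
 qed
 then show ?thesis by (simp add: R_def Im_sum)
qed

lemma root_real: assumes "q < n" "p < n" shows "root (delta q) (pt p) = cr (Re (root (delta q) (pt p)))"
proof -
 have "(\<lambda>d. Im (R d (delta q) (pt p))) \<longlonglongrightarrow> Im (root (delta q) (pt p))"
  by (rule tendsto_Im[OF R_tendsto[OF pt_slice[OF assms(2)]]])
 then have "Im (root (delta q) (pt p)) = 0" using R_real[OF assms] by (simp add: LIMSEQ_const_iff)
 then show ?thesis by (simp add: complex_eq_iff)
qed

lemma act_sqrt_pt: assumes "p < n" shows "act sqrt_mat f (pt p) = root f (pt p)"
proof -
 have "R d f (pt p) = (\<Sum>q<n. f (pt q) * R d (delta q) (pt p))" for d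
 proof -
  have "R d f = R d (mask f)" unfolding R_def[abs_def] by simp
  also have "\<dots> = (\<lambda>x. \<Sum>q<n. f (pt q) * R d (delta q) x)"
   unfolding mask_def[abs_def] lin_sum[OF lin_R finite_lessThan] lin_scale[OF lin_R] ..
  finally show ?thesis by (rule fun_cong)
 qed
 moreover have "(\<lambda>d. \<Sum>q<n. f (pt q) * R d (delta q) (pt p)) \<longlonglongrightarrow> (\<Sum>q<n. f (pt q) * root (delta q) (pt p))"
  by (intro tendsto_intros R_tendsto pt_slice assms)
 ultimately have "root f (pt p) = (\<Sum>q<n. f (pt q) * root (delta q) (pt p))"
  using LIMSEQ_unique[OF R_tendsto[OF pt_slice[OF assms], of f]] by simp
 also have "\<dots> = (\<Sum>q<n. cr (sqrt_mat $$ (p, q)) * f (pt q))"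
 proof (rule sum.cong[OF refl])
  fix q assume "q \<in> {..<n}"
  then have "cr (sqrt_mat $$ (p, q)) = root (delta q) (pt p)"
   using assms by (simp add: sqrt_mat_def root_real[symmetric])
  then show "f (pt q) * root (delta q) (pt p) = cr (sqrt_mat $$ (p, q)) * f (pt q)"
   by (simp add: mult.commute)
 qed
 finally show ?thesis using assms by (simp add: act_pt)
qed

lemma root_mask: "x \<in> slice s ==> root f x = mask (root f) x"
proof (rule LIMSEQ_unique[OF R_tendsto])
 have "(\<lambda>d. mask (R d f) x) \<longlonglongrightarrow> mask (root f) x"
  unfolding mask_def by (intro tendsto_intros R_tendsto pt_slice) simp
 then show "(\<lambda>d. R d f x) \<longlonglongrightarrow> mask (root f) x" by (simp only: R_mask)
qed

lemma act_sqrt: "x \<in> slice s ==> act sqrt_mat f x = root f x"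
proof -
 assume x: "x \<in> slice s"
 have "act sqrt_mat f = mask (act sqrt_mat f)" by simp
 also have "\<dots> = mask (root f)" by (rule mask_cong) (rule act_sqrt_pt)
 finally show ?thesis using root_mask[OF x, of f] by simp
qed

lemma nrm_act_sqrt_R: "nrm s (\<lambda>x. act sqrt_mat f x - R d f x) \<le> \<rho> ^ d / (1 - \<rho>) * nrm s (act C f)"
 using nrm_root_R[of f d] nrm_cong[of s "\<lambda>x. act sqrt_mat f x - R d f x" "\<lambda>x. root f x - R d f x"] by (simp add: act_sqrt)

lemma sqrt_mat_sq: "sqrt_mat * sqrt_mat = C"
proof (rule mat_eqI)
 fix q p assume q: "q < n" and p: "p < n"
 have "act (sqrt_mat * sqrt_mat) (delta q) (pt p) = root (act sqrt_mat (delta q)) (pt p)"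
  by (simp add: act_mult sqrt_mat_carrier act_sqrt_pt p)
 also have "root (act sqrt_mat (delta q)) = root (root (delta q))" by (rule root_cong) (rule act_sqrt_pt)
 also have "root (root (delta q)) (pt p) = act C (delta q) (pt p)"
  using nrm_eq_0[OF root_root pt_slice[OF p]] by simp
 finally show "act (sqrt_mat * sqrt_mat) (delta q) (pt p) = act C (delta q) (pt p)" .
qed (simp_all add: sqrt_mat_carrier C mult_carrier_mat[OF sqrt_mat_carrier sqrt_mat_carrier])

lemma sqrt_mat_psd: "psd sqrt_mat"
 unfolding psd_def
proof (intro conjI ballI)
 show "transpose_mat sqrt_mat = sqrt_mat"
 proof (rule eq_matI)
  fix p q assume "p < dim_row sqrt_mat" "q < dim_col sqrt_mat"
  then have p: "p < n" and q: "q < n" using sqrt_mat_carrier by auto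
  have "root (delta p) (pt q) = cnj (ip s (root (delta p)) (delta q))"
   unfolding ip_cnj by (simp add: ip_delta q)
  also have "\<dots> = cnj (root (delta q) (pt p))" unfolding sym_root by (simp add: ip_delta p)
  finally show "transpose_mat sqrt_mat $$ (p, q) = sqrt_mat $$ (p, q)" using p q by (simp add: sqrt_mat_def)
 qed (simp_all add: sqrt_mat_def)
next
 fix v :: "real Matrix.vec" assume v: "v \<in> carrier_vec (dim_row sqrt_mat)"
 then have v: "v \<in> carrier_vec n" by (simp add: sqrt_mat_def)
 have "cr (scalar_prod v (sqrt_mat *\<^sub>v v)) = ip s (vec_state v) (act sqrt_mat (vec_state v))"
  by (rule scalar_prod_act[OF sqrt_mat_carrier v])
 also have "\<dots> = ip s (vec_state v) (root (vec_state v))"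
  unfolding ip_def by (intro sum.cong refl) (simp add: act_sqrt)
 finally have "Re (cr (scalar_prod v (sqrt_mat *\<^sub>v v))) = Re (ip s (vec_state v) (root (vec_state v)))" by (rule arg_cong)
 then show "0 \<le> scalar_prod v (sqrt_mat *\<^sub>v v)" using nonneg_root[of "vec_state v"] by simp
qed (use sqrt_mat_carrier in auto)

text \<open>Passes from polynomials in \<open>C\<close> to their limit; this is the commutation that
  \<open>psd_sqrt_eq\<close> asks for.\<close>

lemma sqrt_mat_commutes:
 assumes T: "T \<in> carrier_mat n n" "T * C = C * T" shows "T * sqrt_mat = sqrt_mat * T"
proof (rule mat_eqI)
 fix q p assume q: "q < n" and p: "p < n"
 have TC: "act T (act C f) = act C (act T f)" for f
  using act_mult[OF T(1) C] act_mult[OF C T(1)] T(2) by metis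
 have TY: "act T ((Y ^^ j) f) = (Y ^^ j) (act T f)" for j f
  by (induction j arbitrary: f) (simp_all add: Y_def lin_diff[OF lin_act] TC funpow_swap1)
 have TR: "act T (R d f) = R d (act T f)" for d f
  unfolding R_def[abs_def] lin_sum[OF lin_act finite_lessThan] lin_scale[OF lin_act] TY TC ..
 have "(\<lambda>d. act T (R d (delta q)) (pt p)) \<longlonglongrightarrow> act T (root (delta q)) (pt p)"
  unfolding act_def[of T] by (intro tendsto_intros R_tendsto pt_slice) simp
 moreover have "(\<lambda>d. act T (R d (delta q)) (pt p)) \<longlonglongrightarrow> root (act T (delta q)) (pt p)"
  unfolding TR by (intro R_tendsto pt_slice p)
 ultimately have "act T (root (delta q)) (pt p) = root (act T (delta q)) (pt p)" by (rule LIMSEQ_unique)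
 moreover have "act T (act sqrt_mat (delta q)) = act T (root (delta q))"
  by (rule act_cong) (rule act_sqrt_pt)
 ultimately show "act (T * sqrt_mat) (delta q) (pt p) = act (sqrt_mat * T) (delta q) (pt p)"
  by (simp add: act_mult T(1) sqrt_mat_carrier act_sqrt_pt p)
qed (use T sqrt_mat_carrier in auto)

text \<open>The series needs a matrix scaled below one; here the square root of the scale is put
  back.\<close>

lemma psd_sqrt_scaled:
 assumes "0 < a" shows "psd_sqrt (a \<cdot>\<^sub>m C) = sqrt a \<cdot>\<^sub>m sqrt_mat"
proof (rule psd_sqrt_eq[of _ n])
 show "psd (sqrt a \<cdot>\<^sub>m sqrt_mat)"
  unfolding psd_def
 proof (intro conjI ballI)
  have "transpose_mat sqrt_mat = sqrt_mat" using sqrt_mat_psd by (simp add: psd_def)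
  then have "sqrt_mat $$ (i, j) = sqrt_mat $$ (j, i)" if "i < n" "j < n" for i j
   using that sqrt_mat_carrier by (metis carrier_matD index_transpose_mat(1))
  then show "transpose_mat (sqrt a \<cdot>\<^sub>m sqrt_mat) = sqrt a \<cdot>\<^sub>m sqrt_mat"
   using sqrt_mat_carrier by (intro eq_matI) auto
 next
  fix v :: "real Matrix.vec" assume "v \<in> carrier_vec (dim_row (sqrt a \<cdot>\<^sub>m sqrt_mat))"
  then have v: "v \<in> carrier_vec n" using sqrt_mat_carrier by simp
  have "(sqrt a \<cdot>\<^sub>m sqrt_mat) *\<^sub>v v = sqrt a \<cdot>\<^sub>v (sqrt_mat *\<^sub>v v)"
   using v sqrt_mat_carrier by (intro eq_vecI) (auto simp: scalar_prod_def sum_distrib_left mult.assoc)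
  then show "0 \<le> scalar_prod v (sqrt a \<cdot>\<^sub>m sqrt_mat *\<^sub>v v)"
   using sqrt_mat_psd v sqrt_mat_carrier assms unfolding psd_def by simp
 qed (use sqrt_mat_carrier in auto)
 show "sqrt a \<cdot>\<^sub>m sqrt_mat * (sqrt a \<cdot>\<^sub>m sqrt_mat) = a \<cdot>\<^sub>m C"
  using sqrt_mat_carrier assms
  by (simp add: mult_smult_assoc_mat[of _ n n] mult_smult_distrib[of _ n n] sqrt_mat_sq smult_smult_mat)
 fix T :: "real mat" assume T: "T \<in> carrier_mat n n" "T * (a \<cdot>\<^sub>m C) = a \<cdot>\<^sub>m C * T"
 have "a \<cdot>\<^sub>m (T * C) = a \<cdot>\<^sub>m (C * T)"
  using T(2) by (simp only: mult_smult_distrib[OF T(1) C] mult_smult_assoc_mat[OF C T(1)])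
 then have "(1 / a) \<cdot>\<^sub>m (a \<cdot>\<^sub>m (T * C)) = (1 / a) \<cdot>\<^sub>m (a \<cdot>\<^sub>m (C * T))" by simp
 then have "T * C = C * T" using assms by (simp add: smult_smult_mat one_smult_mat)
 then have "T * sqrt_mat = sqrt_mat * T" by (rule sqrt_mat_commutes[OF T(1)])
 then show "T * (sqrt a \<cdot>\<^sub>m sqrt_mat) = sqrt a \<cdot>\<^sub>m sqrt_mat * T"
  using T(1) sqrt_mat_carrier by (simp add: mult_smult_assoc_mat[of _ n n] mult_smult_distrib[of _ n n])
qed (use sqrt_mat_carrier in auto)

end

section \<open>Odd extension to the torus\<close>

text \<open>Bitwise complement; on a register it is the map from \<open>x\<close> to
  \<open>- 1 - x\<close>.\<close>

definition flip :: "nat list => bits => bits" where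
 "flip ws x = (\<lambda>w. if w \<in> set ws then \<not> x w else x w)"

lemma flip_flip [simp]: "flip ws (flip ws x) = x"
 by (simp add: flip_def fun_eq_iff)

lemma flip_Cons: "w \<notin> set ws ==> flip (w # ws) x = (flip ws x)(w := \<not> x w)"
 by (auto simp: flip_def fun_eq_iff)

lemma flip_upd: "v \<notin> set ws ==> flip ws (x(v := b)) = (flip ws x)(v := b)"
 by (auto simp: flip_def fun_eq_iff)

lemma flip_other [simp]: "v \<notin> set ws ==> flip ws x v = x v"
 by (simp add: flip_def)

lemma flip_incr: "distinct ws ==> flip ws (incr ws x) = decr ws (flip ws x)"
proof (induction ws arbitrary: x)
 case (Cons w ws)
 then have "w \<notin> set ws" and IH: "\<And>x. flip ws (incr ws x) = decr ws (flip ws x)" by auto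
 then show ?case
  by (cases "x w") (simp_all only: flip_Cons[OF \<open>w \<notin> set ws\<close>] flip_upd incr_upd decr_upd IH incr.simps decr.simps if_True if_False
   fun_upd_same fun_upd_upd not_True_eq_False not_False_eq_True simp_thms incr_other)
qed (simp add: flip_def)

text \<open>Adding one to the complement is negation. Zero and the half turn, where all low bits
  vanish, are its fixed points: the two faces of the cube.\<close>

lemma incr_flip_zero: "distinct (ws @ [v]) ==> zero_on (set ws) x ==> incr (ws @ [v]) (flip (ws @ [v]) x) = x"
proof (induction ws arbitrary: x)
 case Nil
 then show ?case by (auto simp: flip_def fun_eq_iff)
next
 case (Cons w ws)
 then have "w \<notin> set (ws @ [v])" by auto
 moreover have "x(w := False) = x" using Cons.prems by (auto simp: fun_eq_iff)
 moreover have "\<not> x w" "incr (ws @ [v]) (flip (ws @ [v]) x) = x" using Cons by auto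
 ultimately show ?case
  by (simp only: append_Cons flip_Cons incr_upd incr.simps fun_upd_same fun_upd_upd if_True not_False_eq_True simp_thms)
qed

text \<open>Off the faces negation exchanges the two halves of the circle.\<close>

lemma incr_flip_last: "distinct (ws @ [v]) ==> \<not> zero_on (set ws) x ==> incr (ws @ [v]) (flip (ws @ [v]) x) v = (\<not> x v)"
proof (induction ws arbitrary: x)
 case (Cons w ws)
 then have w: "w \<notin> set (ws @ [v])" "v \<noteq> w" by auto
 show ?case
 proof (cases "x w")
  case True
  have "incr ((w # ws) @ [v]) (flip ((w # ws) @ [v]) x) = (flip (ws @ [v]) x)(w := True)"
   using True w by (simp only: append_Cons flip_Cons[OF w(1)] incr.simps fun_upd_same fun_upd_upd if_False not_True_eq_False)
  then show ?thesis using w by (simp add: flip_def)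
 next
  case False
  have "incr ((w # ws) @ [v]) (flip ((w # ws) @ [v]) x) = (incr (ws @ [v]) (flip (ws @ [v]) x))(w := False)"
   using False w by (simp only: append_Cons flip_Cons[OF w(1)] incr.simps fun_upd_same fun_upd_upd if_True not_False_eq_True incr_upd[OF w(1)])
  then show ?thesis using w False Cons by simp
 qed
qed simp

text \<open>One half of the circle is left only by stepping onto a face.\<close>

lemma incr_last_change: "distinct (ws @ [v]) ==> incr (ws @ [v]) x v \<noteq> x v ==> zero_on (set ws) (incr (ws @ [v]) x)"
proof (induction ws arbitrary: x)
 case (Cons w ws)
 then have w: "w \<notin> set (ws @ [v])" "v \<noteq> w" by auto
 show ?case
 proof (cases "x w")
  case True
  have e: "incr ((w # ws) @ [v]) x = (incr (ws @ [v]) x)(w := False)"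
   using True w by (simp only: append_Cons incr.simps if_True incr_upd[OF w(1)])
  then have "zero_on (set ws) (incr (ws @ [v]) x)" using Cons w by auto
  then show ?thesis unfolding e by simp
 next
  case False
  have "incr ((w # ws) @ [v]) x = x(w := True)" using False by (simp only: append_Cons incr.simps if_False)
  then show ?thesis using Cons.prems(2) w by simp
 qed
qed simp

lemma incr_flip_disjoint: "set ws \<inter> set vs = {} ==> incr ws (flip vs x) = flip vs (incr ws x)"
proof (induction ws arbitrary: x)
 case (Cons w ws)
 then have w: "w \<notin> set vs" and d: "set ws \<inter> set vs = {}" by auto
 show ?case
  by (cases "x w") (simp_all only: incr.simps flip_other[OF w] if_True if_False flip_upd[OF w, symmetric] Cons.IH[OF d])
qed simp

lemma encodable_flip_list: "distinct ws ==> set ws \<subseteq> {..<s} ==> encodable s (length ws) 1 (\<lambda>f x. f (flip ws x)) (\<lambda>f x. f (flip ws x))"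
proof (induction ws)
 case Nil
 then show ?case using encodable_id by (simp add: flip_def)
next
 case (Cons w ws)
 then have w: "w \<notin> set ws" "w < s" and ws: "distinct ws" "set ws \<subseteq> {..<s}" by auto
 show ?case
  by (rule encodable_eqI[OF encodable_comp[OF encodable_not[OF w(2)] Cons.IH[OF ws]]])
   (simp_all only: flip_Cons[OF w(1)] flip_upd[OF w(1)] flip_other[OF w(1)] list.size add_0_right mult_1 add.commute order_refl plus_nat.add_0 One_nat_def)
qed

context grid
begin

abbreviation "low a \<equiv> [a * l..<a * l + l]"
text \<open>Two's complement negation: the reflection of the torus in direction
  \<open>a\<close>.\<close>

abbreviation "neg a x \<equiv> incr (reg a) (flip (reg a) x)"

definition oddp :: "nat => linop" where "oddp a f = (\<lambda>x. (f x - f (neg a x)) / 2)"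

text \<open>The projection onto functions odd in all three directions; on a function that lives on
  the interior nodes it is one eighth of the odd extension.\<close>

definition Q :: linop where "Q f = oddp 0 (oddp 1 (oddp 2 f))"

lemma neg_neg: "a < 3 ==> neg a (neg a x) = x"
 by (simp add: flip_incr distinct_reg incr_decr)

lemma neg_commute: "a < 3 ==> b < 3 ==> neg a (neg b x) = neg b (neg a x)"
proof (cases "a = b")
 case False
 assume "a < 3" "b < 3"
 then have d: "set (reg a) \<inter> set (reg b) = {}" "set (reg b) \<inter> set (reg a) = {}" using False reg_disjoint by auto
 have "flip (reg a) (flip (reg b) x) = flip (reg b) (flip (reg a) x)" by (auto simp: flip_def fun_eq_iff)
 then show ?thesis using incr_flip_disjoint[OF d(1)] incr_flip_disjoint[OF d(2)] incr_commute_disjoint[OF d(1)] by metis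
qed simp

lemma neg_fixed: "a < 3 ==> zero_on (set (low a)) x ==> neg a x = x"
 using incr_flip_zero[of "low a" "3 * l + a" x] distinct_reg[of a] unfolding reg_def by blast

lemma neg_sign: "a < 3 ==> \<not> zero_on (set (low a)) x ==> neg a x (3 * l + a) = (\<not> x (3 * l + a))"
 using incr_flip_last[of "low a" "3 * l + a" x] distinct_reg[of a] unfolding reg_def by blast

lemma neg_other: "v \<notin> set (reg a) ==> neg a x v = x v"
 by simp

lemma neg_not_fixed: 
 assumes "a < 3" "\<not> zero_on (set (low a)) x" shows "\<not> zero_on (set (low a)) (neg a x)"
proof
 assume "zero_on (set (low a)) (neg a x)"
 then have "neg a x = x" using neg_fixed[OF assms(1), of "neg a x"] neg_neg[OF assms(1)] by metis
 then show False using neg_sign[OF assms] by simp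
qed

lemma low_sub: "set (low a) \<subseteq> set (reg a)" "3 * l + a \<in> set (reg a)"
 by (auto simp: reg_def)

lemma neg_reg_other:
 assumes "a < 3" "b < 3" "a \<noteq> b"
 shows "neg a x (3 * l + b) = x (3 * l + b)" "zero_on (set (low b)) (neg a x) \<longleftrightarrow> zero_on (set (low b)) x"
proof -
 have "neg a x v = x v" if "v \<in> set (reg b)" for v using that reg_disjoint[OF assms] by (intro neg_other) blast
 then show "neg a x (3 * l + b) = x (3 * l + b)" "zero_on (set (low b)) (neg a x) \<longleftrightarrow> zero_on (set (low b)) x"
  using low_sub[of b] by (auto simp del: set_upt)
qed

lemma neg_alpha: "a < 3 ==> alpha (neg a x) = alpha x"
 by (simp add: alpha_def al_notin_reg)

lemma slice_flip: "x \<in> slice s ==> set ws \<subseteq> {..<s} ==> flip ws x \<in> slice s"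
 by (auto simp: slice_def flip_def)

lemma reg_sub': "a < 3 ==> set (reg a) \<subseteq> {..<sz}"
 using reg_sub[of a 0] by simp

lemma slice_neg: "a < 3 ==> x \<in> slice sz ==> neg a x \<in> slice sz"
 by (intro slice_incr slice_flip reg_sub')

lemma lin_oddp: "lin (oddp a)"
 by (simp add: lin_def oddp_def fun_eq_iff field_simps)

lemma lin_Q: "lin Q"
 unfolding Q_def by (intro lin_comp[OF lin_oddp lin_comp[OF lin_oddp lin_oddp]])

lemma ip_neg: "a < 3 ==> ip sz (\<lambda>x. f (neg a x)) g = ip sz f (\<lambda>x. g (neg a x))"
 by (rule ip_perm) (simp_all add: slice_neg neg_neg)

lemma oddp_eq: "oddp a f = (\<lambda>x. (1 / 2) * (f x - f (neg a x)))"
 by (simp add: oddp_def)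

lemma ip_oddp: "a < 3 ==> ip sz (oddp a f) g = ip sz f (oddp a g)"
 unfolding oddp_eq ip_scale_left ip_scale_right ip_diff_left ip_diff_right by (simp add: ip_neg)

lemma oddp_commute: "a < 3 ==> b < 3 ==> oddp a (oddp b f) = oddp b (oddp a f)"
proof
 fix x assume a: "a < 3" "b < 3"
 show "oddp a (oddp b f) x = oddp b (oddp a f) x"
  unfolding oddp_def neg_commute[OF a(2,1), of x] by (simp only: diff_divide_distrib) simp
qed

lemma Q_eq: "a < 3 ==> \<exists>g. Q f = oddp a g"
proof -
 assume "a < 3"
 then consider "a = 0" | "a = 1" | "a = 2" by linarith
 then show ?thesis
 proof cases
  case 2
  have "Q f = oddp 1 (oddp 0 (oddp 2 f))" unfolding Q_def by (rule oddp_commute) simp_all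
  then show ?thesis using 2 by blast
 next
  case 3
  have "Q f = oddp 0 (oddp 2 (oddp 1 f))" unfolding Q_def by (rule arg_cong[OF oddp_commute]) simp_all
  also have "\<dots> = oddp 2 (oddp 0 (oddp 1 f))" by (rule oddp_commute) simp_all
  finally show ?thesis using 3 by blast
 qed (auto simp: Q_def)
qed

lemma Q_fixed: "a < 3 ==> zero_on (set (low a)) x ==> Q f x = 0"
 using Q_eq[of a f] neg_fixed[of a x] by (auto simp: oddp_def simp del: set_upt)

lemma ip_Q: "ip sz (Q f) g = ip sz f (Q g)"
proof -
 have "Q g = oddp 1 (oddp 0 (oddp 2 g))" unfolding Q_def by (rule oddp_commute) simp_all
 also have "\<dots> = oddp 1 (oddp 2 (oddp 0 g))" by (rule arg_cong[OF oddp_commute]) simp_all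
 also have "\<dots> = oddp 2 (oddp 1 (oddp 0 g))" by (rule oddp_commute) simp_all
 finally show ?thesis unfolding Q_def[of f] by (simp add: ip_oddp)
qed

lemma Q_cong:
 assumes "P x" "\<And>a y. a < 3 ==> P y ==> P (neg a y)" "\<And>y. P y ==> f y = g y"
 shows "Q f x = Q g x"
proof -
 have 2: "oddp 2 f y = oddp 2 g y" if "P y" for y using assms that by (simp add: oddp_def)
 have 1: "oddp 1 (oddp 2 f) y = oddp 1 (oddp 2 g) y" if "P y" for y
 proof -
  have "P (neg 1 y)" using that by (rule assms(2)[rotated]) simp
  then show ?thesis by (simp only: oddp_def[of 1] 2[OF that] 2)
 qed
 show ?thesis unfolding Q_def using assms(1) assms(2)[of 0] 1 by (simp add: oddp_def[of 0])
qed

definition Q_cost :: nat where "Q_cost = 3 * (14 * Suc l + 8)"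

lemma encodable_oddp: "a < 3 ==> \<exists>B. encodable sz (14 * Suc l + 8) 1 (oddp a) B"
proof -
 assume a: "a < 3"
 have "encodable sz (length (reg a)) 1 (\<lambda>f x. f (flip (reg a) x)) (\<lambda>f x. f (flip (reg a) x))"
  using a by (intro encodable_flip_list distinct_reg reg_sub')
 moreover have "encodable sz (13 * length (reg a)) 1 (\<lambda>f x. f (incr (reg a) x)) (\<lambda>f x. f (decr (reg a) x))"
  using a by (intro encodable_incr distinct_reg reg_sub')
 ultimately obtain B where "encodable sz (14 * Suc l) 1 (\<lambda>f x. f (neg a x)) B"
  using encodable_comp by (fastforce simp: add.commute)
 from encodable_scale[OF encodable_add[OF encodable_id encodable_uminus[OF this]], of "1 / 2"]
 have "encodable sz (0 + (14 * Suc l + 1) + 2) (1 / 2 * (1 + 1)) (\<lambda>f x. cr (1 / 2) * (f x + - f (neg a x))) (\<lambda>f x. cr (1 / 2) * (f x + - B f x))"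
  by simp
 then show ?thesis by (intro exI, rule encodable_eqI[OF _ _ _ _ refl]) (auto simp: oddp_def)
qed

lemma encodable_Q: "\<exists>B. encodable sz Q_cost 1 Q B"
proof -
 have 3: "(0 :: nat) < 3" "(1 :: nat) < 3" "(2 :: nat) < 3" by auto
 obtain B0 B1 B2 where B: "encodable sz (14 * Suc l + 8) 1 (oddp 0) B0" "encodable sz (14 * Suc l + 8) 1 (oddp 1) B1"
  "encodable sz (14 * Suc l + 8) 1 (oddp 2) B2"
  using 3[THEN encodable_oddp] by blast
 show ?thesis
  by (rule exI, rule encodable_eqI[OF encodable_comp[OF B(1) encodable_comp[OF B(2,3)]] _ _ _ refl]) (simp_all add: Q_cost_def Q_def)
qed

section \<open>Reflection symmetry of the discrete gradient\<close>

lemma fac_perm: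
 assumes "\<And>x. incr (reg b) (\<pi> x) = \<pi> (incr (reg b) x)"
 shows "fac b p (\<lambda>x. f (\<pi> x)) = (\<lambda>x. fac b p f (\<pi> x))"
 by (simp add: fac_def avg_def dif_def shift_def assms)

lemma neg_incr_other: "a < 3 ==> b < 3 ==> a \<noteq> b ==> incr (reg b) (neg a x) = neg a (incr (reg b) x)"
 using reg_disjoint[of a b] reg_disjoint[of b a] by (simp add: incr_flip_disjoint incr_commute_disjoint[of "reg b" "reg a"])

lemma flip_incr_other: "a < 3 ==> b < 3 ==> a \<noteq> b ==> incr (reg b) (flip (reg a) x) = flip (reg a) (incr (reg b) x)"
 using reg_disjoint[of b a] by (simp add: incr_flip_disjoint)

definition sg :: "bool => complex" where "sg p = (if p then - 1 else 1)"

text \<open>An edge is indexed by its lower end. Negation maps the edge from \<open>x\<close> to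
  \<open>x + 1\<close> onto the edge from \<open>- x - 1\<close> to \<open>- x\<close>, so edges are
  reflected by \<open>flip\<close> rather than by \<open>neg\<close>, and a difference changes its
  sign.\<close>

lemma fac_neg: "a < 3 ==> fac a p (\<lambda>x. f (neg a x)) = (\<lambda>x. sg p * fac a p f (flip (reg a) x))"
 by (simp add: fac_def avg_def dif_def shift_def flip_incr distinct_reg incr_decr sg_def fun_eq_iff field_simps)

lemma lin_fac: "a < 3 ==> lin (fac a p)"
 by (rule lin_shiftop[OF shiftop_fac])

lemma facs_neg:
 assumes "a < 3"
 shows "facs3 \<beta> (\<lambda>x. f (neg a x)) = (\<lambda>x. sg (bsel \<beta> a) * facs3 \<beta> f (flip (reg a) x))"
proof -
 obtain p q r where \<beta>: "\<beta> = (p, q, r)" by (cases \<beta>)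
 have n: "fac b c (\<lambda>x. f (neg a x)) = (\<lambda>x. fac b c f (neg a x))" if "b < 3" "a \<noteq> b" for b c f
  by (rule fac_perm) (simp add: neg_incr_other assms that)
 have k: "fac b c (\<lambda>x. sg d * f (flip (reg a) x)) = (\<lambda>x. sg d * fac b c f (flip (reg a) x))" if "b < 3" "a \<noteq> b" for b c d f
  unfolding lin_scale[OF lin_fac[OF that(1)]] using fac_perm[of b "flip (reg a)" c f] flip_incr_other[OF assms that] by simp
 consider "a = 0" | "a = 1" | "a = 2" using assms by linarith
 then show ?thesis
 proof cases
  case 1
  then show ?thesis unfolding \<beta> facs_3 using n[of 1] n[of 2] fac_neg[OF assms] by (simp add: bsel_def)
 next
  case 2
  then show ?thesis unfolding \<beta> facs_3 using n[of 2] k[of 0] fac_neg[OF assms] by (simp add: bsel_def)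
 next
  case 3
  then show ?thesis unfolding \<beta> facs_3 using k[of 0] k[of 1] fac_neg[OF assms] by (simp add: bsel_def)
 qed
qed

definition phys :: "bits => bool" where
 "phys x \<longleftrightarrow> x \<in> slice sz \<and> alpha x = z3 \<and> (\<forall>a<3. \<not> x (3 * l + a))"

text \<open>A vanishing register means a face of the cube, so these points are exactly the images of
  the mesh nodes.\<close>

definition interior :: "bits => bool" where
 "interior x \<longleftrightarrow> phys x \<and> (\<forall>a<3. \<not> zero_on (set (low a)) x)"

definition form :: "(bits => real) => state => state => complex" where
 "form \<theta> f g = ip sz (igrad f) (\<lambda>x. cr (\<theta> x) * igrad g x)"

abbreviation "spike y \<equiv> (\<lambda>x. if x = y then 1 else 0 :: complex)"

lemma form_commute: "form \<theta> f g = cnj (form \<theta> g f)"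
 unfolding form_def ip_cnj by (simp add: ip_def mult_ac)

lemma igrad_neg:
 assumes "a < 3"
 shows "igrad (\<lambda>x. f (neg a x)) x = sg (bsel (alpha x) a) * igrad f (flip (reg a) x)"
proof -
 have "put z3 (flip (reg a) x) = flip (reg a) (put z3 x)" "alpha (flip (reg a) x) = alpha x"
  using assms by (simp_all add: put_def flip_upd al_notin_reg alpha_def)
 then show ?thesis by (simp only: grad_def comb_def facs_neg[OF assms] of_real_1 mult_1)
qed

text \<open>The sign of a reflected difference is its own inverse and moves to the other argument;
  the coefficient is invariant under \<open>flip\<close>, the reflection of the cells.\<close>

lemma form_neg:
 assumes "a < 3" and \<theta>: "\<And>x. \<theta> (flip (reg a) x) = \<theta> x"
 shows "form \<theta> f (\<lambda>x. g (neg a x)) = form \<theta> (\<lambda>x. f (neg a x)) g"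
proof -
 let ?c = "\<lambda>x. sg (bsel (alpha x) a)"
 have c: "?c (flip (reg a) x) = ?c x" "cnj (?c x) = ?c x" for x
  using assms(1) by (simp_all add: alpha_def al_notin_reg sg_def)
 have "form \<theta> f (\<lambda>x. g (neg a x)) = ip sz (\<lambda>x. ?c x * igrad f x) (\<lambda>x. cr (\<theta> (flip (reg a) x)) * igrad g (flip (reg a) x))"
  unfolding form_def igrad_neg[OF assms(1)] \<theta> ip_def by (intro sum.cong refl) (simp only: complex_cnj_mult c mult_ac)
 also have "\<dots> = ip sz (\<lambda>x. ?c (flip (reg a) x) * igrad f (flip (reg a) x)) (\<lambda>x. cr (\<theta> x) * igrad g x)"
  by (rule ip_perm[symmetric]) (use assms in \<open>simp_all add: slice_flip reg_sub'\<close>)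
 finally show ?thesis unfolding form_def igrad_neg[OF assms(1)] c .
qed

lemma form_diff_left: "form \<theta> (\<lambda>x. f x - g x) h = form \<theta> f h - form \<theta> g h"
 and form_diff_right: "form \<theta> h (\<lambda>x. f x - g x) = form \<theta> h f - form \<theta> h g"
 and form_scale_left: "form \<theta> (\<lambda>x. c * f x) h = cnj c * form \<theta> f h"
 and form_scale_right: "form \<theta> h (\<lambda>x. c * f x) = c * form \<theta> h f"
 unfolding form_def lin_diff[OF lin_grad] lin_scale[OF lin_grad] right_diff_distrib mult.left_commute[of _ c]
 by (simp_all only: ip_diff_left ip_diff_right ip_scale_left ip_scale_right)

lemma form_oddp:
 assumes "a < 3" "\<And>x. \<theta> (flip (reg a) x) = \<theta> x"
 shows "form \<theta> f (oddp a g) = form \<theta> (oddp a f) g"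
 unfolding oddp_eq form_scale_left form_scale_right form_diff_left form_diff_right form_neg[where a = a and \<theta> = \<theta>, OF assms] by simp

lemma form_Q:
 assumes "\<And>a x. a < 3 ==> \<theta> (flip (reg a) x) = \<theta> x"
 shows "form \<theta> f (Q g) = form \<theta> (Q f) g"
proof -
 have "Q f = oddp 1 (oddp 0 (oddp 2 f))" unfolding Q_def by (rule oddp_commute) simp_all
 also have "\<dots> = oddp 1 (oddp 2 (oddp 0 f))" by (rule arg_cong[OF oddp_commute]) simp_all
 also have "\<dots> = oddp 2 (oddp 1 (oddp 0 f))" by (rule oddp_commute) simp_all
 finally show ?thesis unfolding Q_def[of g] by (simp add: form_oddp assms)
qed

lemma fac_support:
 assumes "fac b p f x \<noteq> 0" shows "f x \<noteq> 0 \<or> f (incr (reg b) x) \<noteq> 0"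
 using assms by (auto simp: fac_def avg_def dif_def shift_def split: if_splits)

text \<open>A step changes the half only by landing on a face (\<open>incr_last_change\<close>), and
  \<open>f\<close> vanishes there. The edges that feel \<open>f\<close> thus lie in the same
  half.\<close>

lemma facs_support:
 assumes "a < 3" and f: "\<And>x. f x \<noteq> 0 ==> x (3 * l + a) = \<sigma> \<and> \<not> zero_on (set (low a)) x" and nz: "facs [0, 1, 2] b f x \<noteq> 0"
 shows "x (3 * l + a) = \<sigma>"
proof -
 let ?P = "\<lambda>x. x (3 * l + a) = \<sigma> \<and> \<not> zero_on (set (low a)) x"
 let ?P' = "\<lambda>x. x (3 * l + a) = \<sigma>"
 have other: "incr (reg c) x v = x v" if "c < 3" "c \<noteq> a" "v \<in> set (reg a)" for c x v
  using reg_disjoint[OF that(1) assms(1) that(2)] that(3) by (intro incr_other) blast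
 have oP: "?P (incr (reg c) x) \<longleftrightarrow> ?P x" if "c < 3" "c \<noteq> a" for c x
  using other[OF that] low_sub[of a] by (auto simp del: set_upt)
 have oP': "?P' (incr (reg c) x) \<longleftrightarrow> ?P' x" if "c < 3" "c \<noteq> a" for c x
  using other[OF that] low_sub[of a] by (auto simp del: set_upt)
 have same: "?P' x" if "?P (incr (reg a) x)" for x
  using incr_last_change[of "low a" "3 * l + a" x] distinct_reg[OF assms(1)] that unfolding reg_def by blast
 have 2: "(a \<noteq> 2 \<longrightarrow> ?P x) \<and> ?P' x" if "fac 2 (b 2) f x \<noteq> 0" for x
  using fac_support[OF that] f[of x] f[of "incr (reg 2) x"] oP[of 2 x] same[of x] by (cases "a = 2") auto
 have 1: "(a \<noteq> 2 \<and> a \<noteq> 1 \<longrightarrow> ?P x) \<and> ?P' x" if "fac 1 (b 1) (fac 2 (b 2) f) x \<noteq> 0" for x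
  using fac_support[OF that] 2[of x] 2[of "incr (reg 1) x"] oP[of 1 x] oP'[of 1 x] same[of x] by (cases "a = 1") auto
 have nz: "fac 0 (b 0) (fac 1 (b 1) (fac 2 (b 2) f)) x \<noteq> 0" using nz by (simp add: facs_def)
 show ?thesis
  using fac_support[OF nz] 1[of x] 1[of "incr (reg 0) x"] oP'[of 0 x] same[of x] assms(1) by (cases "a = 0") auto
qed

lemma igrad_support:
 assumes "a < 3" and f: "\<And>x. f x \<noteq> 0 ==> x (3 * l + a) = \<sigma> \<and> \<not> zero_on (set (low a)) x" and nz: "igrad f x \<noteq> 0"
 shows "x (3 * l + a) = \<sigma>"
proof -
 have "put z3 x (3 * l + a) = \<sigma>"
  by (rule facs_support[OF assms(1) f]) (use nz in \<open>auto simp: grad_def comb_def\<close>)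
 then show ?thesis using assms(1) by (simp add: put_def al_def)
qed

text \<open>Points in different octants do not interact: their gradients have disjoint
  supports.\<close>

lemma form_spike_0:
 assumes u: "\<And>x. u x \<noteq> 0 ==> interior x" and x: "x \<in> slice sz" "\<And>a. a < 3 ==> \<not> zero_on (set (low a)) x" "\<not> interior x"
 shows "form \<theta> (spike x) u = 0"
proof (cases "alpha x = z3")
 case False
 then have 0: "proj (spike x) = (\<lambda>_. 0)" by (intro ext) (auto simp: proj_def)
 have "igrad (spike x) = igrad (proj (spike x))" by (rule grad_proj[symmetric])
 also have "\<dots> = (\<lambda>_. 0)" unfolding 0 by (rule lin_zero[OF lin_grad])
 finally show ?thesis by (simp add: form_def ip_def)
next
 case True
 then obtain a where a: "a < 3" "x (3 * l + a)" using x by (auto simp: interior_def phys_def)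
 have "igrad (spike x) y = 0 \<or> igrad u y = 0" for y
 proof (rule ccontr)
  assume "\<not> ?thesis"
  then have n: "igrad (spike x) y \<noteq> 0" "igrad u y \<noteq> 0" by auto
  have "y (3 * l + a) = True" by (rule igrad_support[OF a(1) _ n(1)]) (use a x in \<open>auto split: if_splits\<close>)
  moreover have "y (3 * l + a) = False"
   by (rule igrad_support[OF a(1) _ n(2)]) (use a(1) u in \<open>auto simp: interior_def phys_def\<close>)
  ultimately show False by simp
 qed
 then have "cnj (igrad (spike x) y) * (cr (\<theta> y) * igrad u y) = 0" for y by (metis complex_cnj_zero mult_zero_left mult_zero_right)
 then show ?thesis unfolding form_def ip_def by (intro sum.neutral) blast
qed

lemma ip_spike: "x \<in> slice s ==> ip s (spike x) f = f x"
 by (simp add: ip_def if_distrib[of cnj] if_distrib[of "\<lambda>c. c * _"] cong: if_cong)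

text \<open>Odd extension intertwines the Dirichlet problem on the cube with the problem on the torus.\<close>
theorem form_odd_extension:
 assumes \<theta>: "\<And>a x. a < 3 ==> \<theta> (flip (reg a) x) = \<theta> x" and u: "\<And>x. u x \<noteq> 0 ==> interior x"
 shows "form \<theta> f (Q u) = ip sz f (Q (\<lambda>x. if interior x then form \<theta> (spike x) u else 0))"
proof -
 obtain G' where "encodable sz igrad_cost 8 igrad G'" using encodable_igrad by blast
 note oG = encodable_oper[OF this]
 \<comment> \<open>The torus operator applied to \<open>u\<close>, without boundary
   conditions.\<close>
 define h where "h = G' (\<lambda>x. cr (\<theta> x) * igrad u x)"
 have h: "form \<theta> g u = ip sz g h" for g
  unfolding form_def h_def by (rule operD(4)[OF oG])
 have hx: "h x = form \<theta> (spike x) u" if "x \<in> slice sz" for x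
  unfolding h by (simp add: ip_spike that)
 \<comment> \<open>Odd functions vanish on the faces; elsewhere \<open>Q\<close> sees only mirror
   images off the faces, and among these \<open>h\<close> vanishes outside the interior.\<close>
 have "Q h x = Q (\<lambda>x. if interior x then form \<theta> (spike x) u else 0) x" if x: "x \<in> slice sz" for x
 proof (cases "\<exists>a<3. zero_on (set (low a)) x")
  case True
  then show ?thesis using Q_fixed by (metis (no_types, lifting))
 next
  case False
  let ?P = "\<lambda>x. x \<in> slice sz \<and> (\<forall>a<3. \<not> zero_on (set (low a)) x)"
  show ?thesis
  proof (rule Q_cong[where P = ?P])
   show "?P x" using False x by blast
   show "?P (neg a y)" if "a < 3" "?P y" for a y
   proof (intro conjI allI impI)
    fix b :: nat assume "b < 3"
    then show "\<not> zero_on (set (low b)) (neg a y)"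
     using that neg_not_fixed[of a y] neg_reg_other(2)[of a b y] by (cases "a = b") blast+
   qed (use that slice_neg in blast)
   show "h y = (if interior y then form \<theta> (spike y) u else 0)" if "?P y" for y
    using that form_spike_0[where u = u and x = y and \<theta> = \<theta>, OF u] hx[of y] by auto
  qed
 qed
 then have "ip sz f (Q h) = ip sz f (Q (\<lambda>x. if interior x then form \<theta> (spike x) u else 0))"
  unfolding ip_def by (intro sum.cong) auto
 moreover have "form \<theta> f (Q u) = ip sz f (Q h)"
  using form_Q[of \<theta> f u, OF \<theta>] h[of "Q f"] ip_Q[of f h] by (simp only:)
 ultimately show ?thesis by simp
qed

text \<open>Every proper mirror image of an interior point has some wire \<open>3 * l + a\<close>
  set, where \<open>w\<close> vanishes; of the eight terms only the identity survives, with factor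
  1/8.\<close>

lemma Q_restrict:
 assumes w: "\<And>x. w x \<noteq> 0 ==> interior x" and x: "phys x"
 shows "8 * Q w x = w x"
proof (cases "interior x")
 case False
 then have "w x = 0" using w by blast
 moreover have "\<exists>a<3. zero_on (set (low a)) x" using False x by (simp add: interior_def)
 ultimately show ?thesis using Q_fixed by (metis (no_types, lifting) mult_zero_right)
next
 case True
 have 3: "(0 :: nat) < 3" "(1 :: nat) < 3" "(2 :: nat) < 3" by auto
 have nx: "\<not> zero_on (set (low a)) x" "\<not> x (3 * l + a)" if "a < 3" for a
  using True that by (simp_all add: interior_def phys_def del: set_upt)
 have z: "w y = 0" if "a < 3" "y (3 * l + a)" for a y
  using w[of y] that by (auto simp: interior_def phys_def)
 have s: "neg a x (3 * l + a)" if "a < 3" for a using neg_sign[OF that nx(1)[OF that]] nx(2)[OF that] by simp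
 have s2: "neg b (neg a x) (3 * l + a)" if "a < 3" "b < 3" "b \<noteq> a" for a b
  using s[OF that(1)] neg_reg_other(1)[OF that(2,1,3)] by simp
 have z1: "w (neg a x) = 0" if "a < 3" for a by (rule z[of a "neg a x", OF that s[OF that]])
 have z2: "w (neg b (neg a x)) = 0" if "a < 3" "b < 3" "b \<noteq> a" for a b by (rule z[of a "neg b (neg a x)", OF that(1) s2[OF that]])
 have zs: "w (neg 0 x) = 0" "w (neg 1 x) = 0" "w (neg 2 x) = 0" "w (neg 2 (neg 1 x)) = 0" "w (neg 2 (neg 0 x)) = 0" "w (neg 1 (neg 0 x)) = 0"
  by (rule z1 z2; simp)+
 have "neg 2 (neg 1 (neg 0 x)) (3 * l + 0) = neg 1 (neg 0 x) (3 * l + 0)"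
  by (rule neg_reg_other(1)) simp_all
 moreover have "neg 1 (neg 0 x) (3 * l + 0)" by (rule s2) simp_all
 ultimately have "neg 2 (neg 1 (neg 0 x)) (3 * l + 0)" by blast
 then have zd: "w (neg 2 (neg 1 (neg 0 x))) = 0" by (rule z[of 0 "neg 2 (neg 1 (neg 0 x))", OF 3(1)])
 then show ?thesis unfolding Q_def by (simp only: oddp_def zs zd) simp
qed

end

subsection \<open>Spectral gap of the mass matrix\<close>

context grid
begin

lemma parallelogram: "(cmod ((u - v) / 2))\<^sup>2 + (cmod ((u + v) / 2))\<^sup>2 = ((cmod u)\<^sup>2 + (cmod v)\<^sup>2) / 2"
 by (simp add: norm_divide power_divide cmod_power2) (simp add: power2_eq_square field_simps)

lemma fac_pointwise:
 "(cmod (fac a True f x))\<^sup>2 + (cmod (fac a False f x))\<^sup>2 = ((cmod (f x))\<^sup>2 + (cmod (f (incr (reg a) x)))\<^sup>2) / 2"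
 using parallelogram[of "f x" "f (incr (reg a) x)"] by (simp add: fac_def avg_def dif_def shift_def)

lemma sum_bool: "(\<Sum>p\<in>UNIV. g p) = g True + (g False :: real)"
 by (simp add: UNIV_bool add.commute)

definition corner :: "bool \<times> bool \<times> bool => bits => bits" where
 "corner = (\<lambda>(p, q, r) x. let x = (if p then incr (reg 0) x else x); x = (if q then incr (reg 1) x else x)
   in if r then incr (reg 2) x else x)"

text \<open>The pointwise form of the isometry: on each cell the eight components carry the mean
  square of the eight corner values.\<close>

lemma sum_facs_pointwise:
 "(\<Sum>\<beta>\<in>UNIV. (cmod (facs3 \<beta> f x))\<^sup>2) = (\<Sum>e\<in>UNIV. (cmod (f (corner e x)))\<^sup>2) / 8"
proof -
 have ar: "a1 + a2 + (b1 + b2) = (u + v + w + z) / 4"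
  if "a1 + b1 = (p1 + p2) / 2" "a2 + b2 = (q1 + q2) / 2" "p1 + q1 = (u + v) / 2" "p2 + q2 = (w + z) / 2"
  for a1 a2 b1 b2 p1 p2 q1 q2 u v w z :: real using that by (simp add: field_simps)
 have ar': "a1 + a2 + (a3 + a4) + (b1 + b2 + (b3 + b4)) = (u1 + u2 + (u3 + u4) + (v1 + v2 + (v3 + v4))) / 2"
  if "a1 + b1 = (u1 + v1) / 2" "a2 + b2 = (u2 + v2) / 2" "a3 + b3 = (u3 + v3) / 2" "a4 + b4 = (u4 + v4) / 2"
  for a1 a2 a3 a4 b1 b2 b3 b4 u1 u2 u3 u4 v1 v2 v3 v4 :: real using that by (simp add: field_simps)
 have 1: "(\<Sum>q\<in>UNIV. \<Sum>r\<in>UNIV. (cmod (fac 1 q (fac 2 r f) y))\<^sup>2)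
  = ((cmod (f y))\<^sup>2 + (cmod (f (incr (reg 2) y)))\<^sup>2 + (cmod (f (incr (reg 1) y)))\<^sup>2 + (cmod (f (incr (reg 2) (incr (reg 1) y))))\<^sup>2) / 4" for y
  unfolding sum_bool by (rule ar[OF fac_pointwise fac_pointwise fac_pointwise fac_pointwise])
 have "(\<Sum>p\<in>UNIV. \<Sum>q\<in>UNIV. \<Sum>r\<in>UNIV. (cmod (fac 0 p (fac 1 q (fac 2 r f)) x))\<^sup>2)
  = ((\<Sum>q\<in>UNIV. \<Sum>r\<in>UNIV. (cmod (fac 1 q (fac 2 r f) x))\<^sup>2) + (\<Sum>q\<in>UNIV. \<Sum>r\<in>UNIV. (cmod (fac 1 q (fac 2 r f) (incr (reg 0) x)))\<^sup>2)) / 2"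
  unfolding sum_bool by (rule ar'[OF fac_pointwise fac_pointwise fac_pointwise fac_pointwise])
 note e = this[unfolded 1]
 show ?thesis
  unfolding sum_bool3 facs_3 e unfolding sum_bool corner_def Let_def prod.case if_True if_False by (simp add: field_simps)
qed

lemma fac_support': "fac b p f x \<noteq> 0 ==> \<exists>e. f (if e then incr (reg b) x else x) \<noteq> 0"
 using fac_support[of b p f x] by (metis (full_types))

lemma facs_corner:
 assumes "facs [0, 1, 2] b f x \<noteq> 0" shows "\<exists>e. f (corner e x) \<noteq> 0"
proof -
 have "fac 0 (b 0) (fac 1 (b 1) (fac 2 (b 2) f)) x \<noteq> 0" using assms by (simp add: facs_def)
 from fac_support'[OF this] obtain p where "fac 1 (b 1) (fac 2 (b 2) f) (if p then incr (reg 0) x else x) \<noteq> 0" by blast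
 from fac_support'[OF this] obtain q where "fac 2 (b 2) f (if q then incr (reg 1) (if p then incr (reg 0) x else x) else (if p then incr (reg 0) x else x)) \<noteq> 0" by blast
 from fac_support'[OF this] obtain r where "f (corner (p, q, r) x) \<noteq> 0"
  unfolding corner_def Let_def prod.case by blast
 then show ?thesis by blast
qed

text \<open>A node where the form can produce a nonzero value is a corner of a cell with positive
  coefficient. On such a cell the form dominates \<open>c\<close> times the mean square of the
  corner values, and every node in the support of \<open>q\<close> is met at least once; hence
  \<open>c / 8\<close>.\<close>

lemma form_gap:
 assumes \<theta>: "\<And>x. \<theta> x = 0 \<or> c \<le> \<theta> x" "0 < c" "\<And>\<beta> x. 0 < \<theta> (put \<beta> x) \<longleftrightarrow> 0 < \<theta> x"
  and q: "\<And>x. q x \<noteq> 0 ==> interior x \<and> form \<theta> (spike x) u \<noteq> 0"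
 shows "c / 8 * (nrm sz q)\<^sup>2 \<le> (\<Sum>x\<in>slice sz. \<theta> x * (cmod (igrad q x))\<^sup>2)"
proof -
 define I where "I = {x \<in> slice sz. alpha x = z3 \<and> 0 < \<theta> x} \<times> (UNIV :: (bool \<times> bool \<times> bool) set)"
 have fin: "finite I" by (simp add: I_def)
 have \<theta>0: "0 \<le> \<theta> x" for x using \<theta>(1)[of x] \<theta>(2) by auto
 have "(nrm sz q)\<^sup>2 = (\<Sum>x\<in>{x \<in> slice sz. q x \<noteq> 0}. (cmod (q x))\<^sup>2)"
  unfolding nrm_sq by (intro sum.mono_neutral_right) auto
 also have "\<dots> \<le> (\<Sum>y\<in>(\<lambda>(x, e). corner e x) ` I. (cmod (q y))\<^sup>2)"
 proof (rule sum_mono2)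
  show "{x \<in> slice sz. q x \<noteq> 0} \<subseteq> (\<lambda>(x, e). corner e x) ` I"
  proof
   fix y assume "y \<in> {x \<in> slice sz. q x \<noteq> 0}"
   then have y: "form \<theta> (spike y) u \<noteq> 0" using q by blast
   then obtain x where x: "x \<in> slice sz" "cnj (igrad (spike y) x) * (cr (\<theta> x) * igrad u x) \<noteq> 0"
    unfolding form_def ip_def by (rule sum.not_neutral_contains_not_neutral)
   then have "0 < \<theta> x" "facs3 (alpha x) (spike y) (put z3 x) \<noteq> 0"
    using \<theta>0[of x] by (auto simp: grad_def comb_def)
   then obtain e where "spike y (corner e (put z3 x)) \<noteq> 0" using facs_corner by blast
   moreover have "(put z3 x, e) \<in> I" using x(1) \<open>0 < \<theta> x\<close> \<theta>(3) by (simp add: I_def slice_put)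
   ultimately show "y \<in> (\<lambda>(x, e). corner e x) ` I" by (auto split: if_splits intro: rev_image_eqI)
  qed
 qed (use fin in auto)
 also have "\<dots> \<le> sum ((\<lambda>y. (cmod (q y))\<^sup>2) \<circ> (\<lambda>(x, e). corner e x)) I"
  by (rule sum_image_le) (use fin in auto)
 also have "\<dots> = (\<Sum>x\<in>{x \<in> slice sz. alpha x = z3 \<and> 0 < \<theta> x}. \<Sum>e\<in>UNIV. (cmod (q (corner e x)))\<^sup>2)"
  unfolding I_def sum.cartesian_product by (intro sum.cong refl) auto
 also have "\<dots> = 8 * (\<Sum>x\<in>{x \<in> slice sz. alpha x = z3 \<and> 0 < \<theta> x}. \<Sum>\<beta>\<in>UNIV. (cmod (facs3 \<beta> q x))\<^sup>2)"
  unfolding sum_facs_pointwise sum_divide_distrib[symmetric] by simp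
 finally have 8: "(nrm sz q)\<^sup>2 \<le> 8 * (\<Sum>x\<in>{x \<in> slice sz. alpha x = z3 \<and> 0 < \<theta> x}. \<Sum>\<beta>\<in>UNIV. (cmod (facs3 \<beta> q x))\<^sup>2)" .
 have 1: "c / 8 * (nrm sz q)\<^sup>2 \<le> (\<Sum>x\<in>{x \<in> slice sz. alpha x = z3 \<and> 0 < \<theta> x}. \<Sum>\<beta>\<in>UNIV. c * (cmod (facs3 \<beta> q x))\<^sup>2)"
  unfolding sum_distrib_left[symmetric] using mult_left_mono[OF 8, of "c / 8"] \<theta>(2) by (simp only: mult.assoc[symmetric]) simp
 have "(\<Sum>x\<in>slice sz. \<theta> x * (cmod (igrad q x))\<^sup>2) = (\<Sum>\<beta>\<in>UNIV. \<Sum>x\<in>{x \<in> slice sz. alpha x = z3}. \<theta> (put \<beta> x) * (cmod (facs3 \<beta> q x))\<^sup>2)"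
  unfolding sum_slice_put by (intro sum.cong refl) (auto simp: grad_def comb_def put_z3)
 also have "\<dots> = (\<Sum>x\<in>{x \<in> slice sz. alpha x = z3}. \<Sum>\<beta>\<in>UNIV. \<theta> (put \<beta> x) * (cmod (facs3 \<beta> q x))\<^sup>2)"
  by (rule sum.swap)
 also have "\<dots> \<ge> (\<Sum>x\<in>{x \<in> slice sz. alpha x = z3 \<and> 0 < \<theta> x}. \<Sum>\<beta>\<in>UNIV. \<theta> (put \<beta> x) * (cmod (facs3 \<beta> q x))\<^sup>2)"
  by (intro sum_mono2 sum_nonneg) (auto simp: \<theta>0)
 finally have 2: "(\<Sum>x\<in>{x \<in> slice sz. alpha x = z3 \<and> 0 < \<theta> x}. \<Sum>\<beta>\<in>UNIV. \<theta> (put \<beta> x) * (cmod (facs3 \<beta> q x))\<^sup>2)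
  \<le> (\<Sum>x\<in>slice sz. \<theta> x * (cmod (igrad q x))\<^sup>2)" .
 have "(\<Sum>x\<in>{x \<in> slice sz. alpha x = z3 \<and> 0 < \<theta> x}. \<Sum>\<beta>\<in>UNIV. c * (cmod (facs3 \<beta> q x))\<^sup>2)
  \<le> (\<Sum>x\<in>{x \<in> slice sz. alpha x = z3 \<and> 0 < \<theta> x}. \<Sum>\<beta>\<in>UNIV. \<theta> (put \<beta> x) * (cmod (facs3 \<beta> q x))\<^sup>2)"
 proof (intro sum_mono mult_right_mono)
  fix x \<beta> assume "x \<in> {x \<in> slice sz. alpha x = z3 \<and> 0 < \<theta> x}"
  then have "0 < \<theta> (put \<beta> x)" using \<theta>(3) by simp
  then show "c \<le> \<theta> (put \<beta> x)" using \<theta>(1)[of "put \<beta> x"] by auto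
 qed simp
 with 1 2 show ?thesis by linarith
qed

end

text \<open>The interface between algorithm and finite elements. The strict
  \<open>wmin < wmax\<close> keeps the contraction factor of the solver positive, as a normalisation
  must be. The positivity of \<open>C\<close> does not depend on the selectors because
  \<open>form_gap\<close> compares all components of a cell.\<close>

locale model = grid l + node_points "grid.sz l" n pt for l n pt +
 fixes W C :: "bits => real" and wmin wmax cmin cmax t :: real and vs :: "nat list" and AM CM :: "real mat"
 assumes pts: "pt ` {..<n} = {x. interior x}"
  and W: "\<And>x. wmin \<le> W x" "\<And>x. W x \<le> wmax" "0 < wmin" "wmin < wmax" "\<And>a x. a < 3 ==> W (flip (reg a) x) = W x"
   "\<And>x y. (\<forall>w\<in>set vs. x w = y w) ==> W x = W y"
  and C: "\<And>x. C x = 0 \<or> cmin \<le> C x" "\<And>x. C x \<le> cmax" "0 < cmin" "cmin \<le> cmax" "\<And>a x. a < 3 ==> C (flip (reg a) x) = C x"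
   "\<And>x y. (\<forall>w\<in>set vs. x w = y w) ==> C x = C y" "\<And>\<beta> x. 0 < C (put \<beta> x) \<longleftrightarrow> 0 < C x"
  and vs: "distinct vs" "set vs \<subseteq> {..<sz}" and t: "0 < t"
  and mats: "AM \<in> carrier_mat n n" "CM \<in> carrier_mat n n"
   "\<And>p q. p < n ==> q < n ==> cr (AM $$ (p, q)) = t * form (\<lambda>x. W x * om (alpha x)) (delta p) (delta q)"
   "\<And>p q. p < n ==> q < n ==> cr (CM $$ (p, q)) = t * form C (delta p) (delta q)"
begin

lemma interior_pt: "interior x \<longleftrightarrow> (\<exists>p<n. x = pt p)"
 using pts by auto

lemma mask_interior: "mask f x = (if interior x then f x else 0)"
proof (cases "interior x")
 case True
 then obtain p where "p < n" "x = pt p" using interior_pt by blast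
 then show ?thesis using True by (simp add: mask_pt)
next
 case False
 then show ?thesis by (auto simp: mask_def delta_def interior_pt intro: sum.neutral)
qed

lemma delta_spike: "delta p = spike (pt p)"
 by (simp add: delta_def fun_eq_iff)

lemma form_mask_right: "form \<theta> h (mask f) = (\<Sum>q<n. f (pt q) * form \<theta> h (delta q))"
proof -
 have "igrad (mask f) = (\<lambda>x. \<Sum>q<n. f (pt q) * igrad (delta q) x)"
  unfolding mask_def[abs_def] lin_sum[OF lin_grad finite_lessThan] lin_scale[OF lin_grad] ..
 then show ?thesis
  unfolding form_def by (simp only: sum_distrib_left mult.left_commute[of "cr _"] ip_sum_right ip_scale_right)
qed

lemma act_form:
 assumes "\<And>p q. p < n ==> q < n ==> cr (M $$ (p, q)) = cr r * form \<theta> (delta p) (delta q)"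
 shows "act M g x = (if interior x then cr r * form \<theta> (spike x) (mask g) else 0)"
proof (cases "interior x")
 case True
 then obtain p where p: "p < n" "x = pt p" using interior_pt by blast
 have "act M g x = (\<Sum>q<n. cr r * (g (pt q) * form \<theta> (delta p) (delta q)))"
  unfolding p(2) act_pt[OF p(1)] using assms[OF p(1)] by (intro sum.cong) auto
 then show ?thesis using True p(2) by (simp add: form_mask_right delta_spike sum_distrib_left)
next
 case False
 then show ?thesis using mask_interior[of "act M g" x] by simp
qed

lemma ip_act_form:
 assumes "\<And>p q. p < n ==> q < n ==> cr (M $$ (p, q)) = cr r * form \<theta> (delta p) (delta q)"
 shows "ip sz f (act M g) = cr r * form \<theta> (mask f) (mask g)"
proof -
 have "ip sz f (act M g) = ip sz (mask f) (act M g)" unfolding ip_mask_swap by simp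
 also have "\<dots> = (\<Sum>p<n. cnj (f (pt p)) * (cr r * form \<theta> (delta p) (mask g)))"
  unfolding ip_mask by (intro sum.cong refl) (simp add: act_form[OF assms] interior_pt delta_spike, blast)
 also have "\<dots> = cr r * cnj (\<Sum>p<n. f (pt p) * form \<theta> (mask g) (delta p))"
  by (simp add: sum_distrib_left mult.left_commute form_commute[of _ _ "mask g", symmetric])
 also have "\<dots> = cr r * cnj (form \<theta> (mask g) (mask f))" unfolding form_mask_right ..
 finally show ?thesis by (simp add: form_commute[of _ "mask f"])
qed

lemma odd_act:
 assumes "\<And>p q. p < n ==> q < n ==> cr (M $$ (p, q)) = cr r * form \<theta> (delta p) (delta q)"
  and "\<And>a x. a < 3 ==> \<theta> (flip (reg a) x) = \<theta> x"
 shows "ip sz f (Q (act M g)) = cr r * form \<theta> f (Q (mask g))"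
proof -
 have "act M g = (\<lambda>x. cr r * (if interior x then form \<theta> (spike x) (mask g) else 0))"
  by (rule ext) (simp add: act_form[of M r \<theta>, OF assms(1)])
 moreover have "form \<theta> f (Q (mask g)) = ip sz f (Q (\<lambda>x. if interior x then form \<theta> (spike x) (mask g) else 0))"
  by (rule form_odd_extension[OF assms(2)]) (auto simp: mask_interior split: if_splits)
 ultimately show ?thesis by (simp add: lin_scale[OF lin_Q] ip_scale_right)
qed

text \<open>The squared normalisation of \<open>B\<close>: \<open>cmax\<close> from the coefficient,
  \<open>8\<^sup>2\<close> from \<open>igrad\<close>.\<close>

definition \<kappa> :: real where "\<kappa> = 64 * cmax"

text \<open>A factor of the mass form: \<open>B' B\<close> is its operator on the torus, and
  \<open>1 - B' B / \<kappa>\<close> is then a complement, of normalisation one.\<close>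

definition B :: linop where
 "B f = (\<lambda>x. cr (sqrt (C x)) * igrad f x)"

definition B' :: linop where
 "B' = (SOME B'. encodable sz (2 ^ length vs * (14 * length vs + 5) + igrad_cost) (sqrt \<kappa>) B B')"

lemma C_nonneg: "0 \<le> C x"
 using C(1)[of x] C(3) by auto

lemma \<kappa>_pos: "0 < \<kappa>" "cmin \<le> \<kappa>"
 using C(3,4) by (auto simp: \<kappa>_def)

definition B_cost :: nat where "B_cost = 2 ^ length vs * (14 * length vs + 5) + igrad_cost"

lemma encodable_B: "encodable sz B_cost (sqrt \<kappa>) B B'"
proof -
 have "encodable sz (2 ^ length vs * (14 * length vs + 5)) (sqrt cmax) (\<lambda>f x. cr (sqrt (C x)) * f x) (\<lambda>f x. cr (sqrt (C x)) * f x)"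
 proof (rule encodable_diag[OF _ _ _ vs])
  show "\<bar>sqrt (C x)\<bar> \<le> sqrt cmax" for x using C(2)[of x] C_nonneg[of x] by simp
  show "sqrt (C x) = sqrt (C y)" if "\<forall>w\<in>set vs. x w = y w" for x y using C(6)[OF that] by simp
 qed (use C(3,4) in simp)
 moreover obtain G' where "encodable sz igrad_cost 8 igrad G'" using encodable_igrad by blast
 ultimately have "encodable sz (2 ^ length vs * (14 * length vs + 5) + igrad_cost) (sqrt cmax * 8)
  (\<lambda>f. (\<lambda>f x. cr (sqrt (C x)) * f x) (igrad f)) (\<lambda>f. G' ((\<lambda>f x. cr (sqrt (C x)) * f x) f))"
  by (rule encodable_comp)
 moreover have "sqrt cmax * 8 = sqrt \<kappa>" by (simp add: \<kappa>_def real_sqrt_mult)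
 ultimately have "\<exists>B'. encodable sz (2 ^ length vs * (14 * length vs + 5) + igrad_cost) (sqrt \<kappa>) B B'"
  unfolding B_def[abs_def] by auto
 from someI_ex[OF this] show ?thesis unfolding B'_def B_cost_def .
qed

lemma ip_B: "ip sz (B f) (B g) = form C f g"
proof -
 have "cr (sqrt (C x)) * cr (sqrt (C x)) = cr (C x)" for x
  using C_nonneg[of x] by (simp flip: of_real_mult)
 then have "cnj (B f x) * B g x = cnj (igrad f x) * (cr (C x) * igrad g x)" for x
  by (simp add: B_def mult.left_commute flip: mult.assoc)
 then show ?thesis unfolding ip_def form_def by simp
qed

lemma oper_B: "oper sz (sqrt \<kappa>) B B'"
 by (rule encodable_oper[OF encodable_B])

definition C0 :: "real mat" where "C0 = (1 / (t * \<kappa>)) \<cdot>\<^sub>m CM"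

lemma C0_carrier: "C0 \<in> carrier_mat n n"
 using mats(2) by (simp add: C0_def)

lemma C0_entries: "p < n ==> q < n ==> cr (C0 $$ (p, q)) = cr (1 / \<kappa>) * form C (delta p) (delta q)"
proof -
 assume pq: "p < n" "q < n"
 then have "C0 $$ (p, q) = CM $$ (p, q) / (t * \<kappa>)" using mats(2) by (simp add: C0_def)
 then show ?thesis using mats(4)[OF pq] t by simp
qed

lemma ip_C0: "ip sz f (act C0 g) = cr (1 / \<kappa>) * form C (mask f) (mask g)"
 by (rule ip_act_form[OF C0_entries])

lemma form_B_sq: "form C f f = cr ((nrm sz (B f))\<^sup>2)"
 unfolding ip_B[symmetric] by (rule ip_self)

text \<open>Cauchy-Schwarz for the mass form: with \<open>q = act C0 f\<close>, \<open>|q|^2\<close>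
  is the form of \<open>q\<close> and \<open>f\<close> divided by \<kappa>, and \<open>|B q|\<close>
  is at most \<open>sqrt \<kappa> * |q|\<close>.\<close>

lemma C0_contr: "(nrm sz (act C0 f))\<^sup>2 \<le> Re (ip sz f (act C0 f))"
proof -
 define q where "q = act C0 f"
 have mq: "mask q = q" by (simp add: q_def)
 have "cr ((nrm sz q)\<^sup>2) = cr (1 / \<kappa>) * ip sz (B q) (B (mask f))"
  using ip_C0[of q f] unfolding ip_B q_def[symmetric] mq ip_self .
 then have "(nrm sz q)\<^sup>2 = cmod (cr (1 / \<kappa>) * ip sz (B q) (B (mask f)))"
  by (metis abs_of_nonneg norm_of_real zero_le_power2)
 also have "\<dots> \<le> 1 / \<kappa> * (nrm sz (B q) * nrm sz (B (mask f)))"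
  unfolding norm_mult norm_of_real using \<kappa>_pos by (intro mult_mono cmod_ip) auto
 also have "\<dots> \<le> 1 / \<kappa> * (sqrt \<kappa> * nrm sz q * nrm sz (B (mask f)))"
  using \<kappa>_pos by (intro mult_left_mono mult_right_mono operD(3)[OF oper_B]) auto
 finally have "nrm sz q * nrm sz q \<le> nrm sz q * (sqrt \<kappa> / \<kappa> * nrm sz (B (mask f)))" by (simp add: power2_eq_square mult_ac)
 then have "nrm sz q = 0 \<or> nrm sz q \<le> sqrt \<kappa> / \<kappa> * nrm sz (B (mask f))" using nrm_nonneg[of sz q]
  by (metis mult_le_cancel_left_pos order_le_less)
 moreover have "0 \<le> sqrt \<kappa> / \<kappa> * nrm sz (B (mask f))" using \<kappa>_pos by simp
 ultimately have "nrm sz q \<le> sqrt \<kappa> / \<kappa> * nrm sz (B (mask f))" by auto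
 then have "(nrm sz q)\<^sup>2 \<le> (sqrt \<kappa> / \<kappa> * nrm sz (B (mask f)))\<^sup>2" by (rule power_mono) simp
 also have "\<dots> = 1 / \<kappa> * (nrm sz (B (mask f)))\<^sup>2"
  using \<kappa>_pos by (simp add: power_mult_distrib power_divide) (simp add: power2_eq_square)
 also have "\<dots> = Re (ip sz f (act C0 f))" unfolding ip_C0 form_B_sq by simp
 finally show ?thesis unfolding q_def .
qed

text \<open>From \<open>|q - C0 q|^2 \<le> |q|^2 - <q, C0 q>\<close> for \<open>q\<close> in the
  range, and the lower bound \<open>cmin / (8 * \<kappa>)\<close> for the form; the 8 is that of
  \<open>form_gap\<close>.\<close>

definition \<rho> :: real where "\<rho> = sqrt (1 - cmin / (8 * \<kappa>))"

lemma \<rho>_bounds: "0 \<le> \<rho>" "\<rho> < 1"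
proof -
 have "0 < cmin / (8 * \<kappa>)" "cmin / (8 * \<kappa>) \<le> 1" using \<kappa>_pos C(3) by (auto simp: field_simps)
 then show "0 \<le> \<rho>" "\<rho> < 1" unfolding \<rho>_def by auto
qed

lemma C0_gap: "nrm sz (\<lambda>x. act C0 f x - act C0 (act C0 f) x) \<le> \<rho> * nrm sz (act C0 f)"
proof -
 define q where "q = act C0 f"
 have mq: "mask q = q" by (simp add: q_def)
 have supp: "interior x \<and> form C (spike x) (mask f) \<noteq> 0" if "q x \<noteq> 0" for x
  using that act_form[of C0 "1 / \<kappa>" C f x, OF C0_entries] unfolding q_def by (auto split: if_splits)
 have "cmin / 8 * (nrm sz q)\<^sup>2 \<le> (\<Sum>x\<in>slice sz. C x * (cmod (igrad q x))\<^sup>2)"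
  by (rule form_gap[OF C(1,3,7) supp])
 also have "\<dots> = (nrm sz (B q))\<^sup>2"
  unfolding nrm_sq by (intro sum.cong refl) (simp add: B_def norm_mult power_mult_distrib C_nonneg)
 finally have g: "cmin / (8 * \<kappa>) * (nrm sz q)\<^sup>2 \<le> 1 / \<kappa> * (nrm sz (B q))\<^sup>2"
  using \<kappa>_pos by (simp add: field_simps)
 have "(nrm sz (\<lambda>x. q x - act C0 q x))\<^sup>2 = (nrm sz q)\<^sup>2 - 2 * Re (ip sz q (act C0 q)) + (nrm sz (act C0 q))\<^sup>2"
  by (rule nrm_diff_sq)
 also have "\<dots> \<le> (nrm sz q)\<^sup>2 - Re (ip sz q (act C0 q))" using C0_contr[of q] by simp
 also have "Re (ip sz q (act C0 q)) = 1 / \<kappa> * (nrm sz (B q))\<^sup>2" unfolding ip_C0 mq form_B_sq by simp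
 also have "(nrm sz q)\<^sup>2 - 1 / \<kappa> * (nrm sz (B q))\<^sup>2 \<le> (1 - cmin / (8 * \<kappa>)) * (nrm sz q)\<^sup>2"
  using g by (simp add: left_diff_distrib)
 also have "\<dots> = (\<rho> * nrm sz q)\<^sup>2"
  using \<kappa>_pos C(3) unfolding \<rho>_def power_mult_distrib by (subst real_sqrt_pow2) (auto simp: field_simps)
 finally show ?thesis unfolding q_def[symmetric] by (rule power2_le_imp_le) (use \<rho>_bounds in simp)
qed

sublocale R: node_sqrt sz n pt C0 \<rho>
proof unfold_locales
 show "ip sz (act C0 f) g = ip sz f (act C0 g)" for f g
 proof -
  have "ip sz (act C0 f) g = cnj (ip sz g (act C0 f))" by (simp add: ip_cnj)
  then show ?thesis unfolding ip_C0 by (simp add: form_commute[of C "mask f"])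
 qed
qed (use lin_act C0_contr C0_gap \<rho>_bounds C0_carrier in auto)

lemma psd_sqrt_CM: "psd_sqrt CM = sqrt (t * \<kappa>) \<cdot>\<^sub>m R.sqrt_mat"
proof -
 have "CM = (t * \<kappa>) \<cdot>\<^sub>m C0" using t \<kappa>_pos by (simp add: C0_def smult_smult_mat one_smult_mat)
 then show ?thesis using R.psd_sqrt_scaled[of "t * \<kappa>"] t \<kappa>_pos by simp
qed

lemma om_ge: "1 \<le> om \<beta>"
 by (simp add: om_def)

lemma proj_mask: "proj (mask f) = mask f"
 by (auto simp: proj_def fun_eq_iff mask_interior interior_def phys_def)

text \<open>Positive definite, since \<open>W * om\<close> is at least \<open>wmin\<close> and the
  gradient is isometric on functions of the nodes.\<close>

lemma AM_inverse: "AM * the (mat_inverse AM) = 1\<^sub>m n" "the (mat_inverse AM) \<in> carrier_mat n n"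
proof -
 have pos: "0 < scalar_prod v (AM *\<^sub>v v)" if v: "v \<in> carrier_vec n" "v \<noteq> 0\<^sub>v n" for v
 proof -
  let ?f = "vec_state v"
  have "cr (scalar_prod v (AM *\<^sub>v v)) = ip sz ?f (act AM ?f)" by (rule scalar_prod_act[OF mats(1) v(1)])
  also have "\<dots> = cr t * form (\<lambda>x. W x * om (alpha x)) ?f ?f"
   using ip_act_form[OF mats(3), of ?f ?f] by simp
  also have "form (\<lambda>x. W x * om (alpha x)) ?f ?f = cr (\<Sum>x\<in>slice sz. W x * om (alpha x) * (cmod (igrad ?f x))\<^sup>2)"
   unfolding form_def ip_def of_real_sum
   by (intro sum.cong refl) (simp only: of_real_mult complex_norm_square mult_ac)
  finally have e: "scalar_prod v (AM *\<^sub>v v) = t * (\<Sum>x\<in>slice sz. W x * om (alpha x) * (cmod (igrad ?f x))\<^sup>2)"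
   unfolding of_real_mult[symmetric] of_real_eq_iff .
  have "wmin * (nrm sz ?f)\<^sup>2 = wmin * (nrm sz (igrad ?f))\<^sup>2"
   unfolding nrm_igrad using proj_mask[of ?f] by simp
  also have "\<dots> \<le> (\<Sum>x\<in>slice sz. W x * om (alpha x) * (cmod (igrad ?f x))\<^sup>2)"
   unfolding nrm_sq sum_distrib_left
  proof (intro sum_mono mult_right_mono)
   fix x
   have "wmin * 1 \<le> W x * om (alpha x)" using W(1)[of x] W(3) om_ge[of "alpha x"] by (intro mult_mono) auto
   then show "wmin \<le> W x * om (alpha x)" by simp
  qed simp
  finally have le: "wmin * (nrm sz ?f)\<^sup>2 \<le> (\<Sum>x\<in>slice sz. W x * om (alpha x) * (cmod (igrad ?f x))\<^sup>2)" .
  have "nrm sz ?f \<noteq> 0"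
  proof
   assume z: "nrm sz ?f = 0"
   have "vec_index v p = 0" if "p < n" for p
    using nrm_eq_0[OF z pt_slice[OF that]] vec_state_pt[OF that, of v] by simp
   then have "v = 0\<^sub>v n" using v(1) by (intro eq_vecI) auto
   then show False using v(2) by simp
  qed
  then have "0 < wmin * (nrm sz ?f)\<^sup>2" using W(3) by simp
  then show ?thesis unfolding e using t le by (intro mult_pos_pos) auto
 qed
 show "AM * the (mat_inverse AM) = 1\<^sub>m n" "the (mat_inverse AM) \<in> carrier_mat n n"
  using mat_inverse_of_posdef[OF mats(1) pos] by auto
qed

end

subsection \<open>Assembly of the Hamiltonian\<close>

lemma nrm_diff_commute: "nrm s (\<lambda>x. f x - g x) = nrm s (\<lambda>x. g x - f x)"
 using nrm_minus[of s "\<lambda>x. f x - g x"] by simp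

lemma nrm_zeroI: "(\<And>f. ip s f g = 0) ==> nrm s g = 0"
 using ip_self[of s g] by simp

context model
begin

text \<open>The torus counterpart of \<open>R.Y\<close>; \<open>Q\<close> intertwines the two, which
  transfers the square root from the cube to the torus.\<close>

definition Yt :: linop where "Yt f = (\<lambda>x. f x - B' (B f) x / cr \<kappa>)"

lemma encodable_Yt: "encodable sz (16 * B_cost + 3) 1 Yt Yt"
 using encodable_complement[OF encodable_B] \<kappa>_pos unfolding Yt_def[abs_def] by simp

lemma lin_Yt: "lin Yt"
 by (rule encodable_lin[OF encodable_Yt])

lemma nrm_Yt: "nrm sz (Yt f) \<le> nrm sz f"
 using operD(3)[OF encodable_oper[OF encodable_Yt]] by simp

lemma nrm_Q: "nrm sz (Q f) \<le> nrm sz f"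
 using encodable_Q encodable_oper operD(3) by (metis mult_1)

lemma mask_Y: "mask u = u ==> mask (R.Y u) = R.Y u"
 unfolding R.Y_def by (simp add: lin_diff[OF lin_mask])

lemma Yt_Q:
 assumes u: "mask u = u" shows "nrm sz (\<lambda>x. Yt (Q u) x - Q (R.Y u) x) = 0"
proof -
 have "ip sz f (\<lambda>x. B' (B (Q u)) x - cr \<kappa> * Q (act C0 u) x) = 0" for f
 proof -
  have "ip sz f (B' (B (Q u))) = form C f (Q u)" unfolding operD(4)[OF oper_B, symmetric] by (rule ip_B)
  moreover have "ip sz f (Q (act C0 u)) = cr (1 / \<kappa>) * form C f (Q u)"
   using odd_act[of C0 "1 / \<kappa>" C f u, OF C0_entries C(5)] u by simp
  ultimately show ?thesis using \<kappa>_pos by (simp add: ip_diff_right ip_scale_right)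
 qed
 then have "nrm sz (\<lambda>x. B' (B (Q u)) x - cr \<kappa> * Q (act C0 u) x) = 0" by (rule nrm_zeroI)
 moreover have "(\<lambda>x. Yt (Q u) x - Q (R.Y u) x) = (\<lambda>x. (- 1 / cr \<kappa>) * (B' (B (Q u)) x - cr \<kappa> * Q (act C0 u) x))"
  using \<kappa>_pos unfolding Yt_def R.Y_def lin_diff[OF lin_Q] by (simp add: fun_eq_iff field_simps)
 ultimately show ?thesis by (simp only: nrm_scale mult_zero_right)
qed

lemma Yt_pow_Q:
 assumes u: "mask u = u" shows "nrm sz (\<lambda>x. (Yt ^^ j) (Q u) x - Q ((R.Y ^^ j) u) x) = 0" "mask ((R.Y ^^ j) u) = (R.Y ^^ j) u"
proof (induction j)
 case (Suc j)
 let ?w = "(R.Y ^^ j) u"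
 {
  case 1
  have "(\<lambda>x. (Yt ^^ Suc j) (Q u) x - Q ((R.Y ^^ Suc j) u) x) = (\<lambda>x. Yt (\<lambda>x. (Yt ^^ j) (Q u) x - Q ?w x) x + (Yt (Q ?w) x - Q (R.Y ?w) x))"
   by (simp add: lin_diff[OF lin_Yt])
  then have "nrm sz (\<lambda>x. (Yt ^^ Suc j) (Q u) x - Q ((R.Y ^^ Suc j) u) x) \<le> nrm sz (Yt (\<lambda>x. (Yt ^^ j) (Q u) x - Q ?w x))"
   by (simp only: nrm_triangle0[OF Yt_Q[OF Suc(2)]])
  also have "\<dots> \<le> 0" using nrm_Yt[of "\<lambda>x. (Yt ^^ j) (Q u) x - Q ?w x"] Suc(1) by simp
  finally show ?case by (rule order_antisym) simp
 next
  case 2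
  show ?case using mask_Y[OF Suc(2)] by simp
 }
qed (use u in simp_all)

text \<open>\<open>R.R\<close> is indexed by its number of terms and \<open>sqrt_poly\<close> by its
  last index, hence \<open>Suc e\<close> against \<open>e\<close>.\<close>

lemma sqrt_poly_Q:
 assumes u: "mask u = u" shows "nrm sz (\<lambda>x. sqrt_poly e Yt (Q u) x - Q (R.R (Suc e) u) x) = 0"
proof -
 define E where "E j = (\<lambda>x. (Yt ^^ j) (Q u) x - Q ((R.Y ^^ j) u) x)" for j
 have E: "nrm sz (E j) = 0" for j unfolding E_def by (rule Yt_pow_Q[OF u])
 have "(R.Y ^^ j) (act C0 u) = (\<lambda>x. (R.Y ^^ j) u x - (R.Y ^^ Suc j) u x)" for j
 proof -
  have "act C0 u = (\<lambda>x. u x - R.Y u x)" by (simp add: R.Y_def)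
  then show ?thesis by (simp only: lin_diff[OF lin_funpow[OF R.lin_Y]] funpow_Suc_right comp_apply)
 qed
 then have "R.R (Suc e) u = (\<lambda>x. \<Sum>j\<le>e. cr (sqc j) * ((R.Y ^^ j) u x - (R.Y ^^ Suc j) u x))"
  unfolding R.R_def[abs_def] lessThan_Suc_atMost by simp
 then have "Q (R.R (Suc e) u) = (\<lambda>x. \<Sum>j\<le>e. cr (sqc j) * (Q ((R.Y ^^ j) u) x - Q ((R.Y ^^ Suc j) u) x))"
  by (simp only: lin_sum[OF lin_Q finite_atMost] lin_scale[OF lin_Q] lin_diff[OF lin_Q])
 then have "(\<lambda>x. sqrt_poly e Yt (Q u) x - Q (R.R (Suc e) u) x) = (\<lambda>x. \<Sum>j\<le>e. cr (sqc j) * (E j x - E (Suc j) x))"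
  unfolding sqrt_poly_def E_def by (simp only: sum_subtractf[symmetric] right_diff_distrib[symmetric]) (simp add: algebra_simps)
 then have "nrm sz (\<lambda>x. sqrt_poly e Yt (Q u) x - Q (R.R (Suc e) u) x) \<le> (\<Sum>j\<le>e. nrm sz (\<lambda>x. cr (sqc j) * (E j x - E (Suc j) x)))"
  by (simp only: nrm_sum finite_atMost)
 also have "\<dots> \<le> (\<Sum>j\<le>e. 0)"
 proof (rule sum_mono)
  fix j
  have "nrm sz (\<lambda>x. E j x - E (Suc j) x) \<le> 0" using nrm_diff[of sz "E j" "E (Suc j)"] E by simp
  then have "nrm sz (\<lambda>x. E j x - E (Suc j) x) = 0" by (rule order_antisym) simp
  then show "nrm sz (\<lambda>x. cr (sqc j) * (E j x - E (Suc j) x)) \<le> 0" by (simp only: nrm_scale)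
 qed
 finally show ?thesis by (simp add: order_antisym)
qed

abbreviation "S \<equiv> R.sqrt_mat"
abbreviation "Z \<equiv> the (mat_inverse AM)"

definition \<epsilon>1 :: "nat => real" where "\<epsilon>1 e = \<rho> ^ Suc e / (1 - \<rho>)"

lemma \<epsilon>1_nonneg: "0 \<le> \<epsilon>1 e"
 using \<rho>_bounds by (simp add: \<epsilon>1_def)

lemma sqrt_poly_approx:
 assumes u: "mask u = u" shows "nrm sz (\<lambda>x. sqrt_poly e Yt (Q u) x - Q (act S u) x) \<le> \<epsilon>1 e * nrm sz u"
proof -
 have "(\<lambda>x. sqrt_poly e Yt (Q u) x - Q (act S u) x) = (\<lambda>x. Q (\<lambda>x. R.R (Suc e) u x - act S u x) x + (sqrt_poly e Yt (Q u) x - Q (R.R (Suc e) u) x))"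
  by (simp add: lin_diff[OF lin_Q])
 then have "nrm sz (\<lambda>x. sqrt_poly e Yt (Q u) x - Q (act S u) x) \<le> nrm sz (Q (\<lambda>x. R.R (Suc e) u x - act S u x))"
  by (simp only: nrm_triangle0[OF sqrt_poly_Q[OF u]])
 also have "\<dots> \<le> nrm sz (\<lambda>x. act S u x - R.R (Suc e) u x)" unfolding nrm_diff_commute[of _ "act S u"] by (rule nrm_Q)
 also have "\<dots> \<le> \<epsilon>1 e * nrm sz (act C0 u)" unfolding \<epsilon>1_def by (rule R.nrm_act_sqrt_R)
 also have "\<dots> \<le> \<epsilon>1 e * nrm sz u" by (intro mult_left_mono R.nrm_M \<epsilon>1_nonneg)
 finally show ?thesis .
qed

lemma nrm_act_S: "nrm sz (act S f) \<le> nrm sz f"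
proof -
 have "ip sz (act S f) (act S f) = ip sz (R.root f) (act S f)"
  unfolding ip_def by (intro sum.cong refl) (simp add: R.act_sqrt)
 also have "\<dots> = ip sz f (R.root (act S f))" by (rule R.sym_root)
 also have "\<dots> = ip sz f (act S (act S f))"
  unfolding ip_def by (intro sum.cong refl) (simp add: R.act_sqrt)
 also have "\<dots> = ip sz f (act C0 f)" by (simp add: R.sqrt_mat_sq R.sqrt_mat_carrier flip: act_mult)
 finally have "cr ((nrm sz (act S f))\<^sup>2) = ip sz f (act C0 f)" unfolding ip_self .
 then have "(nrm sz (act S f))\<^sup>2 = cmod (ip sz f (act C0 f))"
  using norm_of_real[of "(nrm sz (act S f))\<^sup>2", where ?'a = complex] by (simp only: abs_of_nonneg zero_le_power2)
 also have "\<dots> \<le> nrm sz f * nrm sz (act C0 f)" by (rule cmod_ip)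
 also have "\<dots> \<le> nrm sz f * nrm sz f" by (rule mult_left_mono[OF R.nrm_M nrm_nonneg])
 also have "\<dots> = (nrm sz f)\<^sup>2" by (rule power2_eq_square[symmetric])
 finally show ?thesis by (rule power2_le_imp_le[OF _ nrm_nonneg])
qed

definition H :: "real mat" where "H = psd_sqrt CM * Z * psd_sqrt CM"

lemma act_H: "act H f = (\<lambda>x. cr (t * \<kappa>) * act S (act Z (act S f)) x)"
proof -
 let ?a = "sqrt (t * \<kappa>)"
 have c: "?a \<cdot>\<^sub>m S \<in> carrier_mat n n" "Z \<in> carrier_mat n n" using R.sqrt_mat_carrier AM_inverse by auto
 have "act H f = act (?a \<cdot>\<^sub>m S) (act Z (act (?a \<cdot>\<^sub>m S) f))"
  unfolding H_def psd_sqrt_CM using c by (simp add: act_mult mult_carrier_mat[OF c(1,2)])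
 also have "\<dots> = (\<lambda>x. cr ?a * (cr ?a * act S (act Z (act S f)) x))"
  by (simp add: act_smult R.sqrt_mat_carrier lin_scale[OF lin_act])
 also have "\<dots> = (\<lambda>x. cr (?a * ?a) * act S (act Z (act S f)) x)" by (simp only: of_real_mult mult.assoc)
 also have "?a * ?a = t * \<kappa>" using t \<kappa>_pos by simp
 finally show ?thesis .
qed

text \<open>Padding states have a zero register and so lie on a face, which the odd projection does
  not see; on the input side the padding drops out by itself.\<close>

lemma Q_phys:
 assumes "\<And>x. f x \<noteq> 0 ==> phys x" shows "Q f = Q (mask f)"
proof
 fix x
 show "Q f x = Q (mask f) x"
 proof (cases "\<exists>a<3. zero_on (set (low a)) x")
  case True
  then obtain a where a: "a < 3" "zero_on (set (low a)) x" by blast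
  show ?thesis unfolding Q_fixed[OF a] ..
 next
  case False
  let ?P = "\<lambda>x. \<forall>a<3. \<not> zero_on (set (low a)) x"
  show ?thesis
  proof (rule Q_cong[where P = ?P])
   show "?P x" using False by blast
   show "?P (neg a y)" if "a < 3" "?P y" for a y
   proof (intro allI impI)
    fix b :: nat assume "b < 3"
    then show "\<not> zero_on (set (low b)) (neg a y)"
     using that neg_not_fixed[of a y] neg_reg_other(2)[of a b y] by (cases "a = b") blast+
   qed
   show "f y = mask f y" if "?P y" for y
    using that assms[of y] unfolding mask_interior interior_def by auto
  qed
 qed
qed

lemma proj_Q: "mask u = u ==> proj (Q u) = Q u"
proof
 fix x assume u: "mask u = u"
 have "Q u x = Q (\<lambda>_. 0) x" if "alpha x \<noteq> z3"
 proof (rule Q_cong[where P = "\<lambda>x. alpha x \<noteq> z3"])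
  show "u y = 0" if "alpha y \<noteq> z3" for y
  proof -
   have "u y = mask u y" using u by simp
   then show ?thesis using that by (simp add: mask_interior interior_def phys_def)
  qed
 qed (use that neg_alpha in auto)
 then show "proj (Q u) x = Q u x" by (simp add: proj_def lin_zero[OF lin_Q])
qed

lemma nrm_le_8Q:
 assumes "mask u = u" shows "nrm sz u \<le> 8 * nrm sz (Q u)"
proof -
 have "nrm sz u \<le> nrm sz (\<lambda>x. 8 * Q u x)"
 proof (rule nrm_mono)
  fix x
  have nz: "u x \<noteq> 0 ==> interior x" for x using assms mask_interior[of u x] by (auto split: if_splits)
  show "cmod (u x) \<le> cmod (8 * Q u x)"
  proof (cases "interior x")
   case True
   then have "8 * Q u x = u x" by (intro Q_restrict nz) (auto simp: interior_def)
   then show ?thesis by simp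
  next
   case False
   then have "u x = 0" using nz by blast
   then show ?thesis by simp
  qed
 qed
 then show ?thesis by (simp add: nrm_scale)
qed

definition \<epsilon>2 :: "nat => nat => real" where
 "\<epsilon>2 d K = 8 * ((1 - wmin / wmax) ^ Suc K + (1 - gap) ^ d * wmax / wmin) / wmin"

definition cost :: "nat => nat => nat => nat" where
 "cost d K e = 2 * (16 * B_cost + 3 + e * (16 * B_cost + 5) + 3) + solver_cost d K (length vs) + Q_cost"

text \<open>Odd extension, root, solver, root. The 8 undoes the restriction factor of
  \<open>Q\<close>; \<kappa>, together with the scale \<open>t\<close> that the solver brings in,
  restores \<open>H = t \<kappa> S Z S\<close>. The normalisation is \<open>8 \<kappa>\<close> times
  2, \<open>64 / wmin\<close> and 2.\<close>

theorem encodable_H: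
 "\<exists>A A'. encodable sz (cost d K e) (2048 * \<kappa> / wmin) A A' \<and>
  (\<forall>f. (\<forall>x. f x \<noteq> 0 \<longrightarrow> phys x) \<longrightarrow> nrm sz (\<lambda>x. if phys x then A f x - act H f x else 0)
   \<le> 8 * \<kappa> * (2 * (64 / wmin) * \<epsilon>1 e + 2 * \<epsilon>2 d K + 8 * \<epsilon>1 e * (\<epsilon>2 d K + 64 / wmin)) * nrm sz f)"
proof -
 obtain V V' where V: "encodable sz (solver_cost d K (length vs)) (64 / wmin) V V'" and Vs: "\<And>v g. proj v = v ==> proj g = g ==>
   (\<And>f. ip sz (igrad f) (\<lambda>x. cr (W x * om (alpha x)) * igrad v x) = ip sz f g) ==>
   nrm sz (\<lambda>x. v x - V g x) \<le> 8 * ((1 - wmin / wmax) ^ Suc K + (1 - gap) ^ d * wmax / wmin) * nrm sz g / wmin"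
  using solver[of wmin W wmax vs d K, OF W(1,2,3,4) W(6) vs] by blast
 note oV = encodable_oper[OF V]
 define P where "P = sqrt_poly e Yt"
 obtain P' where P: "encodable sz (16 * B_cost + 3 + e * (16 * B_cost + 5) + 3) 2 P P'"
  using encodable_sqrt_poly[OF encodable_Yt, of e] unfolding P_def by (auto simp: add.commute)
 note oP = encodable_oper[OF P]
 obtain Q' where Q': "encodable sz Q_cost 1 Q Q'" using encodable_Q by blast
 define A where "A = (\<lambda>f x. cr (8 * \<kappa>) * P (V (P (Q f))) x)"
 have "0 < 8 * \<kappa>" using \<kappa>_pos by simp
 from encodable_scale[OF encodable_comp[OF P encodable_comp[OF V encodable_comp[OF P Q']]] this]
 have "\<exists>A'. encodable sz (cost d K e) (2048 * \<kappa> / wmin) A A'"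
  unfolding A_def by (intro exI, rule encodable_eqI[OF _ _ _ refl refl]) (auto simp: cost_def)
 moreover have "nrm sz (\<lambda>x. if phys x then A f x - act H f x else 0)
   \<le> 8 * \<kappa> * (2 * (64 / wmin) * \<epsilon>1 e + 2 * \<epsilon>2 d K + 8 * \<epsilon>1 e * (\<epsilon>2 d K + 64 / wmin)) * nrm sz f"
  if f: "\<And>x. f x \<noteq> 0 ==> phys x" for f
 proof -
  define Sf where "Sf = act S f"
  define u where "u = act Z Sf"
  \<comment> \<open>The solver works with the form itself, whereas \<open>AM\<close> is
    \<open>t\<close> times its matrix, so it returns \<open>t\<close> times the solution.\<close>
  define tu where "tu = (\<lambda>x. cr t * u x)"
  define g where "g = Q Sf"
  define X where "X = P (V (P (Q f)))"
  define N where "N = nrm sz f"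
  have mu: "mask u = u" "mask Sf = Sf" "mask tu = tu" by (simp_all add: u_def Sf_def tu_def lin_scale[OF lin_mask])
  have AMu: "act AM u = Sf"
   unfolding u_def using act_mult[OF mats(1) AM_inverse(2), of Sf] AM_inverse(1) by (simp add: act_one mu)
  have gN: "nrm sz g \<le> N" unfolding g_def N_def Sf_def by (rule order_trans[OF nrm_Q nrm_act_S])
  have e2: "0 \<le> \<epsilon>2 d K" using W(3,4) gap_bounds by (auto simp: \<epsilon>2_def intro!: add_nonneg_nonneg mult_nonneg_nonneg divide_nonneg_pos)
  have vg: "nrm sz (\<lambda>x. Q tu x - V g x) \<le> \<epsilon>2 d K * N"
  proof -
   have "nrm sz (\<lambda>x. Q tu x - V g x) \<le> 8 * ((1 - wmin / wmax) ^ Suc K + (1 - gap) ^ d * wmax / wmin) * nrm sz g / wmin"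
   proof (rule Vs)
    show "proj (Q tu) = Q tu" "proj g = g" unfolding g_def by (rule proj_Q[OF mu(3)] proj_Q[OF mu(2)])+
    show "ip sz (igrad F) (\<lambda>x. cr (W x * om (alpha x)) * igrad (Q tu) x) = ip sz F g" for F
    proof -
     have "form (\<lambda>x. W x * om (alpha x)) F (Q tu) = cr t * form (\<lambda>x. W x * om (alpha x)) F (Q (mask u))"
      unfolding tu_def lin_scale[OF lin_Q] form_scale_right mu(1) ..
     also have "\<dots> = ip sz F (Q (act AM u))"
      by (rule odd_act[symmetric, OF mats(3)]) (use W(5) in \<open>simp_all add: alpha_def al_notin_reg\<close>)
     finally show ?thesis unfolding AMu g_def form_def .
    qed
   qed
   also have "\<dots> = \<epsilon>2 d K * nrm sz g" by (simp add: \<epsilon>2_def)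
   also have "\<dots> \<le> \<epsilon>2 d K * N" by (intro mult_left_mono gN e2)
   finally show ?thesis .
  qed
  have vN: "nrm sz (Q tu) \<le> (\<epsilon>2 d K + 64 / wmin) * N"
  proof -
   have "nrm sz (Q tu) = nrm sz (\<lambda>x. (Q tu x - V g x) + V g x)" by simp
   also have "\<dots> \<le> \<epsilon>2 d K * N + 64 / wmin * nrm sz g" by (intro order_trans[OF nrm_add] add_mono vg operD(3)[OF oV])
   also have "\<dots> \<le> \<epsilon>2 d K * N + 64 / wmin * N" using W(3) by (intro add_left_mono mult_left_mono gN) auto
   finally show ?thesis by (simp add: distrib_right)
  qed
  have e1: "nrm sz (\<lambda>x. P (Q f) x - g x) \<le> \<epsilon>1 e * N"
  proof -
   have "nrm sz (\<lambda>x. P (Q (mask f)) x - Q (act S (mask f)) x) \<le> \<epsilon>1 e * nrm sz (mask f)"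
    unfolding P_def by (rule sqrt_poly_approx) simp
   also have "\<dots> \<le> \<epsilon>1 e * N" unfolding N_def by (intro mult_left_mono nrm_mask \<epsilon>1_nonneg)
   finally show ?thesis using Q_phys[OF f] by (simp add: g_def Sf_def)
  qed
  have e3: "nrm sz (\<lambda>x. P (Q tu) x - Q (act S tu) x) \<le> 8 * \<epsilon>1 e * ((\<epsilon>2 d K + 64 / wmin) * N)"
  proof -
   have "nrm sz (\<lambda>x. P (Q tu) x - Q (act S tu) x) \<le> \<epsilon>1 e * nrm sz tu"
    unfolding P_def by (rule sqrt_poly_approx[OF mu(3)])
   also have "\<dots> \<le> \<epsilon>1 e * (8 * ((\<epsilon>2 d K + 64 / wmin) * N))"
    using nrm_le_8Q[OF mu(3)] vN by (intro mult_left_mono \<epsilon>1_nonneg) simp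
   finally show ?thesis by (simp only: mult_ac)
  qed
  \<comment> \<open>Three errors: that of the first root, carried through solver and second root;
    that of the solver; that of the second root at the exact solution.\<close>
  have "(\<lambda>x. X x - Q (act S tu) x) = (\<lambda>x. (P (V (\<lambda>x. P (Q f) x - g x)) x - P (\<lambda>x. Q tu x - V g x) x) + (P (Q tu) x - Q (act S tu) x))"
   unfolding X_def by (simp add: lin_diff[OF operD(1)[OF oP]] lin_diff[OF operD(1)[OF oV]])
  then have "nrm sz (\<lambda>x. X x - Q (act S tu) x) \<le> nrm sz (P (V (\<lambda>x. P (Q f) x - g x))) + nrm sz (P (\<lambda>x. Q tu x - V g x)) + nrm sz (\<lambda>x. P (Q tu) x - Q (act S tu) x)"
   by (simp only: order_trans[OF nrm_add add_right_mono[OF nrm_diff]])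
  also have "\<dots> \<le> 2 * (64 / wmin * (\<epsilon>1 e * N)) + 2 * (\<epsilon>2 d K * N) + 8 * \<epsilon>1 e * ((\<epsilon>2 d K + 64 / wmin) * N)"
  proof (intro add_mono e3)
   show "nrm sz (P (V (\<lambda>x. P (Q f) x - g x))) \<le> 2 * (64 / wmin * (\<epsilon>1 e * N))"
    using W(3) by (intro order_trans[OF operD(3)[OF oP]] mult_left_mono order_trans[OF operD(3)[OF oV]] e1) auto
   show "nrm sz (P (\<lambda>x. Q tu x - V g x)) \<le> 2 * (\<epsilon>2 d K * N)"
    by (intro order_trans[OF operD(3)[OF oP]] mult_left_mono vg) simp
  qed
  finally have XQ: "nrm sz (\<lambda>x. X x - Q (act S tu) x)
   \<le> (2 * (64 / wmin) * \<epsilon>1 e + 2 * \<epsilon>2 d K + 8 * \<epsilon>1 e * (\<epsilon>2 d K + 64 / wmin)) * N"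
   by (simp only: distrib_right mult.assoc)
  have "nrm sz (\<lambda>x. if phys x then A f x - act H f x else 0) \<le> nrm sz (\<lambda>x. cr (8 * \<kappa>) * (X x - Q (act S tu) x))"
  proof (rule nrm_mono)
   fix x
   show "cmod (if phys x then A f x - act H f x else 0) \<le> cmod (cr (8 * \<kappa>) * (X x - Q (act S tu) x))"
   proof (cases "phys x")
    case True
    have "interior y" if "act S tu y \<noteq> 0" for y
     using that mask_interior[of "act S tu" y] unfolding mask_act by presburger
    then have "8 * Q (act S tu) x = act S tu x" by (rule Q_restrict[OF _ True])
    moreover have "act H f x = cr \<kappa> * act S tu x"
     unfolding act_H tu_def lin_scale[OF lin_act] by (simp add: u_def Sf_def)
    ultimately have "A f x - act H f x = cr (8 * \<kappa>) * (X x - Q (act S tu) x)"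
     by (simp add: A_def X_def algebra_simps)
    then show ?thesis using True by simp
   qed simp
  qed
  also have "\<dots> = 8 * \<kappa> * nrm sz (\<lambda>x. X x - Q (act S tu) x)" using \<kappa>_pos by (simp add: nrm_scale norm_mult)
  also have "\<dots> \<le> 8 * \<kappa> * ((2 * (64 / wmin) * \<epsilon>1 e + 2 * \<epsilon>2 d K + 8 * \<epsilon>1 e * (\<epsilon>2 d K + 64 / wmin)) * N)"
   using \<kappa>_pos XQ by (intro mult_left_mono) auto
  finally show ?thesis unfolding N_def by (simp only: mult.assoc)
 qed
 ultimately show ?thesis by blast
qed

end

section \<open>Integrals of finite element functions\<close>

text \<open>Fubini, through the description of \<open>lborel\<close> as the image of a product over
  the basis vectors.\<close>

lemma integral_prod_cart:
 fixes f :: "'n::finite => real => real"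
 assumes f: "\<And>m. integrable lborel (f m)"
 shows "integrable lborel (\<lambda>x::real^'n. \<Prod>m\<in>UNIV. f m (x $ m))"
  "(\<integral>x. (\<Prod>m\<in>UNIV. f m (x $ m)) \<partial>(lborel :: (real^'n) measure)) = (\<Prod>m\<in>UNIV. integral\<^sup>L lborel (f m))"
proof -
 interpret product_sigma_finite "\<lambda>_ :: real^'n. lborel :: real measure" ..
 define ax :: "'n => real^'n" where "ax m = axis m 1" for m
 have inj: "inj ax" by (auto simp: inj_def ax_def axis_eq_axis)
 have B: "Basis = ax ` UNIV" by (auto simp: Basis_vec_def ax_def)
 define f' where "f' b = f (the_inv ax b)" for b
 have f': "f' (ax m) = f m" for m by (simp add: f'_def the_inv_f_f inj)
 have f'i: "integrable lborel (f' b)" for b using f by (simp add: f'_def)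
 have fm [measurable]: "f m \<in> borel_measurable borel" for m using f[of m] by simp
 let ?s = "\<lambda>g :: real^'n => real. \<Sum>b\<in>Basis. g b *\<^sub>R b"
 have comp: "?s g $ m = g (ax m)" for g m
 proof -
  have "?s g $ m = (\<Sum>k\<in>UNIV. g (ax k) * (ax k $ m))"
   unfolding B by (simp add: sum.reindex inj)
  also have "\<dots> = g (ax m)" by (simp add: ax_def axis_def if_distrib[of "\<lambda>c. _ * c"] cong: if_cong)
  finally show ?thesis .
 qed
 have pr: "(\<Prod>m\<in>UNIV. f m (?s g $ m)) = (\<Prod>b\<in>Basis. f' b (g b))" for g
  unfolding comp unfolding B by (simp add: prod.reindex inj f')
 have M: "?s \<in> measurable (\<Pi>\<^sub>M b\<in>Basis. lborel) borel" by measurable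
 have m2: "(\<lambda>x::real^'n. \<Prod>m\<in>UNIV. f m (x $ m)) \<in> borel_measurable borel" by measurable
 have "integrable (\<Pi>\<^sub>M b\<in>Basis. lborel) (\<lambda>g. \<Prod>b\<in>Basis. f' b (g b))"
  by (rule product_integrable_prod) (use f'i in auto)
 then show "integrable lborel (\<lambda>x::real^'n. \<Prod>m\<in>UNIV. f m (x $ m))"
  by (subst lborel_eq) (simp only: integrable_distr_eq[OF M m2] pr)
 have "(\<integral>x. (\<Prod>m\<in>UNIV. f m (x $ m)) \<partial>(lborel :: (real^'n) measure)) = (\<integral>g. (\<Prod>b\<in>Basis. f' b (g b)) \<partial>(\<Pi>\<^sub>M b\<in>Basis. lborel))"
  by (subst lborel_eq) (simp only: integral_distr[OF M m2] pr)
 also have "\<dots> = (\<Prod>b\<in>Basis. integral\<^sup>L lborel (f' b))" by (rule product_integral_prod) (use f'i in auto)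
 also have "\<dots> = (\<Prod>m\<in>UNIV. integral\<^sup>L lborel (f m))" unfolding B by (simp add: prod.reindex inj f')
 finally show "(\<integral>x. (\<Prod>m\<in>UNIV. f m (x $ m)) \<partial>(lborel :: (real^'n) measure)) = (\<Prod>m\<in>UNIV. integral\<^sup>L lborel (f m))" .
qed

text \<open>Together with \<open>de\<close>, the mean and half difference of the end values of hat
  \<open>i\<close> on segment \<open>t\<close>: what \<open>avg\<close> and \<open>dif\<close>
  produce from a spike.\<close>

definition mu :: "nat => nat => real" where "mu t i = (of_bool (t = i) + of_bool (Suc t = i)) / 2"
definition de :: "nat => nat => real" where "de t i = (of_bool (t = i) - of_bool (Suc t = i)) / 2"

lemma hat_cell:
 assumes "0 < h" "real t * h \<le> s" "s \<le> (real t + 1) * h"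
 shows "hat h i s = mu t i + de t i * (1 - 2 * (s / h - real t))"
proof -
 define r where "r = s / h - real t"
 have r: "0 \<le> r" "r \<le> 1" using assms by (auto simp: r_def field_simps)
 have "s = (real t + r) * h" using assms(1) by (simp add: r_def)
 then have "hat h i s = (1 - r) * (if t = i then 1 else 0) + r * (if Suc t = i then 1 else 0)"
  using hat_piecewise_linear[OF assms(1) r, of i t] hat_node[OF assms(1), of i t] hat_node[OF assms(1), of i "Suc t"] by simp
 then show ?thesis unfolding r_def[symmetric] mu_def de_def by (auto simp: field_simps)
qed

definition seg :: "nat => nat => real set" where "seg l t = {real t * mesh l..(real t + 1) * mesh l}"

definition shp :: "nat => nat => nat => real => real" where
 "shp l t i s = mu t i + de t i * (1 - 2 * (s / mesh l - real t))"

text \<open>The affine factor running from 1 to -1 is orthogonal to constants and has mean square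
  1/3, so no mixed terms remain.\<close>

lemma integral_seg:
 "integrable lborel (\<lambda>s. shp l t i s * shp l t j s * indicator (seg l t) s)"
 "(\<integral>s. shp l t i s * shp l t j s * indicator (seg l t) s \<partial>lborel) = mesh l * (mu t i * mu t j + de t i * de t j / 3)"
proof -
 define h where "h = mesh l"
 have h: "0 < h" by (simp add: h_def)
 define w where "w s = 1 - 2 * (s / h - real t)" for s
 \<comment> \<open>An explicit primitive in the local coordinate \<open>w\<close>.\<close>
 define F where "F s = - (h / 2) * (mu t i * mu t j * w s + (mu t i * de t j + de t i * mu t j) * (w s)\<^sup>2 / 2 + de t i * de t j * (w s) ^ 3 / 3)" for s
 have dw: "(w has_real_derivative - (2 / h)) (at s)" for s
  unfolding w_def[abs_def] using h by (auto intro!: derivative_eq_intros)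
 have d: "(F has_real_derivative (shp l t i s * shp l t j s)) (at s)" for s
  unfolding F_def[abs_def] shp_def h_def[symmetric] w_def[symmetric]
  using h by (auto intro!: derivative_eq_intros dw simp: power2_eq_square) (simp add: field_simps power2_eq_square)
 have c: "isCont (\<lambda>s. shp l t i s * shp l t j s) s" for s
  unfolding shp_def by (intro continuous_intros) auto
 have le: "real t * h \<le> (real t + 1) * h" using h by simp
 have wa: "w (real t * h) = 1" "w ((real t + 1) * h) = - 1" using h by (auto simp: w_def field_simps)
 show "integrable lborel (\<lambda>s. shp l t i s * shp l t j s * indicator (seg l t) s)"
  unfolding seg_def h_def[symmetric] by (rule has_bochner_integral_FTC_Icc_real[OF le d c, THEN integrable.intros])
 have "(\<integral>s. shp l t i s * shp l t j s * indicator (seg l t) s \<partial>lborel) = F ((real t + 1) * h) - F (real t * h)"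
  unfolding seg_def h_def[symmetric] by (rule integral_FTC_Icc_real[OF le d c])
 also have "\<dots> = h * (mu t i * mu t j + de t i * de t j / 3)"
  unfolding F_def wa by (simp add: field_simps)
 finally show "(\<integral>s. shp l t i s * shp l t j s * indicator (seg l t) s \<partial>lborel) = mesh l * (mu t i * mu t j + de t i * de t j / 3)"
  unfolding h_def .
qed

lemma integral_seg_1:
 "integrable lborel (indicator (seg l t) :: real => real)" "(\<integral>s. indicator (seg l t) s \<partial>lborel) = mesh l"
 by (auto simp: seg_def field_simps)


section \<open>Integration cell by cell\<close>

definition cmp :: "node => 3 => nat" where
 "cmp = (\<lambda>(i, j, k) m. if m = 1 then i else if m = 2 then j else k)"

lemma cmp_simps [simp]: "cmp (i, j, k) 1 = i" "cmp (i, j, k) 2 = j" "cmp (i, j, k) 3 = k"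
 by (simp_all add: cmp_def)

definition cells :: "nat => node set" where "cells l = {..<2 ^ l} \<times> {..<2 ^ l} \<times> {..<2 ^ l}"

definition ccell :: "nat => node => (real^3) set" where
 "ccell l c = {x. \<forall>m. x $ m \<in> seg l (cmp c m)}"

definition bdry :: "nat => (real^3) set" where
 "bdry l = (\<Union>m. \<Union>j\<le>2 ^ l. {x. x $ m = real j * mesh l})"

lemma finite_cells [simp]: "finite (cells l)"
 by (simp add: cells_def)

lemma negligible_bdry: "negligible (bdry l)"
proof -
 have "negligible {x :: real^3. x $ m = c}" for m c
  using negligible_standard_hyperplane[of "axis m 1 :: real^3" c] by (simp add: inner_axis)
 then show ?thesis unfolding bdry_def by (auto intro!: negligible_Union)
qed

lemma cell_exists:
 assumes "x \<in> Omega - bdry l"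
 shows "\<exists>!c. c \<in> cells l \<and> x \<in> ccell l c" "\<And>c. c \<in> cells l ==> x \<in> ccell l c ==> x \<in> cell l (cmp c)"
proof -
 have b: "x $ m \<noteq> real j * mesh l" if "j \<le> 2 ^ l" for m j using assms that by (auto simp: bdry_def)
 have x: "0 \<le> x $ m" "x $ m \<le> 1" for m using assms by (auto simp: Omega_def)
 define t where "t m = nat \<lfloor>x $ m * 2 ^ l\<rfloor>" for m
 have t: "real (t m) \<le> x $ m * 2 ^ l" "x $ m * 2 ^ l < real (t m) + 1" for m
  using x[of m] by (simp_all add: t_def)
 have tl: "t m < 2 ^ l" for m
 proof -
  have "x $ m * 2 ^ l \<le> 1 * 2 ^ l" using x[of m] by (intro mult_right_mono) auto
  moreover have "x $ m \<noteq> 1" using b[of "2 ^ l" m] by simp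
  then have "x $ m < 1" using x[of m] by simp
  then have "x $ m * 2 ^ l < 2 ^ l" by simp
  then have "real (t m) < 2 ^ l" using t(1)[of m] by linarith
  then have "real (t m) < real (2 ^ l)" by simp
  then show ?thesis by (simp only: of_nat_less_iff)
 qed
 have in_seg: "x $ m \<in> seg l s \<longleftrightarrow> s = t m" if "s < 2 ^ l" for s m
 proof
  assume "x $ m \<in> seg l s"
  then have 1: "real s \<le> x $ m * 2 ^ l" "x $ m * 2 ^ l \<le> real s + 1" by (auto simp: seg_def field_simps)
  have "x $ m * 2 ^ l \<noteq> real s + 1" using b[of "Suc s" m] that by (auto simp: field_simps)
  then have "x $ m * 2 ^ l < real s + 1" using 1 by simp
  then show "s = t m" using 1(1) t[of m] by linarith
 next
  assume "s = t m"
  then show "x $ m \<in> seg l s" using t[of m] by (auto simp: seg_def field_simps)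
 qed
 have iff: "x \<in> ccell l c \<longleftrightarrow> c = (t 1, t 2, t 3)" if "c \<in> cells l" for c
  using that in_seg by (cases c) (auto simp: ccell_def cells_def forall_3)
 have mem: "(t 1, t 2, t 3) \<in> cells l" using tl by (simp add: cells_def)
 show "\<exists>!c. c \<in> cells l \<and> x \<in> ccell l c" using iff mem by metis
 fix c assume "c \<in> cells l" "x \<in> ccell l c"
 then have c: "c = (t 1, t 2, t 3)" using iff by simp
 have "real (t m) * mesh l < x $ m" "x $ m < (real (t m) + 1) * mesh l" for m
 proof -
  have "real (t m) * mesh l \<le> x $ m" using t(1)[of m] by (simp add: field_simps)
  moreover have "x $ m \<noteq> real (t m) * mesh l" using tl[of m] by (intro b) simp
  ultimately show "real (t m) * mesh l < x $ m" by linarith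
  show "x $ m < (real (t m) + 1) * mesh l" using t(2)[of m] by (simp add: pos_less_divide_eq)
 qed
 then show "x \<in> cell l (cmp c)" unfolding cell_def c by (simp add: forall_3)
qed

lemma ccell_Omega: "c \<in> cells l ==> ccell l c \<subseteq> Omega"
proof
 fix x assume c: "c \<in> cells l" and x: "x \<in> ccell l c"
 have "cmp c m < 2 ^ l" for m using c by (cases c) (auto simp: cells_def cmp_def)
 then have "real (cmp c m) + 1 \<le> 2 ^ l" for m
  by (metis Suc_leI add.commute of_nat_Suc of_nat_le_iff of_nat_numeral of_nat_power)
 moreover have "real (cmp c m) * mesh l \<le> x $ m" "x $ m \<le> (real (cmp c m) + 1) * mesh l" for m
  using x by (auto simp: ccell_def seg_def)
 ultimately have "0 \<le> x $ m \<and> x $ m \<le> 1" for m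
 proof -
  assume 1: "\<And>m. real (cmp c m) + 1 \<le> 2 ^ l" and 2: "\<And>m. real (cmp c m) * mesh l \<le> x $ m" "\<And>m. x $ m \<le> (real (cmp c m) + 1) * mesh l"
  have "(real (cmp c m) + 1) * mesh l \<le> 2 ^ l * mesh l" using 1[of m] by (intro mult_right_mono) auto
  also have "\<dots> = 1" by simp
  finally have "(real (cmp c m) + 1) * mesh l \<le> 1" .
  moreover have "0 \<le> real (cmp c m) * mesh l" by simp
  ultimately show "0 \<le> x $ m \<and> x $ m \<le> 1" using 2[of m] by linarith
 qed
 then show "x \<in> Omega" by (simp add: Omega_def)
qed

text \<open>Only the values in open cells matter, since the faces form a null set; the unspecified
  gradient on the faces disappears here.\<close>

lemma integral_cells:
 fixes F :: "real^3 => real"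
 assumes F: "\<And>c x. c \<in> cells l ==> x \<in> cell l (cmp c) ==> F x = \<phi> c x"
  and int: "\<And>c. c \<in> cells l ==> integrable lborel (\<lambda>x. \<phi> c x * indicator (ccell l c) x)"
 shows "(LINT x:Omega|lebesgue. F x) = (\<Sum>c\<in>cells l. \<integral>x. \<phi> c x * indicator (ccell l c) x \<partial>lborel)"
proof -
 define G where "G x = (\<Sum>c\<in>cells l. \<phi> c x * indicator (ccell l c) x)" for x
 have G: "integrable lborel G" unfolding G_def by (intro Bochner_Integration.integrable_sum int)
 have ind: "indicator Omega x *\<^sub>R G x = G x" for x
 proof (cases "x \<in> Omega")
  case False
  then have "x \<notin> ccell l c" if "c \<in> cells l" for c using ccell_Omega[OF that] by blast
  then have "G x = 0" unfolding G_def by (intro sum.neutral ballI) simp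
  then show ?thesis by simp
 qed simp
 have GL: "integrable lebesgue G" using G by (simp add: integrable_completion)
 then have GO: "G absolutely_integrable_on Omega" unfolding set_integrable_def ind .
 have FG: "F x = G x" if x: "x \<in> Omega - bdry l" for x
 proof -
  obtain c where c: "c \<in> cells l" "x \<in> ccell l c" and u: "\<And>c'. c' \<in> cells l ==> x \<in> ccell l c' ==> c' = c"
   using cell_exists(1)[OF x] by blast
  have "G x = (\<Sum>c'\<in>cells l. if c' = c then \<phi> c x else 0)"
   unfolding G_def
  proof (rule sum.cong[OF refl])
   fix c' assume "c' \<in> cells l"
   then have "x \<in> ccell l c' \<longleftrightarrow> c' = c" using u[of c'] c by blast
   then show "\<phi> c' x * indicator (ccell l c') x = (if c' = c then \<phi> c x else 0)" by (simp add: indicator_def)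
  qed
  also have "\<dots> = \<phi> c x" using c(1) by simp
  finally show ?thesis using F[OF c(1) cell_exists(2)[OF x c]] by simp
 qed
 have FO: "F absolutely_integrable_on Omega"
  by (rule absolutely_integrable_spike[OF GO negligible_bdry[of l]]) (use FG in auto)
 have "(LINT x:Omega|lebesgue. F x) = integral Omega F" by (rule set_lebesgue_integral_eq_integral(2)[OF FO])
 also have "\<dots> = integral Omega G" by (rule integral_spike[OF negligible_bdry[of l]]) (use FG in auto)
 also have "\<dots> = (LINT x:Omega|lebesgue. G x)" by (rule set_lebesgue_integral_eq_integral(2)[OF GO, symmetric])
 also have "\<dots> = integral\<^sup>L lebesgue G" unfolding set_lebesgue_integral_def ind ..
 also have "\<dots> = integral\<^sup>L lborel G" using G by (intro integral_completion) simp
 also have "\<dots> = (\<Sum>c\<in>cells l. \<integral>x. \<phi> c x * indicator (ccell l c) x \<partial>lborel)"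
  unfolding G_def by (rule Bochner_Integration.integral_sum[OF int])
 finally show ?thesis .
qed

lemma prod_3: "(\<Prod>m\<in>(UNIV :: 3 set). g m) = g 1 * g 2 * g 3"
 unfolding UNIV_3 by (simp add: ac_simps)

lemma indicator_ccell: "indicator (ccell l c) x = (\<Prod>m\<in>UNIV. indicator (seg l (cmp c m)) (x $ m) :: real)"
 by (auto simp: ccell_def indicator_def prod_3 forall_3)

lemma cell_seg: "x \<in> cell l a ==> x $ m \<in> seg l (a m)"
 by (auto simp: cell_def seg_def less_imp_le)

lemma basis_fun_cell:
 assumes "x \<in> ccell l c" shows "basis_fun l u x = (\<Prod>m\<in>UNIV. shp l (cmp c m) (cmp u m) (x $ m))"
proof -
 have "hat (mesh l) (cmp u m) (x $ m) = shp l (cmp c m) (cmp u m) (x $ m)" for m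
  unfolding shp_def by (rule hat_cell) (use assms in \<open>auto simp: ccell_def seg_def\<close>)
 from this[of 1] this[of 2] this[of 3] show ?thesis by (cases u) (simp add: basis_fun_def prod_3)
qed

lemma cell_ccell: "cell l (cmp c) \<subseteq> ccell l c"
 using cell_seg by (auto simp: ccell_def)

lemma open_cell: "open (cell l a)"
proof -
 have "cell l a = (\<Inter>m. {x. real (a m) * mesh l < x $ m} \<inter> {x. x $ m < (real (a m) + 1) * mesh l})"
  by (auto simp: cell_def)
 moreover have "open ({x :: real^3. real (a m) * mesh l < x $ m} \<inter> {x. x $ m < (real (a m) + 1) * mesh l})" for m
  by (intro open_Int open_Collect_less continuous_intros)
 ultimately show ?thesis by (auto intro: open_INT)
qed

text \<open>The partial derivative in direction \<open>m\<close>; \<open>- 2 * 2 ^ l\<close> is the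
  slope of the local coordinate that runs from 1 to -1.\<close>

definition dshp :: "nat => node => node => real^3 => 3 => real" where
 "dshp l c u x m = (\<Prod>k\<in>UNIV. if k = m then - 2 * 2 ^ l * de (cmp c k) (cmp u k) else shp l (cmp c k) (cmp u k) (x $ k))"

lemma gradient_basis_fun:
 assumes x: "x \<in> cell l (cmp c)" shows "gradient (basis_fun l u) x = (\<chi> m. dshp l c u x m)"
proof -
 let ?P = "\<lambda>x :: real^3. shp l (cmp c 1) (cmp u 1) (x $ 1) * shp l (cmp c 2) (cmp u 2) (x $ 2) * shp l (cmp c 3) (cmp u 3) (x $ 3)"
 have sh: "((\<lambda>x :: real^3. shp l t i (x $ m)) has_derivative (\<lambda>h. - 2 * 2 ^ l * de t i * (h $ m))) (at x)" for t i m
  unfolding shp_def by (auto intro!: derivative_eq_intros bounded_linear_imp_has_derivative[OF bounded_linear_vec_nth])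
 have "(?P has_derivative inner (\<chi> m. dshp l c u x m)) (at x)"
  by (rule has_derivative_eq_rhs, (rule has_derivative_mult sh)+) (simp add: fun_eq_iff inner_vec_def sum_3 dshp_def prod_3 algebra_simps)
 then have "(basis_fun l u has_derivative inner (\<chi> m. dshp l c u x m)) (at x)"
  by (rule has_derivative_transform_within_open[OF _ open_cell x]) (simp add: basis_fun_cell[OF subsetD[OF cell_ccell]] prod_3)
 then have g: "GDERIV (basis_fun l u) x :> (\<chi> m. dshp l c u x m)" unfolding gderiv_def by (simp only: inner_commute[of _ "vec_lambda _"])
 show ?thesis unfolding gradient_def
 proof (rule the_equality)
  show "GDERIV (basis_fun l u) x :> (\<chi> m. dshp l c u x m)" by (rule g)
  fix v assume "GDERIV (basis_fun l u) x :> v"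
  then have "(\<lambda>h. inner h v) = (\<lambda>h. inner h (\<chi> m. dshp l c u x m))"
   using g unfolding gderiv_def by (intro has_derivative_unique)
  then have "\<forall>h. inner h v = inner h (\<chi> m. dshp l c u x m)" by (intro allI) (rule fun_cong)
  then show "v = (\<chi> m. dshp l c u x m)" by (simp only: vector_eq_ldot)
 qed
qed

definition PQ :: "nat => nat => nat => real" where "PQ t i j = mu t i * mu t j + de t i * de t j / 3"

lemma mass_cell:
 "integrable lborel (\<lambda>x. d * basis_fun l u x * basis_fun l v x * indicator (ccell l c) x)"
 "(\<integral>x. d * basis_fun l u x * basis_fun l v x * indicator (ccell l c) x \<partial>lborel)
  = d * mesh l ^ 3 * (\<Prod>m\<in>UNIV. PQ (cmp c m) (cmp u m) (cmp v m))"
proof -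
 let ?f = "\<lambda>m s. shp l (cmp c m) (cmp u m) s * shp l (cmp c m) (cmp v m) s * indicator (seg l (cmp c m)) s"
 have e: "d * basis_fun l u x * basis_fun l v x * indicator (ccell l c) x = d * (\<Prod>m\<in>UNIV. ?f m (x $ m))" for x
  by (cases "x \<in> ccell l c") (simp_all add: basis_fun_cell prod.distrib indicator_ccell[symmetric] mult_ac)
 have i: "integrable lborel (?f m)" for m by (rule integral_seg)
 show "integrable lborel (\<lambda>x. d * basis_fun l u x * basis_fun l v x * indicator (ccell l c) x)"
  unfolding e by (intro integrable_mult_right integral_prod_cart i)
 show "(\<integral>x. d * basis_fun l u x * basis_fun l v x * indicator (ccell l c) x \<partial>lborel)
  = d * mesh l ^ 3 * (\<Prod>m\<in>UNIV. PQ (cmp c m) (cmp u m) (cmp v m))"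
  unfolding e integral_mult_right_zero integral_prod_cart(2)[OF i] integral_seg(2) PQ_def[symmetric]
  by (simp add: prod_3 power3_eq_cube)
qed

definition stiff :: "nat => node => node => node => real" where
 "stiff l c u v = (\<Sum>m\<in>UNIV. \<Prod>k\<in>UNIV. if k = m then 4 * 4 ^ l * de (cmp c k) (cmp u k) * de (cmp c k) (cmp v k) else PQ (cmp c k) (cmp u k) (cmp v k))"

lemma stiff_cell:
 "integrable lborel (\<lambda>x. d * (\<Sum>m\<in>UNIV. dshp l c u x m * dshp l c v x m) * indicator (ccell l c) x)"
 "(\<integral>x. d * (\<Sum>m\<in>UNIV. dshp l c u x m * dshp l c v x m) * indicator (ccell l c) x \<partial>lborel)
  = d * mesh l ^ 3 * stiff l c u v"
proof -
 let ?f = "\<lambda>m k s. (if k = m then 4 * 4 ^ l * de (cmp c k) (cmp u k) * de (cmp c k) (cmp v k) * indicator (seg l (cmp c k)) s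
   else shp l (cmp c k) (cmp u k) s * shp l (cmp c k) (cmp v k) s * indicator (seg l (cmp c k)) s)"
 have four: "(4::real) ^ l = 2 ^ l * 2 ^ l" by (simp flip: power_mult_distrib)
 have "dshp l c u x m * dshp l c v x m * indicator (ccell l c) x = (\<Prod>k\<in>UNIV. ?f m k (x $ k))" for m x
  unfolding dshp_def indicator_ccell prod.distrib[symmetric] four by (intro prod.cong refl) auto
 then have e: "d * (\<Sum>m\<in>UNIV. dshp l c u x m * dshp l c v x m) * indicator (ccell l c) x = d * (\<Sum>m\<in>UNIV. \<Prod>k\<in>UNIV. ?f m k (x $ k))" for x
  by (simp only: mult.assoc sum_distrib_right)
 have i: "integrable lborel (?f m k)" for m k
  by (cases "k = m") (simp_all add: integral_seg integral_seg_1)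
 have I: "integral\<^sup>L lborel (?f m k) = mesh l * (if k = m then 4 * 4 ^ l * de (cmp c k) (cmp u k) * de (cmp c k) (cmp v k) else PQ (cmp c k) (cmp u k) (cmp v k))" for m k
  by (cases "k = m") (simp_all only: integral_seg(2) PQ_def if_True if_False integral_mult_right_zero integral_seg_1(2) mult.commute[of "mesh l"] refl)
 show "integrable lborel (\<lambda>x. d * (\<Sum>m\<in>UNIV. dshp l c u x m * dshp l c v x m) * indicator (ccell l c) x)"
  unfolding e by (intro integrable_mult_right Bochner_Integration.integrable_sum integral_prod_cart i)
 have "(\<integral>x. (\<Prod>k\<in>UNIV. ?f m k (x $ k)) \<partial>(lborel :: (real^3) measure)) = mesh l ^ 3 *
  (\<Prod>k\<in>UNIV. if k = m then 4 * 4 ^ l * de (cmp c k) (cmp u k) * de (cmp c k) (cmp v k) else PQ (cmp c k) (cmp u k) (cmp v k))" for m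
  unfolding integral_prod_cart(2)[OF i] I prod.distrib by simp
 then show "(\<integral>x. d * (\<Sum>m\<in>UNIV. dshp l c u x m * dshp l c v x m) * indicator (ccell l c) x \<partial>lborel)
  = d * mesh l ^ 3 * stiff l c u v"
  unfolding e integral_mult_right_zero by (subst Bochner_Integration.integral_sum[OF integral_prod_cart(1)[OF i]])
   (simp only: stiff_def sum_distrib_left mult.assoc)
qed

lemma mass_entry:
 assumes "\<And>c x. c \<in> cells l ==> x \<in> cell l (cmp c) ==> f x = fv c"
 shows "(LINT x:Omega|lebesgue. f x * basis_fun l u x * basis_fun l v x)
  = mesh l ^ 3 * (\<Sum>c\<in>cells l. fv c * (\<Prod>m\<in>UNIV. PQ (cmp c m) (cmp u m) (cmp v m)))"
proof -
 have "(LINT x:Omega|lebesgue. f x * basis_fun l u x * basis_fun l v x)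
  = (\<Sum>c\<in>cells l. \<integral>x. fv c * basis_fun l u x * basis_fun l v x * indicator (ccell l c) x \<partial>lborel)"
  by (rule integral_cells) (simp_all add: assms mass_cell)
 then show ?thesis unfolding mass_cell by (simp only: sum_distrib_left mult_ac)
qed

lemma stiffness_entry:
 assumes "\<And>c x. c \<in> cells l ==> x \<in> cell l (cmp c) ==> f x = fv c"
 shows "(LINT x:Omega|lebesgue. f x * inner (gradient (basis_fun l u) x) (gradient (basis_fun l v) x))
  = mesh l ^ 3 * (\<Sum>c\<in>cells l. fv c * stiff l c u v)"
proof -
 have "(LINT x:Omega|lebesgue. f x * inner (gradient (basis_fun l u) x) (gradient (basis_fun l v) x))
  = (\<Sum>c\<in>cells l. \<integral>x. fv c * (\<Sum>m\<in>UNIV. dshp l c u x m * dshp l c v x m) * indicator (ccell l c) x \<partial>lborel)"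
  by (rule integral_cells) (simp_all only: assms stiff_cell gradient_basis_fun inner_vec_def vec_lambda_beta inner_real_def)
 then show ?thesis unfolding stiff_cell by (simp only: sum_distrib_left mult_ac)
qed

section \<open>Discretised coefficients\<close>

definition bits_of :: "nat => bits" where "bits_of i = (\<lambda>w. bit i w)"

fun val :: "nat list => bits => nat" where
 "val [] x = 0"
| "val (w # ws) x = of_bool (x w) + 2 * val ws x"

lemma val_less: "val ws x < 2 ^ length ws"
 by (induction ws) auto

lemma val_cong: "(\<And>w. w \<in> set ws ==> x w = y w) ==> val ws x = val ws y"
 by (induction ws) auto

lemma val_eq_iff: "val ws x = val ws y \<longleftrightarrow> (\<forall>w\<in>set ws. x w = y w)"
proof (induction ws)
 case (Cons w ws)
 have "of_bool p + 2 * m = of_bool q + 2 * n \<longleftrightarrow> p = q \<and> m = n" for p q :: bool and m n :: nat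
  by (cases p; cases q; simp; presburger)
 then show ?case using Cons by simp
qed simp

lemma val_append: "val (ws @ vs) x = val ws x + 2 ^ length ws * val vs x"
 by (induction ws) auto

lemma val_incr: "distinct ws ==> val ws (incr ws x) = (val ws x + 1) mod 2 ^ length ws"
proof (induction ws arbitrary: x)
 case (Cons w ws)
 then have w: "w \<notin> set ws" and IH: "\<And>x. val ws (incr ws x) = (val ws x + 1) mod 2 ^ length ws" by auto
 have v: "val ws (y(w := b)) = val ws y" for y b using w by (intro val_cong) auto
 show ?case
 proof (cases "x w")
  case True
  have "val (w # ws) (incr (w # ws) x) = 2 * val ws (incr ws x)"
   using True w by (simp only: incr.simps if_True incr_upd[OF w] val.simps v fun_upd_same of_bool_eq add_0)
  also have "\<dots> = (2 * (val ws x + 1)) mod 2 ^ length (w # ws)" unfolding IH by (simp add: mult_mod_right)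
  finally show ?thesis using True by simp
 next
  case False
  have "val (w # ws) (incr (w # ws) x) = 1 + 2 * val ws x"
   using False w by (simp only: incr.simps if_False val.simps v fun_upd_same of_bool_eq)
  moreover have "1 + 2 * val ws x < 2 ^ length (w # ws)" using val_less[of ws x] by simp
  moreover have "val (w # ws) x + 1 = 1 + 2 * val ws x" using False by simp
  ultimately show ?thesis by (simp only: mod_less)
 qed
qed simp

lemma val_bits:
 "(\<And>i. i < m ==> x (b + i) = bit k i) ==> k < 2 ^ m ==> val [b..<b + m] x = (k :: nat)"
proof (induction m arbitrary: b k)
 case (Suc m)
 have "val [Suc b..<Suc b + m] x = k div 2"
 proof (rule Suc.IH)
  show "x (Suc b + i) = bit (k div 2) i" if "i < m" for i
   using Suc.prems(1)[of "Suc i"] that by (simp add: bit_Suc)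
 qed (use Suc.prems(2) in simp)
 moreover have "[b..<b + Suc m] = b # [Suc b..<Suc b + m]" by (subst upt_conv_Cons) simp_all
 moreover have "x b = odd k" using Suc.prems(1)[of 0] by (simp add: bit_0)
 ultimately show ?case by (simp only: val.simps) (cases "odd k"; simp)
qed simp

lemma bit_pack:
 assumes "b < 2 ^ n" shows "bit (a * 2 ^ n + b :: nat) w \<longleftrightarrow> (if w < n then bit b w else bit a (w - n))"
proof (cases "w < n")
 case True
 have "(a * 2 ^ n + b) div 2 ^ w = a * 2 ^ (n - w) + b div 2 ^ w"
 proof -
  have "a * 2 ^ n + b = (a * 2 ^ (n - w)) * 2 ^ w + b" using True by (simp add: mult.assoc flip: power_add)
  then show ?thesis by (simp only: div_mult_self3 power_not_zero zero_neq_numeral not_False_eq_True simp_thms)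
 qed
 moreover have "even (a * 2 ^ (n - w))" using True by simp
 ultimately show ?thesis using True by (simp add: bit_iff_odd)
next
 case False
 have "(a * 2 ^ n + b) div 2 ^ w = (a * 2 ^ n + b) div 2 ^ n div 2 ^ (w - n)"
  unfolding div_mult2_eq[symmetric] using False by (simp flip: power_add)
 then show ?thesis using False assms by (simp add: bit_iff_odd)
qed

section \<open>Nodes and cells as points of the torus\<close>

context grid
begin

text \<open>The basis index used by \<open>node_embedding\<close>.\<close>

definition code :: "node => nat" where "code = (\<lambda>(i, j, k). i * 2 ^ (2 * l) + j * 2 ^ l + k)"

definition ptc :: "node => bits" where "ptc c = bits_of (code c)"

text \<open>Direction 0 is the last node index, which occupies the lowest wires.\<close>

definition coord :: "nat => node => nat" where
 "coord a c = (case c of (i, j, k) => if a = 0 then k else if a = 1 then j else i)"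

lemma coord_less: "c \<in> cells l ==> coord a c < 2 ^ l"
 by (auto simp: coord_def cells_def)

lemma ptc_bits:
 assumes "c \<in> cells l"
 shows "a < 3 ==> i < l ==> ptc c (a * l + i) = bit (coord a c) i" "3 * l \<le> w ==> \<not> ptc c w"
proof -
 obtain p q r where c: "c = (p, q, r)" "p < 2 ^ l" "q < 2 ^ l" "r < 2 ^ l" using assms by (auto simp: cells_def)
 have "code c = (p * 2 ^ l + q) * 2 ^ l + r" by (simp add: code_def c(1) power_add[symmetric] mult_2 distrib_right)
 then have b: "ptc c w = (if w < l then bit r w else if w - l < l then bit q (w - l) else bit p (w - l - l))" for w
  unfolding ptc_def bits_of_def by (simp only: bit_pack c)
 have hi: "\<not> bit p i" if "l \<le> i" for i
 proof -
  have "p < 2 ^ i" using c(2) that by (meson less_le_trans one_le_numeral power_increasing)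
  then show ?thesis by (simp add: bit_iff_odd)
 qed
 show "ptc c (a * l + i) = bit (coord a c) i" if "a < 3" "i < l"
 proof -
  consider "a = 0" | "a = 1" | "a = 2" using \<open>a < 3\<close> by linarith
  then show ?thesis unfolding b using that by cases (simp_all add: coord_def c(1))
 qed
 show "\<not> ptc c w" if "3 * l \<le> w"
 proof -
  have "\<not> w < l" "\<not> w - l < l" "l \<le> w - l - l" using that by linarith+
  then show ?thesis unfolding b using hi by (simp only: if_False simp_thms)
 qed
qed

lemma val_reg_ptc:
 assumes "c \<in> cells l" "a < 3" shows "val (low a) (ptc c) = coord a c" "val (reg a) (ptc c) = coord a c"
proof -
 show 1: "val (low a) (ptc c) = coord a c"
  by (rule val_bits) (use ptc_bits(1)[OF assms] coord_less[OF assms(1)] in auto)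
 have "\<not> ptc c (3 * l + a)" by (rule ptc_bits(2)[OF assms(1)]) simp
 then show "val (reg a) (ptc c) = coord a c" using 1 unfolding reg_def val_append by simp
qed

lemma coord_eqI: "(\<And>a. a < 3 ==> coord a c = coord a d) ==> c = d"
proof -
 assume c: "\<And>a. a < 3 ==> coord a c = coord a d"
 show "c = d" using c[of 0] c[of 1] c[of 2] by (cases c; cases d) (simp add: coord_def)
qed

lemma inj_ptc: "inj_on ptc (cells l)"
proof (rule inj_onI)
 fix c d assume "c \<in> cells l" "d \<in> cells l" "ptc c = ptc d"
 then show "c = d" using val_reg_ptc(1) by (intro coord_eqI) metis
qed

lemma phys_ptc: "c \<in> cells l ==> phys (ptc c)"
 using ptc_bits(2)[of c] by (simp add: phys_def slice_def sz_def alpha_def al_def)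

lemma phys_agree:
 assumes "phys x" "phys y" "\<And>a w. a < 3 ==> w \<in> set (low a) ==> x w = y w" shows "x = y"
proof
 fix w
 consider "w < l" | "l \<le> w" "w < 2 * l" | "2 * l \<le> w" "w < 3 * l" | a where "a < 3" "w = 3 * l + a"
  | a where "a < 3" "w = 3 * l + 3 + a" | "3 * l + 6 \<le> w"
 proof -
  have "w < l \<or> (l \<le> w \<and> w < 2 * l) \<or> (2 * l \<le> w \<and> w < 3 * l) \<or> (w = 3 * l + (w - 3 * l) \<and> w - 3 * l < 3)
   \<or> (w = 3 * l + 3 + (w - 3 * l - 3) \<and> w - 3 * l - 3 < 3) \<or> 3 * l + 6 \<le> w" by linarith
  then show ?thesis using that by blast
 qed
 then show "x w = y w"
 proof cases
  case 1 then show ?thesis using assms(3)[of 0 w] by simp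
 next
  case 2 then show ?thesis using assms(3)[of 1 w] by simp
 next
  case 3 then show ?thesis using assms(3)[of 2 w] by simp
 next
  case 4 then show ?thesis using assms(1,2) by (simp add: phys_def)
 next
  case (5 a)
  then have "a = 0 \<or> a = 1 \<or> a = 2" by linarith
  then show ?thesis using 5 assms(1,2) by (auto simp: phys_def alpha_def al_def)
 next
  case 6 then show ?thesis using assms(1,2) by (simp add: phys_def slice_def sz_def)
 qed
qed

lemma phys_iff: "phys x \<longleftrightarrow> x \<in> ptc ` cells l"
proof
 assume x: "phys x"
 define c where "c = (val (low 2) x, val (low 1) x, val (low 0) x)"
 have c: "c \<in> cells l" using val_less[of "low 2" x] val_less[of "low 1" x] val_less[of "low 0" x] by (simp add: c_def cells_def)
 have "x = ptc c"
 proof (rule phys_agree[OF x phys_ptc[OF c]])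
  fix a w assume a: "a < 3" and w: "w \<in> set (low a)"
  have "a = 0 \<or> a = 1 \<or> a = 2" using a by linarith
  then have "val (low a) x = coord a c" by (auto simp: c_def coord_def)
  then have "val (low a) x = val (low a) (ptc c)" using val_reg_ptc(1)[OF c a] by simp
  then show "x w = ptc c w" using w unfolding val_eq_iff by blast
 qed
 then show "x \<in> ptc ` cells l" using c by blast
qed (auto simp: phys_ptc)

lemma zero_on_val: "zero_on (set ws) x \<longleftrightarrow> val ws x = 0"
 by (induction ws) auto

lemma interior_ptc: "c \<in> cells l ==> interior (ptc c) \<longleftrightarrow> (\<forall>a<3. 0 < coord a c)"
 using phys_ptc[of c] val_reg_ptc(1)[of c] by (auto simp: interior_def zero_on_val simp del: set_upt)

definition nu :: "bool => nat => nat => real" where "nu p = (if p then de else mu)"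

lemma fac_mult:
 assumes "\<And>z. F (incr (reg b) z) = F z"
 shows "fac b p (\<lambda>z. F z * G z) = (\<lambda>z. F z * fac b p G z)"
 using assms by (simp add: fac_def avg_def dif_def shift_def fun_eq_iff algebra_simps add_divide_distrib diff_divide_distrib)

text \<open>A spike is a product of one factor per register and one factor on the other wires; each
  one-dimensional operator acts on its own factor only.\<close>

lemma facs_spike:
 assumes u: "u \<in> cells l" and c: "c \<in> cells l"
 shows "facs3 (p, q, r) (spike (ptc u)) (ptc c)
  = cr (nu p (coord 0 c) (coord 0 u) * nu q (coord 1 c) (coord 1 u) * nu r (coord 2 c) (coord 2 u))"
proof -
 define rest where "rest = (\<lambda>z. of_bool (\<forall>w. (\<forall>a<3. w \<notin> set (reg a)) \<longrightarrow> z w = ptc u w) :: complex)"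
 define E where "E a = (\<lambda>z. of_bool (val (reg a) z = coord a u) :: complex)" for a
 have E_other: "E a (incr (reg b) z) = E a z" if "a < 3" "b < 3" "a \<noteq> b" for a b z
 proof -
  have "val (reg a) (incr (reg b) z) = val (reg a) z"
   using reg_disjoint[OF that] by (intro val_cong incr_other) blast
  then show ?thesis by (simp add: E_def)
 qed
 have inv: "fac a b (E a) (incr (reg c) z) = fac a b (E a) z" if "a < 3" "c < 3" "a \<noteq> c" for a b c z
  unfolding fac_def avg_def dif_def shift_def
  using E_other[OF that] incr_commute_disjoint[OF reg_disjoint[OF that]] by simp
 have rest_other: "rest (incr (reg b) z) = rest z" if "b < 3" for b z
  unfolding rest_def using that by (metis incr_other)
 have sp: "spike (ptc u) = (\<lambda>z. (rest z * E 0 z * E 1 z) * E 2 z)"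
 proof
  fix z
  have "z = ptc u \<longleftrightarrow> (\<forall>w. (\<forall>a<3. w \<notin> set (reg a)) \<longrightarrow> z w = ptc u w) \<and> (\<forall>a<3. \<forall>w\<in>set (reg a). z w = ptc u w)" by (auto simp: fun_eq_iff)
  also have "(\<forall>a<3. \<forall>w\<in>set (reg a). z w = ptc u w) \<longleftrightarrow> (\<forall>a<3. val (reg a) z = coord a u)"
  proof -
   have "(\<forall>w\<in>set (reg a). z w = ptc u w) \<longleftrightarrow> val (reg a) z = coord a u" if "a < 3" for a
    using val_eq_iff[of "reg a" z "ptc u"] val_reg_ptc(2)[OF u that] by simp
   then show ?thesis by blast
  qed
  also have "\<dots> \<longleftrightarrow> val (reg 0) z = coord 0 u \<and> val (reg 1) z = coord 1 u \<and> val (reg 2) z = coord 2 u"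
   by (auto simp: numeral_3_eq_3 less_Suc_eq numeral_2_eq_2)
  finally show "spike (ptc u) z = (rest z * E 0 z * E 1 z) * E 2 z" by (simp add: rest_def E_def)
 qed
 have "facs3 (p, q, r) (spike (ptc u)) = fac 0 p (fac 1 q (\<lambda>z. rest z * E 0 z * E 1 z * fac 2 r (E 2) z))"
  unfolding facs_3 sp by (subst fac_mult) (simp_all add: rest_other E_other)
 also have "(\<lambda>z. rest z * E 0 z * E 1 z * fac 2 r (E 2) z) = (\<lambda>z. (rest z * E 0 z * fac 2 r (E 2) z) * E 1 z)" by (simp add: mult_ac)
 also have "fac 1 q \<dots> = (\<lambda>z. rest z * E 0 z * fac 2 r (E 2) z * fac 1 q (E 1) z)"
 proof (rule fac_mult)
  show "rest (incr (reg 1) z) * E 0 (incr (reg 1) z) * fac 2 r (E 2) (incr (reg 1) z) = rest z * E 0 z * fac 2 r (E 2) z" for z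
   by (simp add: rest_other E_other inv)
 qed
 also have "\<dots> = (\<lambda>z. (rest z * fac 2 r (E 2) z * fac 1 q (E 1) z) * E 0 z)" by (simp add: mult_ac)
 also have "fac 0 p \<dots> = (\<lambda>z. rest z * fac 2 r (E 2) z * fac 1 q (E 1) z * fac 0 p (E 0) z)"
 proof (rule fac_mult)
  show "rest (incr (reg 0) z) * fac 2 r (E 2) (incr (reg 0) z) * fac 1 q (E 1) (incr (reg 0) z) = rest z * fac 2 r (E 2) z * fac 1 q (E 1) z" for z
   by (simp add: rest_other inv)
 qed
 finally have f: "facs3 (p, q, r) (spike (ptc u)) (ptc c) = rest (ptc c) * fac 2 r (E 2) (ptc c) * fac 1 q (E 1) (ptc c) * fac 0 p (E 0) (ptc c)"
  by (rule fun_cong)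
 have r1: "rest (ptc c) = 1"
 proof -
  have "ptc c w = ptc u w" if "\<forall>a<3. w \<notin> set (reg a)" for w
  proof -
   have n: "w \<notin> set (low a)" if "a < 3" for a using \<open>\<forall>a<3. w \<notin> set (reg a)\<close> low_sub(1)[of a] that by blast
   have "3 * l \<le> w" using n[of 0] n[of 1] n[of 2] by auto
   then show ?thesis using ptc_bits(2)[OF u] ptc_bits(2)[OF c] by blast
  qed
  then show ?thesis by (simp add: rest_def)
 qed
 have fE: "fac a b (E a) (ptc c) = cr (nu b (coord a c) (coord a u))" if a: "a < 3" for a b
 proof -
  \<comment> \<open>The increment does not wrap around, thanks to the extra wire of the
    register.\<close>
  have "coord a c + 1 < 2 ^ Suc l" using coord_less[OF c, of a] by simp
  then have "val (reg a) (incr (reg a) (ptc c)) = Suc (coord a c)"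
   using val_incr[OF distinct_reg[OF a], of "ptc c"] val_reg_ptc(2)[OF c a] by simp
  then show ?thesis using val_reg_ptc(2)[OF c a] by (simp add: fac_def avg_def dif_def shift_def E_def nu_def mu_def de_def)
 qed
 show ?thesis unfolding f r1 by (simp add: fE)
qed

text \<open>Cells with some wire \<open>3 * l + a\<close> set lie outside the cube and do not meet
  an interior node, so the sum over the torus reduces to the mesh.\<close>

lemma form_spikes:
 assumes u: "u \<in> cells l" "interior (ptc u)" and v: "v \<in> cells l"
 shows "form \<theta> (spike (ptc u)) (spike (ptc v)) = cr (\<Sum>c\<in>cells l. \<Sum>\<beta>\<in>UNIV. \<theta> (put \<beta> (ptc c)) *
  (\<Prod>a<3. nu (bsel \<beta> a) (coord a c) (coord a u) * nu (bsel \<beta> a) (coord a c) (coord a v)))"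
proof -
 let ?F = "\<lambda>x. cnj (igrad (spike (ptc u)) x) * (cr (\<theta> x) * igrad (spike (ptc v)) x)"
 have "form \<theta> (spike (ptc u)) (spike (ptc v)) = (\<Sum>\<beta>\<in>UNIV. \<Sum>x\<in>{x \<in> slice sz. alpha x = z3}. ?F (put \<beta> x))"
  unfolding form_def ip_def sum_slice_put ..
 also have "\<dots> = (\<Sum>\<beta>\<in>UNIV. \<Sum>x\<in>ptc ` cells l. ?F (put \<beta> x))"
 proof (rule sum.cong[OF refl], rule sum.mono_neutral_right)
  show "ptc ` cells l \<subseteq> {x \<in> slice sz. alpha x = z3}" using phys_ptc by (auto simp: phys_def)
  show "\<forall>x\<in>{x \<in> slice sz. alpha x = z3} - ptc ` cells l. ?F (put \<beta> x) = 0" for \<beta>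
  proof
   fix x assume x: "x \<in> {x \<in> slice sz. alpha x = z3} - ptc ` cells l"
   then obtain a where a: "a < 3" "x (3 * l + a)" using phys_iff[of x] by (auto simp: phys_def)
   have "igrad (spike (ptc u)) (put \<beta> x) = 0"
   proof (rule ccontr)
    assume "igrad (spike (ptc u)) (put \<beta> x) \<noteq> 0"
    from igrad_support[OF a(1) _ this, of False] have "\<not> put \<beta> x (3 * l + a)"
     using u(2) a(1) by (auto simp: interior_def phys_def split: if_splits)
    then show False using a by (simp add: put_def al_def)
   qed
   then show "?F (put \<beta> x) = 0" by simp
  qed
 qed simp
 also have "\<dots> = (\<Sum>\<beta>\<in>UNIV. \<Sum>c\<in>cells l. ?F (put \<beta> (ptc c)))"
  by (simp add: sum.reindex[OF inj_ptc])
 also have "\<dots> = (\<Sum>c\<in>cells l. \<Sum>\<beta>\<in>UNIV. ?F (put \<beta> (ptc c)))" by (rule sum.swap)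
 also have "\<dots> = (\<Sum>c\<in>cells l. \<Sum>\<beta>\<in>UNIV. cr (\<theta> (put \<beta> (ptc c)) *
  (\<Prod>a<3. nu (bsel \<beta> a) (coord a c) (coord a u) * nu (bsel \<beta> a) (coord a c) (coord a v))))"
 proof (intro sum.cong refl)
  fix c and \<beta> :: "bool \<times> bool \<times> bool" assume c: "c \<in> cells l"
  obtain p q r where \<beta>: "\<beta> = (p, q, r)" by (cases \<beta>)
  have "put z3 (ptc c) = ptc c" using phys_ptc[OF c] by (intro put_z3) (simp add: phys_def)
  then have "igrad (spike (ptc w)) (put \<beta> (ptc c)) = cr (\<Prod>a<3. nu (bsel \<beta> a) (coord a c) (coord a w))" if "w \<in> cells l" for w
   using facs_spike[OF that c, of p q r] by (simp add: grad_def comb_def \<beta> bsel_def numeral_3_eq_3 numeral_2_eq_2 lessThan_Suc mult_ac)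
  then show "?F (put \<beta> (ptc c)) = cr (\<theta> (put \<beta> (ptc c)) *
   (\<Prod>a<3. nu (bsel \<beta> a) (coord a c) (coord a u) * nu (bsel \<beta> a) (coord a c) (coord a v)))"
   using u(1) v by (simp add: prod.distrib)
 qed
 finally show ?thesis by (simp only: of_real_sum)
qed

end

text \<open>Per direction the mass has \<open>A + B / 3\<close>; a derivative replaces this by
  \<open>4 F B\<close>, which is \<open>12 F\<close> times the difference part. A monomial with
  \<open>n\<close> difference factors thus gets \<open>(1 / 3) ^ n * (s + 12 n d F)\<close>, written
  here with \<open>F\<close> drawn out.\<close>

lemma fem_identity:
 fixes F dv sv :: real
 assumes "F \<noteq> 0"
 shows "dv * (4 * F * B2 * (A1 + B1 / 3) * (A0 + B0 / 3) + (A2 + B2 / 3) * (4 * F * B1) * (A0 + B0 / 3) + (A2 + B2 / 3) * (A1 + B1 / 3) * (4 * F * B0))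
   + sv * ((A2 + B2 / 3) * (A1 + B1 / 3) * (A0 + B0 / 3))
  = 1 / 27 * (sv / F + 36 * dv) * F * (B0 * B1 * B2) + 1 / 9 * (sv / F + 24 * dv) * F * (B0 * B1 * A2)
   + (1 / 9 * (sv / F + 24 * dv) * F * (B0 * A1 * B2) + 1 / 3 * (sv / F + 12 * dv) * F * (B0 * A1 * A2))
   + (1 / 9 * (sv / F + 24 * dv) * F * (A0 * B1 * B2) + 1 / 3 * (sv / F + 12 * dv) * F * (A0 * B1 * A2)
   + (1 / 3 * (sv / F + 12 * dv) * F * (A0 * A1 * B2) + sv * 1 * (A0 * A1 * A2)))"
proof -
 have "(sv / F + k) * F = sv + k * F" for k using assms by (simp add: field_simps)
 then have e: "c * (sv / F + k) * F = c * (sv + k * F)" for c k by (simp add: mult.assoc)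
 show ?thesis unfolding e by (simp add: field_simps)
qed

section \<open>Coefficients as functions on the torus\<close>

context grid
begin

definition cnt :: "bool \<times> bool \<times> bool => nat" where "cnt = (\<lambda>(p, q, r). of_bool p + of_bool q + of_bool r)"

abbreviation top :: "nat => nat => nat list" where
 "top l0 a \<equiv> [a * l + (l - l0)..<a * l + (l - l0) + l0]"

text \<open>On a torus point with the sign bit set, complementing the position gives the mirror image of
 the cell, so that all coefficients become symmetric under the reflections \<open>flip (reg a)\<close>.\<close>
definition crs :: "nat => nat => bits => nat" where
 "crs l0 a x = val (top l0 a) (\<lambda>w. x w \<noteq> x (3 * l + a))"

definition cx :: "nat => bits => node" where "cx l0 x = (crs l0 2 x, crs l0 1 x, crs l0 0 x)"

text \<open>\<open>3 * l0 + 6\<close> wires, a number independent of \<open>l\<close>; a diagonal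
  operator pays exponentially for it.\<close>

definition wires :: "nat => nat list" where
 "wires l0 = top l0 0 @ top l0 1 @ top l0 2 @ [3 * l..<3 * l + 6]"

definition coarse :: "nat => node => node" where
 "coarse l0 = (\<lambda>(i, j, k). (i div 2 ^ (l - l0), j div 2 ^ (l - l0), k div 2 ^ (l - l0)))"

lemma crs_less: "crs l0 a x < 2 ^ l0"
 using val_less[of "top l0 a" "\<lambda>w. x w \<noteq> x (3 * l + a)"] by (simp add: crs_def)

lemma cx_cells: "cx l0 x \<in> cells l0"
 by (simp add: cx_def cells_def crs_less)

lemma top_low: "l0 \<le> l ==> set (top l0 a) \<subseteq> set (low a)"
 by auto

text \<open>The complement changes the position bits and the wire \<open>3 * l + a\<close> alike, so
  their exclusive or stays the same.\<close>

lemma crs_flip: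
 assumes "l0 \<le> l" "a < 3" "b < 3" shows "crs l0 b (flip (reg a) x) = crs l0 b x"
proof -
 have "(flip (reg a) x w \<noteq> flip (reg a) x (3 * l + b)) = (x w \<noteq> x (3 * l + b))" if "w \<in> set (top l0 b)" for w
 proof -
  have w: "w \<in> set (reg b)" "3 * l + b \<in> set (reg b)" using that top_low[OF assms(1)] low_sub by blast+
  show ?thesis
  proof (cases "a = b")
   case True
   then show ?thesis using w by (simp add: flip_def)
  next
   case False
   then have "w \<notin> set (reg a)" "3 * l + b \<notin> set (reg a)" using w reg_disjoint[OF assms(2,3)] by auto
   then show ?thesis by simp
  qed
 qed
 then show ?thesis unfolding crs_def by (rule val_cong)
qed

lemma cx_flip: "l0 \<le> l ==> a < 3 ==> cx l0 (flip (reg a) x) = cx l0 x"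
 by (simp add: cx_def crs_flip)

lemma alpha_flip: "a < 3 ==> alpha (flip (reg a) x) = alpha x"
 by (simp add: alpha_def al_notin_reg)

lemma crs_cong:
 assumes "\<And>w. w \<in> set (top l0 a) ==> x w = y w" "x (3 * l + a) = y (3 * l + a)"
 shows "crs l0 a x = crs l0 a y"
 unfolding crs_def using assms by (intro val_cong) simp

lemma cx_put: "l0 \<le> l ==> cx l0 (put \<beta> x) = cx l0 x"
 unfolding cx_def by (auto intro!: crs_cong simp: put_def al_def)

lemma cx_wires:
 assumes "\<forall>w\<in>set (wires l0). x w = y w" shows "cx l0 x = cx l0 y" "alpha x = alpha y"
proof -
 have w: "x w = y w" if "w \<in> set (wires l0)" for w using assms that by blast
 show "cx l0 x = cx l0 y" unfolding cx_def by (auto intro!: crs_cong w simp: wires_def)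
 show "alpha x = alpha y" unfolding alpha_def al_def by (auto intro!: w simp: wires_def)
qed

lemma wires_bounds:
 assumes "l0 \<le> l" shows "distinct (wires l0)" "set (wires l0) \<subseteq> {..<sz}"
 using assms by (auto simp: wires_def sz_def)

lemma cx_ptc:
 assumes "l0 \<le> l" "c \<in> cells l" shows "cx l0 (ptc c) = coarse l0 c"
proof -
 have "crs l0 a (ptc c) = coord a c div 2 ^ (l - l0)" if a: "a < 3" for a
  unfolding crs_def
 proof (rule val_bits)
  show "(ptc c (a * l + (l - l0) + i) \<noteq> ptc c (3 * l + a)) = bit (coord a c div 2 ^ (l - l0)) i" if "i < l0" for i
  proof -
   have "ptc c (a * l + (l - l0 + i)) = bit (coord a c) (l - l0 + i)"
    by (rule ptc_bits(1)[OF assms(2) a]) (use that assms(1) in simp)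
   moreover have "\<not> ptc c (3 * l + a)" by (rule ptc_bits(2)[OF assms(2)]) simp
   ultimately show ?thesis by (simp add: bit_iff_odd power_add div_mult2_eq add.assoc)
  qed
  have "coord a c < 2 ^ l0 * 2 ^ (l - l0)" using coord_less[OF assms(2), of a] assms(1) by (simp flip: power_add)
  then show "coord a c div 2 ^ (l - l0) < 2 ^ l0" by (simp add: less_mult_imp_div_less)
 qed
 then show ?thesis by (cases c) (simp add: cx_def coarse_def coord_def)
qed

lemma cell_coarse:
 assumes "l0 \<le> l" shows "cell l (cmp c) \<subseteq> cell l0 (cmp (coarse l0 c))"
proof
 fix x assume x: "x \<in> cell l (cmp c)"
 define K :: nat where "K = 2 ^ (l - l0)"
 have mesh: "mesh l0 = real K * mesh l"
  using assms by (simp add: K_def field_simps flip: power_add)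
 have K: "0 < K" by (simp add: K_def)
 have "real (cmp (coarse l0 c) m) * mesh l0 < x $ m \<and> x $ m < (real (cmp (coarse l0 c) m) + 1) * mesh l0" for m
 proof -
  define t where "t = cmp c m"
  have co: "cmp (coarse l0 c) m = t div K" by (cases c) (simp add: coarse_def cmp_def K_def t_def)
  have "t div K * K \<le> t" "t + 1 \<le> (t div K + 1) * K"
   using K by (simp_all add: div_times_less_eq_dividend) (metis Suc_leI dividend_less_div_times mult.commute add.commute)
  then have "real (t div K * K) \<le> real t" "real (t + 1) \<le> real ((t div K + 1) * K)" by (simp_all only: of_nat_le_iff)
  then have "real (t div K) * real K \<le> real t" "real t + 1 \<le> (real (t div K) + 1) * real K" by (simp_all only: of_nat_mult of_nat_add of_nat_1)
  then have "real (t div K) * real K * mesh l \<le> real t * mesh l" "(real t + 1) * mesh l \<le> (real (t div K) + 1) * real K * mesh l"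
   by (intro mult_right_mono; simp)+
  moreover have "real t * mesh l < x $ m" "x $ m < (real t + 1) * mesh l" using x by (auto simp: cell_def t_def)
  ultimately show ?thesis unfolding co mesh by (simp only: mult.assoc) linarith
 qed
 then show "x \<in> cell l0 (cmp (coarse l0 c))" by (simp add: cell_def)
qed

text \<open>The coefficient of each component after \<open>om\<close> has been drawn out. In the
  components with a difference the absorption is left with the squared mesh size as factor, so the
  bounds do not depend on \<open>l\<close>.\<close>

definition Wf :: "nat => (node => real) => (node => real) => bits => real" where
 "Wf l0 dv sv x = (if alpha x = z3 then sv (cx l0 x)
   else (1 / 3) ^ cnt (alpha x) * (sv (cx l0 x) / 4 ^ l + 12 * real (cnt (alpha x)) * dv (cx l0 x)))"

definition Cf :: "nat => (node => real) => bits => real" where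
 "Cf l0 nv x = (1 / 3) ^ cnt (alpha x) * nv (cx l0 x)"

text \<open>\<open>12 n / 3 ^ n\<close> is 4, 8/3 and 4/3 for \<open>n = 1, 2, 3\<close>: at least 1
  and at most 4.\<close>

lemma Wf_bounds:
 assumes "\<And>c. c \<in> cells l0 ==> m \<le> sv c \<and> m \<le> dv c \<and> sv c + 4 * dv c \<le> M" "0 < m"
 shows "m \<le> Wf l0 dv sv x" "Wf l0 dv sv x \<le> M"
proof -
 define s d where "s = sv (cx l0 x)" and "d = dv (cx l0 x)"
 have b: "m \<le> s" "m \<le> d" "s + 4 * d \<le> M" using assms(1)[OF cx_cells[of l0 x]] by (auto simp: s_def d_def)
 define e where "e = s / 4 ^ l"
 have s4: "0 \<le> e" "e \<le> s" using b assms(2) by (auto simp: e_def field_simps)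
 obtain p q r where a: "alpha x = (p, q, r)" by (cases "alpha x")
 have "m \<le> Wf l0 dv sv x \<and> Wf l0 dv sv x \<le> M"
  unfolding Wf_def a s_def[symmetric] d_def[symmetric] e_def[symmetric] cnt_def using b s4 assms(2)
  by (cases p; cases q; cases r) (simp_all add: power2_eq_square power3_eq_cube)
 then show "m \<le> Wf l0 dv sv x" "Wf l0 dv sv x \<le> M" by auto
qed

text \<open>27 is the cube of 3, for the component with three differences.\<close>

lemma Cf_bounds:
 assumes "\<And>c. c \<in> cells l0 ==> (nv c = 0 \<or> 27 * m \<le> nv c) \<and> nv c \<le> M" "0 < m" "m \<le> M"
 shows "Cf l0 nv x = 0 \<or> m \<le> Cf l0 nv x" "Cf l0 nv x \<le> M"
proof -
 define s where "s = nv (cx l0 x)"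
 have b: "s = 0 \<or> 27 * m \<le> s" "s \<le> M" using assms(1)[OF cx_cells[of l0 x]] by (auto simp: s_def)
 obtain p q r where a: "alpha x = (p, q, r)" by (cases "alpha x")
 have "(Cf l0 nv x = 0 \<or> m \<le> Cf l0 nv x) \<and> Cf l0 nv x \<le> M"
  unfolding Cf_def a s_def[symmetric] cnt_def using b assms(2,3)
  by (cases p; cases q; cases r) (auto simp: power2_eq_square power3_eq_cube)
 then show "Cf l0 nv x = 0 \<or> m \<le> Cf l0 nv x" "Cf l0 nv x \<le> M" by auto
qed

lemma prod_coord: "(\<Prod>a<3. g a) = g 0 * g 1 * (g (2 :: nat) :: real)"
proof -
 have "{..<3 :: nat} = {0, 1, 2}" by auto
 then show ?thesis by simp
qed

lemma coord_cmp: "cmp c 3 = coord 0 c" "cmp c 2 = coord 1 c" "cmp c 1 = coord 2 c"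
 by (cases c; simp add: coord_def)+

lemma stiffness_mass_entry:
 assumes l0: "l0 \<le> l" and u: "u \<in> cells l" "interior (ptc u)" and v: "v \<in> cells l"
  and D: "\<And>c x. c \<in> cells l ==> x \<in> cell l (cmp c) ==> D x = dv (coarse l0 c)"
  and Sa: "\<And>c x. c \<in> cells l ==> x \<in> cell l (cmp c) ==> Sa x = sv (coarse l0 c)"
 shows "cr ((LINT x:Omega|lebesgue. D x * inner (gradient (basis_fun l u) x) (gradient (basis_fun l v) x))
   + (LINT x:Omega|lebesgue. Sa x * basis_fun l u x * basis_fun l v x))
  = cr (mesh l ^ 3) * form (\<lambda>x. Wf l0 dv sv x * om (alpha x)) (spike (ptc u)) (spike (ptc v))"
proof -
 have "dv (coarse l0 c) * stiff l c u v + sv (coarse l0 c) * (\<Prod>m\<in>UNIV. PQ (cmp c m) (cmp u m) (cmp v m))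
  = (\<Sum>\<beta>\<in>UNIV. Wf l0 dv sv (put \<beta> (ptc c)) * om (alpha (put \<beta> (ptc c))) *
    (\<Prod>a<3. nu (bsel \<beta> a) (coord a c) (coord a u) * nu (bsel \<beta> a) (coord a c) (coord a v)))" if c: "c \<in> cells l" for c
 proof -
  define A where "A a = mu (coord a c) (coord a u) * mu (coord a c) (coord a v)" for a
  define B where "B a = de (coord a c) (coord a u) * de (coord a c) (coord a v)" for a
  have PQ: "PQ (coord a c) (coord a u) (coord a v) = A a + B a / 3" for a by (simp add: PQ_def A_def B_def)
  have nu: "nu p (coord a c) (coord a u) * nu p (coord a c) (coord a v) = (if p then B a else A a)" for p a
   by (simp add: nu_def A_def B_def)
  have S: "stiff l c u v = 4 * 4 ^ l * B 2 * (A 1 + B 1 / 3) * (A 0 + B 0 / 3) + (A 2 + B 2 / 3) * (4 * 4 ^ l * B 1) * (A 0 + B 0 / 3)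
    + (A 2 + B 2 / 3) * (A 1 + B 1 / 3) * (4 * 4 ^ l * B 0)"
   unfolding stiff_def sum_3 prod_3 coord_cmp PQ by (simp add: B_def mult.assoc)
  have P: "(\<Prod>m\<in>UNIV. PQ (cmp c m) (cmp u m) (cmp v m)) = (A 2 + B 2 / 3) * (A 1 + B 1 / 3) * (A 0 + B 0 / 3)"
   unfolding prod_3 coord_cmp PQ ..
  have W: "Wf l0 dv sv (put (p, q, r) (ptc c)) * om (alpha (put (p, q, r) (ptc c))) * (\<Prod>a<3. nu (bsel (p, q, r) a) (coord a c) (coord a u) * nu (bsel (p, q, r) a) (coord a c) (coord a v))
   = (if (p, q, r) = z3 then sv (coarse l0 c) * 1 else (1 / 3) ^ cnt (p, q, r) * (sv (coarse l0 c) / 4 ^ l + 12 * real (cnt (p, q, r)) * dv (coarse l0 c)) * 4 ^ l)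
    * ((if p then B 0 else A 0) * (if q then B 1 else A 1) * (if r then B 2 else A 2))" for p q r
   unfolding Wf_def om_def alpha_put cx_put[OF l0] cx_ptc[OF l0 c] prod_coord nu by (simp add: bsel_def)
  show ?thesis
   unfolding S P sum_bool3 sum_bool W cnt_def
   using fem_identity[of "4 ^ l" "dv (coarse l0 c)" "B 2" "A 1" "B 1" "A 0" "B 0" "A 2" "sv (coarse l0 c)"]
   by (simp add: power2_eq_square power3_eq_cube)
 qed
 note e = this
 have 1: "(LINT x:Omega|lebesgue. D x * inner (gradient (basis_fun l u) x) (gradient (basis_fun l v) x))
  = mesh l ^ 3 * (\<Sum>c\<in>cells l. dv (coarse l0 c) * stiff l c u v)" by (rule stiffness_entry) (rule D)
 have 2: "(LINT x:Omega|lebesgue. Sa x * basis_fun l u x * basis_fun l v x)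
  = mesh l ^ 3 * (\<Sum>c\<in>cells l. sv (coarse l0 c) * (\<Prod>m\<in>UNIV. PQ (cmp c m) (cmp u m) (cmp v m)))"
  by (rule mass_entry) (rule Sa)
 show ?thesis
  unfolding 1 2 form_spikes[OF u v] distrib_left[symmetric] sum.distrib[symmetric] of_real_mult
  by (intro arg_cong2[where f = times] arg_cong[where f = cr] sum.cong refl e)
qed

lemma mass_form_entry:
 assumes l0: "l0 \<le> l" and u: "u \<in> cells l" "interior (ptc u)" and v: "v \<in> cells l"
  and f: "\<And>c x. c \<in> cells l ==> x \<in> cell l (cmp c) ==> f x = nv (coarse l0 c)"
 shows "cr (LINT x:Omega|lebesgue. f x * basis_fun l u x * basis_fun l v x)
  = cr (mesh l ^ 3) * form (Cf l0 nv) (spike (ptc u)) (spike (ptc v))"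
proof -
 have "nv (coarse l0 c) * (\<Prod>m\<in>UNIV. PQ (cmp c m) (cmp u m) (cmp v m))
  = (\<Sum>\<beta>\<in>UNIV. Cf l0 nv (put \<beta> (ptc c)) *
    (\<Prod>a<3. nu (bsel \<beta> a) (coord a c) (coord a u) * nu (bsel \<beta> a) (coord a c) (coord a v)))" if c: "c \<in> cells l" for c
 proof -
  define A where "A a = mu (coord a c) (coord a u) * mu (coord a c) (coord a v)" for a
  define B where "B a = de (coord a c) (coord a u) * de (coord a c) (coord a v)" for a
  have PQ: "PQ (coord a c) (coord a u) (coord a v) = A a + B a / 3" for a by (simp add: PQ_def A_def B_def)
  have nu: "nu p (coord a c) (coord a u) * nu p (coord a c) (coord a v) = (if p then B a else A a)" for p a
   by (simp add: nu_def A_def B_def)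
  show ?thesis
   unfolding prod_3 coord_cmp PQ sum_bool3 sum_bool prod_coord nu Cf_def alpha_put cx_put[OF l0] cx_ptc[OF l0 c] cnt_def
   by (simp add: bsel_def power2_eq_square power3_eq_cube field_simps)
 qed
 note e = this
 have 1: "(LINT x:Omega|lebesgue. f x * basis_fun l u x * basis_fun l v x)
  = mesh l ^ 3 * (\<Sum>c\<in>cells l. nv (coarse l0 c) * (\<Prod>m\<in>UNIV. PQ (cmp c m) (cmp u m) (cmp v m)))"
  by (rule mass_entry) (rule f)
 show ?thesis
  unfolding 1 form_spikes[OF u v] of_real_mult
  by (intro arg_cong2[where f = times] arg_cong[where f = cr] sum.cong refl e)
qed

lemma nodes_cells: "set (nodes l) \<subseteq> cells l"
 by (auto simp: nodes_def cells_def)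

lemma distinct_nodes: "distinct (nodes l)"
 by (simp add: nodes_def distinct_product)

definition pt :: "nat => bits" where "pt p = ptc (nodes l ! p)"

abbreviation "n \<equiv> length (nodes l)"

lemma nodes_interior: "c \<in> set (nodes l) \<longleftrightarrow> c \<in> cells l \<and> interior (ptc c)"
proof (cases "c \<in> cells l")
 case True
 obtain i j k where c: "c = (i, j, k)" by (cases c)
 have "(\<forall>a<3. 0 < coord a c) \<longleftrightarrow> 0 < i \<and> 0 < j \<and> 0 < k"
 proof -
  have "(\<forall>a<3. P a) \<longleftrightarrow> P 0 \<and> P 1 \<and> P 2" for P :: "nat => bool"
  proof -
   have "a = 0 \<or> a = 1 \<or> a = 2" if "a < 3" for a :: nat using that by linarith
   then show ?thesis by auto
  qed
  then show ?thesis by (simp add: c coord_def) blast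
 qed
 then show ?thesis using True by (auto simp: interior_ptc nodes_def cells_def c Suc_le_eq)
next
 case False
 then show ?thesis using nodes_cells by blast
qed

lemma pt_image: "pt ` {..<n} = {x. interior x}"
proof -
 have "set (nodes l) = (!) (nodes l) ` {..<n}" using nth_image[of n "nodes l"] by (simp add: lessThan_atLeast0)
 then have "pt ` {..<n} = ptc ` set (nodes l)" by (simp only: pt_def[abs_def] image_image)
 moreover have "x \<in> ptc ` set (nodes l) \<longleftrightarrow> interior x" for x
 proof
  assume "x \<in> ptc ` set (nodes l)"
  then obtain c where "c \<in> set (nodes l)" "x = ptc c" by (rule imageE)
  then show "interior x" by (simp only: nodes_interior)
 next
  assume x: "interior x"
  then have "x \<in> ptc ` cells l" using phys_iff[of x] by (simp only: interior_def)
  then obtain c where c: "x = ptc c" "c \<in> cells l" by (rule imageE)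
  then have "c \<in> set (nodes l)" using x by (simp only: nodes_interior)
  then show "x \<in> ptc ` set (nodes l)" unfolding c(1) by (rule imageI)
 qed
 ultimately show ?thesis by (simp add: set_eq_iff)
qed

text \<open>One set of constants serves all levels from \<open>l0\<close> on; the scale
  \<open>t\<close> is the volume of a cell.\<close>

theorem model_instance:
 assumes l0: "l0 \<le> l"
  and D: "\<And>c x. c \<in> cells l0 ==> x \<in> cell l0 (cmp c) ==> D x = dv c"
  and Sa: "\<And>c x. c \<in> cells l0 ==> x \<in> cell l0 (cmp c) ==> Sa x = sv c"
  and nSf: "\<And>c x. c \<in> cells l0 ==> x \<in> cell l0 (cmp c) ==> nSf x = nv c"
  and W: "\<And>c. c \<in> cells l0 ==> wmin \<le> sv c \<and> wmin \<le> dv c \<and> sv c + 4 * dv c \<le> wmax" "0 < wmin" "wmin < wmax"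
  and C: "\<And>c. c \<in> cells l0 ==> (nv c = 0 \<or> 27 * cmin \<le> nv c) \<and> nv c \<le> cmax" "0 < cmin" "cmin \<le> cmax"
 shows "model l n pt (Wf l0 dv sv) (Cf l0 nv) wmin wmax cmin cmax (mesh l ^ 3) (wires l0)
  (stiffness_matrix l D + mass_matrix l Sa) (mass_matrix l nSf)"
proof -
 have coarse: "coarse l0 c \<in> cells l0" if "c \<in> cells l" for c
  using cx_cells[of l0 "ptc c"] cx_ptc[OF l0 that] by simp
 have sub: "x \<in> cell l0 (cmp (coarse l0 c))" if "x \<in> cell l (cmp c)" for x c using that cell_coarse[OF l0] by blast
 have nd: "nodes l ! p \<in> cells l" "interior (ptc (nodes l ! p))" if "p < n" for p
  using nth_mem[OF that] nodes_interior by auto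
 interpret node_points sz n pt
 proof
  show "inj_on pt {..<n}"
  proof (rule inj_onI)
   fix p q assume pq: "p \<in> {..<n}" "q \<in> {..<n}" "pt p = pt q"
   then have "nodes l ! p = nodes l ! q" using inj_ptc nd(1) by (auto simp: pt_def inj_on_def)
   then show "p = q" using pq distinct_nodes by (simp add: nth_eq_iff_index_eq)
  qed
  show "pt p \<in> slice sz" if "p < n" for p using nd(2)[OF that] by (simp add: pt_def interior_def phys_def)
 qed
 have delta: "delta p = spike (ptc (nodes l ! p))" for p by (simp add: delta_def[abs_def] pt_def)
 show ?thesis
 proof unfold_locales
  show "pt ` {..<n} = {x. interior x}" by (rule pt_image)
  show "wmin \<le> Wf l0 dv sv x" "Wf l0 dv sv x \<le> wmax" for x using Wf_bounds[of l0 wmin sv dv wmax x, OF W(1,2)] by auto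
  show "Cf l0 nv x = 0 \<or> cmin \<le> Cf l0 nv x" "Cf l0 nv x \<le> cmax" for x using Cf_bounds[of l0 nv cmin cmax x, OF C] by auto
  show "Wf l0 dv sv (flip (reg a) x) = Wf l0 dv sv x" if "a < 3" for a x
   using that by (simp add: Wf_def cx_flip[OF l0] alpha_flip)
  show "Cf l0 nv (flip (reg a) x) = Cf l0 nv x" if "a < 3" for a x
   using that by (simp add: Cf_def cx_flip[OF l0] alpha_flip)
  show "Wf l0 dv sv x = Wf l0 dv sv y" if "\<forall>w\<in>set (wires l0). x w = y w" for x y
   using cx_wires[OF that] by (simp add: Wf_def)
  show "Cf l0 nv x = Cf l0 nv y" if "\<forall>w\<in>set (wires l0). x w = y w" for x y
   using cx_wires[OF that] by (simp add: Cf_def)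
  show "0 < Cf l0 nv (put \<beta> x) \<longleftrightarrow> 0 < Cf l0 nv x" for \<beta> x
   by (simp add: Cf_def cx_put[OF l0] zero_less_mult_iff)
  show "distinct (wires l0)" "set (wires l0) \<subseteq> {..<sz}" using wires_bounds[OF l0] by auto
  show "stiffness_matrix l D + mass_matrix l Sa \<in> carrier_mat n n" "mass_matrix l nSf \<in> carrier_mat n n"
   by (simp_all add: stiffness_matrix_def mass_matrix_def node_matrix_def)
  fix p q assume p: "p < n" and q: "q < n"
  show "cr ((stiffness_matrix l D + mass_matrix l Sa) $$ (p, q))
   = cr (mesh l ^ 3) * form (\<lambda>x. Wf l0 dv sv x * om (alpha x)) (delta p) (delta q)"
   unfolding delta using stiffness_mass_entry[OF l0 nd[OF p] nd(1)[OF q], of D dv Sa sv] D[OF coarse sub] Sa[OF coarse sub] p q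
   by (simp add: stiffness_matrix_def mass_matrix_def node_matrix_def)
  show "cr (mass_matrix l nSf $$ (p, q)) = cr (mesh l ^ 3) * form (Cf l0 nv) (delta p) (delta q)"
   unfolding delta using mass_form_entry[OF l0 nd[OF p] nd(1)[OF q], of nSf nv] nSf[OF coarse sub] p q
   by (simp add: mass_matrix_def node_matrix_def)
 qed (use W C in auto)
qed

end

section \<open>From circuits to matrices\<close>

lemma bits_of_inj: "bits_of i = bits_of j \<longleftrightarrow> i = j"
 by (auto simp: bits_of_def fun_eq_iff bit_eq_iff)

lemma bits_of_slice: "i < 2 ^ M ==> bits_of i \<in> slice M"
proof -
 assume i: "i < 2 ^ M"
 have "\<not> bit i w" if "M \<le> w" for w
 proof -
  have "i < 2 ^ w" using i that by (meson less_le_trans one_le_numeral power_increasing)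
  then show ?thesis by (simp add: bit_iff_odd)
 qed
 then show ?thesis by (simp add: slice_def bits_of_def)
qed

lemma bits_of_val: "x \<in> slice M ==> bits_of (val [0..<M] x) = x"
proof -
 assume x: "x \<in> slice M"
 have "val [0..<M] (bits_of (val [0..<M] x)) = val [0..<M] x"
  using val_bits[of M "bits_of (val [0..<M] x)" 0 "val [0..<M] x"] val_less[of "[0..<M]" x] by (simp add: bits_of_def)
 then have "\<forall>w<M. bits_of (val [0..<M] x) w = x w" unfolding val_eq_iff by simp
 moreover have "bits_of (val [0..<M] x) \<in> slice M" using val_less[of "[0..<M]" x] by (intro bits_of_slice) simp
 ultimately show ?thesis using x unfolding slice_def by (intro ext) (metis (mono_tags, lifting) mem_Collect_eq not_less)
qed

lemma bits_of_image: "bits_of ` {..<2 ^ M} = slice M"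
proof
 show "slice M \<subseteq> bits_of ` {..<2 ^ M}"
 proof
  fix x assume "x \<in> slice M"
  then have "x = bits_of (val [0..<M] x)" using bits_of_val by simp
  moreover have "val [0..<M] x < 2 ^ M" using val_less[of "[0..<M]" x] by simp
  ultimately show "x \<in> bits_of ` {..<2 ^ M}" by blast
 qed
qed (use bits_of_slice in auto)

lemma sum_slice: "(\<Sum>x\<in>slice M. g x) = (\<Sum>i<2 ^ M. g (bits_of i))"
 unfolding bits_of_image[symmetric] by (rule sum.reindex_cong[OF _ refl refl]) (simp add: inj_on_def bits_of_inj)

lemma unitary_norm:
 assumes "unitary m G" shows "(\<Sum>k<m. (cmod (\<Sum>j<m. G $$ (k, j) * c j))\<^sup>2) = (\<Sum>j<m. (cmod (c j))\<^sup>2)"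
proof -
 have G: "G \<in> carrier_mat m m" "mat_adjoint G * G = 1\<^sub>m m" using assms by (auto simp: unitary_def)
 have Ge: "G = mat m m (\<lambda>(i, j). G $$ (i, j))" using G(1) by (intro eq_matI) auto
 have o: "(\<Sum>k<m. cnj (G $$ (k, i)) * G $$ (k, j)) = (if i = j then 1 else 0)" if "i < m" "j < m" for i j
 proof -
  have "(mat_adjoint G * G) $$ (i, j) = (\<Sum>k<m. cnj (G $$ (k, i)) * G $$ (k, j))"
   using that G(1) by (subst Ge, subst mat_adjoint_mat) (simp add: scalar_prod_def lessThan_atLeast0)
  then show ?thesis using G(2) that by simp
 qed
 have "cr (\<Sum>k<m. (cmod (\<Sum>j<m. G $$ (k, j) * c j))\<^sup>2)
  = (\<Sum>k<m. cnj (\<Sum>i<m. G $$ (k, i) * c i) * (\<Sum>j<m. G $$ (k, j) * c j))"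
  unfolding of_real_sum complex_norm_square by (intro sum.cong refl mult.commute)
 also have "\<dots> = (\<Sum>k<m. \<Sum>i<m. \<Sum>j<m. cnj (c i) * c j * (cnj (G $$ (k, i)) * G $$ (k, j)))"
  unfolding cnj_sum sum_product by (simp add: mult_ac)
 also have "\<dots> = (\<Sum>i<m. \<Sum>j<m. \<Sum>k<m. cnj (c i) * c j * (cnj (G $$ (k, i)) * G $$ (k, j)))"
  by (subst sum.swap) (intro sum.cong refl sum.swap)
 also have "\<dots> = (\<Sum>i<m. \<Sum>j<m. cnj (c i) * c j * (if i = j then 1 else 0))"
  unfolding sum_distrib_left[symmetric] by (intro sum.cong refl) (simp add: o)
 also have "\<dots> = cr (\<Sum>j<m. (cmod (c j))\<^sup>2)"
 proof -
  have "(\<Sum>j<m. cnj (c i) * c j * (if i = j then 1 else 0)) = c i * cnj (c i)" if "i < m" for i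
   using that by (simp add: if_distrib[of "\<lambda>x. _ * x"] mult.commute cong: if_cong)
  then show ?thesis unfolding of_real_sum complex_norm_square by simp
 qed
 finally show ?thesis unfolding of_real_eq_iff .
qed

lemma sum_slice_wire:
 assumes "t < M" shows "(\<Sum>x\<in>slice M. F x) = (\<Sum>x\<in>{x \<in> slice M. \<not> x t}. F x + (F (x(t := True)) :: 'a :: comm_monoid_add))"
proof -
 have s: "slice M = {x \<in> slice M. \<not> x t} \<union> (\<lambda>x. x(t := True)) ` {x \<in> slice M. \<not> x t}"
 proof (intro equalityI subsetI)
  fix x assume x: "x \<in> slice M"

  then show "x \<in> {x \<in> slice M. \<not> x t} \<union> (\<lambda>x. x(t := True)) ` {x \<in> slice M. \<not> x t}"
  proof (cases "x t")
   case True
   have "x(t := False) \<in> {x \<in> slice M. \<not> x t}" using slice_upd[OF x assms, of False] by simp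
   moreover have "(x(t := False))(t := True) = x" unfolding fun_upd_upd by (rule fun_upd_idem) (use True in simp)
   ultimately show ?thesis by (intro UnI2 image_eqI[of _ _ "x(t := False)"]) (simp_all only:)
  qed (use x in simp)
 next
  fix x assume "x \<in> {x \<in> slice M. \<not> x t} \<union> (\<lambda>x. x(t := True)) ` {x \<in> slice M. \<not> x t}"
  then show "x \<in> slice M"
  proof
   assume "x \<in> (\<lambda>x. x(t := True)) ` {x \<in> slice M. \<not> x t}"
   then obtain y where "x = y(t := True)" "y \<in> slice M" by blast
   then show ?thesis using slice_upd[OF _ assms, of y True] by (simp only:)
  qed (simp only: mem_Collect_eq)
 qed
 have i: "inj_on (\<lambda>x. x(t := True)) {x \<in> slice M. \<not> x t}"
 proof (rule inj_on_inverseI[where g = "\<lambda>x. x(t := False)"])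
  fix x assume "x \<in> {x \<in> slice M. \<not> x t}"
  then have "x t = False" by simp
  then show "(x(t := True))(t := False) = x" unfolding fun_upd_upd by (rule fun_upd_idem)
 qed
 have "(\<Sum>x\<in>slice M. F x) = (\<Sum>x\<in>{x \<in> slice M. \<not> x t}. F x) + (\<Sum>x\<in>(\<lambda>x. x(t := True)) ` {x \<in> slice M. \<not> x t}. F x)"
  by (subst s, rule sum.union_disjoint) auto
 also have "\<dots> = (\<Sum>x\<in>{x \<in> slice M. \<not> x t}. F x + F (x(t := True)))"
  by (simp add: sum.reindex[OF i] sum.distrib)
 finally show ?thesis .
qed

lemma upd_idem: "x t = b ==> x(t := b) = x"
 by (rule fun_upd_idem)

lemma sum_slice1:
 fixes F :: "bits => 'a :: comm_monoid_add"
 assumes "t < M" shows "(\<Sum>x\<in>slice M. F x) = (\<Sum>x\<in>{x \<in> slice M. \<not> x t}. F (x(t := False)) + F (x(t := True)))"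
 unfolding sum_slice_wire[OF assms, of F] by (intro sum.cong refl) (simp add: upd_idem)

lemma upd_pair: "t \<noteq> u ==> x(t := p, u := q, t := p', u := q') = x(t := p', u := q')"
 by (rule ext) simp

lemma sum_slice2:
 fixes F :: "bits => 'a :: comm_monoid_add"
 assumes "t < M" "u < M" "t \<noteq> u"
 shows "(\<Sum>x\<in>slice M. F x) = (\<Sum>x\<in>{x \<in> slice M. \<not> x t \<and> \<not> x u}.
  (F (x(t := False, u := False)) + F (x(t := True, u := False))) + (F (x(t := False, u := True)) + F (x(t := True, u := True))))"
proof -
 let ?G = "\<lambda>x. if x t then 0 else F (x(t := False)) + F (x(t := True))"
 have "(\<Sum>x\<in>slice M. F x) = (\<Sum>x\<in>slice M. ?G x)"
  unfolding sum_slice1[OF assms(1), of F] by (intro sum.mono_neutral_cong_left) auto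
 also have "\<dots> = (\<Sum>x\<in>{x \<in> slice M. \<not> x u}. ?G (x(u := False)) + ?G (x(u := True)))" by (rule sum_slice1[OF assms(2)])
 also have "\<dots> = (\<Sum>x\<in>{x \<in> slice M. \<not> x t \<and> \<not> x u}. ?G (x(u := False)) + ?G (x(u := True)))"
  using assms(3) by (intro sum.mono_neutral_right) auto
 also have "\<dots> = (\<Sum>x\<in>{x \<in> slice M. \<not> x t \<and> \<not> x u}.
  (F (x(t := False, u := False)) + F (x(t := True, u := False))) + (F (x(t := False, u := True)) + F (x(t := True, u := True))))"
  using assms(3) by (intro sum.cong refl) (simp only: mem_Collect_eq fun_upd_other if_False simp_thms fun_upd_twist[of u t])
 finally show ?thesis .
qed

lemma unitary2:
 assumes "unitary 2 G"
 shows "(cmod (G $$ (0, 0) * a + G $$ (0, 1) * b))\<^sup>2 + (cmod (G $$ (1, 0) * a + G $$ (1, 1) * b))\<^sup>2 = (cmod a)\<^sup>2 + (cmod b)\<^sup>2"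
 using unitary_norm[OF assms, of "\<lambda>j. if j = 0 then a else b"] by (simp add: numeral_2_eq_2 lessThan_Suc add.commute)

lemma sum_4: "(\<Sum>j<4. g j) = g 0 + g 1 + g 2 + (g (3::nat) :: 'a :: comm_monoid_add)"
proof -
 have "{..<4 :: nat} = {0, 1, 2, 3}" by auto
 then show ?thesis by (simp add: add.assoc)
qed

lemma unitary4:
 assumes "unitary 4 G"
 shows "(cmod (G $$ (0, 0) * a + G $$ (0, 1) * b + G $$ (0, 2) * c + G $$ (0, 3) * d))\<^sup>2
  + (cmod (G $$ (1, 0) * a + G $$ (1, 1) * b + G $$ (1, 2) * c + G $$ (1, 3) * d))\<^sup>2
  + (cmod (G $$ (2, 0) * a + G $$ (2, 1) * b + G $$ (2, 2) * c + G $$ (2, 3) * d))\<^sup>2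
  + (cmod (G $$ (3, 0) * a + G $$ (3, 1) * b + G $$ (3, 2) * c + G $$ (3, 3) * d))\<^sup>2
  = (cmod a)\<^sup>2 + (cmod b)\<^sup>2 + (cmod c)\<^sup>2 + (cmod d)\<^sup>2"
 using unitary_norm[OF assms, of "\<lambda>j. if j = 0 then a else if j = 1 then b else if j = 2 then c else d"] by (simp add: sum_4)

text \<open>The basis splits into pairs or quadruples that differ only on the wires of the gate, and
  on each group a unitary matrix acts.\<close>

lemma nrm_gate:
 assumes "valid_gate M g" shows "nrm M (gate_op g \<psi>) = nrm M \<psi>"
proof -
 have "(nrm M (gate_op g \<psi>))\<^sup>2 = (nrm M \<psi>)\<^sup>2"
 proof (cases g)
  case (Gate1 t G)
  then have t: "t < M" and G: "unitary 2 G" using assms by auto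
  show ?thesis unfolding nrm_sq sum_slice1[OF t] Gate1
  proof (intro sum.cong refl)
   fix x :: bits
   have g: "gate_op (Gate1 t G) \<psi> (x(t := p)) = G $$ (of_bool p, 0) * \<psi> (x(t := False)) + G $$ (of_bool p, 1) * \<psi> (x(t := True))" for p
    by (simp only: gate_op.simps fun_upd_same fun_upd_upd)
   show "(cmod (gate_op (Gate1 t G) \<psi> (x(t := False))))\<^sup>2 + (cmod (gate_op (Gate1 t G) \<psi> (x(t := True))))\<^sup>2
    = (cmod (\<psi> (x(t := False))))\<^sup>2 + (cmod (\<psi> (x(t := True))))\<^sup>2"
    unfolding g of_bool_eq by (rule unitary2[OF G])
  qed
 next
  case (Gate2 t u G)
  then have t: "t < M" "u < M" "t \<noteq> u" and G: "unitary 4 G" using assms by auto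
  show ?thesis unfolding nrm_sq sum_slice2[OF t] Gate2
  proof (intro sum.cong refl)
   fix x :: bits
   let ?a = "\<psi> (x(t := False, u := False))" and ?b = "\<psi> (x(t := False, u := True))"
    and ?c = "\<psi> (x(t := True, u := False))" and ?d = "\<psi> (x(t := True, u := True))"
   have g: "gate_op (Gate2 t u G) \<psi> (x(t := p, u := q)) = G $$ (2 * of_bool p + of_bool q, 0) * ?a + G $$ (2 * of_bool p + of_bool q, 1) * ?b
    + G $$ (2 * of_bool p + of_bool q, 2) * ?c + G $$ (2 * of_bool p + of_bool q, 3) * ?d" for p q
   proof -
    have v: "(x(t := p, u := q)) t = p" using t(3) by simp
    show ?thesis unfolding gate_op.simps v by (simp only: upd_pair[OF t(3)] fun_upd_same)
   qed
   have e: "2 * of_bool False + of_bool False = (0::nat)" "2 * of_bool False + of_bool True = (1::nat)"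
    "2 * of_bool True + of_bool False = (2::nat)" "2 * of_bool True + of_bool True = (3::nat)" by auto
   show "(cmod (gate_op (Gate2 t u G) \<psi> (x(t := False, u := False))))\<^sup>2 + (cmod (gate_op (Gate2 t u G) \<psi> (x(t := True, u := False))))\<^sup>2
    + ((cmod (gate_op (Gate2 t u G) \<psi> (x(t := False, u := True))))\<^sup>2 + (cmod (gate_op (Gate2 t u G) \<psi> (x(t := True, u := True))))\<^sup>2)
    = (cmod ?a)\<^sup>2 + (cmod ?c)\<^sup>2 + ((cmod ?b)\<^sup>2 + (cmod ?d)\<^sup>2)"
    unfolding g e using unitary4[OF G, of ?a ?b ?c ?d] by linarith
  qed
 qed
 then show ?thesis by (simp add: power2_eq_iff_nonneg)
qed

section \<open>Circuit matrices acting on amplitude vectors\<close>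

definition vecst :: "nat => state => complex Matrix.vec" where "vecst M \<psi> = Matrix.vec (2 ^ M) (\<lambda>i. \<psi> (bits_of i))"

text \<open>\<open>gate_mat\<close> compares only wires below \<open>M\<close>; inside
  \<open>slice M\<close> the others agree anyway.\<close>

lemma agree_bits:
 assumes "x \<in> slice M" "y \<in> slice M" shows "(\<forall>b<M. b \<notin> W \<longrightarrow> x b = y b) \<longleftrightarrow> (\<forall>b. b \<notin> W \<longrightarrow> x b = y b)"
 using assms unfolding slice_def by (metis (mono_tags, lifting) mem_Collect_eq not_less)

lemma gate_mat_row:
 assumes "i < 2 ^ M" "gate_mat M g = mat (2 ^ M) (2 ^ M) (\<lambda>(i, j). E (bits_of i) (bits_of j))"
 shows "vec_index (gate_mat M g *\<^sub>v vecst M \<psi>) i = (\<Sum>y\<in>slice M. E (bits_of i) y * \<psi> y)"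
 using assms unfolding sum_slice by (simp add: scalar_prod_def vecst_def lessThan_atLeast0)

lemma gate_mat_op:
 assumes "valid_gate M g" shows "gate_mat M g *\<^sub>v vecst M \<psi> = vecst M (gate_op g \<psi>)"
proof (rule eq_vecI)
 show "dim_vec (gate_mat M g *\<^sub>v vecst M \<psi>) = dim_vec (vecst M (gate_op g \<psi>))" by (cases g) (simp_all add: vecst_def)
 fix i assume "i < dim_vec (vecst M (gate_op g \<psi>))"
 then have i: "i < 2 ^ M" by (simp add: vecst_def)
 define x where "x = bits_of i"
 have x: "x \<in> slice M" unfolding x_def by (rule bits_of_slice[OF i])
 have "vec_index (gate_mat M g *\<^sub>v vecst M \<psi>) i = gate_op g \<psi> x"
 proof (cases g)
  case (Gate1 t G)
  then have t: "t < M" using assms by auto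
  let ?E = "\<lambda>x y. if \<forall>b<M. b \<noteq> t \<longrightarrow> x b = y b then G $$ (of_bool (x t), of_bool (y t)) else 0"
  have "vec_index (gate_mat M g *\<^sub>v vecst M \<psi>) i = (\<Sum>y\<in>slice M. ?E x y * \<psi> y)"
   unfolding x_def Gate1 by (rule gate_mat_row[OF i]) (simp add: bits_of_def cong: if_cong)
  also have "\<dots> = (\<Sum>y\<in>{y \<in> slice M. \<not> y t}. if y = x(t := False) then gate_op g \<psi> x else 0)"
   unfolding sum_slice1[OF t]
  proof (rule sum.cong[OF refl])
   fix y assume y: "y \<in> {y \<in> slice M. \<not> y t}"
   have c: "(\<forall>b<M. b \<noteq> t \<longrightarrow> x b = (y(t := p)) b) \<longleftrightarrow> y = x(t := False)" for p
   proof -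
    have "(\<forall>b<M. b \<noteq> t \<longrightarrow> x b = (y(t := p)) b) \<longleftrightarrow> (\<forall>b<M. b \<notin> {t} \<longrightarrow> x b = y b)" by auto
    also have "\<dots> \<longleftrightarrow> (\<forall>b. b \<notin> {t} \<longrightarrow> x b = y b)" using x y by (intro agree_bits) auto
    also have "\<dots> \<longleftrightarrow> y = x(t := False)"
    proof
     assume a: "\<forall>b. b \<notin> {t} \<longrightarrow> x b = y b"
     show "y = x(t := False)"
     proof
      fix b show "y b = (x(t := False)) b" using a y by (cases "b = t") auto
     qed
    qed simp
    finally show ?thesis .
   qed
   show "?E x (y(t := False)) * \<psi> (y(t := False)) + ?E x (y(t := True)) * \<psi> (y(t := True))
    = (if y = x(t := False) then gate_op g \<psi> x else 0)"
    unfolding c Gate1 gate_op.simps fun_upd_same by (cases "y = x(t := False)") (simp_all only: refl if_True if_False fun_upd_upd of_bool_eq mult_zero_left add_0_right)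
  qed
  also have "\<dots> = gate_op g \<psi> x" using slice_upd[OF x t, of False] by (simp add: sum.delta)
  finally show ?thesis .
 next
  case (Gate2 t u G)
  then have t: "t < M" "u < M" "t \<noteq> u" using assms by auto
  let ?E = "\<lambda>x y. if \<forall>b<M. b \<noteq> t \<and> b \<noteq> u \<longrightarrow> x b = y b then G $$ (2 * of_bool (x t) + of_bool (x u), 2 * of_bool (y t) + of_bool (y u)) else 0"
  let ?z = "x(t := False, u := False)"
  have "vec_index (gate_mat M g *\<^sub>v vecst M \<psi>) i = (\<Sum>y\<in>slice M. ?E x y * \<psi> y)"
   unfolding x_def Gate2 by (rule gate_mat_row[OF i]) (simp add: bits_of_def cong: if_cong)
  also have "\<dots> = (\<Sum>y\<in>{y \<in> slice M. \<not> y t \<and> \<not> y u}. if y = ?z then gate_op g \<psi> x else 0)"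
   unfolding sum_slice2[OF t]
  proof (rule sum.cong[OF refl])
   fix y assume y: "y \<in> {y \<in> slice M. \<not> y t \<and> \<not> y u}"
   have c: "(\<forall>b<M. b \<noteq> t \<and> b \<noteq> u \<longrightarrow> x b = (y(t := p, u := q)) b) \<longleftrightarrow> y = ?z" for p q
   proof -
    have "(\<forall>b<M. b \<noteq> t \<and> b \<noteq> u \<longrightarrow> x b = (y(t := p, u := q)) b) \<longleftrightarrow> (\<forall>b<M. b \<notin> {t, u} \<longrightarrow> x b = y b)" by auto
    also have "\<dots> \<longleftrightarrow> (\<forall>b. b \<notin> {t, u} \<longrightarrow> x b = y b)" using x y by (intro agree_bits) auto
    also have "\<dots> \<longleftrightarrow> y = ?z"
    proof
     assume a: "\<forall>b. b \<notin> {t, u} \<longrightarrow> x b = y b"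
     show "y = ?z"
     proof
      fix b show "y b = ?z b" using a y by (cases "b = t"; cases "b = u") auto
     qed
    qed simp
    finally show ?thesis .
   qed
   have e: "2 * of_bool False + of_bool False = (0::nat)" "2 * of_bool False + of_bool True = (1::nat)"
    "2 * of_bool True + of_bool False = (2::nat)" "2 * of_bool True + of_bool True = (3::nat)" by auto
   have v: "(y(t := p, u := q)) t = p" for p q using t(3) by simp
   show "?E x (y(t := False, u := False)) * \<psi> (y(t := False, u := False)) + ?E x (y(t := True, u := False)) * \<psi> (y(t := True, u := False))
    + (?E x (y(t := False, u := True)) * \<psi> (y(t := False, u := True)) + ?E x (y(t := True, u := True)) * \<psi> (y(t := True, u := True)))
    = (if y = ?z then gate_op g \<psi> x else 0)"
   proof (cases "y = ?z")
    case True
    have "y(t := p, u := q) = x(t := p, u := q)" for p q unfolding True by (rule upd_pair[OF t(3)])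
    then show ?thesis unfolding c v fun_upd_same e using True by (simp only: refl if_True Gate2 gate_op.simps add_ac)
   next
    case False
    then show ?thesis unfolding c by (simp only: if_False mult_zero_left add_0_right)
   qed
  qed
  also have "\<dots> = gate_op g \<psi> x" using slice_upd[OF slice_upd[OF x t(1), of False] t(2), of False] t(3) by (simp add: sum.delta)
  finally show ?thesis .
 qed
 then show "vec_index (gate_mat M g *\<^sub>v vecst M \<psi>) i = vec_index (vecst M (gate_op g \<psi>)) i" using i by (simp add: vecst_def x_def)
qed

lemma gate_mat_carrier [simp]: "gate_mat M g \<in> carrier_mat (2 ^ M) (2 ^ M)"
 by (cases g) simp_all

lemma circuit_mat_carrier [simp]: "circuit_mat M gs \<in> carrier_mat (2 ^ M) (2 ^ M)"
 by (induction gs) (auto intro: mult_carrier_mat[OF _ gate_mat_carrier])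

lemma vecst_carrier [simp]: "vecst M \<psi> \<in> carrier_vec (2 ^ M)"
 by (simp add: vecst_def)

lemma circuit_mat_op:
 "\<forall>g\<in>set gs. valid_gate M g ==> circuit_mat M gs *\<^sub>v vecst M \<psi> = vecst M (run gs \<psi>)"
proof (induction gs arbitrary: \<psi>)
 case (Cons g gs)
 have "circuit_mat M (g # gs) *\<^sub>v vecst M \<psi> = circuit_mat M gs *\<^sub>v (gate_mat M g *\<^sub>v vecst M \<psi>)"
  unfolding circuit_mat.simps by (rule assoc_mult_mat_vec[OF circuit_mat_carrier gate_mat_carrier vecst_carrier])
 then show ?case using Cons by (simp add: gate_mat_op)
qed simp

lemma nrm_run: "\<forall>g\<in>set gs. valid_gate M g ==> nrm M (run gs \<psi>) = nrm M \<psi>"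
 by (induction gs arbitrary: \<psi>) (simp_all add: nrm_gate)

lemma lin_run: "lin (run gs)"
 unfolding lin_def by (simp add: run_add run_scale)

lemma circuit_mat_entry:
 assumes "\<forall>g\<in>set gs. valid_gate M g" "i < 2 ^ M" "j < 2 ^ M"
 shows "circuit_mat M gs $$ (i, j) = run gs (\<lambda>x. if x = bits_of j then 1 else 0) (bits_of i)"
proof -
 have "vecst M (\<lambda>x. if x = bits_of j then 1 else 0) = unit_vec (2 ^ M) j"
  using assms(3) by (intro eq_vecI) (simp_all add: vecst_def bits_of_inj unit_vec_def)
 then have "circuit_mat M gs *\<^sub>v unit_vec (2 ^ M) j = vecst M (run gs (\<lambda>x. if x = bits_of j then 1 else 0))"
  using circuit_mat_op[OF assms(1), of "\<lambda>x. if x = bits_of j then 1 else 0"] by simp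
 then have "vec_index (circuit_mat M gs *\<^sub>v unit_vec (2 ^ M) j) i = run gs (\<lambda>x. if x = bits_of j then 1 else 0) (bits_of i)"
  using assms(2) by (simp add: vecst_def)
 moreover have "dim_row (circuit_mat M gs) = 2 ^ M" "dim_col (circuit_mat M gs) = 2 ^ M" using circuit_mat_carrier by blast+
 ultimately show ?thesis using assms(2,3) by simp
qed

text \<open>The columns are the images of the basis states, and polarisation turns preservation of
  norms into their orthonormality.\<close>

lemma unitary_circuit_mat:
 assumes v: "\<forall>g\<in>set gs. valid_gate M g" shows "unitary (2 ^ M) (circuit_mat M gs)"
proof -
 let ?s = "\<lambda>j x. if x = bits_of j then 1 else (0 :: complex)"
 have "unitary (2 ^ M) (mat (2 ^ M) (2 ^ M) (\<lambda>(i, j). circuit_mat M gs $$ (i, j)))"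
 proof (rule unitary_matI)
  fix i j :: nat assume ij: "i < 2 ^ M" "j < 2 ^ M"
  have "(\<Sum>k<2 ^ M. cnj (case (k, i) of (i, j) => circuit_mat M gs $$ (i, j)) * (case (k, j) of (i, j) => circuit_mat M gs $$ (i, j)))
   = ip M (run gs (?s i)) (run gs (?s j))"
   unfolding ip_def sum_slice using ij by (intro sum.cong refl) (simp add: circuit_mat_entry[OF v])
  also have "\<dots> = ip M (?s i) (?s j)"
   using ip_eq_of_nrm_eq[OF lin_run, of "\<lambda>f. f" M gs "?s i" "?s j"] nrm_run[OF v] by (simp add: lin_def)
  also have "\<dots> = (if i = j then 1 else 0)"
  proof -
   have "ip M (?s i) (?s j) = (\<Sum>k<2 ^ M. if k = j then if i = j then 1 else 0 else 0)"
    unfolding ip_def sum_slice by (intro sum.cong refl) (auto simp: bits_of_inj)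
   then show ?thesis using ij by simp
  qed
  finally show "(\<Sum>k<2 ^ M. cnj (case (k, i) of (i, j) => circuit_mat M gs $$ (i, j)) * (case (k, j) of (i, j) => circuit_mat M gs $$ (i, j)))
   = (if i = j then 1 else 0)" .
 qed
 also have "mat (2 ^ M) (2 ^ M) (\<lambda>(i, j). circuit_mat M gs $$ (i, j)) = circuit_mat M gs"
 proof (rule eq_matI)
  have "dim_row (circuit_mat M gs) = 2 ^ M" "dim_col (circuit_mat M gs) = 2 ^ M" using circuit_mat_carrier by blast+
  then show "dim_row (mat (2 ^ M) (2 ^ M) (\<lambda>(i, j). circuit_mat M gs $$ (i, j))) = dim_row (circuit_mat M gs)"
   "dim_col (mat (2 ^ M) (2 ^ M) (\<lambda>(i, j). circuit_mat M gs $$ (i, j))) = dim_col (circuit_mat M gs)"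
   "\<And>i j. i < dim_row (circuit_mat M gs) ==> j < dim_col (circuit_mat M gs) ==>
    mat (2 ^ M) (2 ^ M) (\<lambda>(i, j). circuit_mat M gs $$ (i, j)) $$ (i, j) = circuit_mat M gs $$ (i, j)" by simp_all
 qed
 finally show ?thesis .
qed

section \<open>Circuits read as block encodings\<close>

lemma kron_ket0_0: "kron (ket0 0) X = X"
 by (rule eq_matI) (simp_all add: kron_def ket0_def)

text \<open>Ancillas are the high bits of the index, so adjoining zeros is the inclusion of the
  first \<open>2 ^ s\<close> basis states and projecting is the restriction to them.\<close>

lemma kron_ket0:
 "kron (ket0 q) (1\<^sub>m (2 ^ s)) = mat (2 ^ (q + s)) (2 ^ s) (\<lambda>(i, j). if i = j then 1 else 0)" (is "?K = ?R")
 "kron (mat_adjoint (ket0 q)) (1\<^sub>m (2 ^ s)) = mat (2 ^ s) (2 ^ (q + s)) (\<lambda>(i, j). if i = j then 1 else 0)" (is "?L = ?T")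
proof -
 have d: "i div 2 ^ s = 0 \<and> i mod 2 ^ s = j \<longleftrightarrow> i = j" if "j < 2 ^ s" for i j :: nat
  using that by (auto simp: div_eq_0_iff)
 have lt: "i div 2 ^ s < 2 ^ q" if "i < 2 ^ (q + s)" for i :: nat
  using that by (simp add: less_mult_imp_div_less power_add)
 have ad: "mat_adjoint (ket0 q) = mat 1 (2 ^ q) (\<lambda>(i, j). if j = 0 then 1 else 0)"
  by (rule eq_matI) (auto simp: ket0_def mat_adjoint_def mat_of_rows_def)
 show "?K = ?R"
  by (rule eq_matI) (use d lt in \<open>auto simp: kron_def ket0_def power_add\<close>)
 show "?L = ?T"
  unfolding ad by (rule eq_matI) (use lt in \<open>auto simp: kron_def power_add div_eq_0_iff\<close>)
qed

definition vst :: "nat => complex Matrix.vec => state" where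
 "vst s v x = (if x \<in> slice s then vec_index v (val [0..<s] x) else 0)"

lemma bits_of_slice_iff: "bits_of i \<in> slice s \<longleftrightarrow> i < 2 ^ s"
 unfolding bits_of_image[symmetric] by (auto simp: bits_of_inj)

lemma val_bits_of: "i < 2 ^ s ==> val [0..<s] (bits_of i) = i"
 using bits_of_val[of "bits_of i" s] by (simp add: bits_of_slice bits_of_inj)

lemma vst_bits: "vst s v (bits_of i) = (if i < 2 ^ s then vec_index v i else 0)"
 by (simp add: vst_def bits_of_slice_iff val_bits_of)

lemma vst_supp: "vst s v x \<noteq> 0 ==> x \<in> slice s"
 by (simp add: vst_def split: if_splits)

lemma slice_mono: "s \<le> M ==> slice s \<subseteq> slice M"
 by (auto simp: slice_def)

lemma sum_slice_mono:
 assumes "s \<le> M" "\<And>x. x \<notin> slice s ==> g x = 0" shows "(\<Sum>x\<in>slice M. g x) = (\<Sum>i<2 ^ s. g (bits_of i))"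
 unfolding sum_slice[of g s, symmetric] using assms slice_mono by (intro sum.mono_neutral_right) auto

lemma nrm_vst:
 assumes "s \<le> M" "v \<in> carrier_vec (2 ^ s)" shows "nrm M (vst s v) = vec_l2norm v"
proof -
 have "(nrm M (vst s v))\<^sup>2 = (\<Sum>i<2 ^ s. (cmod (vst s v (bits_of i)))\<^sup>2)"
  unfolding nrm_sq by (rule sum_slice_mono[OF assms(1)]) (simp add: vst_def)
 also have "\<dots> = (\<Sum>i<dim_vec v. (cmod (vec_index v i))\<^sup>2)" using assms(2) by (simp add: vst_bits)
 finally show ?thesis unfolding vec_l2norm_def by (simp add: real_sqrt_unique)
qed

lemma smult_mat_mult_vec: "A \<in> carrier_mat m n ==> v \<in> carrier_vec n ==> (c \<cdot>\<^sub>m A) *\<^sub>v v = (c :: complex) \<cdot>\<^sub>v (A *\<^sub>v v)"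
 by (rule eq_vecI) (auto simp: scalar_prod_def sum_distrib_left mult_ac)

lemma block_encodingI:
 assumes v: "\<forall>g\<in>set gs. valid_gate (q + s) g" and M: "M \<in> carrier_mat (2 ^ s) (2 ^ s)"
  and e: "\<And>v. v \<in> carrier_vec (2 ^ s) ==> vec_l2norm v = 1 ==>
   (\<Sum>i<2 ^ s. (cmod (vec_index (M *\<^sub>v v) i - cr \<alpha> * run gs (vst s v) (bits_of i)))\<^sup>2) \<le> \<epsilon>\<^sup>2" and "0 \<le> \<epsilon>"
 shows "block_encoding s \<alpha> q \<epsilon> (circuit_mat (q + s) gs) M"
proof -
 let ?U = "circuit_mat (q + s) gs"
 let ?L = "kron (mat_adjoint (ket0 q)) (1\<^sub>m (2 ^ s))" and ?R = "kron (ket0 q) (1\<^sub>m (2 ^ s))"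
 let ?B = "?L * ?U * ?R"
 have L: "?L \<in> carrier_mat (2 ^ s) (2 ^ (q + s))" and R: "?R \<in> carrier_mat (2 ^ (q + s)) (2 ^ s)" unfolding kron_ket0 by simp_all
 have U: "?U \<in> carrier_mat (2 ^ (q + s)) (2 ^ (q + s))" by simp
 have LU: "?L * ?U \<in> carrier_mat (2 ^ s) (2 ^ (q + s))" using L U by (rule mult_carrier_mat)
 have B: "?B \<in> carrier_mat (2 ^ s) (2 ^ s)" using LU R by (rule mult_carrier_mat)
 have le: "(2::nat) ^ s \<le> 2 ^ (q + s)" by simp
 have block: "vec_index (?B *\<^sub>v v) i = run gs (vst s v) (bits_of i)" if v': "v \<in> carrier_vec (2 ^ s)" and i: "i < 2 ^ s" for v i
 proof -
  have "?R *\<^sub>v v = vecst (q + s) (vst s v)"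
   unfolding kron_ket0 using v'
   by (intro eq_vecI) (auto simp: vecst_def vst_bits scalar_prod_def if_distrib[of "\<lambda>c. c * _"] cong: if_cong)
  moreover have "?B *\<^sub>v v = ?L *\<^sub>v (?U *\<^sub>v (?R *\<^sub>v v))"
   using assoc_mult_mat_vec[OF LU R v'] assoc_mult_mat_vec[OF L U mult_mat_vec_carrier[OF R v']] by simp
  ultimately have "?B *\<^sub>v v = ?L *\<^sub>v vecst (q + s) (run gs (vst s v))" using circuit_mat_op[OF v] by simp
  moreover have "i < 2 ^ (q + s)" using i le by linarith
  ultimately show ?thesis
   unfolding kron_ket0 using i by (simp add: vecst_def scalar_prod_def if_distrib[of "\<lambda>c. c * _"] cong: if_cong)
 qed
 let ?D = "M - cr \<alpha> \<cdot>\<^sub>m ?B"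
 have cD: "?D \<in> carrier_mat (2 ^ s) (2 ^ s)" by (rule minus_carrier_mat[OF smult_carrier_mat[OF B]])
 have dc: "dim_col ?D = 2 ^ s" by (rule carrier_matD(2)[OF cD])
 have "spectral_norm ?D \<le> \<epsilon>"
  unfolding spectral_norm_def dc
 proof (rule cSUP_least)
  have "vec_l2norm (unit_vec (2 ^ s) 0) = 1"
   unfolding vec_l2norm_def by (simp add: unit_vec_def if_distrib[of cmod] if_distrib[of "\<lambda>x. x\<^sup>2"] cong: if_cong)
  then show "{v \<in> carrier_vec (2 ^ s). vec_l2norm v = 1} \<noteq> {}" by (auto intro!: exI[of _ "unit_vec (2 ^ s) 0"])
 next
  fix v :: "complex Matrix.vec" assume "v \<in> {v \<in> carrier_vec (2 ^ s). vec_l2norm v = 1}"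
  then have v': "v \<in> carrier_vec (2 ^ s)" and v1: "vec_l2norm v = 1" by auto
  have ent: "vec_index (?D *\<^sub>v v) i = vec_index (M *\<^sub>v v) i - cr \<alpha> * run gs (vst s v) (bits_of i)" if i: "i < 2 ^ s" for i
  proof -
   have "?D *\<^sub>v v = M *\<^sub>v v - (cr \<alpha> \<cdot>\<^sub>m ?B) *\<^sub>v v"
    by (rule minus_mult_distrib_mat_vec[OF M smult_carrier_mat[OF B] v'])
   also have "(cr \<alpha> \<cdot>\<^sub>m ?B) *\<^sub>v v = cr \<alpha> \<cdot>\<^sub>v (?B *\<^sub>v v)"
    by (rule smult_mat_mult_vec[OF B v'])
   finally have "?D *\<^sub>v v = M *\<^sub>v v - cr \<alpha> \<cdot>\<^sub>v (?B *\<^sub>v v)" .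
   moreover have "dim_vec (?B *\<^sub>v v) = 2 ^ s" using carrier_vecD[OF mult_mat_vec_carrier[OF B v']] .
   ultimately have "vec_index (?D *\<^sub>v v) i = vec_index (M *\<^sub>v v) i - cr \<alpha> * vec_index (?B *\<^sub>v v) i"
    using i by (simp only: index_minus_vec index_smult_vec)
   then show ?thesis unfolding block[OF v' i] .
  qed
  have d: "dim_vec (?D *\<^sub>v v) = 2 ^ s" using carrier_vecD[OF mult_mat_vec_carrier[OF cD v']] .
  have "(\<Sum>i<2 ^ s. (cmod (vec_index (?D *\<^sub>v v) i))\<^sup>2)
   = (\<Sum>i<2 ^ s. (cmod (vec_index (M *\<^sub>v v) i - cr \<alpha> * run gs (vst s v) (bits_of i)))\<^sup>2)"
   by (intro sum.cong refl) (simp only: ent lessThan_iff)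
  then show "vec_l2norm (?D *\<^sub>v v) \<le> \<epsilon>"
   unfolding vec_l2norm_def d using e[OF v' v1] \<open>0 \<le> \<epsilon>\<close> by (auto intro: real_le_lsqrt)
 qed
 then show ?thesis unfolding block_encoding_def using unitary_circuit_mat[OF v] M by simp
qed

text \<open>A negation of the flag before and after switches the control on for good and turns the
  flag into one more ancilla that starts at zero; the gate count grows by two.\<close>

lemma encodable_circuit:
 assumes "encodable s \<kappa> N A A'"
 shows "\<exists>gs. length gs \<le> \<kappa> + 2 \<and> (\<forall>g\<in>set gs. valid_gate (s + 1 + \<kappa>) g) \<and>
  (\<forall>\<psi> x. (\<forall>x. \<psi> x \<noteq> 0 \<longrightarrow> x \<in> slice s) \<longrightarrow> x \<in> slice s \<longrightarrow> run gs \<psi> x = A \<psi> x / cr N)"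
proof -
 let ?A = "\<lambda>f x. A f x / cr N" and ?K = "{s + 1..<s + 1 + \<kappa>}"
 have en: "encodes s \<kappa> ?A (\<lambda>f x. A' f x / cr N)" using assms by (simp add: encodable_def)
 obtain gs hs where r: "realises ({..<s} \<union> {s} \<union> ?K) ?K \<kappa> gs hs (flagged s ?A) (flagged s (\<lambda>f x. A' f x / cr N))"
  by (rule encodesD[OF en, of s "s + 1"]) auto
 let ?gs = "not_gate s # gs @ [not_gate s]"
 have len: "length ?gs \<le> \<kappa> + 2" using r by (simp add: realises_def)
 have nv: "proper_gate (not_gate s)" "gate_wires (not_gate s) = {s}" by (simp_all add: not_gate_def unitary_basic)
 have va: "\<forall>g\<in>set ?gs. valid_gate (s + 1 + \<kappa>) g"
  using r nv unfolding realises_def circuit_on_def valid_gate_iff by fastforce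
 have bl: "run gs \<psi> x = flagged s ?A \<psi> x" if "clean ?K \<psi>" "zero_on ?K x" for \<psi> x
  using r that unfolding realises_def blocks_def by blast
 have loc: "local s ?A" by (rule encodes_props(3)[OF en])
 have "run ?gs \<psi> x = A \<psi> x / cr N" if s: "\<And>x. \<psi> x \<noteq> 0 ==> x \<in> slice s" and x: "x \<in> slice s" for \<psi> x
 proof -
  define \<phi> where "\<phi> = gate_op (not_gate s) \<psi>"
  define y where "y = x(s := \<not> x s)"
  have \<phi>: "\<phi> z = \<psi> (z(s := \<not> z s))" for z unfolding \<phi>_def by (rule not_gate_op)
  have x0: "\<not> x w" if "s \<le> w" for w using x that by (simp add: slice_def)
  have "clean ?K \<phi>"
  proof (rule cleanI, rule ccontr)
   fix z w assume w: "w \<in> ?K" "z w" and "\<phi> z \<noteq> 0"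
   then have "z(s := \<not> z s) \<in> slice s" using s unfolding \<phi> by blast
   then have "\<forall>v\<ge>s. \<not> (z(s := \<not> z s)) v" unfolding slice_def by (rule CollectD)
   then have "\<not> (z(s := \<not> z s)) w" using w(1) by (metis add_leD1 atLeastLessThan_iff)
   moreover have "w \<noteq> s" using w(1) by simp
   ultimately show False using w(2) fun_upd_other[of w s z "\<not> z s"] by argo
  qed
  moreover have "zero_on ?K y" using x0 by (simp add: y_def)
  ultimately have "run gs \<phi> y = flagged s ?A \<phi> y" by (rule bl)
  also have "\<dots> = ?A \<phi> y" using x0[of s] by (simp add: flagged_def y_def)
  also have "\<dots> = ?A \<psi> x"
  proof (rule localD[OF loc])
   fix w assume "w < s" then show "y w = x w" by (simp add: y_def)
  next
   fix u
   have p: "paste s y u s = True" using x0[of s] unfolding paste_def y_def by simp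
   have "(paste s y u)(s := False) = paste s x u"
    by (rule ext) (use x0[of s] in \<open>simp add: paste_def y_def\<close>)
   then show "\<phi> (paste s y u) = \<psi> (paste s x u)" unfolding \<phi> p by simp
  qed
  finally have "run gs \<phi> y = ?A \<psi> x" .
  moreover have "run ?gs \<psi> x = run gs \<phi> y" by (simp only: fold_simps run_append \<phi>_def[symmetric] not_gate_op y_def id_apply comp_apply)
  ultimately show ?thesis by simp
 qed
 with len va show ?thesis by (intro exI[of _ ?gs] conjI) simp_all
qed

lemma mat_mult_entry:
 assumes "A \<in> carrier_mat m k" "B \<in> carrier_mat k n" "i < m" "j < n"
 shows "(A * B) $$ (i, j) = (\<Sum>p<k. A $$ (i, p) * B $$ (p, j))"
 using assms by (simp add: scalar_prod_def lessThan_atLeast0)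

context grid
begin

lemma phys_slice: "phys x \<longleftrightarrow> x \<in> slice (3 * l)"
proof
 assume p: "phys x"
 have "\<not> x w" if "3 * l \<le> w" for w
 proof (cases "w < sz")
  case True
  then have "w = 3 * l + 0 \<or> w = 3 * l + 1 \<or> w = 3 * l + 2 \<or> w = al 0 \<or> w = al 1 \<or> w = al 2"
   using that by (auto simp: sz_def al_def)
  moreover have "\<not> x (3 * l + 0)" "\<not> x (3 * l + 1)" "\<not> x (3 * l + 2)" using p unfolding phys_def by (metis numeral_3_eq_3 zero_less_Suc Suc_1 lessI less_SucI One_nat_def)+
  moreover have "\<not> x (al 0)" "\<not> x (al 1)" "\<not> x (al 2)" using p unfolding phys_def alpha_def by auto
  ultimately show ?thesis by metis
 next
  case False
  then show ?thesis using p by (auto simp: phys_def slice_def)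
 qed
 then show "x \<in> slice (3 * l)" by (simp add: slice_def)
qed (auto simp: phys_def slice_def alpha_def al_def sz_def)

end

context model
begin

lemma H_carrier: "H \<in> carrier_mat n n"
proof -
 have c: "sqrt (t * \<kappa>) \<cdot>\<^sub>m S \<in> carrier_mat n n" "Z \<in> carrier_mat n n" using R.sqrt_mat_carrier AM_inverse by auto
 show ?thesis unfolding H_def psd_sqrt_CM using c by (intro mult_carrier_mat)
qed

lemma zero_pad_act:
 assumes n: "n = length (nodes l)" and pt: "\<And>p. p < n ==> pt p = ptc (nodes l ! p)"
  and M: "M \<in> carrier_mat n n" and v: "v \<in> carrier_vec (2 ^ (3 * l))" and i: "i < 2 ^ (3 * l)"
 shows "vec_index (zero_pad l M *\<^sub>v v) i = act M (vst (3 * l) v) (bits_of i)"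
proof -
 let ?E = "node_embedding l" and ?m = "2 ^ (3 * l) :: nat" and ?c = "\<lambda>p. code (nodes l ! p)"
 have E: "?E \<in> carrier_mat ?m n" by (simp add: node_embedding_def n)
 have e: "?E $$ (P, p) = (if P = ?c p then 1 else 0)" if "P < ?m" "p < n" for P p
  using that by (simp add: node_embedding_def n code_def split: prod.split)
 have c: "?c p < ?m" if "p < n" for p
 proof -
  have "nodes l ! p \<in> cells l" using nodes_cells nth_mem[of p "nodes l"] that n by auto
  then have "bits_of (?c p) \<in> slice (3 * l)" using phys_ptc phys_slice by (simp add: ptc_def)
  then show ?thesis by (simp add: bits_of_slice_iff)
 qed
 have f: "vst (3 * l) v (pt q) = (\<Sum>Q<?m. cr (?E $$ (Q, q)) * vec_index v Q)" if q: "q < n" for q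
 proof -
  have "(\<Sum>Q<?m. cr (?E $$ (Q, q)) * vec_index v Q) = (\<Sum>Q<?m. if Q = ?c q then vec_index v Q else 0)"
   using q by (intro sum.cong) (auto simp: e)
  also have "\<dots> = vec_index v (?c q)" using c[OF q] by simp
  finally show ?thesis using c[OF q] by (simp add: pt[OF q] ptc_def vst_bits)
 qed
 have d: "delta p (bits_of i) = cr (?E $$ (i, p))" if "p < n" for p
  using that i by (simp add: delta_def pt ptc_def bits_of_inj e)
 have Et: "transpose_mat ?E \<in> carrier_mat n ?m" using E by simp
 have EM: "?E * M \<in> carrier_mat ?m n" by (rule mult_carrier_mat[OF E M])
 have EME: "(?E * M * transpose_mat ?E) $$ (P, Q) = (\<Sum>q<n. (\<Sum>p<n. ?E $$ (P, p) * M $$ (p, q)) * ?E $$ (Q, q))" if "P < ?m" "Q < ?m" for P Q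
  unfolding mat_mult_entry[OF EM Et that] using that E by (intro sum.cong refl) (simp add: mat_mult_entry[OF E M])
 have "dim_row (?E * M * transpose_mat ?E) = ?m" "dim_col (?E * M * transpose_mat ?E) = ?m" using mult_carrier_mat[OF EM Et] by blast+
 then have "vec_index (zero_pad l M *\<^sub>v v) i = (\<Sum>Q<?m. cr ((?E * M * transpose_mat ?E) $$ (i, Q)) * vec_index v Q)"
  using i v unfolding zero_pad_def by (simp add: scalar_prod_def lessThan_atLeast0 del: index_mult_mat)
 also have "\<dots> = (\<Sum>Q<?m. \<Sum>q<n. \<Sum>p<n. cr (?E $$ (i, p)) * cr (M $$ (p, q)) * cr (?E $$ (Q, q)) * vec_index v Q)"
  using i by (intro sum.cong refl) (simp add: EME sum_distrib_right)
 also have "\<dots> = (\<Sum>q<n. \<Sum>p<n. \<Sum>Q<?m. cr (?E $$ (i, p)) * cr (M $$ (p, q)) * cr (?E $$ (Q, q)) * vec_index v Q)"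
  by (subst sum.swap) (intro sum.cong refl sum.swap)
 also have "\<dots> = (\<Sum>p<n. \<Sum>q<n. \<Sum>Q<?m. cr (?E $$ (i, p)) * cr (M $$ (p, q)) * cr (?E $$ (Q, q)) * vec_index v Q)"
  by (rule sum.swap)
 also have "\<dots> = act M (vst (3 * l) v) (bits_of i)"
  unfolding act_def sum_distrib_right
 proof (intro sum.cong refl)
  fix p q assume "p \<in> {..<n}" "q \<in> {..<n}"
  then show "(\<Sum>Q<?m. cr (?E $$ (i, p)) * cr (M $$ (p, q)) * cr (?E $$ (Q, q)) * vec_index v Q)
   = cr (M $$ (p, q)) * vst (3 * l) v (pt q) * delta p (bits_of i)"
   by (simp only: lessThan_iff d f) (simp only: sum_distrib_left sum_distrib_right mult_ac)
 qed
 finally show ?thesis .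
qed

definition err :: "nat => nat => nat => real" where
 "err d K e = 8 * \<kappa> * (2 * (64 / wmin) * \<epsilon>1 e + 2 * \<epsilon>2 d K + 8 * \<epsilon>1 e * (\<epsilon>2 d K + 64 / wmin))"

text \<open>The 7 further ancillas are the six torus and selector wires and the flag. All ancillas
  are counted in the block encoding, so the circuit acts with no work ancillas of its own.\<close>

lemma block_encoding_H:
 assumes n: "n = length (nodes l)" and pt: "\<And>p. p < n ==> pt p = ptc (nodes l ! p)" and "0 \<le> err d K e"
 shows "\<exists>U gs. block_encoding (3 * l) (2048 * \<kappa> / wmin) (cost d K e + 7) (err d K e) U (zero_pad l H) \<and>
  implements gs 0 (cost d K e + 7 + 3 * l) U \<and> length gs \<le> cost d K e + 2"
proof -
 obtain A A' where A: "encodable sz (cost d K e) (2048 * \<kappa> / wmin) A A'" and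
  err: "\<And>f. (\<And>x. f x \<noteq> 0 ==> phys x) ==> nrm sz (\<lambda>x. if phys x then A f x - act H f x else 0) \<le> err d K e * nrm sz f"
  unfolding err_def using encodable_H[of d K e] by blast
 let ?N = "2048 * \<kappa> / wmin"
 have "0 < ?N" using A unfolding encodable_def by (rule conjunct1)
 then have N: "?N \<noteq> 0" by (rule less_imp_neq[THEN not_sym])
 obtain gs where gs: "length gs \<le> cost d K e + 2 \<and> (\<forall>g\<in>set gs. valid_gate (sz + 1 + cost d K e) g) \<and>
  (\<forall>\<psi> x. (\<forall>x. \<psi> x \<noteq> 0 \<longrightarrow> x \<in> slice sz) \<longrightarrow> x \<in> slice sz \<longrightarrow> run gs \<psi> x = A \<psi> x / cr ?N)"
  using encodable_circuit[OF A] by (rule exE)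
 note len = gs[THEN conjunct1] and va = gs[THEN conjunct2, THEN conjunct1]
  and run = gs[THEN conjunct2, THEN conjunct2, rule_format]
 have M: "sz + 1 + cost d K e = cost d K e + 7 + 3 * l" by (simp add: sz_def)
 note va' = va[unfolded M]
 have le: "3 * l \<le> sz" by (simp add: sz_def)
 have "block_encoding (3 * l) ?N (cost d K e + 7) (err d K e) (circuit_mat (cost d K e + 7 + 3 * l) gs) (zero_pad l H)"
 proof (rule block_encodingI[OF va'])
  show "zero_pad l H \<in> carrier_mat (2 ^ (3 * l)) (2 ^ (3 * l))"
  unfolding zero_pad_def by (rule map_carrier_mat[THEN iffD2]) (rule carrier_matI, simp_all add: node_embedding_def)
 next
  fix v :: "complex Matrix.vec" assume v: "v \<in> carrier_vec (2 ^ (3 * l))" "vec_l2norm v = 1"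
  let ?f = "vst (3 * l) v"
  have s: "phys x" if "?f x \<noteq> 0" for x using vst_supp[OF that] phys_slice by simp
  have s': "x \<in> slice sz" if "?f x \<noteq> 0" for x using s[OF that] by (simp add: phys_def)
  have "(\<Sum>i<2 ^ (3 * l). (cmod (vec_index (zero_pad l H *\<^sub>v v) i - cr ?N * run gs ?f (bits_of i)))\<^sup>2)
   = (\<Sum>i<2 ^ (3 * l). (cmod (if phys (bits_of i) then A ?f (bits_of i) - act H ?f (bits_of i) else 0))\<^sup>2)"
  proof (intro sum.cong refl)
   fix i assume "i \<in> {..<2 ^ (3 * l) :: nat}"
   then have i: "i < 2 ^ (3 * l)" by simp
   then have p: "phys (bits_of i)" by (simp add: phys_slice bits_of_slice)
   then have "run gs ?f (bits_of i) = A ?f (bits_of i) / cr ?N" using s' by (intro run) (simp_all add: phys_def)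
   then show "(cmod (vec_index (zero_pad l H *\<^sub>v v) i - cr ?N * run gs ?f (bits_of i)))\<^sup>2
    = (cmod (if phys (bits_of i) then A ?f (bits_of i) - act H ?f (bits_of i) else 0))\<^sup>2"
    using p N zero_pad_act[OF n pt H_carrier v(1) i]
    by (simp only: if_True nonzero_mult_div_cancel_left times_divide_eq_right of_real_eq_0_iff not_False_eq_True norm_minus_commute)
  qed
  also have "\<dots> = (nrm sz (\<lambda>x. if phys x then A ?f x - act H ?f x else 0))\<^sup>2"
   unfolding nrm_sq by (rule sum_slice_mono[OF le, symmetric]) (simp add: phys_slice)
  also have "\<dots> \<le> (err d K e * nrm sz ?f)\<^sup>2" using err[OF s] nrm_nonneg by (intro power_mono) auto
  also have "nrm sz ?f = 1" using nrm_vst[OF le v(1)] v(2) by simp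
  finally show "(\<Sum>i<2 ^ (3 * l). (cmod (vec_index (zero_pad l H *\<^sub>v v) i - cr ?N * run gs ?f (bits_of i)))\<^sup>2) \<le> (err d K e)\<^sup>2"
   by simp
 qed (rule assms(3))
 moreover have "implements gs 0 (cost d K e + 7 + 3 * l) (circuit_mat (cost d K e + 7 + 3 * l) gs)"
  unfolding implements_def kron_ket0_0 using va'
  by (simp add: right_mult_one_mat[OF circuit_mat_carrier])
 ultimately show ?thesis using len by blast
qed

end

section \<open>Choice of the parameters\<close>

text \<open>Nonnegativity is included so that products can be bounded factor by factor.\<close>

definition polylog :: "nat => (nat => real => real) => bool" where
 "polylog k F \<longleftrightarrow> (\<exists>c. \<forall>l \<delta>. 0 < \<delta> \<longrightarrow> \<delta> < 1 \<longrightarrow> 0 \<le> F l \<delta> \<and> F l \<delta> \<le> c * polylog_base (mesh l) \<delta> ^ k)"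

lemma polylog_base_mesh: "polylog_base (mesh l) \<delta> = 1 + real l * ln 2 + ln (1 / \<delta>)"
 by (simp add: polylog_base_def ln_realpow)

lemma ln_inverse_pos: "0 < \<delta> ==> \<delta> < 1 ==> 0 < ln (1 / \<delta> :: real)"
 by simp

lemma polylog_base_ge_1: "0 < \<delta> ==> \<delta> < 1 ==> 1 \<le> polylog_base (mesh l) \<delta>"
 using ln_inverse_pos[of \<delta>] unfolding polylog_base_mesh by (simp add: add_nonneg_nonneg)

lemma polylog_const: "0 \<le> a ==> polylog 0 (\<lambda>l \<delta>. a)"
 unfolding polylog_def by (intro exI[of _ a]) simp

lemma polylog_level: "polylog 1 (\<lambda>l \<delta>. real l)"
 unfolding polylog_def
proof (intro exI[of _ 2] allI impI conjI)
 fix l :: nat and \<delta> :: real assume d: "0 < \<delta>" "\<delta> < 1"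
 have "real l * (2 / 3) \<le> real l * ln 2" by (rule mult_left_mono[OF ln2_ge_two_thirds]) simp
 moreover have "0 < ln (1 / \<delta>)" by (rule ln_inverse_pos[OF d])
 ultimately show "real l \<le> 2 * polylog_base (mesh l) \<delta> ^ 1" unfolding polylog_base_mesh by simp
qed simp

lemma polylog_ln: "polylog 1 (\<lambda>l \<delta>. ln (1 / \<delta>))"
 unfolding polylog_def
proof (intro exI[of _ 1] allI impI)
 fix l :: nat and \<delta> :: real assume d: "0 < \<delta>" "\<delta> < 1"
 have "0 \<le> real l * ln 2" by simp
 then show "0 \<le> ln (1 / \<delta>) \<and> ln (1 / \<delta>) \<le> 1 * polylog_base (mesh l) \<delta> ^ 1"
  using ln_inverse_pos[OF d] unfolding polylog_base_mesh power_one_right mult_1 by (intro conjI) linarith+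
qed

lemma polylog_mono:
 assumes "polylog j F" "j \<le> k" shows "polylog k F"
proof -
 obtain c where c: "\<And>l \<delta>. 0 < \<delta> ==> \<delta> < 1 ==> 0 \<le> F l \<delta> \<and> F l \<delta> \<le> c * polylog_base (mesh l) \<delta> ^ j"
  using assms(1) unfolding polylog_def by blast
 show ?thesis unfolding polylog_def
 proof (intro exI[of _ "max 0 c"] allI impI conjI)
  fix l :: nat and \<delta> :: real assume d: "0 < \<delta>" "\<delta> < 1"
  note b = polylog_base_ge_1[OF d, of l]
  have "F l \<delta> \<le> c * polylog_base (mesh l) \<delta> ^ j" using c[OF d] by blast
  also have "\<dots> \<le> max 0 c * polylog_base (mesh l) \<delta> ^ j" using b by (intro mult_right_mono) auto
  also have "\<dots> \<le> max 0 c * polylog_base (mesh l) \<delta> ^ k" using b assms(2) by (intro mult_left_mono power_increasing) auto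
  finally show "F l \<delta> \<le> max 0 c * polylog_base (mesh l) \<delta> ^ k" .
 qed (use c in blast)
qed

lemma polylog_add:
 assumes "polylog j F" "polylog k G" shows "polylog (max j k) (\<lambda>l \<delta>. F l \<delta> + G l \<delta>)"
proof -
 obtain c d where c: "\<And>l \<delta>. 0 < \<delta> ==> \<delta> < 1 ==> 0 \<le> F l \<delta> \<and> F l \<delta> \<le> c * polylog_base (mesh l) \<delta> ^ max j k"
  and d: "\<And>l \<delta>. 0 < \<delta> ==> \<delta> < 1 ==> 0 \<le> G l \<delta> \<and> G l \<delta> \<le> d * polylog_base (mesh l) \<delta> ^ max j k"
  using polylog_mono[OF assms(1) max.cobounded1[of j k]] polylog_mono[OF assms(2) max.cobounded2[of k j]]
  unfolding polylog_def by blast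
 show ?thesis unfolding polylog_def
 proof (intro exI[of _ "c + d"] allI impI)
  fix l :: nat and \<delta> :: real assume "0 < \<delta>" "\<delta> < 1"
  then show "0 \<le> F l \<delta> + G l \<delta> \<and> F l \<delta> + G l \<delta> \<le> (c + d) * polylog_base (mesh l) \<delta> ^ max j k"
   using c[of \<delta> l] d[of \<delta> l] unfolding distrib_right by linarith
 qed
qed

lemma polylog_mult:
 assumes "polylog j F" "polylog k G" shows "polylog (j + k) (\<lambda>l \<delta>. F l \<delta> * G l \<delta>)"
proof -
 obtain c d where c: "\<And>l \<delta>. 0 < \<delta> ==> \<delta> < 1 ==> 0 \<le> F l \<delta> \<and> F l \<delta> \<le> c * polylog_base (mesh l) \<delta> ^ j"
  and d: "\<And>l \<delta>. 0 < \<delta> ==> \<delta> < 1 ==> 0 \<le> G l \<delta> \<and> G l \<delta> \<le> d * polylog_base (mesh l) \<delta> ^ k"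
  using assms unfolding polylog_def by blast
 show ?thesis unfolding polylog_def
 proof (intro exI[of _ "c * d"] allI impI conjI)
  fix l :: nat and \<delta> :: real assume e: "0 < \<delta>" "\<delta> < 1"
  have "F l \<delta> * G l \<delta> \<le> (c * polylog_base (mesh l) \<delta> ^ j) * (d * polylog_base (mesh l) \<delta> ^ k)"
   using c[OF e, of l] d[OF e, of l] by (intro mult_mono) linarith+
  then show "F l \<delta> * G l \<delta> \<le> c * d * polylog_base (mesh l) \<delta> ^ (j + k)" by (simp only: power_add mult_ac)
  show "0 \<le> F l \<delta> * G l \<delta>" using c[OF e, of l] d[OF e, of l] by simp
 qed
qed

lemma nat_ceiling_bounds:
 assumes "0 \<le> (y :: real)" shows "y \<le> real (nat \<lceil>y\<rceil>)" "real (nat \<lceil>y\<rceil>) \<le> y + 1"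
 using assms by linarith+

lemma polylog_ceiling:
 assumes "polylog k F" shows "polylog k (\<lambda>l \<delta>. real (nat \<lceil>F l \<delta>\<rceil>))"
proof -
 have "polylog (max k 0) (\<lambda>l \<delta>. F l \<delta> + 1)" by (intro polylog_add assms polylog_const) simp
 then obtain c where c: "\<And>l \<delta>. 0 < \<delta> ==> \<delta> < 1 ==> F l \<delta> + 1 \<le> c * polylog_base (mesh l) \<delta> ^ k"
  unfolding polylog_def by auto
 show ?thesis unfolding polylog_def
 proof (intro exI[of _ c] allI impI conjI)
  fix l :: nat and \<delta> :: real assume e: "0 < \<delta>" "\<delta> < 1"
  have "0 \<le> F l \<delta>" using assms e unfolding polylog_def by blast
  then show "real (nat \<lceil>F l \<delta>\<rceil>) \<le> c * polylog_base (mesh l) \<delta> ^ k"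
   using nat_ceiling_bounds(2)[of "F l \<delta>"] c[OF e, of l] by linarith
 qed simp
qed

text \<open>The cost with \<nu> in place of the wire list and everything unfolded, so that its
  growth can be read off term by term.\<close>

definition total_cost :: "nat => nat => nat => nat => nat => nat" where
 "total_cost \<nu> l d K e = (let
   g = 8 * (3 * (13 * l + 16) + 400);
   B = 2 ^ \<nu> * (14 * \<nu> + 5) + g;
   S = 16 * (d * ((l + 2) * (16 * (8 * (3 * (l + 2) * (13 * l + 16) + 5 + 400)) + 5))) + 3
  in 2 * (16 * B + 3 + e * (16 * B + 5) + 3) + (2 * g + 757 + K * (S + 2 ^ \<nu> * (14 * \<nu> + 5) + 2) + S)
   + 3 * (14 * (l + 1) + 8))"

text \<open>Exponent 7: the projection costs \<open>d\<close> (degree 3) times the number of levels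
  (1) times the frame (2), and the Neumann series repeats it \<open>K\<close> (1) times.\<close>

lemma polylog_total_cost:
 assumes "polylog 3 (\<lambda>l \<delta>. real (d l \<delta>))" "polylog 1 (\<lambda>l \<delta>. real (K l \<delta>))" "polylog 1 (\<lambda>l \<delta>. real (e l \<delta>))"
 shows "polylog 7 (\<lambda>l \<delta>. real (total_cost \<nu> l (d l \<delta>) (K l \<delta>) (e l \<delta>)))"
 unfolding total_cost_def Let_def of_nat_add of_nat_mult of_nat_numeral of_nat_1
 by (rule polylog_mono, (rule polylog_const of_nat_0_le_iff zero_le_numeral zero_le_one
   polylog_level assms polylog_add polylog_mult)+) simp

text \<open>From \<open>1 - r \<le> exp (- r)\<close>.\<close>

lemma power_le_of_ln:
 assumes "0 \<le> r" "r \<le> 1" "0 < \<delta>" "ln (1 / \<delta>) \<le> r * real m" shows "(1 - r) ^ m \<le> \<delta>"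
proof -
 have "(1 - r) ^ m \<le> exp (- r) ^ m" using exp_ge_add_one_self[of "- r"] assms(2) by (intro power_mono) auto
 also have "\<dots> = exp (- (r * real m))" by (simp add: mult.commute flip: exp_of_nat_mult)
 also have "\<dots> \<le> exp (- ln (1 / \<delta>))" using assms(4) by simp
 also have "\<dots> = \<delta>" using assms(3) by (simp add: ln_div)
 finally show ?thesis .
qed

context model
begin

lemma cost_eq: "cost d K e = total_cost (length vs) l d K e"
 unfolding cost_def B_cost_def solver_cost_def Q_cost_def igrad_cost_def frame_cost_def total_cost_def Let_def by simp

lemma err_bound:
 fixes \<delta> :: real
 defines "E \<equiv> 8 * (1 + wmax / wmin) / wmin"
 assumes \<delta>: "0 < \<delta>" "\<delta> < 1" and d: "ln (1 / \<delta>) \<le> gap * real d"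
  and K: "ln (1 / \<delta>) \<le> wmin / wmax * real K" and e: "ln (1 / \<delta>) \<le> (1 - \<rho>) * real e"
 shows "0 \<le> err d K e"
  "err d K e \<le> 8 * \<kappa> * (2 * (64 / wmin) / (1 - \<rho>) + 2 * E + 8 / (1 - \<rho>) * (E + 64 / wmin)) * \<delta>"
proof -
 have w: "0 < wmin" "0 < wmax" "wmin < wmax" using W(3,4) by auto
 have r: "0 \<le> 1 - \<rho>" "1 - \<rho> \<le> 1" "0 < 1 - \<rho>" using \<rho>_bounds by auto
 have "\<rho> ^ e \<le> \<delta>" using power_le_of_ln[OF r(1,2) \<delta>(1) e] by simp
 moreover have "\<rho> ^ Suc e \<le> 1 * \<rho> ^ e" unfolding power_Suc using \<rho>_bounds by (intro mult_right_mono) auto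
 ultimately have "\<rho> ^ Suc e \<le> \<delta>" by linarith
 then have e1: "\<epsilon>1 e \<le> \<delta> / (1 - \<rho>)" unfolding \<epsilon>1_def using r by (intro divide_right_mono) auto
 have q: "0 \<le> wmin / wmax" "wmin / wmax \<le> 1" using w by auto
 have "(1 - wmin / wmax) ^ K \<le> \<delta>" using power_le_of_ln[OF q \<delta>(1) K] .
 moreover have "(1 - wmin / wmax) ^ Suc K \<le> 1 * (1 - wmin / wmax) ^ K" unfolding power_Suc using q by (intro mult_right_mono) auto
 ultimately have k: "(1 - wmin / wmax) ^ Suc K \<le> \<delta>" by linarith
 have "(1 - gap) ^ d \<le> \<delta>" using power_le_of_ln[OF _ gap_bounds(2) \<delta>(1) d] gap_bounds(1) by simp
 then have "(1 - gap) ^ d * (wmax / wmin) \<le> \<delta> * (wmax / wmin)" using w by (intro mult_right_mono) auto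
 then have "(1 - wmin / wmax) ^ Suc K + (1 - gap) ^ d * wmax / wmin \<le> \<delta> * (1 + wmax / wmin)" using k by (simp add: algebra_simps)
 then have "8 * ((1 - wmin / wmax) ^ Suc K + (1 - gap) ^ d * wmax / wmin) / wmin \<le> 8 * (\<delta> * (1 + wmax / wmin)) / wmin"
  using w by (intro divide_right_mono mult_left_mono) auto
 then have e2: "\<epsilon>2 d K \<le> E * \<delta>" unfolding \<epsilon>2_def E_def by (simp only: mult_ac times_divide_eq_right times_divide_eq_left)
 have n2: "0 \<le> \<epsilon>2 d K" unfolding \<epsilon>2_def using w q gap_bounds by (intro divide_nonneg_pos mult_nonneg_nonneg add_nonneg_nonneg zero_le_power) auto
 have E: "0 \<le> E" unfolding E_def using w by simp
 have "E * \<delta> \<le> E" using E \<delta> by (simp add: mult_left_le)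
 then have "8 * \<epsilon>1 e * (\<epsilon>2 d K + 64 / wmin) \<le> 8 * (\<delta> / (1 - \<rho>)) * (E + 64 / wmin)"
  using e1 e2 n2 w r \<delta> by (intro mult_mono mult_left_mono) auto
 moreover have "2 * (64 / wmin) * \<epsilon>1 e \<le> 2 * (64 / wmin) * (\<delta> / (1 - \<rho>))" using e1 w by (intro mult_left_mono) auto
 ultimately have "2 * (64 / wmin) * \<epsilon>1 e + 2 * \<epsilon>2 d K + 8 * \<epsilon>1 e * (\<epsilon>2 d K + 64 / wmin)
  \<le> 2 * (64 / wmin) * (\<delta> / (1 - \<rho>)) + 2 * (E * \<delta>) + 8 * (\<delta> / (1 - \<rho>)) * (E + 64 / wmin)" using e2 by linarith
 also have "\<dots> = (2 * (64 / wmin) / (1 - \<rho>) + 2 * E + 8 / (1 - \<rho>) * (E + 64 / wmin)) * \<delta>" by (simp add: algebra_simps add_divide_distrib)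
 finally have "err d K e \<le> 8 * \<kappa> * ((2 * (64 / wmin) / (1 - \<rho>) + 2 * E + 8 / (1 - \<rho>) * (E + 64 / wmin)) * \<delta>)"
  unfolding err_def using \<kappa>_pos by (intro mult_left_mono) auto
 then show "err d K e \<le> 8 * \<kappa> * (2 * (64 / wmin) / (1 - \<rho>) + 2 * E + 8 / (1 - \<rho>) * (E + 64 / wmin)) * \<delta>" by (simp only: mult.assoc)
 show "0 \<le> err d K e" unfolding err_def using w n2 \<epsilon>1_nonneg \<kappa>_pos
  by (intro mult_nonneg_nonneg add_nonneg_nonneg) auto
qed

end

text \<open>A sample point in every open cell, by which the coefficients become functions of the
  cell.\<close>

definition midpoint_of :: "nat => node => real^3" where
 "midpoint_of l c = (\<chi> m. (real (cmp c m) + 1 / 2) * mesh l)"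

lemma midpoint_of_cell: "midpoint_of l c \<in> cell l (cmp c)"
 by (simp add: midpoint_of_def cell_def field_simps)

lemma cmp_less: "c \<in> cells l ==> cmp c m < 2 ^ l"
 by (auto simp: cells_def cmp_def)

lemma midpoint_of_Omega:
 assumes "c \<in> cells l" shows "midpoint_of l c \<in> Omega"
proof -
 have "(real (cmp c m) + 1 / 2) * mesh l \<le> 1" for m
 proof -
  have "real (cmp c m) + 1 \<le> 2 ^ l" using cmp_less[OF assms, of m]
   by (metis Suc_eq_plus1 Suc_leI of_nat_Suc of_nat_le_iff of_nat_numeral of_nat_power add.commute)
  then show ?thesis by (simp add: field_simps)
 qed
 then show ?thesis by (simp add: midpoint_of_def Omega_def)
qed

lemma const_on_cell:
 assumes "grid_resolves l Rs" "\<forall>R\<in>set Rs. f constant_on R" "c \<in> cells l" "x \<in> cell l (cmp c)"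
 shows "f x = f (midpoint_of l c)"
proof -
 obtain R where "R \<in> set Rs" "cell l (cmp c) \<subseteq> R" using assms(1,3) cmp_less unfolding grid_resolves_def by blast
 then show ?thesis using assms(2,4) midpoint_of_cell[of l c] unfolding constant_on_def by (metis subsetD)
qed

lemma finite_pos_lower:
 assumes "finite A" "\<And>a. a \<in> A ==> 0 < (f a :: real)" shows "\<exists>m>0. \<forall>a\<in>A. m \<le> f a"
proof (cases "A = {}")
 case False
 then show ?thesis using assms by (intro exI[of _ "Min (f ` A)"]) auto
qed (auto intro: exI[of _ 1])

lemma finite_upper:
 assumes "finite A" shows "\<exists>m. \<forall>a\<in>A. (f a :: real) \<le> m"
 using assms by (intro exI[of _ "Max (f ` A)"]) auto



theorem theorem13:
  "\<exists>k::nat. \<forall>D Sa nSf :: real^3 \<Rightarrow> real.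
     (\<forall>x\<in>Omega. 0 < D x \<and> 0 < Sa x \<and> 0 \<le> nSf x) \<longrightarrow>
     (\<exists>c::real. 0 < c \<and> (\<forall>Rs l h \<delta>.
        material_regions Rs \<and>
        (\<forall>R\<in>set Rs. D constant_on R \<and> Sa constant_on R \<and> nSf constant_on R) \<and>
        0 < l \<and> h = 1 / 2 ^ l \<and> grid_resolves l Rs \<and> 0 < \<delta> \<and> \<delta> < 1 \<longrightarrow>
        (\<exists>\<alpha> q \<epsilon> U r gs.
           block_encoding (3 * l) \<alpha> q \<epsilon> U (zero_pad l (hamiltonian l D Sa nSf)) \<and>
           implements gs r (q + 3 * l) U \<and>
           0 < \<alpha> \<and> \<alpha> \<le> c * (ln (1 / h))\<^sup>2 \<and>
           real q \<le> c * polylog_base h \<delta> ^ k \<and>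
           \<epsilon> \<le> c * \<delta> powr (1 / 4) * polylog_base h \<delta> ^ k \<and>
           real (length gs) \<le> c * real (length Rs) * polylog_base h \<delta> ^ k \<and>
           real r \<le> c * polylog_base h \<delta> ^ k)))"
  (is "\<exists>k. \<forall>D Sa nSf. ?pos D Sa nSf \<longrightarrow> (\<exists>c. 0 < c \<and> (\<forall>Rs l h \<delta>. ?adm D Sa nSf Rs l h \<delta> \<longrightarrow> ?enc k D Sa nSf c Rs l h \<delta>))")
\<comment> \<open>The degree of the cost in \<open>polylog_total_cost\<close>.\<close>
proof (rule exI[of _ 7], intro allI impI)
 fix D Sa nSf :: "real^3 => real"
 assume pos: "?pos D Sa nSf"
 let ?res = "\<lambda>Rs l. (\<forall>R\<in>set Rs. D constant_on R \<and> Sa constant_on R \<and> nSf constant_on R) \<and> grid_resolves l Rs"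
 show "\<exists>c. 0 < c \<and> (\<forall>Rs l h \<delta>. ?adm D Sa nSf Rs l h \<delta> \<longrightarrow> ?enc 7 D Sa nSf c Rs l h \<delta>)"
 proof (cases "\<exists>l Rs. ?res Rs l")
  \<comment> \<open>If no mesh resolves the coefficients, the hypotheses can never be met.\<close>
  case False
  show ?thesis by (rule exI[of _ 1], rule conjI, simp, intro allI impI, elim conjE) (use False in blast)
 next
  case True
  \<comment> \<open>\<open>l0\<close> is a level on which the coefficients are cellwise constant; it depends on \<open>D\<close>, \<open>Sa\<close>, \<open>nSf\<close> only.\<close>
  define l0 where "l0 = (LEAST l. \<exists>Rs. ?res Rs l)"
  have "\<exists>Rs. ?res Rs l0" unfolding l0_def by (rule LeastI_ex[OF True])
  then obtain Rs0 where Rs0: "\<forall>R\<in>set Rs0. D constant_on R \<and> Sa constant_on R \<and> nSf constant_on R" "grid_resolves l0 Rs0" by blast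
  define dv sv nv where v: "dv = (\<lambda>c. D (midpoint_of l0 c))" "sv = (\<lambda>c. Sa (midpoint_of l0 c))" "nv = (\<lambda>c. nSf (midpoint_of l0 c))"
  have vals: "D x = dv c" "Sa x = sv c" "nSf x = nv c" if "c \<in> cells l0" "x \<in> cell l0 (cmp c)" for c x
   unfolding v using Rs0 that by (auto intro: const_on_cell[OF Rs0(2)])
  have vp: "0 < dv c" "0 < sv c" "0 \<le> nv c" if "c \<in> cells l0" for c
   using pos midpoint_of_Omega[OF that] unfolding v by auto
  obtain m1 where m1: "0 < m1" "\<And>c. c \<in> cells l0 ==> m1 \<le> dv c" using finite_pos_lower[OF finite_cells, of l0 dv] vp(1) by auto
  obtain m2 where m2: "0 < m2" "\<And>c. c \<in> cells l0 ==> m2 \<le> sv c" using finite_pos_lower[OF finite_cells, of l0 sv] vp(2) by auto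
  \<comment> \<open>Zeros are replaced by 1, so that the minimum over finitely many cells is
    positive and bounds the nonzero values from below.\<close>
  obtain m3 where m3: "0 < m3" "\<And>c. c \<in> cells l0 ==> m3 \<le> (if nv c = 0 then 1 else nv c)"
   using finite_pos_lower[OF finite_cells, of l0 "\<lambda>c. if nv c = 0 then 1 else nv c"] vp(3) by (auto simp: order.not_eq_order_implies_strict)
  obtain M1 where M1: "\<And>c. c \<in> cells l0 ==> sv c + 4 * dv c \<le> M1" using finite_upper[OF finite_cells, of l0 "\<lambda>c. sv c + 4 * dv c"] by auto
  obtain M2 where M2: "\<And>c. c \<in> cells l0 ==> nv c \<le> M2" using finite_upper[OF finite_cells, of l0 nv] by auto
  \<comment> \<open>\<open>wmin + 1\<close> forces the strict inequality, 27 is that of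
    \<open>Cf_bounds\<close>, and the maximum with \<open>cmin\<close> covers a vanishing fission
    coefficient.\<close>
  define wmin wmax cmin cmax where w: "wmin = min m1 m2" "wmax = max M1 (wmin + 1)" "cmin = m3 / 27" "cmax = max M2 cmin"
  have wp: "0 < wmin" "wmin < wmax" "0 < cmin" "cmin \<le> cmax" using m1(1) m2(1) m3(1) by (auto simp: w)
  have wb: "wmin \<le> sv c \<and> wmin \<le> dv c \<and> sv c + 4 * dv c \<le> wmax" "(nv c = 0 \<or> 27 * cmin \<le> nv c) \<and> nv c \<le> cmax" if "c \<in> cells l0" for c
   using m1(2)[OF that] m2(2)[OF that] m3(2)[OF that] M1[OF that] M2[OF that] unfolding w by (auto split: if_splits)
  define \<kappa> \<rho> where \<kappa>\<rho>: "\<kappa> = 64 * cmax" "\<rho> = sqrt (1 - cmin / (8 * \<kappa>))"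
  define E where "E = 8 * (1 + wmax / wmin) / wmin"
  define err where "err = 8 * \<kappa> * (2 * (64 / wmin) / (1 - \<rho>) + 2 * E + 8 / (1 - \<rho>) * (E + 64 / wmin))"
  have \<rho>1: "\<rho> < 1" using wp(3,4) by (simp add: \<kappa>\<rho>)
  \<comment> \<open>\<open>729 (l + 2)\<^sup>2\<close> is the inverse of \<open>gap\<close>, so that
    \<open>(1 - gap) ^ d\<close> falls below \<delta>; \<open>K\<close> and \<open>e\<close> follow
    the same pattern with their own contraction factors.\<close>
  define d where "d l \<delta> = nat \<lceil>ln (1 / \<delta>) * (729 * ((real l + 2) * (real l + 2)))\<rceil>" for l :: nat and \<delta>
  define K where "K \<delta> = nat \<lceil>ln (1 / \<delta>) * (wmax / wmin)\<rceil>" for \<delta>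
  define e where "e \<delta> = nat \<lceil>ln (1 / \<delta>) * (1 / (1 - \<rho>))\<rceil>" for \<delta>
  \<comment> \<open>The number of wires does not depend on the level, so level 0 may stand in for
    every later \<open>l\<close>.\<close>
  define \<nu> where "\<nu> = length (grid.wires 0 l0)"
  have "polylog 3 (\<lambda>l \<delta>. real (d l \<delta>))"
   unfolding d_def by (rule polylog_mono, (rule polylog_const zero_le_numeral polylog_level
     polylog_ln polylog_ceiling polylog_add polylog_mult)+) simp
  moreover have "polylog 1 (\<lambda>l \<delta>. real (K \<delta>))"
  proof -
   have "0 \<le> wmax / wmin" using wp by simp
   then have "polylog (1 + 0) (\<lambda>l \<delta>. real (K \<delta>))"
    unfolding K_def by (intro polylog_ceiling polylog_mult polylog_ln polylog_const)
   then show ?thesis by simp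
  qed
  moreover have "polylog 1 (\<lambda>l \<delta>. real (e \<delta>))"
  proof -
   have "0 \<le> 1 / (1 - \<rho>)" using \<rho>1 by simp
   then have "polylog (1 + 0) (\<lambda>l \<delta>. real (e \<delta>))"
    unfolding e_def by (intro polylog_ceiling polylog_mult polylog_ln polylog_const)
   then show ?thesis by simp
  qed
  ultimately have "polylog 7 (\<lambda>l \<delta>. real (total_cost \<nu> l (d l \<delta>) (K \<delta>) (e \<delta>)))" by (rule polylog_total_cost)
  then have "polylog (max 7 0) (\<lambda>l \<delta>. real (total_cost \<nu> l (d l \<delta>) (K \<delta>) (e \<delta>)) + 7)"
   by (intro polylog_add polylog_const) simp_all
  then obtain c0 where c0: "\<And>l \<delta>. 0 < \<delta> ==> \<delta> < 1 ==> real (total_cost \<nu> l (d l \<delta>) (K \<delta>) (e \<delta>)) + 7 \<le> c0 * polylog_base (mesh l) \<delta> ^ 7"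
   unfolding polylog_def by auto
  \<comment> \<open>The factor 4 pays for \<open>ln (1 / h) \<ge> 1 / 2\<close>, where the bounded
    normalisation is compared with the squared logarithm.\<close>
  define c where "c = \<bar>c0\<bar> + 4 * (2048 * \<kappa> / wmin) + \<bar>err\<bar> + 1"
  have \<alpha>0: "0 < 2048 * \<kappa> / wmin" using wp by (simp add: \<kappa>\<rho>)
  have cb: "0 < c" "c0 \<le> c" "4 * (2048 * \<kappa> / wmin) \<le> c" "err \<le> c" using \<alpha>0 unfolding c_def by linarith+
  show ?thesis
  proof (rule exI[of _ c], rule conjI[OF cb(1)], intro allI impI)
   fix Rs l and h \<delta> :: real
   assume "?adm D Sa nSf Rs l h \<delta>"
   then have mr: "material_regions Rs" and ad: "?res Rs l" and l: "0 < l" and h: "h = mesh l" and \<delta>: "0 < \<delta>" "\<delta> < 1" by auto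
   have l0: "l0 \<le> l" unfolding l0_def by (rule Least_le) (use ad in blast)
   \<comment> \<open>The origin lies in \<open>Omega\<close>, so there is a region, and the factor
     \<open>length Rs\<close> of the gate bound is at least one.\<close>
   have "Rs \<noteq> []" using mr unfolding material_regions_def Omega_def by (auto dest!: spec[of _ "0 :: real^3"] simp: set_eq_iff)
   then have Rs: "1 \<le> real (length Rs)" by (cases Rs) auto
   interpret grid l .
   interpret m: model l n pt "Wf l0 dv sv" "Cf l0 nv" wmin wmax cmin cmax "mesh l ^ 3" "wires l0"
    "stiffness_matrix l D + mass_matrix l Sa" "mass_matrix l nSf"
    by (rule model_instance[OF l0 vals wb(1) wp(1,2) wb(2) wp(3,4)])
   have \<nu>: "length (wires l0) = \<nu>" unfolding \<nu>_def by (simp add: wires_def grid.wires_def)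
   have k: "m.\<kappa> = \<kappa>" "m.\<rho> = \<rho>" by (simp_all add: m.\<kappa>_def m.\<rho>_def \<kappa>\<rho>)
   let ?d = "d l \<delta>" and ?K = "K \<delta>" and ?e = "e \<delta>"
   let ?q = "m.cost ?d ?K ?e + 7"
   have L: "0 < ln (1 / \<delta>)" by (rule ln_inverse_pos[OF \<delta>])
   have hd: "ln (1 / \<delta>) \<le> gap * real ?d"
   proof -
    have "ln (1 / \<delta>) * (729 * ((real l + 2) * (real l + 2))) \<le> real ?d" unfolding d_def using L by (intro nat_ceiling_bounds(1)) simp
    then show ?thesis unfolding gap_def power2_eq_square by (subst mult.commute, subst times_divide_eq_right, subst pos_le_divide_eq) simp_all
   qed
   have hK: "ln (1 / \<delta>) \<le> wmin / wmax * real ?K"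
   proof -
    have "ln (1 / \<delta>) * (wmax / wmin) \<le> real ?K" unfolding K_def using L wp by (intro nat_ceiling_bounds(1)) simp
    then have "wmin / wmax * (ln (1 / \<delta>) * (wmax / wmin)) \<le> wmin / wmax * real ?K" using wp by (intro mult_left_mono) auto
    then show ?thesis using wp by simp
   qed
   have he: "ln (1 / \<delta>) \<le> (1 - m.\<rho>) * real ?e"
   proof -
    have "ln (1 / \<delta>) * (1 / (1 - \<rho>)) \<le> real ?e" unfolding e_def using L \<rho>1 by (intro nat_ceiling_bounds(1)) simp
    then have "(1 - \<rho>) * (ln (1 / \<delta>) * (1 / (1 - \<rho>))) \<le> (1 - \<rho>) * real ?e" using \<rho>1 by (intro mult_left_mono) auto
    then show ?thesis using \<rho>1 by (simp add: k)
   qed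
   note eb = m.err_bound[OF \<delta> hd hK he]
   have "hamiltonian l D Sa nSf = m.H" by (simp add: hamiltonian_def m.H_def Let_def)
   then obtain U gs where U: "block_encoding (3 * l) (2048 * \<kappa> / wmin) ?q (m.err ?d ?K ?e) U (zero_pad l (hamiltonian l D Sa nSf))"
    "implements gs 0 (?q + 3 * l) U" "length gs \<le> m.cost ?d ?K ?e + 2"
    using m.block_encoding_H[OF refl _ eb(1)] unfolding k pt_def by auto
   let ?X = "polylog_base h \<delta> ^ 7"
   have "1 \<le> polylog_base h \<delta>" unfolding h by (rule polylog_base_ge_1[OF \<delta>])
   then have X: "1 \<le> ?X" "0 \<le> polylog_base h \<delta>" by simp_all
   have "real ?q \<le> c0 * ?X" using c0[OF \<delta>, of l] unfolding h m.cost_eq \<nu> by simp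
   also have "\<dots> \<le> c * ?X" using cb(2) X by (intro mult_right_mono) auto
   finally have q: "real ?q \<le> c * ?X" .
   have "c * ?X * 1 \<le> c * ?X * real (length Rs)" using X(2) cb(1) by (intro mult_left_mono[OF Rs]) simp
   then have g: "real (length gs) \<le> c * real (length Rs) * ?X" using q U(3) by (simp add: mult_ac)
   have "ln 2 \<le> ln (1 / h)"
    using l unfolding h by (simp add: ln_realpow mult_le_cancel_right1)
   then have "1 / 2 \<le> ln (1 / h)" using ln2_ge_two_thirds by linarith
   then have "(1 / 2)\<^sup>2 \<le> (ln (1 / h))\<^sup>2" by (intro power_mono) auto
   then have "c * (1 / 4) \<le> c * (ln (1 / h))\<^sup>2" using cb(1) by (intro mult_left_mono) (simp_all add: power2_eq_square)
   then have a: "2048 * \<kappa> / wmin \<le> c * (ln (1 / h))\<^sup>2" using cb(3) by linarith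
   \<comment> \<open>On the unit interval \<delta> is at most its fourth root, which weakens the
     linear error bound to the claimed one.\<close>
   have "\<delta> powr 1 \<le> \<delta> powr (1 / 4)" using \<delta> by (intro powr_mono') auto
   then have p: "\<delta> \<le> \<delta> powr (1 / 4)" using \<delta> by simp
   have "m.err ?d ?K ?e \<le> err * \<delta>" using eb(2) unfolding k err_def E_def .
   also have "\<dots> \<le> c * \<delta>" using cb(4) \<delta> by (intro mult_right_mono) auto
   also have "\<dots> \<le> c * \<delta> powr (1 / 4)" using cb(1) p by (intro mult_left_mono) auto
   also have "\<dots> \<le> c * \<delta> powr (1 / 4) * ?X" using mult_left_mono[OF X(1), of "c * \<delta> powr (1 / 4)"] cb(1) by simp
   finally have er: "m.err ?d ?K ?e \<le> c * \<delta> powr (1 / 4) * ?X" .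
   have r: "real 0 \<le> c * ?X" using X cb(1) by simp
   show "?enc 7 D Sa nSf c Rs l h \<delta>"
    by (intro exI conjI) (rule U(1) U(2) \<alpha>0 a q er g r)+
  qed
 qed
qed

end
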